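(* Consider LinUCB run for $T$ rounds on the unit ball $\mathcal{B}^d$ ($d\ge 2$) with exploration parameter $\beta=\beta(T,d)$, under the sub-Gaussian noise assumption described in the context. Suppose $\beta\gg d^2(\sigma\sqrt{d+\log\log T}+1)$ and $\beta=O(\mathrm{poly}\log T)$. Let $\widehat\sigma^2$ be a consistent estimator of the noise variance $\sigma^2$, let $\delta\in(0,1)$, and let $\chi^2_{d-1,1-\delta}$ be the $(1-\delta)$-quantile of the $\chi^2$ distribution with $d-1$ degrees of freedom. Then $$\mathcal C_\delta=\left\{\boldsymbol\theta\in\mathcal S^{d-1}:\ \left\|\widehat{\boldsymbol\theta}_T-\boldsymbol\theta\right\|_2^2\le\widehat\sigma^2\sqrt{\frac{d+1}{2\beta^2T}}\cdot\chi^2_{d-1,1-\delta}\right\}$$ is an asymptotic $(1-\delta)$ confidence set for $\boldsymbol\theta^\star$, i.e. $\mathbb P(\boldsymbol\theta^\star\in\mathcal C_\delta)\to1-\delta$ as $T\to\infty$.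
   Context: Setting. Let $d\ge 2$, let $T$ be the horizon, and let $\boldsymbol\theta^\star\in\mathbb R^d$ with $\|\boldsymbol\theta^\star\|_2=1$. In each round $t=1,\dots,T$ the learner picks an action $\boldsymbol a_t$ in the unit ball $\mathcal B^d=\{\boldsymbol x\in\mathbb R^d:\|\boldsymbol x\|_2\le 1\}$ (every vector of the ball is available in every round) and observes $r_t=\langle\boldsymbol a_t,\boldsymbol\theta^\star\rangle+\epsilon_t$. With $\mathcal F_t=\sigma(\boldsymbol a_1,r_1,\dots,\boldsymbol a_t,r_t)$, the noise satisfies $\mathbb E[\epsilon_t\mid\mathcal F_{t-1}]=0$, $\mathrm{Var}[\epsilon_t\mid\mathcal F_{t-1}]=\sigma^2$, and $\mathbb E[\exp(\lambda\epsilon_t)\mid\mathcal F_{t-1}]\le\exp(\sigma^2\lambda^2/2)$ for all $\lambda\in\mathbb R$ and $t\ge1$, where $\sigma>0$. $\mathcal S^{d-1}$ is the unit sphere in $\mathbb R^d$. LinUCB with deterministic exploration parameter $\beta>0$: $\boldsymbol\Lambda_0=\boldsymbol I_d$, $\boldsymbol\Lambda_t=\boldsymbol I_d+\sum_{s=1}^t\boldsymbol a_s\boldsymbol a_s^\top$, ridge estimator $\overline{\boldsymbol\theta}_t=\boldsymbol\Lambda_t^{-1}\sum_{s=1}^t\boldsymbol a_s r_s$, projected estimator $\widehat{\boldsymbol\theta}_t=\overline{\boldsymbol\theta}_t/\|\overline{\boldsymbol\theta}_t\|_2$ (an arbitrary unit vector if $\overline{\boldsymbol\theta}_t=0$, e.g.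 at $t=0$), and $$\boldsymbol a_t\in\arg\max_{\boldsymbol a\in\mathcal B^d}\Big\{\langle\boldsymbol a,\widehat{\boldsymbol\theta}_{t-1}\rangle+\beta\sqrt{\boldsymbol a^\top\boldsymbol\Lambda_{t-1}^{-1}\boldsymbol a}\Big\}.$$ Asymptotics: $T\to\infty$ with $d,\sigma,\boldsymbol\theta^\star$ fixed; for each horizon $T$ the algorithm is run anew with parameter $\beta=\beta(T,d)$. $f(T)\gg g(T)$ means $f(T)/g(T)\to\infty$ as $T\to\infty$; $\beta=O(\mathrm{poly}\log T)$ means $\beta\le C(\log T)^k$ for some constants $C,k$ not depending on $T$. *)

theory Defs
  imports "HOL-Probability.Probability"
begin

text \<open>The sigma-algebra generated by the pairs of action and reward of rounds \<open>1, \<dots>, t\<close>,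
  the trivial one for \<open>t = 0\<close>.\<close>

definition history ::
  "'w measure \<Rightarrow> (nat \<Rightarrow> 'w \<Rightarrow> real^'n) \<Rightarrow> (nat \<Rightarrow> 'w \<Rightarrow> real) \<Rightarrow> nat \<Rightarrow> 'w measure" where
  "history M a r t =
     vimage_algebra (space M) (\<lambda>\<omega>. \<lambda>s\<in>{1..t}. (a s \<omega>, r s \<omega>))
       (\<Pi>\<^sub>M s\<in>{1..t}. borel \<Otimes>\<^sub>M borel)"

text \<open>The sigma-algebra generated by the rounds \<open>1, \<dots>, t - 1\<close> together with the action of
  round \<open>t\<close>; it equals \<open>history M a r (t - 1)\<close> if that action is a function of the past.\<close>

definition history_action ::
  "'w measure \<Rightarrow> (nat \<Rightarrow> 'w \<Rightarrow> real^'n) \<Rightarrow> (nat \<Rightarrow> 'w \<Rightarrow> real) \<Rightarrow> nat \<Rightarrow> 'w measure" where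
  "history_action M a r t =
     vimage_algebra (space M) (\<lambda>\<omega>. (\<lambda>s\<in>{1..t-1}. (a s \<omega>, r s \<omega>), a t \<omega>))
       ((\<Pi>\<^sub>M s\<in>{1..t-1}. borel \<Otimes>\<^sub>M borel) \<Otimes>\<^sub>M borel)"

definition cond_variance :: "'w measure \<Rightarrow> 'w measure \<Rightarrow> ('w \<Rightarrow> real) \<Rightarrow> 'w \<Rightarrow> real" where
  "cond_variance M F X = real_cond_exp M F (\<lambda>\<omega>. (X \<omega> - real_cond_exp M F X \<omega>)\<^sup>2)"

definition outer :: "real^'n \<Rightarrow> real^'n^'n" where
  "outer x = (\<chi> i j. x $ i * x $ j)"

definition gram :: "(nat \<Rightarrow> real^'n) \<Rightarrow> nat \<Rightarrow> real^'n^'n" where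
  "gram a t = mat 1 + (\<Sum>s=1..t. outer (a s))"

definition ridge :: "(nat \<Rightarrow> real^'n) \<Rightarrow> (nat \<Rightarrow> real) \<Rightarrow> nat \<Rightarrow> real^'n" where
  "ridge a r t = matrix_inv (gram a t) *v (\<Sum>s=1..t. r s *\<^sub>R a s)"

definition ucb :: "real \<Rightarrow> real^'n \<Rightarrow> real^'n^'n \<Rightarrow> real^'n \<Rightarrow> real" where
  "ucb \<beta> \<theta>' \<Lambda> x = x \<bullet> \<theta>' + \<beta> * sqrt (x \<bullet> (matrix_inv \<Lambda> *v x))"

text \<open>One run of LinUCB over \<open>T\<close> rounds. The projected estimator \<open>\<theta>hat\<close> is a parameter, as it
  is an arbitrary random unit vector where the ridge estimator vanishes; ties in the
  maximisation may be broken arbitrarily as well.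

  The noise conditions are relative to the past rewards and actions only. The assumption
  \<open>nonanticipating\<close> says that the learner picks the action of round \<open>t\<close> before the noise of
  that round is drawn: given the past, action and noise are conditionally independent.
  It holds trivially if the action is a function of the past, and it also admits ties broken
  by private randomness.

  The exponential moment bound is stated with \<^const>\<open>nn_cond_exp\<close>, so it includes the
  integrability of all moments of the noise; hence \<^const>\<open>real_cond_exp\<close>, whose values are
  only meaningful for integrable functions, is applied to integrable functions.\<close>

locale linucb = prob_space M for M :: "'w measure" +
  fixes \<theta> :: "real^'n"
    and \<sigma> \<beta> :: real
    and T :: nat
    and a :: "nat \<Rightarrow> 'w \<Rightarrow> real^'n"
    and r \<epsilon> :: "nat \<Rightarrow> 'w \<Rightarrow> real"
    and \<theta>hat :: "nat \<Rightarrow> 'w \<Rightarrow> real^'n"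
  assumes measurable_action: "\<And>t. t \<in> {1..T} \<Longrightarrow> a t \<in> borel_measurable M"
    and measurable_noise: "\<And>t. t \<in> {1..T} \<Longrightarrow> \<epsilon> t \<in> borel_measurable M"
    and measurable_estimator: "\<And>t. t \<le> T \<Longrightarrow> \<theta>hat t \<in> borel_measurable M"
    and reward: "\<And>t \<omega>. t \<in> {1..T} \<Longrightarrow> \<omega> \<in> space M \<Longrightarrow> r t \<omega> = a t \<omega> \<bullet> \<theta> + \<epsilon> t \<omega>"
    and noise_mean: "\<And>t. t \<in> {1..T} \<Longrightarrow>
      AE \<omega> in M. real_cond_exp M (history M a r (t - 1)) (\<epsilon> t) \<omega> = 0"
    and noise_variance: "\<And>t. t \<in> {1..T} \<Longrightarrow>
      AE \<omega> in M. cond_variance M (history M a r (t - 1)) (\<epsilon> t) \<omega> = \<sigma>\<^sup>2"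
    and noise_subgaussian: "\<And>t c. t \<in> {1..T} \<Longrightarrow>
      AE \<omega> in M. nn_cond_exp M (history M a r (t - 1)) (\<lambda>\<omega>. ennreal (exp (c * \<epsilon> t \<omega>))) \<omega>
        \<le> ennreal (exp (\<sigma>\<^sup>2 * c\<^sup>2 / 2))"
    and nonanticipating: "\<And>t g. t \<in> {1..T} \<Longrightarrow> g \<in> borel_measurable borel \<Longrightarrow>
      integrable M (\<lambda>\<omega>. g (\<epsilon> t \<omega>)) \<Longrightarrow>
      AE \<omega> in M. real_cond_exp M (history_action M a r t) (\<lambda>\<omega>. g (\<epsilon> t \<omega>)) \<omega>
        = real_cond_exp M (history M a r (t - 1)) (\<lambda>\<omega>. g (\<epsilon> t \<omega>)) \<omega>"
    and estimator_unit: "\<And>t \<omega>. t \<le> T \<Longrightarrow> \<omega> \<in> space M \<Longrightarrow> norm (\<theta>hat t \<omega>) = 1"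
    and estimator_projected: "\<And>t \<omega>. t \<le> T \<Longrightarrow> \<omega> \<in> space M \<Longrightarrow>
      ridge (\<lambda>s. a s \<omega>) (\<lambda>s. r s \<omega>) t \<noteq> 0 \<Longrightarrow>
      \<theta>hat t \<omega> = ridge (\<lambda>s. a s \<omega>) (\<lambda>s. r s \<omega>) t /\<^sub>R norm (ridge (\<lambda>s. a s \<omega>) (\<lambda>s. r s \<omega>) t)"
    and action_arg_max: "\<And>t \<omega>. t \<in> {1..T} \<Longrightarrow> \<omega> \<in> space M \<Longrightarrow>
      is_arg_max (ucb \<beta> (\<theta>hat (t - 1) \<omega>) (gram (\<lambda>s. a s \<omega>) (t - 1)))
        (\<lambda>x. x \<in> cball 0 1) (a t \<omega>)"

definition tendsto_in_prob ::
  "(nat \<Rightarrow> 'w measure) \<Rightarrow> (nat \<Rightarrow> 'w \<Rightarrow> real) \<Rightarrow> real \<Rightarrow> bool" where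
  "tendsto_in_prob M X c \<longleftrightarrow>
     (\<forall>n. X n \<in> borel_measurable (M n)) \<and>
     (\<forall>e>0. (\<lambda>n. measure (M n) {\<omega> \<in> space (M n). \<bar>X n \<omega> - c\<bar> > e}) \<longlonglongrightarrow> 0)"

text \<open>The law of the sum of the squares of \<open>k\<close> independent standard normal variables.\<close>

definition chi_square :: "nat \<Rightarrow> real measure" where
  "chi_square k =
     distr (\<Pi>\<^sub>M i\<in>{..<k}. density lborel (\<lambda>x. ennreal (std_normal_density x))) borel
       (\<lambda>x. \<Sum>i<k. (x i)\<^sup>2)"

definition quantile :: "real measure \<Rightarrow> real \<Rightarrow> real" where
  "quantile D p = Inf {x. p \<le> cdf D x}"

definition confidence_set :: "real \<Rightarrow> nat \<Rightarrow> real \<Rightarrow> real^'n \<Rightarrow> real \<Rightarrow> (real^'n) set" where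
  "confidence_set \<beta> T \<delta> \<theta>hat v =
     {\<theta> \<in> sphere 0 1. (norm (\<theta>hat - \<theta>))\<^sup>2
        \<le> v * sqrt ((real CARD('n) + 1) / (2 * \<beta>\<^sup>2 * real T))
            * quantile (chi_square (CARD('n) - 1)) (1 - \<delta>)}"

end

theory Submission
  imports Defs "HOL-Real_Asymp.Real_Asymp"
begin

text \<open>After \<open>h\<close> rounds the Gram matrix is close to the matrix with eigenvalue \<open>h\<close> along \<open>\<theta>\<close> and
  \<open>\<beta> sqrt (2 h / (d + 1))\<close> across it. The distance is measured by a log-determinant divergence. If the
  estimation error is small against \<open>\<beta>\<close> in the norm of the Gram matrix, then the optimality
  conditions for the action make the divergence contract by a factor \<open>1 - 1 / (4 h)\<close> in
  each round, up to an error that is small in the limit. A crude lower bound on the Gram matrix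
  after polylogarithmically many rounds starts the recursion. The estimation error is controlled
  by a maximal inequality for the self-normalised noise during a polylogarithmic number of rounds, by which
  time the divergence is below \<open>1\<close>; from then on the Gram matrix is comparable to a
  deterministic one, and peeled exponential tail bounds in finitely many fixed directions lose only
  a factor \<open>sqrt (ln (ln T))\<close>.

  Since the Gram matrix across \<open>\<theta>\<close>, divided by its predicted size, tends to the identity in
  probability, the noise across \<open>\<theta>\<close> satisfies a martingale central limit theorem. The projection of
  the ridge estimator removes the bias along \<open>\<theta>\<close> and leaves, to first order, exactly this noise,
  so that the squared error is asymptotically a multiple of a chi-square variable with \<open>d - 1\<close>
  degrees of freedom.\<close>

section \<open>Positive definite matrices\<close>

text \<open>Origin of the prediction: if the chosen action has bonus \<open>w\<close>, second-order
  optimality balances the size across \<open>\<theta>\<close> at about \<open>\<beta> / w\<close>,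
  while each round adds about \<open>w\<^sup>2\<close> to the log-determinant. With size
  \<open>h\<close> along \<open>\<theta>\<close> and a multiple of \<open>sqrt h\<close> in the
  other \<open>d - 1\<close> directions the log-determinant has slope
  \<open>(d + 1) / (2 h)\<close>. Hence \<open>w\<^sup>2 = (d + 1) / (2 h)\<close>, and
  \<open>\<beta> / w\<close> is the stated size. Obstacle: optimality gives inequalities only and
  does not say which direction across \<open>\<theta>\<close> is explored. The divergence copes with
  this: its trace part needs only those inequalities, its determinant part follows each update
  exactly, and it bounds all Rayleigh quotients at once. The argument is circular: contraction needs
  an accurate estimator, and accuracy at cost \<open>ln (ln T)\<close> needs a small divergence,
  because the general self-normalised bound costs \<open>ln n\<close> over \<open>n\<close> rounds
  and \<open>\<beta>\<close> is only known to beat \<open>sqrt (ln (ln T))\<close>. A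
  polylogarithmic \<open>\<beta>\<close> makes the start-up phase polylogarithmic too, and there
  \<open>ln n\<close> is of order \<open>ln (ln T)\<close>.\<close>

definition tensor :: "real^'n \<Rightarrow> real^'n \<Rightarrow> real^'n^'n" where
  "tensor x y = (\<chi> i j. x $ i * y $ j)"

definition posdef :: "real^'n^'n \<Rightarrow> bool" where
  "posdef A \<longleftrightarrow> transpose A = A \<and> (\<forall>x. x \<noteq> 0 \<longrightarrow> x \<bullet> (A *v x) > 0)"

lemma outer_eq_tensor: "outer x = tensor x x"
  by (simp add: outer_def tensor_def)

lemma tensor_mult_vec: "tensor x y *v z = (y \<bullet> z) *\<^sub>R x"
  by (simp add: tensor_def matrix_vector_mult_def inner_vec_def vec_eq_iff sum_distrib_right
      sum_distrib_left mult_ac)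

lemma transpose_tensor: "transpose (tensor x y) = tensor y x"
  by (simp add: tensor_def transpose_def mult.commute)

lemma transpose_add: "transpose (A + B) = transpose A + transpose (B :: 'a::plus^'n^'m)"
  by (simp add: transpose_def vec_eq_iff)

lemma transpose_diff: "transpose (A - B) = transpose A - transpose (B :: 'a::minus^'n^'m)"
  by (simp add: transpose_def vec_eq_iff)

lemma transpose_scale: "transpose (c *\<^sub>R A) = c *\<^sub>R transpose (A :: real^'n^'m)"
  by (simp add: transpose_def vec_eq_iff)

lemma matrix_mult_tensor: "A ** tensor x y = tensor (A *v x) y"
  by (simp add: tensor_def matrix_matrix_mult_def matrix_vector_mult_def vec_eq_iff
      sum_distrib_left sum_distrib_right mult_ac)

lemma tensor_mult_matrix: "tensor x y ** A = tensor x (transpose A *v y)"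
  by (simp add: tensor_def matrix_matrix_mult_def matrix_vector_mult_def vec_eq_iff
      sum_distrib_left transpose_def mult_ac)

lemma trace_tensor: "trace (tensor x y) = x \<bullet> y"
  by (simp add: trace_def tensor_def inner_vec_def)

lemma trace_scale: "trace (c *\<^sub>R A) = c * trace (A :: real^'n^'n)"
  by (simp add: trace_def sum_distrib_left)

lemma posdef_transpose: "posdef A \<Longrightarrow> transpose A = A"
  by (simp add: posdef_def)

lemma inner_matrix_transpose: "x \<bullet> (A *v y) = (transpose A *v x) \<bullet> (y :: real^'n)"
  by (simp add: dot_lmul_matrix[symmetric])

lemma posdef_sym: "posdef A \<Longrightarrow> x \<bullet> (A *v y) = y \<bullet> (A *v x)"
  by (metis inner_commute inner_matrix_transpose posdef_transpose)

lemma posdef_pos: "posdef A \<Longrightarrow> x \<noteq> 0 \<Longrightarrow> x \<bullet> (A *v x) > 0"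
  by (simp add: posdef_def)

lemma posdef_nonneg: "posdef A \<Longrightarrow> x \<bullet> (A *v x) \<ge> 0"
  by (cases "x = 0") (auto simp: posdef_def less_imp_le)

lemma norm_axis_real: "norm (axis k c :: real^'n) = \<bar>c\<bar>"
  by (simp add: norm_eq_sqrt_inner inner_axis_axis)

lemma matrix_mult_add_rdistrib: "(A + B) ** C = A ** C + B ** (C :: real^'n^'n)"
  by (simp add: vec_eq_iff matrix_matrix_mult_def sum.distrib distrib_right)

text \<open>Matrix determinant lemma. An orthogonal map carries \<open>y\<close> to a multiple of an
  axis; there the matrix differs from the identity in a single column, and Cramer's lemma evaluates
  its determinant.\<close>

lemma det_id_tensor:
  fixes x y :: "real^'n"
  shows "det (mat 1 + tensor x y) = 1 + x \<bullet> y"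
proof -
  fix k :: 'n
  have ax: "det (mat 1 + tensor z (axis k c)) = 1 + c * z $ k" for z :: "real^'n" and c
  proof -
    have "mat 1 + tensor z (axis k c) =
      (\<chi> i j. if j = k then (mat 1 *v (axis k 1 + c *\<^sub>R z)) $ i else (mat 1 :: real^'n^'n) $ i $ j)"
      unfolding matrix_vector_mul_lid by (auto simp: vec_eq_iff tensor_def axis_def mat_def)
    then show ?thesis
      by (simp only: cramer_lemma) (simp add: axis_def)
  qed
  obtain f where f: "orthogonal_transformation f" "f y = axis k (norm y)"
    using orthogonal_transformation_exists[of y "axis k (norm y)"] by (auto simp: norm_axis_real)
  define R where "R = matrix f"
  have R: "orthogonal_matrix R" "\<And>v. R *v v = f v"
    using f(1) by (auto simp: R_def orthogonal_transformation_matrix orthogonal_transformation_linear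
        matrix_works linear_matrix_vector_mul_eq)
  have RR: "R ** transpose R = mat 1"
    using R(1) by (simp add: orthogonal_matrix_def)
  have "R ** (mat 1 + tensor x y) ** transpose R = mat 1 + tensor (R *v x) (R *v y)"
    by (simp add: matrix_add_ldistrib matrix_mult_add_rdistrib matrix_mult_tensor tensor_mult_matrix RR)
  then have "det (R ** (mat 1 + tensor x y) ** transpose R) = 1 + norm y * (R *v x) $ k"
    by (simp add: R(2) f(2) ax)
  moreover have "det R * det R = 1"
    by (metis RR det_I det_mul det_transpose)
  then have "det (R ** (mat 1 + tensor x y) ** transpose R) = det (mat 1 + tensor x y)"
    by (simp add: det_mul)
  moreover have "norm y * (R *v x) $ k = x \<bullet> y"
  proof -
    have "x \<bullet> y = f x \<bullet> f y"
      using f(1) by (simp add: orthogonal_transformation_def)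
    then show ?thesis
      by (simp add: f(2) R(2) inner_axis)
  qed
  ultimately show ?thesis by simp
qed

lemma posdef_invertible:
  assumes "posdef A" shows "invertible A"
proof -
  have "inj ((*v) A)"
  proof (rule injI)
    fix x y assume "A *v x = A *v y"
    then have "(x - y) \<bullet> (A *v (x - y)) = 0"
      by (simp add: matrix_vector_mult_diff_distrib)
    then show "x = y" using posdef_pos[OF assms, of "x - y"] by force
  qed
  then show ?thesis
    by (metis inj_matrix_vector_mult invertible_left_inverse matrix_left_invertible_injective)
qed

lemma
  assumes "posdef A"
  shows posdef_inv_right: "A *v (matrix_inv A *v x) = x"
    and posdef_inv_left: "matrix_inv A *v (A *v x) = x"
    and posdef_inv_mult: "A ** matrix_inv A = mat 1"
    and posdef_inv_mult_left: "matrix_inv A ** A = mat 1"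
  using posdef_invertible[OF assms] someI_ex[of "\<lambda>A'. A ** A' = mat 1 \<and> A' ** A = mat 1"]
  by (auto simp: matrix_vector_mul_assoc matrix_inv_def invertible_def)

lemma posdef_inverse:
  assumes "posdef A" shows "posdef (matrix_inv A)"
proof -
  let ?V = "matrix_inv A"
  have "transpose ?V ** A = mat 1"
    by (metis assms matrix_transpose_mul posdef_inv_mult posdef_transpose transpose_mat)
  then have "transpose ?V = ?V"
    by (metis assms matrix_mul_assoc matrix_mul_lid matrix_mul_rid posdef_inv_mult)
  moreover have "x \<bullet> (?V *v x) > 0" if "x \<noteq> 0" for x
  proof -
    have "?V *v x \<noteq> 0" using that posdef_inv_right[OF assms, of x] by force
    then show ?thesis
      using posdef_pos[OF assms, of "?V *v x"] posdef_inv_right[OF assms, of x] by (simp add: inner_commute)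
  qed
  ultimately show ?thesis by (simp add: posdef_def)
qed

lemma posdef_cauchy:
  assumes "posdef A"
  shows "(x \<bullet> (A *v y))\<^sup>2 \<le> (x \<bullet> (A *v x)) * (y \<bullet> (A *v y))"
proof (cases "y = 0")
  case False
  define c s where "c = y \<bullet> (A *v y)" and "s = (x \<bullet> (A *v y)) / c"
  have c: "c > 0" using posdef_pos[OF assms False] by (simp add: c_def)
  have "0 \<le> (x - s *\<^sub>R y) \<bullet> (A *v (x - s *\<^sub>R y))"
    by (rule posdef_nonneg[OF assms])
  also have "\<dots> = x \<bullet> (A *v x) - 2 * s * (x \<bullet> (A *v y)) + s\<^sup>2 * c"
    by (simp add: matrix_vector_mult_diff_distrib inner_diff_left inner_diff_right
        posdef_sym[OF assms, of y x] c_def power2_eq_square matrix_vector_mult_scaleR algebra_simps)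
  also have "\<dots> = x \<bullet> (A *v x) - (x \<bullet> (A *v y))\<^sup>2 / c"
    using c by (simp add: s_def power2_eq_square field_simps)
  finally show ?thesis using c by (simp add: field_simps c_def[symmetric])
qed simp

lemma posdef_cauchy_inverse:
  assumes "posdef A"
  shows "(x \<bullet> y)\<^sup>2 \<le> (x \<bullet> (A *v x)) * (y \<bullet> (matrix_inv A *v y))"
  using posdef_cauchy[OF assms, of x "matrix_inv A *v y"]
  by (simp add: posdef_inv_right[OF assms] inner_commute)

text \<open>In terms of eigenvalues this is \<open>ln c \<le> c - 1\<close>, summed up. Elimination
  takes the place of eigenvalues: \<open>K\<close> is the set of coordinates in which
  \<open>X\<close> may still differ from the identity, each step clears one of them, and its pivot
  \<open>c\<close> contributes \<open>ln c \<le> c - 1\<close>.\<close>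

lemma posdef_det_trace_aux:
  fixes X :: "real^'n^'n"
  assumes "finite K" "posdef X"
    and "\<And>i j. i \<notin> K \<or> j \<notin> K \<Longrightarrow> X $ i $ j = (if i = j then 1 else 0)"
  shows "0 < det X \<and> real CARD('n) + ln (det X) \<le> trace X"
  using assms
proof (induction K arbitrary: X rule: finite_induct)
  case empty
  then have "X = mat 1" by (simp add: vec_eq_iff mat_def)
  then show ?case by (simp add: trace_I)
next
  case (insert k K)
  define e :: "real^'n" where "e = axis k 1"
  define y where "y = X *v e"
  define c where "c = y $ k"
  have yi: "y $ i = X $ i $ k" for i
    by (simp add: y_def e_def matrix_vector_mult_def axis_def if_distrib cong: if_cong)
  have sym: "X $ i $ j = X $ j $ i" for i j
    using posdef_transpose[OF insert.prems(1)] by (metis transpose_def vec_lambda_beta)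
  have ce: "e \<bullet> (X *v e) = c" by (simp add: c_def y_def e_def inner_axis')
  have e0: "e \<noteq> 0" by (simp add: e_def axis_eq_0_iff)
  have c: "c > 0" using posdef_pos[OF insert.prems(1) e0] ce by simp
  \<comment> \<open>\<open>Y\<close> is the Schur complement of the pivot, with row and column
    \<open>k\<close> reset to those of the identity. \<open>D\<close> puts the pivot back on the
    diagonal, and \<open>I + z e^T\<close> is the unipotent factor in
    \<open>X = (I + z e^T) D (I + z e^T)^T\<close>.\<close>
  define Y where "Y = X - (1 / c) *\<^sub>R tensor y y + tensor e e"
  define D where "D = Y + (c - 1) *\<^sub>R tensor e e"
  define z where "z = (1 / c) *\<^sub>R y - e"
  have ek: "e $ i = (if i = k then 1 else 0)" for i by (auto simp: e_def axis_def)
  have Yij: "Y $ i $ j = X $ i $ j - y $ i * y $ j / c + (if i = k \<and> j = k then 1 else 0)" for i j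
    by (simp add: Y_def tensor_def ek)
  have pdY: "posdef Y"
    unfolding posdef_def
  proof (intro conjI allI impI)
    show "transpose Y = Y"
      by (simp add: Y_def transpose_add transpose_diff transpose_scale transpose_tensor
          posdef_transpose[OF insert.prems(1)])
    fix x :: "real^'n" assume x: "x \<noteq> 0"
    \<comment> \<open>\<open>s\<close> minimises the form of \<open>X\<close> along the line
      \<open>x - s e\<close>; the form of \<open>Y\<close> is this minimum plus the square of
      coordinate \<open>k\<close>.\<close>
    define s where "s = (x \<bullet> y) / c"
    have eq: "x \<bullet> (Y *v x) = (x - s *\<^sub>R e) \<bullet> (X *v (x - s *\<^sub>R e)) + (x $ k)\<^sup>2"
    proof -
      have "x \<bullet> (Y *v x) = x \<bullet> (X *v x) - (x \<bullet> y)\<^sup>2 / c + (x $ k)\<^sup>2"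
        unfolding Y_def
        by (simp add: matrix_vector_mult_add_rdistrib matrix_vector_mult_diff_rdistrib
            scaleR_matrix_vector_assoc[symmetric] tensor_mult_vec inner_add_right inner_diff_right inner_commute power2_eq_square)
          (simp add: e_def inner_axis inner_commute)
      moreover have "(x - s *\<^sub>R e) \<bullet> (X *v (x - s *\<^sub>R e)) = x \<bullet> (X *v x) - 2 * s * (x \<bullet> y) + s\<^sup>2 * c"
        by (simp add: matrix_vector_mult_diff_distrib inner_diff_left inner_diff_right
            posdef_sym[OF insert.prems(1), of e x] y_def[symmetric] ce power2_eq_square matrix_vector_mult_scaleR algebra_simps)
          (simp add: ce[folded y_def])
      moreover have "2 * s * (x \<bullet> y) - s\<^sup>2 * c = (x \<bullet> y)\<^sup>2 / c"
        using c by (simp add: s_def power2_eq_square field_simps)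
      ultimately show ?thesis by linarith
    qed
    show "x \<bullet> (Y *v x) > 0"
    proof (cases "x = s *\<^sub>R e")
      case True
      then have "x $ k \<noteq> 0" using x by (auto simp: ek)
      then show ?thesis using eq True by simp
    next
      case False
      then have "(x - s *\<^sub>R e) \<bullet> (X *v (x - s *\<^sub>R e)) > 0"
        using posdef_pos[OF insert.prems(1)] by simp
      then show ?thesis using eq by (simp add: add_pos_nonneg)
    qed
  qed
  have idY: "Y $ i $ j = (if i = j then 1 else 0)" if "i \<notin> K \<or> j \<notin> K" for i j
  proof -
    have kk: "X $ k $ k > 0" using c by (simp add: c_def yi)
    show ?thesis
    proof (cases "i = k \<or> j = k")
      case True
      then show ?thesis using kk sym[of j k] sym[of i k] by (auto simp: Yij yi c_def)
    next
      case False
      then have "X $ i $ k = 0 \<or> X $ j $ k = 0"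
        using that insert.prems(2)[of i k] insert.prems(2)[of j k] by auto
      then show ?thesis using False that insert.prems(2)[of i j] by (auto simp: Yij yi)
    qed
  qed
  have IH: "0 < det Y" "real CARD('n) + ln (det Y) \<le> trace Y"
    using insert.IH[OF pdY idY] by auto
  have detD: "det D = c * det Y"
  proof -
    have "det ((\<chi> i. if i = k then c *s row k Y else row i Y) :: real^'n^'n) =
        c * det ((\<chi> i. if i = k then row k Y else row i Y) :: real^'n^'n)"
      by (rule det_row_mul[of k c "\<lambda>i. row k Y" "\<lambda>i. row i Y"])
    moreover have "(\<chi> i. if i = k then c *s row k Y else row i Y) = D"
      using insert.hyps idY[of k] by (auto simp: D_def vec_eq_iff row_def tensor_def ek)
    moreover have "(\<chi> i. if i = k then row k Y else row i Y) = Y"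
      by (auto simp: vec_eq_iff row_def)
    ultimately show ?thesis by simp
  qed
  have LDL: "(mat 1 + tensor z e) ** D ** transpose (mat 1 + tensor z e) = X"
  proof -
    have De: "D *v e = c *\<^sub>R e"
      using insert.hyps idY[of _ k]
      by (auto simp: D_def vec_eq_iff matrix_vector_mult_def tensor_def ek if_distrib cong: if_cong)
    have tD: "transpose D = D"
      using pdY by (simp add: D_def transpose_add transpose_scale transpose_tensor posdef_transpose)
    have "(mat 1 + tensor z e) ** D = D + tensor z (c *\<^sub>R e)"
      by (simp add: matrix_mult_add_rdistrib tensor_mult_matrix tD De)
    moreover have "(D + tensor z (c *\<^sub>R e)) *v e = c *\<^sub>R e + c *\<^sub>R z"
      by (simp add: matrix_vector_mult_add_rdistrib De tensor_mult_vec) (simp add: e_def inner_axis_axis)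
    ultimately have "(mat 1 + tensor z e) ** D ** transpose (mat 1 + tensor z e)
       = D + tensor z (c *\<^sub>R e) + tensor (c *\<^sub>R e + c *\<^sub>R z) z"
      by (simp add: transpose_add transpose_tensor matrix_add_ldistrib matrix_mult_tensor)
    also have "\<dots> = X"
      using c by (simp add: vec_eq_iff tensor_def D_def Y_def z_def field_simps)
    finally show ?thesis .
  qed
  have "det (mat 1 + tensor z e) = 1"
  proof -
    have "z $ k = 0" using c by (simp add: z_def c_def[symmetric] ek)
    then show ?thesis by (simp add: det_id_tensor e_def inner_axis)
  qed
  then have detX: "det X = c * det Y"
    using arg_cong[OF LDL, of det] by (simp add: det_mul detD)
  have "trace X = trace Y + (1 / c) * (y \<bullet> y) - 1"
    by (simp add: Y_def trace_add trace_sub trace_scale trace_tensor)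
      (simp add: e_def inner_axis_axis)
  moreover have "y \<bullet> y \<ge> c * c"
    unfolding c_def inner_vec_def inner_real_def by (rule member_le_sum) auto
  then have "(1 / c) * (y \<bullet> y) \<ge> c" using c by (simp add: field_simps)
  moreover have "ln (det X) = ln c + ln (det Y)" using c IH(1) by (simp add: detX ln_mult)
  moreover have "ln c \<le> c - 1" using c by (rule ln_le_minus_one)
  ultimately show ?case using IH c detX by simp
qed

lemma
  fixes X :: "real^'n^'n"
  assumes "posdef X"
  shows posdef_det_pos: "0 < det X"
    and posdef_ln_det_le_trace: "real CARD('n) + ln (det X) \<le> trace X"
  using posdef_det_trace_aux[of UNIV X] assms by auto

section \<open>The log-determinant divergence\<close>

text \<open>For unit \<theta>, the trace of the compression of \<open>A\<close> to the orthogonal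
  complement of \<theta>.\<close>

definition tau :: "real^'n \<Rightarrow> real^'n^'n \<Rightarrow> real" where
  "tau \<theta> A = trace A - \<theta> \<bullet> (A *v \<theta>)"

text \<open>For unit \<theta>, the symmetric matrix with eigenvalue \<open>p\<close> on the line of
  \<theta> and \<open>q\<close> across it. Products, inverses and square roots stay in this family,
  which is all the spectral calculus that the proof uses.\<close>

definition stretch :: "real^'n \<Rightarrow> real \<Rightarrow> real \<Rightarrow> real^'n^'n" where
  "stretch \<theta> p q = q *\<^sub>R mat 1 + (p - q) *\<^sub>R tensor \<theta> \<theta>"

lemma stretch_vec: "stretch \<theta> p q *v x = q *\<^sub>R x + ((p - q) * (\<theta> \<bullet> x)) *\<^sub>R \<theta>"
  by (simp add: stretch_def matrix_vector_mult_add_rdistrib scaleR_matrix_vector_assoc[symmetric]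
      tensor_mult_vec)

lemma transpose_stretch: "transpose (stretch \<theta> p q) = stretch \<theta> p q"
  by (simp add: stretch_def transpose_add transpose_scale transpose_tensor)

lemma det_scaleR: "det (c *\<^sub>R (A :: real^'n^'n)) = c ^ CARD('n) * det A"
proof -
  have "c *\<^sub>R A = (\<chi> i. c *s A $ i)"
    by (simp add: vec_eq_iff)
  then show ?thesis by (simp add: det_rows_mul)
qed

lemma stretch_mult:
  assumes "norm \<theta> = 1"
  shows "stretch \<theta> p q ** stretch \<theta> p' q' = stretch \<theta> (p * p') (q * q')"
proof -
  have t: "\<theta> \<bullet> \<theta> = 1" using assms by (simp add: norm_eq_1)
  show ?thesis
    by (rule iffD2[OF matrix_eq])
      (simp add: matrix_vector_mul_assoc[symmetric] stretch_vec inner_add_right t algebra_simps)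
qed

lemma det_stretch:
  fixes \<theta> :: "real^'n"
  assumes "norm \<theta> = 1" "q \<noteq> 0"
  shows "det (stretch \<theta> p q) = p * q ^ (CARD('n) - 1)"
proof -
  have t: "\<theta> \<bullet> \<theta> = 1" using assms by (simp add: norm_eq_1)
  have "stretch \<theta> p q = q *\<^sub>R (mat 1 + tensor (((p - q) / q) *\<^sub>R \<theta>) \<theta>)"
    using assms(2) by (simp add: stretch_def vec_eq_iff tensor_def field_simps)
  then have "det (stretch \<theta> p q) = q ^ CARD('n) * (1 + (p - q) / q)"
    by (simp add: det_scaleR det_id_tensor t)
  also have "\<dots> = q ^ (CARD('n) - 1) * q * (p / q)"
    using assms(2) by (simp add: field_simps flip: power_Suc)
  finally show ?thesis using assms(2) by simp
qed

lemma inner_sandwich: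
  "x \<bullet> ((transpose B ** A ** B) *v y) = (B *v x) \<bullet> (A *v (B *v (y :: real^'n)))"
  by (metis inner_matrix_transpose matrix_vector_mul_assoc transpose_transpose)

lemma posdef_sandwich:
  fixes A B :: "real^'n^'n"
  assumes "posdef A" "invertible B"
  shows "posdef (transpose B ** A ** B)"
  unfolding posdef_def
proof (intro conjI allI impI)
  show "transpose (transpose B ** A ** B) = transpose B ** A ** B"
    using assms(1) by (simp add: matrix_transpose_mul posdef_transpose matrix_mul_assoc)
  fix x :: "real^'n" assume "x \<noteq> 0"
  then have "B *v x \<noteq> 0"
    using assms(2) by (metis inj_matrix_vector_mult injD matrix_vector_mult_0_right)
  then show "0 < x \<bullet> ((transpose B ** A ** B) *v x)"
    by (simp add: inner_sandwich posdef_pos[OF assms(1)])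
qed

text \<open>The tangent plane inequality of the concave function \<open>ln det\<close> at the matrices that are
  scalar on the line of \<open>\<theta>\<close> and on its orthogonal complement.\<close>

lemma ln_det_le_stretched_trace:
  fixes A :: "real^'n^'n"
  assumes A: "posdef A" and \<theta>: "norm \<theta> = 1" and h: "h1 > 0" "h2 > 0"
  shows "real CARD('n) + ln (det A) + ln h1 + (real CARD('n) - 1) * ln h2
    \<le> h1 * (\<theta> \<bullet> (A *v \<theta>)) + h2 * tau \<theta> A"
proof -
  \<comment> \<open>\<open>S\<close> is the square root of the matrix with weights \<open>h1\<close>
    and \<open>h2\<close>. Congruence by \<open>S\<close> turns the weighted traces into an ordinary
    trace and reduces the claim to the inequality at the identity.\<close>
  define S where "S = stretch \<theta> (sqrt h1) (sqrt h2)"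
  have detS: "det S = sqrt h1 * sqrt h2 ^ (CARD('n) - 1)"
    using h by (simp add: S_def det_stretch[OF \<theta>])
  have pd: "posdef (transpose S ** A ** S)"
    using h detS by (intro posdef_sandwich[OF A]) (simp add: invertible_det_nz)
  have SS: "S ** transpose S = stretch \<theta> h1 h2"
    using h by (simp add: S_def transpose_stretch stretch_mult[OF \<theta>])
  have "trace (transpose S ** A ** S) = trace (stretch \<theta> h1 h2 ** A)"
    by (metis SS matrix_mul_assoc trace_mul_sym)
  also have "\<dots> = h2 * trace A + (h1 - h2) * (\<theta> \<bullet> (A *v \<theta>))"
  proof -
    have "stretch \<theta> h1 h2 ** A = h2 *\<^sub>R A + (h1 - h2) *\<^sub>R tensor \<theta> (A *v \<theta>)"
      using A by (simp add: stretch_def matrix_mult_add_rdistrib scalar_matrix_assoc[symmetric]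
          tensor_mult_matrix posdef_transpose)
    then show ?thesis by (simp add: trace_add trace_scale trace_tensor)
  qed
  finally have tr: "trace (transpose S ** A ** S) = h1 * (\<theta> \<bullet> (A *v \<theta>)) + h2 * tau \<theta> A"
    by (simp add: tau_def algebra_simps)
  have c: "real (CARD('n) - 1) = real CARD('n) - 1"
    by (simp add: of_nat_diff Suc_leI)
  have dp: "det A > 0" by (rule posdef_det_pos[OF A])
  have "det (transpose S ** A ** S) = det A * (det S * det S)" by (simp add: det_mul)
  also have "det S * det S = h1 * h2 ^ (CARD('n) - 1)"
    using h by (simp add: detS algebra_simps flip: power_mult_distrib)
  finally have "ln (det (transpose S ** A ** S)) = ln (det A) + (ln h1 + (real CARD('n) - 1) * ln h2)"
    using h dp by (simp add: ln_mult ln_realpow c)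
  then show ?thesis
    using posdef_ln_det_le_trace[OF pd] tr by simp
qed

text \<open>The tangent inequality with weight \<open>1 / q\<close> along \<open>e\<close> and
  \<open>1\<close> across it, where \<open>q\<close> is the Rayleigh quotient of \<open>e\<close>:
  the deviation in one direction never exceeds the total one.\<close>

lemma ln_det_rayleigh:
  fixes A :: "real^'n^'n"
  assumes A: "posdef A" and e: "norm e = 1"
  shows "e \<bullet> (A *v e) - 1 - ln (e \<bullet> (A *v e)) \<le> trace A - real CARD('n) - ln (det A)"
proof -
  have e0: "e \<noteq> 0" using e by auto
  have q: "e \<bullet> (A *v e) > 0" by (rule posdef_pos[OF A e0])
  have "real CARD('n) + ln (det A) + ln (1 / (e \<bullet> (A *v e))) \<le> 1 + tau e A"
    using ln_det_le_stretched_trace[OF A e, of "1 / (e \<bullet> (A *v e))" 1] q by simp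
  then show ?thesis using q by (simp add: tau_def ln_div)
qed

text \<open>The quadratic form of \<open>stretch \<theta> h1 h2\<close> for unit \<theta>, written
  without the matrix.\<close>

definition wnorm2 :: "real^'n \<Rightarrow> real \<Rightarrow> real \<Rightarrow> real^'n \<Rightarrow> real" where
  "wnorm2 \<theta> h1 h2 x = h1 * (\<theta> \<bullet> x)\<^sup>2 + h2 * (x \<bullet> x - (\<theta> \<bullet> x)\<^sup>2)"

lemma norm_stretch:
  assumes \<theta>: "norm \<theta> = 1"
  shows "(stretch \<theta> p q *v x) \<bullet> (stretch \<theta> p q *v x) = wnorm2 \<theta> (p\<^sup>2) (q\<^sup>2) x"
proof -
  have t: "\<theta> \<bullet> \<theta> = 1" using assms by (simp add: norm_eq_1)
  show ?thesis
    by (simp add: stretch_vec wnorm2_def inner_add_left inner_add_right t inner_commute[of x \<theta>]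
        power2_eq_square algebra_simps)
qed

text \<open>Stein's loss of \<open>A\<close> relative to \<open>P = stretch \<theta> h1 h2\<close>,
  that is \<open>tr (P^-1 A) - d - ln det (P^-1 A)\<close>: twice the Kullback-Leibler divergence
  between centred Gaussians with covariances \<open>A\<close> and \<open>P\<close>.\<close>

definition logdet_div :: "real^'n \<Rightarrow> real \<Rightarrow> real \<Rightarrow> real^'n^'n \<Rightarrow> real" where
  "logdet_div \<theta> h1 h2 A = (\<theta> \<bullet> (A *v \<theta>)) / h1 + tau \<theta> A / h2 - real CARD('n)
     - ln (det A) + ln h1 + (real CARD('n) - 1) * ln h2"

text \<open>Whitening by \<open>S = P^(-1/2)\<close> turns the quotient \<open>q\<close> into the
  Rayleigh quotient of a unit vector, to which \<open>ln_det_rayleigh\<close> applies. In this way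
  one scalar controls the matrix in every direction.\<close>

lemma logdet_div_rayleigh:
  fixes A :: "real^'n^'n"
  assumes A: "posdef A" and \<theta>: "norm \<theta> = 1" and h: "h1 > 0" "h2 > 0" and x: "x \<noteq> 0"
  defines "q \<equiv> (x \<bullet> (A *v x)) / wnorm2 \<theta> h1 h2 x"
  shows "wnorm2 \<theta> h1 h2 x > 0" "q > 0" "q - 1 - ln q \<le> logdet_div \<theta> h1 h2 A"
proof -
  define S where "S = stretch \<theta> (1 / sqrt h1) (1 / sqrt h2)"
  define R where "R = stretch \<theta> (sqrt h1) (sqrt h2)"
  have t: "\<theta> \<bullet> \<theta> = 1" using \<theta> by (simp add: norm_eq_1)
  have SR: "S ** R = mat 1"
    unfolding S_def R_def stretch_mult[OF \<theta>] using h by (simp add: stretch_def)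
  define y where "y = R *v x"
  have Sy: "S *v y = x" by (simp add: y_def matrix_vector_mul_assoc SR)
  have y0: "y \<noteq> 0" using Sy x by force
  have ny: "norm y ^ 2 = wnorm2 \<theta> h1 h2 x"
    using h by (simp add: y_def R_def power2_norm_eq_inner norm_stretch[OF \<theta>])
  show n0: "wnorm2 \<theta> h1 h2 x > 0" using ny y0 by (metis zero_less_norm_iff zero_less_power)
  show "q > 0" using posdef_pos[OF A x] n0 by (simp add: q_def)
  define e where "e = y /\<^sub>R norm y"
  have e: "norm e = 1" using y0 by (simp add: e_def)
  have detS: "det S = (1 / sqrt h1) * (1 / sqrt h2) ^ (CARD('n) - 1)"
    using h by (simp add: S_def det_stretch[OF \<theta>])
  define X where "X = transpose S ** A ** S"
  have pd: "posdef X"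
    unfolding X_def using h detS by (intro posdef_sandwich[OF A]) (simp add: invertible_det_nz)
  have "e \<bullet> (X *v e) = q"
    unfolding X_def inner_sandwich
    by (simp add: e_def matrix_vector_mult_scaleR Sy q_def ny[symmetric] power2_eq_square divide_inverse)
  moreover have "trace X = (\<theta> \<bullet> (A *v \<theta>)) / h1 + tau \<theta> A / h2"
  proof -
    have SS: "S ** transpose S = stretch \<theta> (1 / h1) (1 / h2)"
      using h by (simp add: S_def transpose_stretch stretch_mult[OF \<theta>])
    have "trace X = trace (stretch \<theta> (1 / h1) (1 / h2) ** A)"
      unfolding X_def by (metis SS matrix_mul_assoc trace_mul_sym)
    also have "stretch \<theta> (1 / h1) (1 / h2) ** A
        = (1 / h2) *\<^sub>R A + (1 / h1 - 1 / h2) *\<^sub>R tensor \<theta> (A *v \<theta>)"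
      using A unfolding stretch_def matrix_mult_add_rdistrib scalar_matrix_assoc[symmetric]
      by (simp add: tensor_mult_matrix posdef_transpose)
    finally show ?thesis
      by (simp only: trace_add trace_scale trace_tensor tau_def)
        (simp add: algebra_simps diff_divide_distrib)
  qed
  moreover have "ln (det X) = ln (det A) - ln h1 - (real CARD('n) - 1) * ln h2"
  proof -
    have c: "real (CARD('n) - 1) = real CARD('n) - 1"
      by (simp add: of_nat_diff Suc_leI)
    have "det X = det A * (det S * det S)" by (simp add: X_def det_mul)
    also have "det S * det S = (1 / h1) * (1 / h2) ^ (CARD('n) - 1)"
    proof -
      have "det S * det S = ((1 / sqrt h1) * (1 / sqrt h1)) * ((1 / sqrt h2) * (1 / sqrt h2)) ^ (CARD('n) - 1)"
        unfolding detS by (simp only: power_mult_distrib mult_ac)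
      also have "(1 / sqrt h1) * (1 / sqrt h1) = 1 / h1" using h by simp
      also have "(1 / sqrt h2) * (1 / sqrt h2) = 1 / h2" using h by simp
      finally show ?thesis .
    qed
    finally show ?thesis
      using h posdef_det_pos[OF A] by (simp add: ln_mult ln_realpow ln_div c power_divide)
  qed
  ultimately show "q - 1 - ln q \<le> logdet_div \<theta> h1 h2 A"
    using ln_det_rayleigh[OF pd e] by (simp add: logdet_div_def)
qed

text \<open>The projections of the standard basis form a tight frame of the hyperplane across
  \<theta>, so the trace there can be summed without choosing an orthonormal basis.\<close>

lemma tau_eq_sum:
  fixes A :: "real^'n^'n"
  assumes A: "posdef A" and \<theta>: "norm \<theta> = 1"
  shows "tau \<theta> A = (\<Sum>j\<in>UNIV. (axis j 1 - (\<theta> $ j) *\<^sub>R \<theta>) \<bullet> (A *v (axis j 1 - (\<theta> $ j) *\<^sub>R \<theta>)))"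
proof -
  have t: "(\<Sum>j\<in>UNIV. \<theta> $ j * \<theta> $ j) = 1" using \<theta> by (simp add: norm_eq_1 inner_vec_def)
  have "(axis j 1 - (\<theta> $ j) *\<^sub>R \<theta>) \<bullet> (A *v (axis j 1 - (\<theta> $ j) *\<^sub>R \<theta>))
     = A $ j $ j - 2 * (\<theta> $ j * (A *v \<theta>) $ j) + \<theta> $ j * \<theta> $ j * (\<theta> \<bullet> (A *v \<theta>))" for j
  proof -
    have "axis j 1 \<bullet> (A *v axis j 1) = A $ j $ j"
      unfolding inner_axis' by (simp add: matrix_vector_mult_def axis_def if_distrib cong: if_cong)
    then show ?thesis
      by (simp add: matrix_vector_mult_diff_distrib inner_diff_left inner_diff_right
          posdef_sym[OF A, of \<theta> "axis j 1"] matrix_vector_mult_scaleR inner_axis' algebra_simps)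
  qed
  then show ?thesis
    by (simp add: tau_def trace_def sum.distrib sum_subtractf t inner_vec_def
        flip: sum_distrib_left sum_distrib_right)
qed

section \<open>Gram matrices and the action of LinUCB\<close>

lemma gram_0 [simp]: "gram a 0 = mat 1"
  by (simp add: gram_def)

lemma gram_Suc: "gram a (Suc t) = gram a t + tensor (a (Suc t)) (a (Suc t))"
  by (simp add: gram_def outer_eq_tensor add.assoc)

lemma matrix_sum_vec: "(\<Sum>i\<in>I. A i) *v x = (\<Sum>i\<in>I. A i *v (x :: real^'n))"
  by (induction I rule: infinite_finite_induct) (auto simp: matrix_vector_mult_add_rdistrib)

lemma gram_vec: "gram a t *v x = x + (\<Sum>s=1..t. (a s \<bullet> x) *\<^sub>R a s)"
  by (simp add: gram_def matrix_vector_mult_add_rdistrib matrix_sum_vec outer_eq_tensor tensor_mult_vec)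

lemma gram_form: "x \<bullet> (gram a t *v x) = x \<bullet> x + (\<Sum>s=1..t. (a s \<bullet> x)\<^sup>2)"
  by (simp add: gram_vec inner_add_right inner_sum_right power2_eq_square inner_commute)

lemma gram_form_ge: "x \<bullet> x \<le> x \<bullet> (gram a t *v x)"
  by (simp add: gram_form sum_nonneg)

lemma posdef_gram: "posdef (gram a t)"
proof -
  have "transpose (gram a t) = gram a t"
    by (induction t) (auto simp: gram_Suc transpose_add transpose_tensor)
  moreover have "x \<bullet> (gram a t *v x) > 0" if "x \<noteq> 0" for x
    using gram_form_ge[of x a t] that by (metis inner_gt_zero_iff order.strict_trans2)
  ultimately show ?thesis by (simp add: posdef_def)
qed

lemma gram_form_mono:
  assumes "s \<le> t" shows "x \<bullet> (gram a s *v x) \<le> x \<bullet> (gram a t *v x)"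
  unfolding gram_form using assms by (intro add_left_mono sum_mono2) auto

section \<open>Determinants and inverses under rank-one updates\<close>

lemma det_add_tensor:
  assumes "posdef A"
  shows "det (A + tensor x x) = det A * (1 + x \<bullet> (matrix_inv A *v x))"
proof -
  have "A + tensor x x = A ** (mat 1 + tensor (matrix_inv A *v x) x)"
    by (simp add: matrix_add_ldistrib matrix_mult_tensor posdef_inv_right[OF assms])
  then show ?thesis by (simp add: det_mul det_id_tensor inner_commute)
qed

text \<open>The identity behind the elliptical potential lemma: every round multiplies the
  determinant by one plus the squared bonus of its action.\<close>

lemma ln_det_gram:
  "ln (det (gram a t)) = (\<Sum>s<t. ln (1 + a (Suc s) \<bullet> (matrix_inv (gram a s) *v a (Suc s))))"
proof (induction t)
  case (Suc t)
  have "0 \<le> a (Suc t) \<bullet> (matrix_inv (gram a t) *v a (Suc t))"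
    by (intro posdef_nonneg posdef_inverse posdef_gram)
  then show ?case
    using posdef_det_pos[OF posdef_gram, of a t] Suc
    by (simp add: gram_Suc det_add_tensor[OF posdef_gram] ln_mult)
qed simp

lemma trace_gram:
  assumes "\<And>s. s \<in> {1..t} \<Longrightarrow> norm (a s) = 1"
  shows "trace (gram a t :: real^'n^'n) = real CARD('n) + real t"
  using assms
proof (induction t)
  case (Suc t)
  then show ?case by (simp add: gram_Suc trace_add trace_tensor norm_eq_1[symmetric])
qed (simp add: trace_I)

text \<open>The tangent inequality with both weights \<open>1 / (1 + t)\<close>, combined with the
  known trace \<open>d + t\<close>. With equal weights the auxiliary unit vector cancels.\<close>

lemma sum_ln_le:
  fixes a :: "nat \<Rightarrow> real^'n"
  assumes "\<And>s. s \<in> {1..t} \<Longrightarrow> norm (a s) = 1"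
  shows "ln (det (gram a t)) \<le> real CARD('n) * ln (1 + real t)"
proof -
  obtain \<theta> :: "real^'n" where \<theta>: "norm \<theta> = 1"
    using vector_choose_size[of 1] by auto
  have "1 + real t \<noteq> 0" by linarith
  have "real CARD('n) + ln (det (gram a t)) + ln (1 / (1 + real t)) + (real CARD('n) - 1) * ln (1 / (1 + real t))
     \<le> 1 / (1 + real t) * (\<theta> \<bullet> (gram a t *v \<theta>)) + 1 / (1 + real t) * tau \<theta> (gram a t)"
    by (rule ln_det_le_stretched_trace[OF posdef_gram \<theta>]) auto
  also have "\<dots> = (real CARD('n) + real t) / (1 + real t)"
    using trace_gram[OF assms] by (simp add: tau_def flip: distrib_left add_divide_distrib)
  also have "\<dots> \<le> real CARD('n)"
  proof -
    have "1 \<le> real CARD('n)" by (simp add: Suc_leI)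
    then have "real t * 1 \<le> real t * real CARD('n)" by (intro mult_left_mono) auto
    then show ?thesis by (simp add: field_simps)
  qed
  finally show ?thesis by (simp add: ln_div algebra_simps)
qed

text \<open>Inversion reverses the order of positive definite matrices. Cauchy-Schwarz between the
  form of \<open>B\<close> and that of its inverse, at \<open>y = matrix_inv A *v x\<close>, bounds
  the form by itself times the wanted quotient.\<close>

lemma inverse_form_le:
  assumes A: "posdef A" and B: "posdef B" and c: "c > 0"
    and le: "\<And>y. c * (y \<bullet> (B *v y)) \<le> y \<bullet> (A *v y)"
  shows "x \<bullet> (matrix_inv A *v x) \<le> (x \<bullet> (matrix_inv B *v x)) / c"
proof (cases "x = 0")
  case False
  define y where "y = matrix_inv A *v x"
  have q: "x \<bullet> y > 0" unfolding y_def by (intro posdef_pos posdef_inverse A False)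
  have Ay: "A *v y = x" by (simp add: y_def posdef_inv_right[OF A])
  have "(y \<bullet> x)\<^sup>2 \<le> (y \<bullet> (B *v y)) * (x \<bullet> (matrix_inv B *v x))"
    by (rule posdef_cauchy_inverse[OF B])
  also have "\<dots> \<le> ((y \<bullet> x) / c) * (x \<bullet> (matrix_inv B *v x))"
    using le[of y] c by (intro mult_right_mono posdef_nonneg posdef_inverse B) (simp add: Ay field_simps)
  finally have "(y \<bullet> x) * (y \<bullet> x) \<le> (y \<bullet> x) * ((x \<bullet> (matrix_inv B *v x)) / c)"
    by (simp add: power2_eq_square)
  then have "y \<bullet> x \<le> (x \<bullet> (matrix_inv B *v x)) / c"
    using q by (simp only: mult_le_cancel_left_pos inner_commute)
  then show ?thesis by (simp add: y_def inner_commute)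
qed simp

lemma sherman_morrison_vec:
  assumes A: "posdef A" and A': "posdef (A + tensor a a)"
  defines "V \<equiv> matrix_inv A"
  shows "matrix_inv (A + tensor a a) *v x = V *v x - ((a \<bullet> (V *v x)) / (1 + a \<bullet> (V *v a))) *\<^sub>R (V *v a)"
proof -
  define k where "k = (a \<bullet> (V *v x)) / (1 + a \<bullet> (V *v a))"
  have "0 \<le> a \<bullet> (V *v a)" unfolding V_def by (intro posdef_nonneg posdef_inverse A)
  then have "k * (1 + a \<bullet> (V *v a)) = a \<bullet> (V *v x)" by (simp add: k_def)
  then have k: "a \<bullet> (V *v x) = k + k * (a \<bullet> (V *v a))" by (simp add: algebra_simps)
  have "(A + tensor a a) *v (V *v x - k *\<^sub>R (V *v a)) = x"
    by (simp add: matrix_vector_mult_add_rdistrib matrix_vector_mult_diff_distrib tensor_mult_vec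
        matrix_vector_mult_scaleR V_def posdef_inv_right[OF A] inner_diff_right flip: k_def)
      (simp add: k[unfolded V_def] algebra_simps)
  then show ?thesis unfolding k_def[symmetric] by (metis posdef_inv_left[OF A'])
qed

text \<open>The increment of the self-normalised form, sorted by powers of the new noise
  \<open>e\<close>. For centred noise of variance \<sigma>^2 given the past, the linear term
  averages out, the term in \<open>b\<close> only helps, and the mean growth is at most
  \<open>\<sigma>^2 w2 / (1 + w2)\<close>.\<close>

lemma selfnorm_step:
  fixes A :: "real^'n^'n" and S :: "real^'n"
  assumes A: "posdef A" and A': "posdef (A + tensor a a)"
  defines "V \<equiv> matrix_inv A"
  defines "w2 \<equiv> a \<bullet> (V *v a)" and "b \<equiv> a \<bullet> (V *v S)"
  shows "(S + e *\<^sub>R a) \<bullet> (matrix_inv (A + tensor a a) *v (S + e *\<^sub>R a))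
    = S \<bullet> (V *v S) - b\<^sup>2 / (1 + w2) + 2 * e * b / (1 + w2) + e\<^sup>2 * w2 / (1 + w2)"
proof -
  have w: "0 \<le> w2" unfolding V_def w2_def by (intro posdef_nonneg posdef_inverse A)
  have b': "S \<bullet> (V *v a) = b"
    unfolding b_def V_def by (rule posdef_sym[OF posdef_inverse[OF A]])
  have "(S + e *\<^sub>R a) \<bullet> (matrix_inv (A + tensor a a) *v (S + e *\<^sub>R a))
     = S \<bullet> (V *v S) + 2 * e * b + e * e * w2 - (b + e * w2)\<^sup>2 / (1 + w2)"
    unfolding sherman_morrison_vec[OF A A'] V_def[symmetric] w2_def[symmetric]
    by (simp add: matrix_vector_right_distrib inner_add_left inner_add_right inner_diff_right
        matrix_vector_mult_scaleR b' power2_eq_square flip: b_def w2_def)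
      (simp add: algebra_simps add_divide_distrib)
  also have "\<dots> = S \<bullet> (V *v S) - b\<^sup>2 / (1 + w2) + 2 * e * b / (1 + w2) + e\<^sup>2 * w2 / (1 + w2)"
    using w by (simp add: power2_eq_square divide_simps) (simp add: algebra_simps)
  finally show ?thesis .
qed

text \<open>Global optimality for the trust-region problem hidden in the maximisation: at a maximiser
  the Lagrangian is concave, so the stationary point \<open>a\<close> maximises it over the whole space.\<close>

lemma ucb_maximiser:
  fixes \<Lambda> :: "real^'n^'n"
  assumes \<Lambda>: "posdef \<Lambda>" and \<beta>: "\<beta> > 0" and \<theta>: "norm \<theta> = 1"
    and max: "is_arg_max (ucb \<beta> \<theta> \<Lambda>) (\<lambda>x. x \<in> cball 0 1) a"
  defines "V \<equiv> matrix_inv \<Lambda>"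
  defines "w \<equiv> sqrt (a \<bullet> (V *v a))"
  defines "\<mu> \<equiv> a \<bullet> \<theta> + \<beta> * w"
  shows "norm a = 1" "w > 0"
    "(\<beta> / w) * (e \<bullet> (V *v e)) \<le> \<mu> * (e \<bullet> e)"
    "norm x = 1 \<Longrightarrow> (\<beta> / w) * (x \<bullet> (V *v x)) \<le> \<beta> * w + 2 * ((a - x) \<bullet> \<theta>)"
proof -
  have V: "posdef V" unfolding V_def by (rule posdef_inverse[OF \<Lambda>])
  have th0: "\<theta> \<noteq> 0" using \<theta> by auto
  define g where "g = ucb \<beta> \<theta> \<Lambda>"
  have g: "g x = x \<bullet> \<theta> + \<beta> * sqrt (x \<bullet> (V *v x))" for x by (simp add: g_def ucb_def V_def)
  have le: "g x \<le> g a" if "norm x \<le> 1" for x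
    using max that by (auto simp: is_arg_max_def g_def not_less)
  have na: "norm a \<le> 1" using max by (simp add: is_arg_max_def)
  have gs: "g (c *\<^sub>R x) = c * g x" if "c \<ge> 0" for c x
    using that by (simp add: g matrix_vector_mult_scaleR real_sqrt_mult algebra_simps flip: mult.assoc)
  have ga: "g a = \<mu>" by (simp add: g \<mu>_def w_def)
  have "1 < g \<theta>" using posdef_pos[OF V th0] \<beta> \<theta> by (simp add: g norm_eq_1)
  then have \<mu>1: "\<mu> > 1" using le[of \<theta>] \<theta> ga by simp
  have a0: "a \<noteq> 0" using \<mu>1 ga by (auto simp: g)
  have "g ((1 / norm a) *\<^sub>R a) \<le> \<mu>" using a0 le ga by simp
  then have "\<mu> \<le> \<mu> * norm a" using a0 by (subst (asm) gs) (auto simp: ga field_simps)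
  then show a1: "norm a = 1" using na \<mu>1 by simp
  have aa: "a \<bullet> a = 1" using a1 by (simp add: norm_eq_1)
  show w0: "w > 0" unfolding w_def using posdef_pos[OF V a0] by simp
  have w2: "w\<^sup>2 = a \<bullet> (V *v a)" unfolding w_def using posdef_nonneg[OF V] by simp
  have hom: "g x \<le> \<mu> * norm x" for x
  proof (cases "x = 0")
    case False
    then have "g ((1 / norm x) *\<^sub>R x) \<le> \<mu>" using le ga by simp
    then show ?thesis using False by (subst (asm) gs) (auto simp: field_simps)
  qed (simp add: g)
  have norm_le: "norm (a + s *\<^sub>R y) \<le> 1 + s * (a \<bullet> y) + s\<^sup>2 * (y \<bullet> y) / 2" for s y
  proof -
    have "(norm (a + s *\<^sub>R y))\<^sup>2 = 1 + 2 * (s * (a \<bullet> y)) + s\<^sup>2 * (y \<bullet> y)"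
      unfolding power2_norm_eq_inner
      by (simp add: inner_add_left inner_add_right aa inner_commute[of y a] power2_eq_square algebra_simps)
    moreover have "2 * norm (a + s *\<^sub>R y) \<le> 1 + (norm (a + s *\<^sub>R y))\<^sup>2"
      using sum_squares_bound[of 1 "norm (a + s *\<^sub>R y)"] by simp
    ultimately show ?thesis by simp
  qed
  \<comment> \<open>The first-order condition. Cauchy-Schwarz bounds the square root from below by
    its tangent at \<open>a\<close>, which gives the quadratic inequality in \<open>s\<close> below;
    it can hold for all \<open>s\<close> only if its linear coefficient \<open>L\<close>
    vanishes.\<close>
  have stat: "\<mu> * (a \<bullet> y) = y \<bullet> \<theta> + \<beta> * (a \<bullet> (V *v y)) / w" for y
  proof -
    define L where "L = \<mu> * (a \<bullet> y) - y \<bullet> \<theta> - \<beta> * (a \<bullet> (V *v y)) / w"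
    have *: "0 \<le> s * L + s\<^sup>2 * (\<mu> * (y \<bullet> y) / 2)" for s
    proof -
      have "(a \<bullet> (V *v (a + s *\<^sub>R y)))\<^sup>2 \<le> w\<^sup>2 * ((a + s *\<^sub>R y) \<bullet> (V *v (a + s *\<^sub>R y)))"
        unfolding w2 by (rule posdef_cauchy[OF V])
      then have "\<bar>a \<bullet> (V *v (a + s *\<^sub>R y))\<bar> \<le> w * sqrt ((a + s *\<^sub>R y) \<bullet> (V *v (a + s *\<^sub>R y)))"
        using w0 by (metis abs_of_pos real_sqrt_abs real_sqrt_le_mono real_sqrt_mult)
      moreover have "a \<bullet> (V *v (a + s *\<^sub>R y)) = w\<^sup>2 + s * (a \<bullet> (V *v y))"
        by (simp add: matrix_vector_right_distrib inner_add_right matrix_vector_mult_scaleR w2)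
      ultimately have "w\<^sup>2 + s * (a \<bullet> (V *v y)) \<le> w * sqrt ((a + s *\<^sub>R y) \<bullet> (V *v (a + s *\<^sub>R y)))"
        by linarith
      then have "w + s * (a \<bullet> (V *v y)) / w \<le> sqrt ((a + s *\<^sub>R y) \<bullet> (V *v (a + s *\<^sub>R y)))"
        using w0 by (simp add: field_simps power2_eq_square)
      then have "\<beta> * (w + s * (a \<bullet> (V *v y)) / w) \<le> \<beta> * sqrt ((a + s *\<^sub>R y) \<bullet> (V *v (a + s *\<^sub>R y)))"
        using \<beta> by simp
      also have "\<dots> \<le> \<mu> * norm (a + s *\<^sub>R y) - (a + s *\<^sub>R y) \<bullet> \<theta>"
        using hom[of "a + s *\<^sub>R y"] by (simp add: g)
      also have "\<dots> \<le> \<mu> * (1 + s * (a \<bullet> y) + s\<^sup>2 * (y \<bullet> y) / 2) - (a + s *\<^sub>R y) \<bullet> \<theta>"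
        using norm_le[of s y] \<mu>1 by simp
      finally show ?thesis
        by (simp add: L_def \<mu>_def inner_add_left algebra_simps)
    qed
    have "L = 0"
    proof (cases "\<mu> * (y \<bullet> y) / 2 = 0")
      case True
      then have "0 \<le> - (L * L)" using *[of "-L"] by (simp only: mult_zero_right)
      then show ?thesis by (auto simp: mult_le_0_iff)
    next
      case False
      define K where "K = \<mu> * (y \<bullet> y) / 2"
      have K: "K > 0" using False \<mu>1 by (auto simp: K_def)
      have "0 \<le> (- L / (2 * K)) * L + (- L / (2 * K))\<^sup>2 * K" using *[of "- L / (2 * K)"] by (simp add: K_def)
      also have "\<dots> = - (L\<^sup>2 / (4 * K))" using K by (simp add: power2_eq_square field_simps)
      finally have "L\<^sup>2 / (4 * K) \<le> 0" by simp
      then show ?thesis using K by (simp add: divide_le_0_iff)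
    qed
    then show ?thesis by (simp add: L_def)
  qed
  \<comment> \<open>The square root is replaced by the quadratic form with the same gradient at
    \<open>a\<close>. Stationarity then removes the linear terms: the Lagrangian at
    \<open>a + e\<close> is its value at \<open>a\<close> plus \<open>Q e\<close>, so only the sign
    of \<open>Q\<close> is left.\<close>
  define Q where "Q = (\<lambda>e. (\<beta> / w) * (e \<bullet> (V *v e)) - \<mu> * (e \<bullet> e))"
  have expand: "(\<beta> / w) * ((a + e) \<bullet> (V *v (a + e))) + 2 * ((a + e) \<bullet> \<theta>) - \<mu> * ((a + e) \<bullet> (a + e))
     = a \<bullet> \<theta> + Q e" for e
  proof -
    have "(\<beta> / w) * ((a + e) \<bullet> (V *v (a + e))) = (\<beta> / w) * w\<^sup>2 + 2 * (\<beta> * (a \<bullet> (V *v e)) / w) + (\<beta> / w) * (e \<bullet> (V *v e))"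
      by (simp add: matrix_vector_right_distrib inner_add_left inner_add_right w2 posdef_sym[OF V, of e a] algebra_simps)
    also have "(\<beta> / w) * w\<^sup>2 = \<beta> * w" using w0 by (simp add: power2_eq_square)
    also have "\<beta> * (a \<bullet> (V *v e)) / w = \<mu> * (a \<bullet> e) - e \<bullet> \<theta>" using stat[of e] by simp
    finally show ?thesis
      by (simp add: Q_def inner_add_left inner_add_right aa inner_commute[of e a] \<mu>_def algebra_simps)
  qed
  have Q1: "Q e \<le> 0" if ne: "a \<bullet> (V *v e) \<noteq> 0" for e
  proof -
    have e0: "e \<noteq> 0" using ne by auto
    have E: "e \<bullet> (V *v e) > 0" by (rule posdef_pos[OF V e0])
    \<comment> \<open>Chosen so that \<open>a + s e\<close> has exactly the bonus of
      \<open>a\<close>. The comparison of the two points then involves no square root and shows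
      \<open>Q (s e) \<le> 0\<close>; \<open>Q\<close> is homogeneous of degree two.\<close>
    define s where "s = - 2 * (a \<bullet> (V *v e)) / (e \<bullet> (V *v e))"
    have s0: "s \<noteq> 0" using ne E by (simp add: s_def)
    have "(a + s *\<^sub>R e) \<bullet> (V *v (a + s *\<^sub>R e)) = w\<^sup>2 + s * (2 * (a \<bullet> (V *v e)) + s * (e \<bullet> (V *v e)))"
      by (simp add: matrix_vector_right_distrib inner_add_left inner_add_right w2 posdef_sym[OF V, of e a]
          matrix_vector_mult_scaleR algebra_simps)
    also have "2 * (a \<bullet> (V *v e)) + s * (e \<bullet> (V *v e)) = 0" using E by (simp add: s_def)
    finally have eq: "(a + s *\<^sub>R e) \<bullet> (V *v (a + s *\<^sub>R e)) = w\<^sup>2" by simp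
    have "(a + s *\<^sub>R e) \<bullet> \<theta> \<le> \<mu> * norm (a + s *\<^sub>R e) - \<beta> * w"
      using hom[of "a + s *\<^sub>R e"] w0 by (simp add: g eq)
    moreover have "\<mu> * (2 * norm (a + s *\<^sub>R e)) \<le> \<mu> * (1 + (a + s *\<^sub>R e) \<bullet> (a + s *\<^sub>R e))"
      using sum_squares_bound[of 1 "norm (a + s *\<^sub>R e)"] \<mu>1 by (simp add: power2_norm_eq_inner)
    moreover have "(\<beta> / w) * w\<^sup>2 = \<beta> * w" using w0 by (simp add: power2_eq_square)
    ultimately have "a \<bullet> \<theta> + Q (s *\<^sub>R e) \<le> \<mu> - \<beta> * w"
      unfolding expand[symmetric] eq by (simp add: algebra_simps)
    then have "Q (s *\<^sub>R e) \<le> 0" by (simp add: \<mu>_def)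
    moreover have "Q (s *\<^sub>R e) = s\<^sup>2 * Q e"
      by (simp add: Q_def matrix_vector_mult_scaleR power2_eq_square algebra_simps)
    ultimately show ?thesis using s0 by (simp add: mult_le_0_iff)
  qed
  have Q: "Q e \<le> 0" for e
  proof (cases "a \<bullet> (V *v e) = 0")
    case True
    \<comment> \<open>Directions that are conjugate to \<open>a\<close> give \<open>s = 0\<close>
      above; they are reached as limits of \<open>e + d a\<close>.\<close>
    have *: "Q (e + d *\<^sub>R a) \<le> 0" if "d > 0" for d
    proof (rule Q1)
      have "a \<bullet> (V *v (e + d *\<^sub>R a)) = d * w\<^sup>2"
        by (simp add: matrix_vector_right_distrib inner_add_right matrix_vector_mult_scaleR True w2)
      then show "a \<bullet> (V *v (e + d *\<^sub>R a)) \<noteq> 0" using that w0 by simp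
    qed
    have "((\<lambda>d. Q (e + d *\<^sub>R a)) \<longlongrightarrow> Q (e + 0 *\<^sub>R a)) (at_right 0)"
      unfolding Q_def using w0
      by (auto simp: matrix_vector_right_distrib matrix_vector_mult_scaleR inner_add_left inner_add_right
          intro!: tendsto_eq_intros)
    then have "Q (e + 0 *\<^sub>R a) \<le> 0"
      by (rule tendsto_upperbound) (auto intro!: eventually_at_rightI[of 0 1] *)
    then show ?thesis by simp
  qed (rule Q1)
  then show "(\<beta> / w) * (e \<bullet> (V *v e)) \<le> \<mu> * (e \<bullet> e)" by (simp add: Q_def)
  show "(\<beta> / w) * (x \<bullet> (V *v x)) \<le> \<beta> * w + 2 * ((a - x) \<bullet> \<theta>)" if "norm x = 1"
    using expand[of "x - a"] Q[of "x - a"] that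
    by (simp add: norm_eq_1 \<mu>_def inner_diff_left)
qed

section \<open>One step of the Lyapunov function\<close>

lemma tau_add_tensor:
  assumes "norm x = 1"
  shows "tau \<theta> (A + tensor x x) = tau \<theta> A + (1 - (x \<bullet> \<theta>)\<^sup>2)"
  using assms by (simp add: tau_def trace_add trace_tensor matrix_vector_mult_add_rdistrib tensor_mult_vec
      inner_add_right norm_eq_1 inner_commute power2_eq_square)

lemma sum_perp_axis:
  fixes \<theta> :: "real^'n"
  assumes "norm \<theta> = 1"
  shows "(\<Sum>j\<in>UNIV. (axis j 1 - (\<theta> $ j) *\<^sub>R \<theta>) \<bullet> (axis j 1 - (\<theta> $ j) *\<^sub>R \<theta>)) = real CARD('n) - 1"
  using tau_eq_sum[OF posdef_gram[of _ 0] assms] assms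
  by (simp add: tau_def trace_I norm_eq_1)

lemma tau_nonneg: "posdef A \<Longrightarrow> norm \<theta> = 1 \<Longrightarrow> 0 \<le> tau \<theta> A"
  by (simp add: tau_eq_sum sum_nonneg posdef_nonneg)

text \<open>The drift estimate in scalars: \<rho> is the chosen bonus divided by its prediction,
  \<open>A\<close> and \<open>W\<close> are the scaled parts along and across \<theta> of the trace
  of the inverse Gram matrix, \<open>\<tau> - L - n\<close> is the Lyapunov function,
  \<open>D\<close> its increment times \<open>h\<close>. For \<open>\<epsilon> = 0\<close> the
  hypotheses say \<open>D \<le> - I\<close>, and \<open>I\<close> is at least half of the function;
  half of this decay is kept and the rest covers the errors.\<close>

lemma lyapunov_scalar_drift:
  fixes \<epsilon> B m n \<rho> A W \<tau> L bw U D :: real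
  assumes e: "0 \<le> \<epsilon>" "\<epsilon> \<le> 1/4" and B: "1 - \<epsilon> \<le> B" "B \<le> 1 + \<epsilon>"
    and n: "n \<ge> 0" "m = (n + 2) / 2" and \<rho>: "\<rho> > 0" and A: "A \<ge> 1" and W: "W \<ge> 0" and \<tau>: "\<tau> \<ge> 0"
    and logdet: "\<rho> * (n + 1 - L - (n + 1) * ln \<rho>) \<le> A + W"
    and \<Psi>: "\<tau> - L - n \<ge> 0" and bw: "bw \<le> \<epsilon> * \<rho>"
    and U: "U \<le> B * (\<rho> * m - A / \<rho>) + \<epsilon> * (3 * (\<rho> * m) + A / \<rho>) + B * ((1 + bw) * n - W / \<rho>) / 2"
    and D: "D \<le> - (1 - \<epsilon>) * \<tau> / 2 + U - (1 - \<epsilon>) * (\<rho>\<^sup>2 * m) + m"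
  shows "D \<le> - (\<tau> - L - n) / 4 + 21 * m * \<epsilon>"
proof -
  define a b where "a = A / \<rho>" and "b = W / \<rho>"
  have a: "a \<ge> 1 / \<rho>" using A \<rho> by (simp add: a_def divide_right_mono)
  have a0: "a \<ge> 0" using a \<rho> by (smt (verit) divide_nonneg_pos)
  have b: "b \<ge> 0" using W \<rho> by (simp add: b_def)
  have m: "m \<ge> 0" using n by simp
  have ab: "n + 1 - L - (n + 1) * ln \<rho> \<le> a + b"
    using logdet \<rho> by (simp add: a_def b_def add_divide_distrib[symmetric] pos_le_divide_eq mult.commute)
  define I where "I = \<tau> / 2 + a + b / 2 + \<rho>\<^sup>2 * m - \<rho> * m - n / 2 - m"
  \<comment> \<open>After \<open>ln \<rho> \<le> \<rho> - 1\<close>, and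
    \<open>a \<ge> 1 / \<rho>\<close> for one half of \<open>a\<close>, the difference of the two
    sides is at least \<open>(n + 1) (\<rho> - 1)^2 / 2\<close>. This is where
    \<open>m = (n + 2) / 2\<close> is needed.\<close>
  have I: "I \<ge> (\<tau> - L - n) / 2"
  proof -
    have "(n + 1) * ln \<rho> \<le> (n + 1) * (\<rho> - 1)"
      using n \<rho> ln_le_minus_one by (intro mult_left_mono) auto
    then have "n + 1 - L - (n + 1) * (\<rho> - 1) \<le> a + b" using ab by linarith
    moreover have "0 \<le> (\<rho>\<^sup>2 - 1) * (1 - 1 / \<rho>)"
    proof -
      have "(\<rho>\<^sup>2 - 1) * (1 - 1 / \<rho>) = (\<rho> - 1)\<^sup>2 * (\<rho> + 1) / \<rho>"
        using \<rho> by (simp add: field_simps power2_eq_square)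
      then show ?thesis using \<rho> by simp
    qed
    then have "0 \<le> \<rho>\<^sup>2 - \<rho> - 1 + 1 / \<rho>" using \<rho> by (simp add: field_simps power2_eq_square)
    then have "- (\<rho>\<^sup>2 - \<rho> - 1) / 2 \<le> a / 2" using a by simp
    ultimately have "(n + 1 - L - (n + 1) * (\<rho> - 1)) / 2 + - (\<rho>\<^sup>2 - \<rho> - 1) / 2 \<le> (a + b) / 2 + a / 2"
      by (intro add_mono divide_right_mono) auto
    then have "(n + 1 - L - (n + 1) * (\<rho> - 1)) / 2 - (\<rho>\<^sup>2 - \<rho> - 1) / 2 \<le> a + b / 2"
      by (simp add: add_divide_distrib diff_divide_distrib)
    moreover have "0 \<le> (n + 1) * (\<rho> - 1)\<^sup>2" using n by simp
    ultimately show ?thesis unfolding I_def n(2) by (simp add: field_simps power2_eq_square)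
  qed
  have "B * (\<rho> * m - a) \<le> (1 + \<epsilon>) * (\<rho> * m) - (1 - \<epsilon>) * a"
  proof -
    have "B * (\<rho> * m) \<le> (1 + \<epsilon>) * (\<rho> * m)" using B(2) \<rho> m by (intro mult_right_mono) auto
    then show ?thesis using mult_right_mono[OF B(1) a0] by (simp add: right_diff_distrib)
  qed
  moreover have "B * ((1 + bw) * n - b) \<le> (1 + \<epsilon>) * ((1 + \<epsilon> * \<rho>) * n) - (1 - \<epsilon>) * b"
  proof -
    have "B * ((1 + bw) * n) \<le> B * ((1 + \<epsilon> * \<rho>) * n)"
      using bw n B e by (intro mult_left_mono mult_right_mono) auto
    also have "\<dots> \<le> (1 + \<epsilon>) * ((1 + \<epsilon> * \<rho>) * n)"
      using B n e \<rho> by (intro mult_right_mono) auto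
    finally show ?thesis using mult_right_mono[OF B(1) b] by (simp add: right_diff_distrib)
  qed
  ultimately have "B * (\<rho> * m - a) + \<epsilon> * (3 * (\<rho> * m) + a) + B * ((1 + bw) * n - b) / 2
    \<le> ((1 + \<epsilon>) * (\<rho> * m) - (1 - \<epsilon>) * a) + \<epsilon> * (3 * (\<rho> * m) + a)
      + ((1 + \<epsilon>) * ((1 + \<epsilon> * \<rho>) * n) - (1 - \<epsilon>) * b) / 2"
    by (intro add_mono divide_right_mono order_refl) auto
  with U have "U \<le> (1 + \<epsilon>) * (\<rho> * m) - (1 - \<epsilon>) * a + \<epsilon> * (3 * (\<rho> * m) + a)
      + ((1 + \<epsilon>) * ((1 + \<epsilon> * \<rho>) * n) - (1 - \<epsilon>) * b) / 2"
    unfolding a_def[symmetric] b_def[symmetric] by (rule order_trans)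
  moreover have "(1 + \<epsilon>) * ((1 + \<epsilon> * \<rho>) * n) \<le> n + \<epsilon> * (2 * m) + 4 * (\<epsilon> * (\<rho> * m))"
  proof -
    have "\<epsilon> * \<epsilon> \<le> \<epsilon> * 1" using e by (intro mult_left_mono) auto
    then have "\<epsilon> * \<epsilon> * (\<rho> * n) \<le> \<epsilon> * (\<rho> * n)" using \<rho> n by (intro mult_right_mono) auto
    moreover have "\<epsilon> * (\<rho> * n) \<le> \<epsilon> * (\<rho> * (2 * m))" "\<epsilon> * n \<le> \<epsilon> * (2 * m)"
      using e \<rho> n by (auto intro!: mult_left_mono)
    ultimately show ?thesis by (simp add: algebra_simps)
  qed
  ultimately have "D \<le> - I + \<epsilon> * (\<tau> / 2 + 2 * a + b / 2 + \<rho>\<^sup>2 * m + 6 * (\<rho> * m) + m)"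
    using D by (simp add: I_def algebra_simps add_divide_distrib diff_divide_distrib)
  also have "\<dots> = - (1 - 2 * \<epsilon>) * I + \<epsilon> * (- \<tau> / 2 - b / 2 + 8 * (\<rho> * m) - \<rho>\<^sup>2 * m + 3 * m + n)"
    by (simp add: I_def algebra_simps add_divide_distrib)
  \<comment> \<open>\<open>21 = 16 + 3 + 2\<close>: from
    \<open>8 \<rho> - \<rho>^2 \<le> 16\<close>, the term \<open>3 m\<close>, and
    \<open>n \<le> 2 m\<close>.\<close>
  also have "\<dots> \<le> - (1 - 2 * \<epsilon>) * I + \<epsilon> * (21 * m)"
  proof -
    have mn: "n \<le> 2 * m" using n by simp
    have "0 \<le> (\<rho> - 4)\<^sup>2 * m" using m by simp
    then have "8 * (\<rho> * m) - \<rho>\<^sup>2 * m \<le> 16 * m"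
      unfolding power2_eq_square by (simp only: algebra_simps)
    then have "- \<tau> / 2 - b / 2 + 8 * (\<rho> * m) - \<rho>\<^sup>2 * m + 3 * m + n \<le> 21 * m"
      using \<tau> b n(1) mn by linarith
    then show ?thesis using e by (intro add_left_mono mult_left_mono) auto
  qed
  also have "\<dots> \<le> - (1 / 2) * ((\<tau> - L - n) / 2) + \<epsilon> * (21 * m)"
  proof -
    have "(1 / 2) * ((\<tau> - L - n) / 2) \<le> (1 - 2 * \<epsilon>) * I"
      using e I \<Psi> by (intro mult_mono) auto
    then show ?thesis by (simp add: algebra_simps)
  qed
  finally show ?thesis by (simp add: algebra_simps add_divide_distrib diff_divide_distrib)
qed

text \<open>The predicted size of the Gram matrix across \<open>\<theta>\<close>, of which it has size \<open>h\<close> along \<open>\<theta>\<close>.\<close>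

definition rate :: "'n itself \<Rightarrow> real \<Rightarrow> real \<Rightarrow> real" where
  "rate _ \<beta> h = \<beta> * sqrt (2 * h / (real CARD('n) + 1))"

text \<open>The divergence of the Gram matrix from its prediction, with the Rayleigh quotient along \<open>\<theta>\<close>
  divided by \<open>h\<close> replaced by its upper bound \<open>1\<close>.\<close>

definition lyap :: "real^'n \<Rightarrow> real \<Rightarrow> (nat \<Rightarrow> real^'n) \<Rightarrow> nat \<Rightarrow> real" where
  "lyap \<theta> \<beta> a k = (let h = real (Suc k); l = rate TYPE('n) \<beta> h; n = real CARD('n) - 1 in
     tau \<theta> (gram a k) / l - n - ln (det (gram a k)) + ln h + n * ln l)"

lemma rate_pos: "\<beta> > 0 \<Longrightarrow> h > 0 \<Longrightarrow> rate TYPE('n) \<beta> h > 0"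
  by (simp add: rate_def divide_pos_pos add_pos_nonneg)

lemma rate_sq:
  "h \<ge> 0 \<Longrightarrow> (rate TYPE('n) \<beta> h)\<^sup>2 * ((real CARD('n) + 1) / 2) = \<beta>\<^sup>2 * h"
  by (simp add: rate_def power_mult_distrib)

lemma ln_rate:
  assumes "\<beta> > 0" "h > 0"
  shows "ln (rate TYPE('n) \<beta> h) = ln \<beta> + (ln (2 / (real CARD('n) + 1)) + ln h) / 2"
proof -
  define c where "c = 2 / (real CARD('n) + 1)"
  have "c > 0" by (simp add: c_def add_nonneg_pos)
  moreover have "rate TYPE('n) \<beta> h = \<beta> * sqrt (c * h)" by (simp add: rate_def c_def)
  ultimately show ?thesis using assms unfolding c_def[symmetric] by (simp add: ln_mult ln_sqrt)
qed

text \<open>The identity contributes 1 to the Gram form of \<theta> and each unit action at most 1,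
  so the form is at most \<open>Suc k\<close>; this is why the prediction uses \<open>Suc k\<close>
  and not \<open>k\<close>.\<close>

lemma logdet_div_le_lyap:
  fixes a :: "nat \<Rightarrow> real^'n"
  assumes \<theta>: "norm \<theta> = 1" and a: "\<And>s. s \<in> {1..k} \<Longrightarrow> norm (a s) = 1"
  shows "logdet_div \<theta> (real (Suc k)) (rate TYPE('n) \<beta> (real (Suc k))) (gram a k) \<le> lyap \<theta> \<beta> a k"
proof -
  have "\<theta> \<bullet> (gram a k *v \<theta>) \<le> 1 + (\<Sum>s=1..k. 1)"
    unfolding gram_form
  proof (intro add_mono sum_mono)
    fix s assume "s \<in> {1..k}"
    then have "\<bar>a s \<bullet> \<theta>\<bar> \<le> 1" using Cauchy_Schwarz_ineq2[of "a s" \<theta>] a \<theta> by simp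
    then show "(a s \<bullet> \<theta>)\<^sup>2 \<le> 1" by (simp add: abs_square_le_1)
  qed (use \<theta> in \<open>simp add: norm_eq_1\<close>)
  then have "(\<theta> \<bullet> (gram a k *v \<theta>)) / real (Suc k) \<le> 1" by (simp add: field_simps)
  then show ?thesis by (simp add: lyap_def logdet_div_def Let_def)
qed

lemma logdet_div_nonneg:
  fixes A :: "real^'n^'n"
  assumes "posdef A" "norm \<theta> = 1" "h1 > 0" "h2 > 0"
  shows "0 \<le> logdet_div \<theta> h1 h2 A"
  using ln_det_le_stretched_trace[OF assms(1,2), of "1 / h1" "1 / h2"] assms(3,4)
  by (simp add: logdet_div_def ln_div)

text \<open>\<eta> stands for the ridge estimator and \<theta>' for its direction. An update has
  three effects: the trace across \<theta> grows by \<open>1 - (x . \<theta>)^2\<close>, the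
  determinant by the factor \<open>1 + w^2\<close>, and the prediction moves from \<open>h\<close>
  to \<open>h + 1\<close>. The optimality conditions bound the first effect, and the scalar drift
  lemma adds the three up.\<close>

lemma lyap_step:
  fixes a :: "nat \<Rightarrow> real^'n" and \<theta> \<theta>' \<eta> :: "real^'n"
  assumes \<theta>: "norm \<theta> = 1" and \<beta>: "\<beta> > 0" and a: "\<And>s. s \<in> {1..k} \<Longrightarrow> norm (a s) = 1"
    and max: "is_arg_max (ucb \<beta> \<theta>' (gram a k)) (\<lambda>x. x \<in> cball 0 1) (a (Suc k))"
    and unit: "norm \<theta>' = 1" and \<eta>: "\<eta> = norm \<eta> *\<^sub>R \<theta>'"
    and e: "0 \<le> \<epsilon>" "\<epsilon> \<le> 1/4"
    and est: "(\<eta> - \<theta>) \<bullet> (gram a k *v (\<eta> - \<theta>)) \<le> (\<epsilon> * \<beta>)\<^sup>2"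
    and B: "\<bar>norm \<eta> - 1\<bar> \<le> \<epsilon>"
    and w: "a (Suc k) \<bullet> (matrix_inv (gram a k) *v a (Suc k)) \<le> \<epsilon>"
    and late: "\<beta>\<^sup>2 \<le> \<epsilon> * rate TYPE('n) \<beta> (real (Suc k))" "1 \<le> \<epsilon> * real (Suc k)"
  shows "real (Suc k) * (lyap \<theta> \<beta> a (Suc k) - lyap \<theta> \<beta> a k)
    \<le> - lyap \<theta> \<beta> a k / 4 + 21 * ((real CARD('n) + 1) / 2) * \<epsilon>"
proof -
  define x where "x = a (Suc k)"
  define G where "G = gram a k"
  define V where "V = matrix_inv G"
  define w where "w = sqrt (x \<bullet> (V *v x))"
  define h where "h = real (Suc k)"
  define l where "l = rate TYPE('n) \<beta> h"
  define l' where "l' = rate TYPE('n) \<beta> (h + 1)"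
  define n m where "n = real CARD('n) - 1" and "m = (real CARD('n) + 1) / 2"
  define \<rho> where "\<rho> = w * l / \<beta>"
  define A where "A = h * (\<theta> \<bullet> (V *v \<theta>))"
  define W where "W = l * tau \<theta> V"
  define \<tau> where "\<tau> = tau \<theta> G / l"
  define L where "L = ln (det G) - ln h - n * ln l"
  define U0 where "U0 = 1 - (x \<bullet> \<theta>)\<^sup>2"
  define Vt where "Vt = \<theta> \<bullet> (V *v \<theta>)"
  have card: "real CARD('n) \<ge> 1" by (simp add: Suc_leI)
  have n0: "n \<ge> 0" and m0: "m > 0" and mn: "m = (n + 2) / 2" using card by (auto simp: n_def m_def)
  have h: "h \<ge> 1" by (simp add: h_def)
  have l: "l > 0" using \<beta> h by (simp add: l_def rate_pos)
  have lm: "l\<^sup>2 * m = \<beta>\<^sup>2 * h" unfolding l_def m_def using h by (intro rate_sq) simp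
  have G: "posdef G" by (simp add: G_def posdef_gram)
  have V: "posdef V" unfolding V_def by (rule posdef_inverse[OF G])
  note ucb = ucb_maximiser[OF G \<beta> unit max[folded x_def G_def], folded V_def, folded w_def]
  have w0: "w > 0" by (rule ucb(2))
  have nx: "norm x = 1" by (rule ucb(1))
  have w2: "w\<^sup>2 = x \<bullet> (V *v x)" unfolding w_def using posdef_nonneg[OF V] by simp
  have \<rho>: "\<rho> > 0" using w0 l \<beta> by (simp add: \<rho>_def)
  have th: "\<theta> \<bullet> \<theta> = 1" using \<theta> by (simp add: norm_eq_1)
  \<comment> \<open>\<open>lm\<close> is the defining relation of the rate. With it
    \<open>c1\<close> to \<open>c4\<close> translate the optimality conditions into the scaled
    quantities \<rho>, \<open>A\<close> and \<open>W\<close>.\<close>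
  have c1: "h / l * (\<beta> * w) = \<rho> * m"
  proof -
    have "h * \<beta>\<^sup>2 * w = l * l * m * w" using lm by (simp add: power2_eq_square mult_ac)
    then show ?thesis using l \<beta> by (simp add: \<rho>_def field_simps power2_eq_square)
  qed
  have c2: "h / l * (\<beta> / w * Vt) = A / \<rho>"
    using l \<beta> w0 by (simp add: \<rho>_def A_def Vt_def mult_ac)
  have c3: "\<beta> / w * tau \<theta> V = W / \<rho>"
    using l \<beta> w0 by (simp add: \<rho>_def W_def mult_ac)
  have c4: "h * w\<^sup>2 = \<rho>\<^sup>2 * m"
  proof -
    have "\<rho>\<^sup>2 * m = w\<^sup>2 * (l\<^sup>2 * m) / \<beta>\<^sup>2" by (simp add: \<rho>_def power_mult_distrib power_divide)
    also have "\<dots> = h * w\<^sup>2" unfolding lm using \<beta> by simp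
    finally show ?thesis by simp
  qed
  have Vt: "Vt > 0" unfolding Vt_def using \<theta> by (intro posdef_pos[OF V]) auto
  have lower: "h * Vt \<ge> 1"
  proof -
    have "(\<theta> \<bullet> \<theta>)\<^sup>2 \<le> (\<theta> \<bullet> (G *v \<theta>)) * Vt"
      unfolding Vt_def V_def by (rule posdef_cauchy_inverse[OF G])
    also have "\<dots> \<le> h * Vt"
    proof (rule mult_right_mono)
      have "\<theta> \<bullet> (G *v \<theta>) \<le> 1 + (\<Sum>s=1..k. 1)"
        unfolding gram_form G_def
      proof (intro add_mono sum_mono)
        fix s assume "s \<in> {1..k}"
        then have "\<bar>a s \<bullet> \<theta>\<bar> \<le> 1" using Cauchy_Schwarz_ineq2[of "a s" \<theta>] a \<theta> by simp
        then show "(a s \<bullet> \<theta>)\<^sup>2 \<le> 1" by (simp add: abs_square_le_1)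
      qed (simp add: th)
      then show "\<theta> \<bullet> (G *v \<theta>) \<le> h" by (simp add: h_def)
    qed (use Vt in simp)
    finally show ?thesis by (simp add: th)
  qed
  define B where "B = norm \<eta>"
  have B': "1 - \<epsilon> \<le> B" "B \<le> 1 + \<epsilon>" "B \<ge> 0" using B by (auto simp: B_def)
  define z where "z = \<eta> - \<theta>"
  have Bth: "B *\<^sub>R \<theta>' = \<theta> + z" using \<eta> by (simp add: B_def z_def)
  have zz: "z \<bullet> (G *v z) \<le> (\<epsilon> * \<beta>)\<^sup>2" using est by (simp add: z_def G_def)
  have cs: "\<bar>z \<bullet> y\<bar> \<le> \<epsilon> * \<beta> * sqrt (y \<bullet> (V *v y))" for y
  proof -
    have "(z \<bullet> y)\<^sup>2 \<le> (\<epsilon> * \<beta>)\<^sup>2 * (y \<bullet> (V *v y))"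
      using posdef_cauchy_inverse[OF G, of z y] mult_right_mono[OF zz posdef_nonneg[OF V, of y]]
      by (simp add: V_def)
    then have "sqrt ((z \<bullet> y)\<^sup>2) \<le> sqrt ((\<epsilon> * \<beta>)\<^sup>2 * (y \<bullet> (V *v y)))" by (rule real_sqrt_le_mono)
    then show ?thesis using e \<beta> by (simp add: real_sqrt_mult)
  qed
  \<comment> \<open>Optimality against the competitor \<theta>, multiplied by the length
    \<open>B\<close> of the ridge estimator: this replaces \<theta>' by \<open>\<theta> + z\<close>,
    where \<open>z\<close> is small in the norm of the Gram matrix. The passage to \<open>U0\<close>
    is \<open>1 - t^2 \<le> 2 (1 - t)\<close>.\<close>
  have U0: "U0 \<le> B * (\<beta> * w - \<beta> / w * Vt) + 2 * (\<epsilon> * \<beta>) * (w + sqrt Vt)"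
  proof -
    have "B * (\<beta> / w * Vt) \<le> B * (\<beta> * w + 2 * ((x - \<theta>) \<bullet> \<theta>'))"
      unfolding Vt_def by (intro mult_left_mono ucb(4) \<theta> B')
    also have "B * (\<beta> * w + 2 * ((x - \<theta>) \<bullet> \<theta>')) = B * (\<beta> * w) + 2 * ((x - \<theta>) \<bullet> (B *\<^sub>R \<theta>'))"
      by (simp add: algebra_simps)
    also have "(x - \<theta>) \<bullet> (B *\<^sub>R \<theta>') = (x \<bullet> \<theta> - 1) + (z \<bullet> x - z \<bullet> \<theta>)"
      unfolding Bth by (simp add: inner_add_right inner_diff_left th inner_commute[of z])
    also have "z \<bullet> x - z \<bullet> \<theta> \<le> \<epsilon> * \<beta> * w + \<epsilon> * \<beta> * sqrt Vt"
      using cs[of x] cs[of \<theta>] unfolding w_def Vt_def by linarith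
    finally have 1: "B * (\<beta> / w * Vt) \<le> B * (\<beta> * w) + 2 * ((x \<bullet> \<theta> - 1) + (\<epsilon> * \<beta> * w + \<epsilon> * \<beta> * sqrt Vt))"
      by simp
    have "0 \<le> (x \<bullet> \<theta> - 1)\<^sup>2" by simp
    then have "U0 \<le> - 2 * (x \<bullet> \<theta> - 1)" unfolding U0_def by (simp add: power2_eq_square algebra_simps)
    then show ?thesis using 1 by (simp add: algebra_simps)
  qed
  \<comment> \<open>The second-order condition, summed over the projected standard basis.\<close>
  have tV: "W / \<rho> \<le> (1 + \<beta> * w) * n"
  proof -
    have "\<beta> / w * tau \<theta> V \<le> (x \<bullet> \<theta>' + \<beta> * w) * n"
      unfolding tau_eq_sum[OF V \<theta>] sum_distrib_left n_def sum_perp_axis[OF \<theta>, symmetric]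
      by (intro sum_mono ucb(3))
    also have "\<dots> \<le> (1 + \<beta> * w) * n"
      using Cauchy_Schwarz_ineq2[of x \<theta>'] nx unit n0 by (intro mult_right_mono) auto
    finally show ?thesis unfolding c3 .
  qed
  have hU: "h * U0 / l \<le> B * (\<rho> * m - A / \<rho>) + \<epsilon> * (3 * (\<rho> * m) + A / \<rho>) + B * ((1 + \<beta> * w) * n - W / \<rho>) / 2"
  proof -
    have "h / l * U0 \<le> h / l * (B * (\<beta> * w - \<beta> / w * Vt) + 2 * (\<epsilon> * \<beta>) * (w + sqrt Vt))"
      using U0 h l by (intro mult_left_mono) auto
    also have "\<dots> = B * (h / l * (\<beta> * w) - h / l * (\<beta> / w * Vt)) + 2 * \<epsilon> * (h / l * (\<beta> * w)) + 2 * \<epsilon> * (h / l * (\<beta> * sqrt Vt))"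
      by (simp only: algebra_simps)
    also have "\<dots> = B * (\<rho> * m - A / \<rho>) + 2 * \<epsilon> * (\<rho> * m) + 2 * \<epsilon> * (h / l * (\<beta> * sqrt Vt))"
      unfolding c1 c2 ..
    \<comment> \<open>By \<open>lm\<close> the left side is twice the geometric mean of
      \<open>\<rho> m\<close> and \<open>A / \<rho>\<close>.\<close>
    also have "2 * (h / l * (\<beta> * sqrt Vt)) \<le> \<rho> * m + A / \<rho>"
    proof -
      have "(h / l * (\<beta> * sqrt Vt))\<^sup>2 = (h * \<beta>\<^sup>2) * h * Vt / l\<^sup>2"
        using Vt by (simp add: power_mult_distrib power_divide power2_eq_square)
      also have "\<dots> = m * (h * Vt)" using l lm by (simp add: field_simps)
      also have "\<dots> = (\<rho> * m) * (A / \<rho>)" using \<rho> by (simp add: A_def Vt_def)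
      finally have "(h / l * (\<beta> * sqrt Vt))\<^sup>2 = (\<rho> * m) * (A / \<rho>)" .
      then have "h / l * (\<beta> * sqrt Vt) = sqrt ((\<rho> * m) * (A / \<rho>))"
        using h l \<beta> Vt by (metis abs_of_nonneg real_sqrt_abs divide_nonneg_pos less_imp_le mult_nonneg_nonneg
            order_trans real_sqrt_ge_zero zero_le_one)
      also have "\<dots> \<le> (\<rho> * m + A / \<rho>) / 2"
        using lower h Vt \<rho> m0 by (intro arith_geo_mean_sqrt) (auto simp: A_def Vt_def[symmetric])
      finally show ?thesis by (simp add: mult_ac)
    qed
    then have "2 * \<epsilon> * (h / l * (\<beta> * sqrt Vt)) \<le> \<epsilon> * (\<rho> * m + A / \<rho>)"
      using mult_left_mono[OF _ e(1)] by (metis mult.assoc mult.left_commute)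
    finally have "h / l * U0 \<le> B * (\<rho> * m - A / \<rho>) + \<epsilon> * (3 * (\<rho> * m) + A / \<rho>)"
      by (simp add: algebra_simps)
    \<comment> \<open>The slack of \<open>tV\<close> is added on purpose. It brings
      \<open>- W / \<rho>\<close> into the bound, which the log-determinant inequality for the
      inverse needs.\<close>
    moreover have "0 \<le> B * ((1 + \<beta> * w) * n - W / \<rho>) / 2" using tV B' by simp
    ultimately have "h / l * U0 \<le> B * (\<rho> * m - A / \<rho>) + \<epsilon> * (3 * (\<rho> * m) + A / \<rho>)
        + B * ((1 + \<beta> * w) * n - W / \<rho>) / 2"
      by (rule add_increasing2[rotated])
    then show ?thesis by (simp only: times_divide_eq_left)
  qed
  have logdet: "\<rho> * (n + 1 - L - (n + 1) * ln \<rho>) \<le> A + W"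
  proof -
    have "real CARD('n) + ln (det V) + ln (h / \<rho>) + (real CARD('n) - 1) * ln (l / \<rho>)
        \<le> h / \<rho> * (\<theta> \<bullet> (V *v \<theta>)) + l / \<rho> * tau \<theta> V"
      using h l \<rho> by (intro ln_det_le_stretched_trace V \<theta>) auto
    moreover have "ln (det V) = - ln (det G)"
    proof -
      have "det G * det V = 1"
        unfolding V_def by (metis G det_I det_mul posdef_inv_mult)
      then have "det V = 1 / det G" using posdef_det_pos[OF G] by (simp add: field_simps)
      then show ?thesis using posdef_det_pos[OF G] by (simp add: ln_div)
    qed
    ultimately have "n + 1 - L - (n + 1) * ln \<rho> \<le> (A + W) / \<rho>"
      using h l \<rho> by (simp add: ln_div L_def A_def W_def n_def algebra_simps add_divide_distrib)
    then show ?thesis using \<rho> by (simp add: field_simps)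
  qed
  have lyap_eq: "lyap \<theta> \<beta> a k = \<tau> - L - n"
    unfolding lyap_def Let_def h_def[symmetric] l_def[symmetric] G_def[symmetric] n_def[symmetric]
    by (simp add: \<tau>_def L_def)
  have "0 \<le> logdet_div \<theta> h l G" using h l by (intro logdet_div_nonneg G \<theta>) auto
  then have \<Psi>: "\<tau> - L - n \<ge> 0"
  proof -
    have "logdet_div \<theta> h l G \<le> lyap \<theta> \<beta> a k"
      unfolding h_def l_def G_def by (rule logdet_div_le_lyap[OF \<theta>]) (use a in auto)
    with \<open>0 \<le> logdet_div \<theta> h l G\<close> show ?thesis by (simp add: lyap_eq)
  qed
  have l'l: "ln l' = ln l + (ln (h + 1) - ln h) / 2"
    using h \<beta> unfolding l_def l'_def by (simp add: ln_rate field_simps)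
  \<comment> \<open>This is \<open>sqrt (1 - y) \<le> 1 - y / 2\<close> for
    \<open>y = 1 / (h + 1)\<close>. The growth of the rate damps the trace term and is the source of
    the decay \<open>- \<tau> / 2\<close>.\<close>
  have inv_l': "1 / l' \<le> (1 / l) * (1 - 1 / (2 * (h + 1)))"
  proof -
    have "l = l' * sqrt (h / (h + 1))"
    proof -
      have "2 * h / (real CARD('n) + 1) = (2 * (h + 1) / (real CARD('n) + 1)) * (h / (h + 1))"
      proof -
        have "h + 1 \<noteq> 0" using h by simp
        then have "(2 * (h + 1) / c) * (h / (h + 1)) = 2 * h / c" for c :: real
          by (cases "c = 0") (simp_all add: divide_simps)
        then show ?thesis by simp
      qed
      then show ?thesis unfolding l_def l'_def rate_def by (simp only: real_sqrt_mult mult.assoc)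
    qed
    then have "1 / l' = (1 / l) * sqrt (h / (h + 1))" using h l by (auto simp: field_simps)
    also have "sqrt (h / (h + 1)) \<le> 1 - 1 / (2 * (h + 1))"
    proof (rule real_le_lsqrt)
      show "0 \<le> 1 - 1 / (2 * (h + 1))" using h by (simp add: field_simps)
      show "h / (h + 1) \<le> (1 - 1 / (2 * (h + 1)))\<^sup>2"
        using h by (simp add: power2_eq_square divide_simps) (simp add: algebra_simps)
    qed
    finally show ?thesis using l by (simp add: mult_left_mono divide_right_mono)
  qed
  define D where "D = h * (lyap \<theta> \<beta> a (Suc k) - lyap \<theta> \<beta> a k)"
  have lyap': "lyap \<theta> \<beta> a (Suc k) = (tau \<theta> G + U0) / l' - n - (ln (det G) + ln (1 + w\<^sup>2)) + ln (h + 1) + n * ln l'"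
  proof -
    have "gram a (Suc k) = G + tensor x x" by (simp add: gram_Suc G_def x_def)
    moreover have "ln (det (G + tensor x x)) = ln (det G) + ln (1 + w\<^sup>2)"
    proof -
      have "1 + w\<^sup>2 > 0" by (simp add: add_pos_nonneg)
      then show ?thesis
        using posdef_det_pos[OF G] by (simp add: det_add_tensor[OF G] V_def[symmetric] w2[symmetric] ln_mult_pos)
    qed
    ultimately show ?thesis
      by (simp add: lyap_def Let_def tau_add_tensor[OF nx] U0_def h_def l'_def n_def add.commute)
  qed
  have D: "D \<le> - (1 - \<epsilon>) * \<tau> / 2 + h * U0 / l - (1 - \<epsilon>) * (\<rho>\<^sup>2 * m) + m"
  proof -
    have U00: "0 \<le> U0" using Cauchy_Schwarz_ineq2[of x \<theta>] nx \<theta> by (simp add: U0_def abs_square_le_1)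
    have t0: "0 \<le> tau \<theta> G" by (rule tau_nonneg[OF G \<theta>])
    have "(tau \<theta> G + U0) / l' \<le> (tau \<theta> G + U0) * ((1 / l) * (1 - 1 / (2 * (h + 1))))"
      using mult_left_mono[OF inv_l', of "tau \<theta> G + U0"] t0 U00 by simp
    also have "\<dots> = \<tau> + U0 / l - (\<tau> + U0 / l) / (2 * (h + 1))"
      using l by (simp add: \<tau>_def divide_simps) (simp add: algebra_simps)
    also have "\<dots> \<le> \<tau> + U0 / l - \<tau> / (2 * (h + 1))"
      using U00 l h by (simp add: divide_right_mono)
    finally have "h * ((tau \<theta> G + U0) / l' - \<tau>) \<le> h * (U0 / l - \<tau> / (2 * (h + 1)))"
      using h by (intro mult_left_mono) auto
    also have "\<dots> = h * U0 / l - (h / (h + 1)) * (\<tau> / 2)" using h by (simp add: field_simps)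
    also have "\<dots> \<le> h * U0 / l - (1 - \<epsilon>) * (\<tau> / 2)"
    proof -
      have "1 - \<epsilon> \<le> h / (h + 1)" using late(2)[folded h_def] h e by (simp add: field_simps)
      then show ?thesis using t0 l by (intro diff_left_mono mult_right_mono) (auto simp: \<tau>_def)
    qed
    finally have 1: "h * ((tau \<theta> G + U0) / l' - \<tau>) \<le> h * U0 / l - (1 - \<epsilon>) * (\<tau> / 2)" .
    have "w\<^sup>2 \<le> \<epsilon>" using w by (simp add: w2 x_def V_def G_def)
    then have "w\<^sup>2 - w\<^sup>2 * w\<^sup>2 \<le> ln (1 + w\<^sup>2)"
      using ln_one_plus_pos_lower_bound[of "w\<^sup>2"] e by (simp add: power2_eq_square)
    moreover have "w\<^sup>2 * w\<^sup>2 \<le> w\<^sup>2 * \<epsilon>" using \<open>w\<^sup>2 \<le> \<epsilon>\<close> by (intro mult_left_mono) auto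
    ultimately have "h * ((1 - \<epsilon>) * w\<^sup>2) \<le> h * ln (1 + w\<^sup>2)"
      using h by (intro mult_left_mono) (auto simp: algebra_simps)
    then have 2: "(1 - \<epsilon>) * (\<rho>\<^sup>2 * m) \<le> h * ln (1 + w\<^sup>2)"
      unfolding c4[symmetric] by (simp add: mult_ac)
    have "h * (ln (h + 1) - ln h) \<le> 1"
    proof -
      have "ln (h + 1) - ln h = ln (1 + 1 / h)"
      proof -
        have "1 + 1 / h = (h + 1) / h" using h by (simp add: field_simps)
        then show ?thesis using h by (simp add: ln_div)
      qed
      also have "\<dots> \<le> 1 / h" using h by (intro ln_add_one_self_le_self) auto
      finally show ?thesis using h by (simp add: field_simps)
    qed
    then have 3: "m * (h * (ln (h + 1) - ln h)) \<le> m" using m0 by (simp add: mult_left_le)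
    have "D = h * ((tau \<theta> G + U0) / l' - \<tau>) - h * ln (1 + w\<^sup>2) + m * (h * (ln (h + 1) - ln h))"
      unfolding D_def lyap' lyap_eq l'l L_def mn by (simp add: algebra_simps add_divide_distrib diff_divide_distrib)
    moreover have "- (1 - \<epsilon>) * \<tau> / 2 = - ((1 - \<epsilon>) * (\<tau> / 2))" by (simp add: algebra_simps diff_divide_distrib)
    ultimately show ?thesis using 1 2 3 by linarith
  qed
  have bw: "\<beta> * w \<le> \<epsilon> * \<rho>"
  proof -
    have "\<beta>\<^sup>2 * w \<le> \<epsilon> * l * w" using late(1) w0 by (intro mult_right_mono) (auto simp: l_def h_def)
    then show ?thesis using \<beta> by (simp add: \<rho>_def field_simps power2_eq_square)
  qed
  have "D \<le> - (\<tau> - L - n) / 4 + 21 * m * \<epsilon>"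
    by (rule lyapunov_scalar_drift[OF e B'(1,2) n0 mn \<rho> _ _ _ logdet \<Psi> bw hU D])
      (use lower tau_nonneg[OF V \<theta>] tau_nonneg[OF G \<theta>] l in \<open>auto simp: A_def W_def \<tau>_def Vt_def\<close>)
  then show ?thesis unfolding D_def lyap_eq h_def m_def .
qed

section \<open>The trajectory of the Lyapunov function\<close>

lemma inverse_gram_form_le:
  fixes x :: "real^'n"
  shows "x \<bullet> (matrix_inv (gram a t) *v x) \<le> x \<bullet> x"
proof -
  have "x \<bullet> (matrix_inv (gram a t) *v x) \<le> (x \<bullet> (matrix_inv (gram a 0) *v x)) / 1"
    by (rule inverse_form_le[OF posdef_gram posdef_gram]) (use gram_form_ge in auto)
  moreover have "matrix_inv (mat 1 :: real^'n^'n) *v x = x"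
    using posdef_inv_left[OF posdef_gram[of _ 0], of "\<lambda>_. 0" x] by simp
  ultimately show ?thesis by simp
qed

lemma inverse_form_le_of_lower:
  fixes A :: "real^'n^'n"
  assumes A: "posdef A" and c: "c > 0" and le: "\<And>y. c * (y \<bullet> y) \<le> y \<bullet> (A *v y)"
  shows "x \<bullet> (matrix_inv A *v x) \<le> (x \<bullet> x) / c"
proof -
  have "x \<bullet> (matrix_inv A *v x) \<le> (x \<bullet> (matrix_inv (gram (\<lambda>_. 0) 0) *v x)) / c"
    by (rule inverse_form_le[OF A posdef_gram c]) (use le in auto)
  also have "\<dots> \<le> (x \<bullet> x) / c"
    using c inverse_gram_form_le[of x "\<lambda>_. 0" 0] by (intro divide_right_mono) auto
  finally show ?thesis .
qed

lemma ln_1_plus_ge_half: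
  assumes "0 \<le> x" "x \<le> (1 :: real)" shows "x / 2 \<le> ln (1 + x)"
proof -
  have "- ln (1 + x) = ln (1 / (1 + x))" using assms by (simp add: ln_div)
  also have "\<dots> \<le> 1 / (1 + x) - 1" using assms by (intro ln_le_minus_one) auto
  also have "\<dots> \<le> - (x / 2)" using assms mult_left_mono[of x 1 x] by (simp add: field_simps)
  finally show ?thesis by simp
qed

text \<open>Among the first \<open>K\<close> rounds there is one with a small exploration bonus; by the maximality
  of the chosen action no direction can then have a large bonus, whatever the estimator is.\<close>

lemma gram_lower_bound:
  fixes a :: "nat \<Rightarrow> real^'n"
  assumes \<beta>: "\<beta> \<ge> 1" and K: "K \<ge> 1" and c: "c > 0"
    and cK: "8 * real CARD('n) * ln (1 + real K) * c\<^sup>2 \<le> real K"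
    and max: "\<And>k. k < K \<Longrightarrow> is_arg_max (ucb \<beta> (\<theta>' k) (gram a k)) (\<lambda>x. x \<in> cball 0 1) (a (Suc k))"
    and unit: "\<And>k. k < K \<Longrightarrow> norm (\<theta>' k) = 1"
    and t: "t \<ge> K"
  shows "c * (x \<bullet> x) \<le> x \<bullet> (gram a t *v x)"
proof -
  define w2 where "w2 = (\<lambda>k. a (Suc k) \<bullet> (matrix_inv (gram a k) *v a (Suc k)))"
  have b0: "\<beta> > 0" using \<beta> by simp
  have na: "norm (a (Suc k)) = 1" if "k < K" for k
    by (rule ucb_maximiser(1)[OF posdef_gram b0 unit[OF that] max[OF that]])
  have "(\<Sum>k<K. ln (1 + w2 k)) \<le> real CARD('n) * ln (1 + real K)"
    unfolding w2_def ln_det_gram[symmetric]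
  proof (rule sum_ln_le)
    fix s assume "s \<in> {1..K}"
    then show "norm (a s) = 1" using na[of "s - 1"] by (cases s) auto
  qed
  \<comment> \<open>Pigeonhole: the \<open>K\<close> rounds share a budget of
    \<open>d ln (1 + K)\<close>, so one of them is at or below the average.\<close>
  then have "\<exists>k<K. ln (1 + w2 k) \<le> real CARD('n) * ln (1 + real K) / real K"
  proof (rule contrapos_pp)
    assume "\<not> (\<exists>k<K. ln (1 + w2 k) \<le> real CARD('n) * ln (1 + real K) / real K)"
    then have "(\<Sum>k<K. real CARD('n) * ln (1 + real K) / real K) < (\<Sum>k<K. ln (1 + w2 k))"
      using K by (intro sum_strict_mono) (auto simp: lessThan_empty_iff)
    then show "\<not> (\<Sum>k<K. ln (1 + w2 k)) \<le> real CARD('n) * ln (1 + real K)"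
      using K by simp
  qed
  then obtain k where k: "k < K" "ln (1 + w2 k) \<le> real CARD('n) * ln (1 + real K) / real K"
    by blast
  note ucb = ucb_maximiser[OF posdef_gram b0 unit[OF k(1)] max[OF k(1)]]
  have w0: "w2 k > 0" using ucb(2) by (simp add: w2_def)
  have w1: "w2 k \<le> 1"
    using inverse_gram_form_le[of "a (Suc k)" a k] na[OF k(1)] by (simp add: w2_def norm_eq_1)
  define w where "w = sqrt (w2 k)"
  have w: "w > 0" "w \<le> 1" "w\<^sup>2 = w2 k" using w0 w1 by (auto simp: w_def)
  have "w\<^sup>2 / 2 \<le> real CARD('n) * ln (1 + real K) / real K"
    unfolding w(3) using ln_1_plus_ge_half[of "w2 k"] w0 w1 k(2) by linarith
  then have "real K * w\<^sup>2 \<le> 2 * real CARD('n) * ln (1 + real K)"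
    using K by (simp add: field_simps)
  then have "4 * c\<^sup>2 * (real K * w\<^sup>2) \<le> 4 * c\<^sup>2 * (2 * real CARD('n) * ln (1 + real K))"
    by (intro mult_left_mono) auto
  also have "\<dots> \<le> real K" using cK by (simp add: mult_ac)
  finally have "(2 * c * w)\<^sup>2 \<le> 1" using K by (simp add: power_mult_distrib)
  then have cw: "2 * c * w \<le> 1" using c w by (simp add: abs_square_le_1)
  \<comment> \<open>The multiplier is at most \<open>1 + \<beta> w \<le> 2 \<beta>\<close>, so
    \<beta> cancels and the small bonus \<open>w\<close> of the chosen action bounds the inverse by
    \<open>2 w\<close> in every direction.\<close>
  have V: "x \<bullet> (matrix_inv (gram a k) *v x) \<le> 2 * w * (x \<bullet> x)" for x
  proof -
    let ?\<mu> = "a (Suc k) \<bullet> \<theta>' k + \<beta> * w"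
    have "\<beta> / w * (x \<bullet> (matrix_inv (gram a k) *v x)) \<le> ?\<mu> * (x \<bullet> x)"
      using ucb(3)[of x] by (simp add: w_def w2_def)
    also have "\<dots> \<le> (1 + \<beta> * w) * (x \<bullet> x)"
      using Cauchy_Schwarz_ineq2[of "a (Suc k)" "\<theta>' k"] ucb(1) unit[OF k(1)]
      by (intro mult_right_mono) auto
    also have "\<dots> \<le> (2 * \<beta>) * (x \<bullet> x)"
    proof (rule mult_right_mono)
      have "\<beta> * w \<le> \<beta> * 1" using w(2) \<beta> by (intro mult_left_mono) auto
      then show "1 + \<beta> * w \<le> 2 * \<beta>" using \<beta> by linarith
    qed simp
    finally show ?thesis using w b0 by (simp add: field_simps)
  qed
  have "c * (x \<bullet> x) \<le> x \<bullet> (gram a k *v x)"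
  proof (cases "x = 0")
    case False
    have "(x \<bullet> x)\<^sup>2 \<le> (x \<bullet> (gram a k *v x)) * (x \<bullet> (matrix_inv (gram a k) *v x))"
      by (rule posdef_cauchy_inverse[OF posdef_gram])
    also have "\<dots> \<le> (x \<bullet> (gram a k *v x)) * (2 * w * (x \<bullet> x))"
      by (intro mult_left_mono V posdef_nonneg posdef_gram)
    finally have "(x \<bullet> x) * (x \<bullet> x) \<le> ((x \<bullet> (gram a k *v x)) * (2 * w)) * (x \<bullet> x)"
      by (simp add: power2_eq_square mult_ac)
    then have "x \<bullet> x \<le> (x \<bullet> (gram a k *v x)) * (2 * w)" using False by simp
    then have "c * (x \<bullet> x) \<le> (x \<bullet> (gram a k *v x)) * (2 * c * w)"
      using mult_left_mono[of _ _ c] c by (fastforce simp: mult_ac)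
    also have "\<dots> \<le> (x \<bullet> (gram a k *v x)) * 1"
      by (intro mult_left_mono cw posdef_nonneg posdef_gram)
    finally show ?thesis by simp
  qed simp
  also have "\<dots> \<le> x \<bullet> (gram a t *v x)" using k t by (intro gram_form_mono) auto
  finally show ?thesis .
qed

lemma ln_det_gram_nonneg: "0 \<le> ln (det (gram a t))"
  unfolding ln_det_gram by (intro sum_nonneg) (auto intro!: ln_ge_zero posdef_nonneg posdef_inverse posdef_gram)

text \<open>A bound polynomial in \<open>K\<close> is enough: the recursion divides the start by a
  power of the round, and \<open>K\<close> will be polylogarithmic. The hypothesis
  \<open>late\<close> forces \<open>\<beta> \<le> h\<close>, which removes \<beta> from the
  bound.\<close>

lemma lyap_initial_bound:
  fixes a :: "nat \<Rightarrow> real^'n"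
  assumes \<theta>: "norm \<theta> = 1" and a: "\<And>s. s \<in> {1..K} \<Longrightarrow> norm (a s) = 1" and \<beta>: "\<beta> \<ge> 1"
    and late: "\<beta>\<^sup>2 \<le> rate TYPE('n) \<beta> (real (Suc K))"
  shows "lyap \<theta> \<beta> a K \<le> 2 * real CARD('n) * (real (Suc K))\<^sup>2"
proof -
  define h l n where "h = real (Suc K)" and "l = rate TYPE('n) \<beta> h" and "n = real CARD('n) - 1"
  have h: "h \<ge> 1" by (simp add: h_def)
  have card: "real CARD('n) \<ge> 1" by (simp add: Suc_leI)
  have n0: "n \<ge> 0" using card by (simp add: n_def)
  have bl: "\<beta>\<^sup>2 \<le> l" using late by (simp add: l_def h_def)
  have l1: "l \<ge> 1" using bl \<beta> one_le_power[OF \<beta>, of 2] by linarith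
  have "sqrt (2 * h / (real CARD('n) + 1)) \<le> sqrt (h\<^sup>2)"
  proof (rule real_sqrt_le_mono)
    have "2 * h / (real CARD('n) + 1) \<le> 2 * h / 2" using card h by (intro divide_left_mono) auto
    also have "\<dots> \<le> h\<^sup>2" using h by (simp add: power2_eq_square)
    finally show "2 * h / (real CARD('n) + 1) \<le> h\<^sup>2" .
  qed
  then have lh: "l \<le> \<beta> * h" using \<beta> h by (simp add: l_def rate_def)
  have "\<beta> * \<beta> \<le> \<beta> * h" using bl lh by (simp add: power2_eq_square)
  then have bh: "\<beta> \<le> h" using \<beta> by simp
  have lh2: "l \<le> h\<^sup>2" using lh mult_right_mono[OF bh, of h] h unfolding power2_eq_square by linarith
  have "tau \<theta> (gram a K) \<le> n + real K"
  proof -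
    have "trace (gram a K) = real CARD('n) + real K" by (rule trace_gram) (use a in auto)
    moreover have "1 \<le> \<theta> \<bullet> (gram a K *v \<theta>)" using gram_form_ge[of \<theta> a K] \<theta> by (simp add: norm_eq_1)
    ultimately show ?thesis by (simp add: tau_def n_def)
  qed
  then have "tau \<theta> (gram a K) / l \<le> n + real K"
    using l1 n0 tau_nonneg[OF posdef_gram \<theta>, of a K]
    by (smt (verit) divide_le_eq_1 mult_left_le_one_le frac_le div_by_1)
  moreover have "ln h \<le> h - 1" using h by (intro ln_le_minus_one) auto
  moreover have "n * ln l \<le> n * h\<^sup>2" using n0 l1 lh2 ln_bound[of l] by (intro mult_left_mono) auto
  ultimately have "lyap \<theta> \<beta> a K \<le> real K + h + n * h\<^sup>2"
    using ln_det_gram_nonneg[of a K] h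
    unfolding lyap_def Let_def h_def[symmetric] l_def[symmetric] n_def[symmetric] by linarith
  also have "\<dots> \<le> h\<^sup>2 + h\<^sup>2 + n * h\<^sup>2"
  proof -
    have "h * 1 \<le> h * h" using h by (intro mult_left_mono) auto
    moreover have "real K \<le> h" by (simp add: h_def)
    ultimately show ?thesis by (simp add: power2_eq_square)
  qed
  also have "\<dots> \<le> 2 * real CARD('n) * h\<^sup>2"
    using mult_right_mono[OF card, of "h\<^sup>2"] by (simp add: n_def algebra_simps)
  finally show ?thesis by (simp add: h_def)
qed

text \<open>Bounded by ratios of consecutive powers, the contraction factors telescope. With
  \<open>y = 1 / (4 h)\<close>, Bernoulli's inequality gives
  \<open>(1 - y)^4 (1 + 4 y) \<le> (1 - y^2)^4 \<le> 1\<close>.\<close>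

lemma contraction_powr:
  assumes "h \<ge> (1 :: real)"
  shows "1 - 1 / (4 * h) \<le> (h / (h + 1)) powr (1/4)"
proof -
  have "(1 - 1 / (4 * h)) ^ 4 * (1 + 1 / h) \<le> 1"
  proof -
    define y where "y = 1 / (4 * h)"
    have y: "0 < y" "y \<le> 1/4" using assms by (auto simp: y_def field_simps)
    have "(1 - y) ^ 4 * (1 + 4 * y) \<le> (1 - y) ^ 4 * (1 + y) ^ 4"
      using y Bernoulli_inequality[of y 4] by (intro mult_left_mono) auto
    also have "\<dots> = ((1 - y) * (1 + y)) ^ 4" by (simp only: power_mult_distrib)
    also have "\<dots> = (1 - y\<^sup>2) ^ 4" by (simp add: power2_eq_square algebra_simps)
    also have "\<dots> \<le> 1" using y by (intro power_le_one) (auto simp: abs_square_le_1)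
    finally show ?thesis by (simp add: y_def)
  qed
  then have "(1 - 1 / (4 * h)) ^ 4 \<le> h / (h + 1)" using assms by (simp add: field_simps)
  then have "((1 - 1 / (4 * h)) ^ 4) powr (1/4) \<le> (h / (h + 1)) powr (1/4)"
    using assms by (intro powr_mono2) (auto simp: field_simps)
  moreover have "((1 - 1 / (4 * h)) ^ 4) powr (1/4) = 1 - 1 / (4 * h)"
  proof -
    have "1 - 1 / (4 * h) > 0" using assms by (simp add: field_simps)
    then show ?thesis by (simp add: powr_powr flip: powr_numeral)
  qed
  ultimately show ?thesis by simp
qed

text \<open>The noise condition is available only during an initial phase or when the function is at
  most 1. The induction closes the circle: after the initial phase its own bound, at most
  \<open>1/2 + 1/2\<close>, shows that the function is at most 1 in the round where the next
  contraction is wanted.\<close>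

theorem lyap_trajectory:
  fixes a :: "nat \<Rightarrow> real^'n" and \<theta> :: "real^'n"
  assumes \<theta>: "norm \<theta> = 1" and \<beta>: "\<beta> \<ge> 1"
    and max: "\<And>k. k < T \<Longrightarrow> is_arg_max (ucb \<beta> (\<theta>' k) (gram a k)) (\<lambda>x. x \<in> cball 0 1) (a (Suc k))"
    and unit: "\<And>k. k < T \<Longrightarrow> norm (\<theta>' k) = 1"
    and \<eta>: "\<And>k. k < T \<Longrightarrow> \<eta> k = norm (\<eta> k) *\<^sub>R \<theta>' k"
    and e: "0 < \<epsilon>" "\<epsilon> \<le> 1/4" "84 * (real CARD('n) + 1) * \<epsilon> \<le> 1"
    and K: "K \<ge> 1" and KT: "K \<le> T"
    and noise: "\<And>k. K \<le> k \<Longrightarrow> k < T \<Longrightarrow> k \<le> 256 * CARD('n) ^ 4 * (Suc K) ^ 9 \<or> lyap \<theta> \<beta> a k \<le> 1 \<Longrightarrow>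
      (\<eta> k - \<theta>) \<bullet> (gram a k *v (\<eta> k - \<theta>)) \<le> (\<epsilon> * \<beta>)\<^sup>2"
    and late1: "8 * real CARD('n) * ln (1 + real K) * (\<beta>\<^sup>2 + 1 / \<epsilon>)\<^sup>2 \<le> real K"
    and late2: "\<beta>\<^sup>2 \<le> \<epsilon> * rate TYPE('n) \<beta> (real (Suc K))" and late3: "1 \<le> \<epsilon> * real (Suc K)"
  shows "lyap \<theta> \<beta> a T \<le> 42 * (real CARD('n) + 1) * \<epsilon>
    + 2 * real CARD('n) * (real (Suc K))\<^sup>2 * (real (Suc K) / real (Suc T)) powr (1/4)"
proof -
  define R where "R = 2 * real CARD('n) * (real (Suc K))\<^sup>2"
  \<comment> \<open>The fixed point of the recursion: four times the error term of
    \<open>lyap_step\<close>. The hypothesis with the constant 84 makes it at most 1/2.\<close>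
  define b where "b = 42 * (real CARD('n) + 1) * \<epsilon>"
  \<comment> \<open>Equal to \<open>16 R^4 (K + 1)\<close>, so that after this round
    \<open>R\<close> times the fourth root of \<open>(K + 1) / (k + 1)\<close> is at most
    1/2.\<close>
  define K1 where "K1 = 256 * CARD('n) ^ 4 * (Suc K) ^ 9"
  have card: "real CARD('n) \<ge> 1" by (simp add: Suc_leI)
  have R: "R \<ge> 0" by (simp add: R_def)
  have b: "b \<le> 1/2" "b \<ge> 0" using e card by (simp_all add: b_def algebra_simps)
  have b0: "\<beta> > 0" using \<beta> by simp
  have na: "norm (a s) = 1" if "s \<in> {1..T}" for s
    using ucb_maximiser(1)[OF posdef_gram b0 unit max, of "s - 1"] that by (cases s) auto
  \<comment> \<open>The lower bound \<open>c\<close> on the Gram matrix serves twice: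
    \<open>\<beta>^2\<close> turns the error in the Gram norm into the Euclidean bound \<epsilon>,
    and \<open>1 / \<epsilon>\<close> makes all squared bonuses at most \<epsilon>.\<close>
  define c where "c = \<beta>\<^sup>2 + 1 / \<epsilon>"
  have c: "c > 0" "\<beta>\<^sup>2 \<le> c" "1 / \<epsilon> \<le> c" using e b0 by (auto simp: c_def add_pos_pos)
  have low: "c * (x \<bullet> x) \<le> x \<bullet> (gram a k *v x)" if "k \<ge> K" for x k
    using KT max unit late1 that by (intro gram_lower_bound[OF \<beta> K c(1), of \<theta>']) (auto simp: c_def)
  have contract: "lyap \<theta> \<beta> a (Suc k) - b \<le> (1 - 1 / (4 * real (Suc k))) * (lyap \<theta> \<beta> a k - b)"
    if k: "K \<le> k" "k < T" and ok: "k \<le> K1 \<or> lyap \<theta> \<beta> a k \<le> 1" for k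
  proof -
    let ?z = "\<eta> k - \<theta>"
    have est: "?z \<bullet> (gram a k *v ?z) \<le> (\<epsilon> * \<beta>)\<^sup>2"
      using noise[OF k] ok by (auto simp: K1_def)
    have "\<beta>\<^sup>2 * (?z \<bullet> ?z) \<le> c * (?z \<bullet> ?z)" by (intro mult_right_mono c) auto
    also have "\<dots> \<le> (\<epsilon> * \<beta>)\<^sup>2" using low[OF k(1), of ?z] est by simp
    finally have "(norm ?z)\<^sup>2 \<le> \<epsilon>\<^sup>2" using b0 by (simp add: power_mult_distrib power2_norm_eq_inner)
    then have "norm ?z \<le> \<epsilon>" using e by (simp add: power2_le_iff_abs_le)
    then have B: "\<bar>norm (\<eta> k) - 1\<bar> \<le> \<epsilon>" using norm_triangle_ineq3[of "\<eta> k" \<theta>] \<theta> by simp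
    have "a (Suc k) \<bullet> (matrix_inv (gram a k) *v a (Suc k)) \<le> (a (Suc k) \<bullet> a (Suc k)) / c"
      by (rule inverse_form_le_of_lower[OF posdef_gram c(1) low[OF k(1)]])
    also have "\<dots> = 1 / c" using na[of "Suc k"] k by (simp add: norm_eq_1)
    also have "\<dots> \<le> \<epsilon>" using c e by (simp add: field_simps)
    finally have w: "a (Suc k) \<bullet> (matrix_inv (gram a k) *v a (Suc k)) \<le> \<epsilon>" .
    have "rate TYPE('n) \<beta> (real (Suc K)) \<le> rate TYPE('n) \<beta> (real (Suc k))"
      unfolding rate_def using k b0 by (intro mult_left_mono real_sqrt_le_mono divide_right_mono) auto
    then have l2: "\<beta>\<^sup>2 \<le> \<epsilon> * rate TYPE('n) \<beta> (real (Suc k))"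
      using late2 e by (smt (verit) mult_left_mono)
    have l3: "1 \<le> \<epsilon> * real (Suc k)"
      using late3 k e mult_left_mono[of "real (Suc K)" "real (Suc k)" \<epsilon>] by linarith
    have "real (Suc k) * (lyap \<theta> \<beta> a (Suc k) - lyap \<theta> \<beta> a k)
        \<le> - lyap \<theta> \<beta> a k / 4 + 21 * ((real CARD('n) + 1) / 2) * \<epsilon>"
      using k na by (intro lyap_step[OF \<theta> b0 _ max unit \<eta> _ e(2) est B w l2 l3]) (use e in auto)
    also have "\<dots> = - (lyap \<theta> \<beta> a k - b) / 4" by (simp add: b_def)
    finally show ?thesis by (simp add: field_simps)
  qed
  have main: "lyap \<theta> \<beta> a k \<le> b + R * (real (Suc K) / real (Suc k)) powr (1/4)"
    if "K \<le> k" "k \<le> T" for k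
    using that
  proof (induction k rule: dec_induct)
    case base
    have "rate TYPE('n) \<beta> (real (Suc K)) > 0" by (rule rate_pos[OF b0]) simp
    then have "\<beta>\<^sup>2 \<le> rate TYPE('n) \<beta> (real (Suc K))"
      using late2 e mult_right_mono[of \<epsilon> 1 "rate TYPE('n) \<beta> (real (Suc K))"] by linarith
    then have "lyap \<theta> \<beta> a K \<le> R"
      unfolding R_def using na KT by (intro lyap_initial_bound[OF \<theta> _ \<beta>]) auto
    then show ?case using b by simp
  next
    case (step k)
    have IH: "lyap \<theta> \<beta> a k - b \<le> R * (real (Suc K) / real (Suc k)) powr (1/4)"
      using step by simp
    have ok: "k \<le> K1 \<or> lyap \<theta> \<beta> a k \<le> 1"
    proof (rule disjCI)
      assume "\<not> lyap \<theta> \<beta> a k \<le> 1"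
      then have half: "1/2 < R * (real (Suc K) / real (Suc k)) powr (1/4)" using IH b by simp
      show "k \<le> K1"
      proof (rule ccontr)
        assume "\<not> k \<le> K1"
        then have "real K1 \<le> real (Suc k)" by simp
        have "R ^ 4 * 16 * real (Suc K) = real K1"
          by (simp add: R_def K1_def power_mult_distrib flip: power_mult power_Suc2)
        then have "R ^ 4 * 16 * (real (Suc K) / real (Suc k)) \<le> 1"
          using \<open>real K1 \<le> real (Suc k)\<close> by (simp add: field_simps del: of_nat_Suc)
        moreover have "((real (Suc K) / real (Suc k)) powr (1/4)) ^ 4 = real (Suc K) / real (Suc k)"
          by (simp add: powr_powr flip: powr_realpow)
        ultimately have "(2 * (R * (real (Suc K) / real (Suc k)) powr (1/4))) ^ 4 \<le> 1"
          by (simp only: power_mult_distrib mult_ac) (simp add: field_simps)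
        moreover have "1 < (2 * (R * (real (Suc K) / real (Suc k)) powr (1/4))) ^ 4"
          using half by (intro one_less_power) auto
        ultimately show False by simp
      qed
    qed
    have "lyap \<theta> \<beta> a (Suc k) - b \<le> (1 - 1 / (4 * real (Suc k))) * (lyap \<theta> \<beta> a k - b)"
      using step ok by (intro contract) auto
    also have "\<dots> \<le> (1 - 1 / (4 * real (Suc k))) * (R * (real (Suc K) / real (Suc k)) powr (1/4))"
      using IH by (intro mult_left_mono) (auto simp: field_simps)
    also have "\<dots> \<le> (real (Suc k) / (real (Suc k) + 1)) powr (1/4) * (R * (real (Suc K) / real (Suc k)) powr (1/4))"
      using R by (intro mult_right_mono contraction_powr) auto
    also have "\<dots> = R * ((real (Suc k) / (real (Suc k) + 1)) * (real (Suc K) / real (Suc k))) powr (1/4)"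
      by (subst powr_mult) (auto simp: mult_ac)
    also have "(real (Suc k) / (real (Suc k) + 1)) * (real (Suc K) / real (Suc k)) = real (Suc K) / real (Suc (Suc k))"
    proof -
      have "real (Suc k) \<noteq> 0" by simp
      then show ?thesis by (simp del: of_nat_Suc)
    qed
    finally show ?case by simp
  qed
  show ?thesis using main[OF KT order_refl] by (simp add: b_def R_def)
qed

section \<open>The error of the estimators\<close>

definition noise_sum :: "(nat \<Rightarrow> real^'n) \<Rightarrow> (nat \<Rightarrow> real) \<Rightarrow> nat \<Rightarrow> real^'n" where
  "noise_sum a e t = (\<Sum>s=1..t. e s *\<^sub>R a s)"

lemma ridge_error:
  assumes r: "\<And>s. s \<in> {1..t} \<Longrightarrow> r s = a s \<bullet> \<theta> + e s"
  shows "ridge a r t - \<theta> = matrix_inv (gram a t) *v (noise_sum a e t - \<theta>)"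
proof -
  have "(\<Sum>s=1..t. r s *\<^sub>R a s) = (\<Sum>s=1..t. (a s \<bullet> \<theta>) *\<^sub>R a s + e s *\<^sub>R a s)"
    by (intro sum.cong) (auto simp: r scaleR_add_left)
  also have "\<dots> = gram a t *v \<theta> + (noise_sum a e t - \<theta>)"
    by (simp add: gram_vec sum.distrib noise_sum_def)
  finally show ?thesis
    by (simp add: ridge_def matrix_vector_right_distrib posdef_inv_left[OF posdef_gram])
qed

text \<open>The triangle inequality in the norm of the inverse Gram matrix: the noise contributes
  \<open>c\<close>, and the bias of the regularisation, which is the vector \<theta>, at most
  1.\<close>

lemma ridge_error_norm:
  assumes r: "\<And>s. s \<in> {1..t} \<Longrightarrow> r s = a s \<bullet> \<theta> + e s" and \<theta>: "norm \<theta> = 1"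
    and c: "c \<ge> 0" "noise_sum a e t \<bullet> (matrix_inv (gram a t) *v noise_sum a e t) \<le> c\<^sup>2"
  shows "(ridge a r t - \<theta>) \<bullet> (gram a t *v (ridge a r t - \<theta>)) \<le> (c + 1)\<^sup>2"
proof -
  define V S where "V = matrix_inv (gram a t)" and "S = noise_sum a e t"
  have V: "posdef V" unfolding V_def by (intro posdef_inverse posdef_gram)
  have th: "\<theta> \<bullet> (V *v \<theta>) \<le> 1"
    using inverse_gram_form_le[of \<theta> a t] \<theta> by (simp add: V_def norm_eq_1)
  have "(ridge a r t - \<theta>) \<bullet> (gram a t *v (ridge a r t - \<theta>)) = (S - \<theta>) \<bullet> (V *v (S - \<theta>))"
  proof -
    have "ridge a r t - \<theta> = V *v (S - \<theta>)" unfolding V_def S_def by (rule ridge_error) (use r in auto)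
    then show ?thesis by (simp add: posdef_inv_right[OF posdef_gram] V_def inner_commute)
  qed
  also have "\<dots> = S \<bullet> (V *v S) - 2 * (S \<bullet> (V *v \<theta>)) + \<theta> \<bullet> (V *v \<theta>)"
    by (simp add: matrix_vector_mult_diff_distrib inner_diff_left inner_diff_right posdef_sym[OF V, of \<theta> S])
  also have "\<dots> \<le> c\<^sup>2 + 2 * c + 1"
  proof -
    have "(S \<bullet> (V *v \<theta>))\<^sup>2 \<le> (S \<bullet> (V *v S)) * (\<theta> \<bullet> (V *v \<theta>))" by (rule posdef_cauchy[OF V])
    also have "\<dots> \<le> c\<^sup>2 * 1"
      using c th by (intro mult_mono posdef_nonneg[OF V]) (auto simp: V_def S_def)
    finally have "\<bar>S \<bullet> (V *v \<theta>)\<bar> \<le> c" using c(1) by (simp add: power2_le_iff_abs_le)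
    then show ?thesis using c(2) th by (simp add: V_def S_def)
  qed
  finally show ?thesis by (simp add: power2_eq_square algebra_simps)
qed

text \<open>The first two bounds follow from \<open>q - 1 - ln q \<ge> (sqrt q - 1)^2\<close>; the
  last one from \<open>ln q \<ge> -2\<close> and \<open>exp 2 \<le> 10\<close>.\<close>

lemma divergence_bounds:
  fixes q :: real
  assumes q: "q > 0" and d: "q - 1 - ln q \<le> \<psi>" and \<psi>: "\<psi> \<le> 1"
  shows "\<bar>q - 1\<bar> \<le> 3 * sqrt \<psi>" "q \<le> 4" "q \<ge> 1/10"
proof -
  have "ln q = 2 * ln (sqrt q)" using q by (simp add: ln_sqrt)
  also have "\<dots> \<le> 2 * (sqrt q - 1)" using q by (intro mult_left_mono ln_le_minus_one) auto
  finally have "(sqrt q - 1)\<^sup>2 \<le> \<psi>" using d q by (simp add: power2_diff)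
  then have s: "\<bar>sqrt q - 1\<bar> \<le> sqrt \<psi>" by (metis real_sqrt_abs real_sqrt_le_mono)
  have \<psi>1: "sqrt \<psi> \<le> 1" using \<psi> by simp
  have sq: "sqrt q \<le> 2" using s \<psi>1 by linarith
  have "\<bar>q - 1\<bar> = \<bar>sqrt q - 1\<bar> * (sqrt q + 1)"
  proof -
    have "q - 1 = (sqrt q - 1) * (sqrt q + 1)" using q by (simp add: algebra_simps)
    then show ?thesis using q by (simp add: abs_mult)
  qed
  also have "\<dots> \<le> sqrt \<psi> * 3" using s sq q order_trans[OF abs_ge_zero s] by (intro mult_mono) auto
  finally show "\<bar>q - 1\<bar> \<le> 3 * sqrt \<psi>" by simp
  show "q \<le> 4" using sq q real_sqrt_le_iff[of q 4] by simp
  have "- 2 \<le> ln q" using d \<psi> q by linarith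
  then have "exp (- 2) \<le> q" using q by (simp add: ln_ge_iff)
  moreover have "exp (2 :: real) \<le> 10"
  proof -
    have "exp (2 :: real) = exp 1 * exp 1" by (simp flip: exp_add)
    also have "\<dots> \<le> 3 * 3" using exp_le by (intro mult_mono) auto
    finally show ?thesis by simp
  qed
  then have "1/10 \<le> exp (- 2 :: real)" by (simp add: exp_minus field_simps)
  ultimately show "q \<ge> 1/10" by linarith
qed

section \<open>From the divergence to quadratic forms of the Gram matrix\<close>

lemma wnorm2_nonneg:
  assumes "norm \<theta> = 1" "h1 \<ge> 0" "h2 \<ge> 0" shows "0 \<le> wnorm2 \<theta> h1 h2 x"
  using norm_stretch[OF assms(1), of "sqrt h1" "sqrt h2" x] assms(2,3)
  by (metis inner_ge_zero real_sqrt_pow2)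

lemma wnorm2_cauchy:
  assumes \<theta>: "norm \<theta> = 1" and h: "h1 > 0" "h2 > 0"
  shows "(y \<bullet> x)\<^sup>2 \<le> wnorm2 \<theta> h1 h2 y * wnorm2 \<theta> (1 / h1) (1 / h2) x"
proof -
  define P Q where "P = stretch \<theta> (sqrt h1) (sqrt h2)" and "Q = stretch \<theta> (1 / sqrt h1) (1 / sqrt h2)"
  have "P ** Q = mat 1"
    unfolding P_def Q_def stretch_mult[OF \<theta>] using h by (simp add: stretch_def)
  then have "y \<bullet> x = y \<bullet> (P *v (Q *v x))" by (simp add: matrix_vector_mul_assoc)
  also have "\<dots> = (P *v y) \<bullet> (Q *v x)"
    by (metis P_def inner_matrix_transpose transpose_stretch)
  finally have "(y \<bullet> x)\<^sup>2 \<le> ((P *v y) \<bullet> (P *v y)) * ((Q *v x) \<bullet> (Q *v x))"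
    by (simp add: Cauchy_Schwarz_ineq)
  then show ?thesis
    using h by (simp add: P_def Q_def norm_stretch[OF \<theta>] power_divide)
qed

context
  fixes a :: "nat \<Rightarrow> real^'n" and \<theta> :: "real^'n" and \<beta> :: real and k :: nat
  assumes \<theta>: "norm \<theta> = 1" and \<beta>: "\<beta> > 0" and a: "\<And>s. s \<in> {1..k} \<Longrightarrow> norm (a s) = 1"
begin

private lemma div_le:
  assumes "x \<noteq> 0"
  defines "W \<equiv> wnorm2 \<theta> (real (Suc k)) (rate TYPE('n) \<beta> (real (Suc k))) x"
  shows "W > 0" "(x \<bullet> (gram a k *v x)) / W > 0"
    "(x \<bullet> (gram a k *v x)) / W - 1 - ln ((x \<bullet> (gram a k *v x)) / W) \<le> lyap \<theta> \<beta> a k"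
proof -
  have h: "real (Suc k) > 0" "rate TYPE('n) \<beta> (real (Suc k)) > 0" by (auto intro: rate_pos \<beta>)
  have "logdet_div \<theta> (real (Suc k)) (rate TYPE('n) \<beta> (real (Suc k))) (gram a k) \<le> lyap \<theta> \<beta> a k"
    by (rule logdet_div_le_lyap[OF \<theta>]) (use a in auto)
  then show "W > 0" "(x \<bullet> (gram a k *v x)) / W > 0"
    "(x \<bullet> (gram a k *v x)) / W - 1 - ln ((x \<bullet> (gram a k *v x)) / W) \<le> lyap \<theta> \<beta> a k"
    using logdet_div_rayleigh[OF posdef_gram[of a k] \<theta> h assms(1)] unfolding W_def by auto
qed

lemma lyap_nonneg: "0 \<le> lyap \<theta> \<beta> a k"
proof -
  have h: "real (Suc k) > 0" "rate TYPE('n) \<beta> (real (Suc k)) > 0" by (auto intro: rate_pos \<beta>)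
  have "logdet_div \<theta> (real (Suc k)) (rate TYPE('n) \<beta> (real (Suc k))) (gram a k) \<le> lyap \<theta> \<beta> a k"
    by (rule logdet_div_le_lyap[OF \<theta>]) (use a in auto)
  with logdet_div_nonneg[OF posdef_gram[of a k] \<theta> h] show ?thesis by linarith
qed

text \<open>The relative accuracy \<open>3 sqrt \<psi>\<close> serves the limit theorem, where
  \<psi> tends to 0; the crude factors 4 and 10 serve the tail bounds, where the function is only
  known to be at most 1.\<close>

lemma gram_form_bounds:
  assumes "lyap \<theta> \<beta> a k \<le> \<psi>" "\<psi> \<le> 1"
  defines "W \<equiv> wnorm2 \<theta> (real (Suc k)) (rate TYPE('n) \<beta> (real (Suc k)))"
  shows "\<bar>x \<bullet> (gram a k *v x) - W x\<bar> \<le> 3 * sqrt \<psi> * W x"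
    "x \<bullet> (gram a k *v x) \<le> 4 * W x" "W x \<le> 10 * (x \<bullet> (gram a k *v x))"
proof -
  have "\<bar>x \<bullet> (gram a k *v x) - W x\<bar> \<le> 3 * sqrt \<psi> * W x \<and>
    x \<bullet> (gram a k *v x) \<le> 4 * W x \<and> W x \<le> 10 * (x \<bullet> (gram a k *v x))"
  proof (cases "x = 0")
    case False
    define q where "q = (x \<bullet> (gram a k *v x)) / W x"
    have W: "W x > 0" and q: "q > 0" "q - 1 - ln q \<le> \<psi>"
      using div_le[OF False] assms(1) by (auto simp: q_def W_def)
    have eq: "x \<bullet> (gram a k *v x) = q * W x" using W by (simp add: q_def)
    have "\<bar>x \<bullet> (gram a k *v x) - W x\<bar> = \<bar>q - 1\<bar> * W x"
    proof -
      have "q * W x - W x = (q - 1) * W x" by (simp add: algebra_simps)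
      then show ?thesis using W by (simp add: eq abs_mult)
    qed
    then show ?thesis
      using divergence_bounds[OF q assms(2)] W unfolding eq
      by (auto intro!: mult_right_mono simp: field_simps)
  qed (simp add: W_def wnorm2_def)
  then show "\<bar>x \<bullet> (gram a k *v x) - W x\<bar> \<le> 3 * sqrt \<psi> * W x"
    "x \<bullet> (gram a k *v x) \<le> 4 * W x" "W x \<le> 10 * (x \<bullet> (gram a k *v x))" by auto
qed

text \<open>Duality turns the lower bound on the Gram form into an upper bound on the inverse form.
  The weights on the right are deterministic, so finitely many fixed directions control the
  noise.\<close>

lemma selfnorm_le_wnorm2:
  assumes "lyap \<theta> \<beta> a k \<le> 1"
  shows "S \<bullet> (matrix_inv (gram a k) *v S)
    \<le> 10 * wnorm2 \<theta> (1 / real (Suc k)) (1 / rate TYPE('n) \<beta> (real (Suc k))) S"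
proof -
  define h l where "h = real (Suc k)" and "l = rate TYPE('n) \<beta> h"
  have h: "h > 0" "l > 0" by (auto simp: h_def l_def intro: rate_pos \<beta>)
  define y where "y = matrix_inv (gram a k) *v S"
  define q where "q = S \<bullet> y"
  have Sy: "gram a k *v y = S" by (simp add: y_def posdef_inv_right[OF posdef_gram])
  have q: "q = y \<bullet> (gram a k *v y)" by (simp add: Sy q_def inner_commute)
  have q0: "q \<ge> 0" unfolding q by (intro posdef_nonneg posdef_gram)
  have nn: "0 \<le> wnorm2 \<theta> (1 / h) (1 / l) S" using h by (intro wnorm2_nonneg[OF \<theta>]) auto
  have "q\<^sup>2 \<le> wnorm2 \<theta> h l y * wnorm2 \<theta> (1 / h) (1 / l) S"
    using wnorm2_cauchy[OF \<theta> h, of y S] by (simp add: q_def inner_commute)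
  also have "\<dots> \<le> (10 * q) * wnorm2 \<theta> (1 / h) (1 / l) S"
    using gram_form_bounds(3)[OF assms order_refl, of y] nn
    by (intro mult_right_mono) (auto simp: q h_def l_def)
  finally have "q * q \<le> q * (10 * wnorm2 \<theta> (1 / h) (1 / l) S)"
    by (simp add: power2_eq_square mult_ac)
  then have "q \<le> 10 * wnorm2 \<theta> (1 / h) (1 / l) S"
    using q0 nn by (cases "q = 0") auto
  then show ?thesis by (simp add: q_def y_def h_def l_def)
qed

end

text \<open>Polarisation with a vector \<open>y\<close> of the length of \<open>x\<close> that
  points along \<open>E x\<close>.\<close>

lemma symmetric_operator_bound:
  fixes E :: "real^'n^'n"
  assumes sym: "transpose E = E" and le: "\<And>x. \<bar>x \<bullet> (E *v x)\<bar> \<le> c * (x \<bullet> x)"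
  shows "norm (E *v x) \<le> c * norm x"
proof (cases "E *v x = 0 \<or> x = 0")
  case True
  have "0 \<le> c * (norm x)\<^sup>2" using le[of x] by (simp add: power2_norm_eq_inner)
  then have "0 \<le> c * norm x" using True
    by (cases "x = 0") (auto simp: zero_le_mult_iff)
  then show ?thesis using True by auto
next
  case False
  define y where "y = (norm x / norm (E *v x)) *\<^sub>R (E *v x)"
  have ny: "norm y = norm x" using False by (simp add: y_def)
  have yy: "y \<bullet> y = x \<bullet> x" using ny by (metis power2_norm_eq_inner)
  have s: "x \<bullet> (E *v y) = y \<bullet> (E *v x)" by (metis inner_commute inner_matrix_transpose sym)
  have "4 * (y \<bullet> (E *v x)) = (x + y) \<bullet> (E *v (x + y)) - (x - y) \<bullet> (E *v (x - y))"
    by (simp add: matrix_vector_right_distrib matrix_vector_mult_diff_distrib inner_add_left inner_add_right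
        inner_diff_left inner_diff_right s)
  also have "\<dots> \<le> c * ((x + y) \<bullet> (x + y)) + c * ((x - y) \<bullet> (x - y))"
    using le[of "x + y"] le[of "x - y"] by linarith
  also have "\<dots> = 4 * (c * (x \<bullet> x))"
    by (simp add: inner_add_left inner_add_right inner_diff_left inner_diff_right inner_commute[of y x] yy algebra_simps)
  finally have "y \<bullet> (E *v x) \<le> c * (norm x)\<^sup>2" by (simp add: power2_norm_eq_inner)
  moreover have "y \<bullet> (E *v x) = norm x * norm (E *v x)"
    using False by (simp add: y_def power2_eq_square flip: power2_norm_eq_inner)
  ultimately have "norm x * norm (E *v x) \<le> norm x * (c * norm x)"
    by (simp add: power2_eq_square mult_ac)
  then show ?thesis using False by simp
qed

text \<open>\<open>1 + p\<close> and \<open>q\<close> are the parts of an estimator along and across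
  \<theta>, and the difference \<open>2 - 2 u / r\<close> is the squared distance of its
  normalisation from \<theta>. It equals \<open>2 q^2 / (r (r + u))\<close> with \<open>r\<close>
  and \<open>u\<close> near 1, so the error \<open>p\<close> along \<theta> enters only through the
  relative error \<open>4 \<delta>\<close>.\<close>

lemma normalisation_error:
  fixes p q :: real
  assumes u: "1 + p > 0" and p: "\<bar>p\<bar> \<le> \<delta>" and q: "0 \<le> q" "q \<le> \<delta>" and \<delta>: "\<delta> \<le> 1/4"
  shows "\<bar>2 - 2 * (1 + p) / sqrt ((1 + p)\<^sup>2 + q\<^sup>2) - q\<^sup>2\<bar> \<le> 4 * \<delta> * q\<^sup>2"
proof -
  define u where "u = 1 + p"
  define r where "r = sqrt (u\<^sup>2 + q\<^sup>2)"
  have u0: "u > 0" using assms by (simp add: u_def)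
  have r2: "r\<^sup>2 = u\<^sup>2 + q\<^sup>2" by (simp add: r_def)
  have ru: "r \<ge> u" unfolding r_def using u0 by (intro real_le_rsqrt) simp
  have r0: "r > 0" using ru u0 by linarith
  have \<delta>0: "\<delta> \<ge> 0" using p by linarith
  have eq: "2 - 2 * u / r = 2 * q\<^sup>2 / (r * (r + u))"
  proof -
    have "(2 - 2 * u / r) * (r * (r + u)) = 2 * (r\<^sup>2 - u\<^sup>2)"
      using r0 by (simp add: field_simps power2_eq_square)
    also have "\<dots> = 2 * q\<^sup>2" by (simp add: r2)
    finally show ?thesis using r0 u0 by (simp add: eq_divide_eq)
  qed
  have up: "2 / (r * (r + u)) \<le> 1 + 4 * \<delta>"
  proof -
    have "2 * u\<^sup>2 \<le> r * (r + u)"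
    proof -
      have "u * u \<le> r * r" "u * u \<le> r * u" using ru u0 by (auto intro: mult_mono)
      then show ?thesis by (simp add: power2_eq_square distrib_left)
    qed
    then have "2 / (r * (r + u)) \<le> 2 / (2 * u\<^sup>2)" using u0 r0 by (intro divide_left_mono) auto
    also have "\<dots> = 1 / u\<^sup>2" by simp
    also have "\<dots> \<le> 1 / (1 - \<delta>)\<^sup>2"
      using p \<delta> u0 by (intro divide_left_mono power_mono) (auto simp: u_def)
    also have "\<dots> \<le> 1 + 4 * \<delta>"
    proof -
      have "(1 + 4 * \<delta>) * (1 - \<delta>)\<^sup>2 - 1 = \<delta> * (2 - 7 * \<delta> + 4 * \<delta>\<^sup>2)"
        by (simp add: power2_eq_square algebra_simps)
      also have "\<dots> \<ge> 0" using \<delta> \<delta>0 by (intro mult_nonneg_nonneg) (auto intro!: add_nonneg_nonneg)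
      finally show ?thesis using \<delta> by (simp add: divide_le_eq)
    qed
    finally show ?thesis .
  qed
  have low: "1 - 4 * \<delta> \<le> 2 / (r * (r + u))"
  proof -
    have "r * (r + u) \<le> 2 * r\<^sup>2" using ru r0 by (simp add: power2_eq_square distrib_left)
    also have "\<dots> \<le> 2 * ((1 + \<delta>)\<^sup>2 + \<delta>\<^sup>2)"
      unfolding r2 using p q u0 by (intro mult_left_mono add_mono power_mono) (auto simp: u_def)
    finally have 1: "2 / (2 * ((1 + \<delta>)\<^sup>2 + \<delta>\<^sup>2)) \<le> 2 / (r * (r + u))"
      using r0 u0 \<delta>0 by (intro divide_left_mono) (auto intro!: mult_pos_pos add_pos_nonneg)
    have "(1 - 4 * \<delta>) * ((1 + \<delta>)\<^sup>2 + \<delta>\<^sup>2) = 1 - \<delta> * (2 + 6 * \<delta> + 8 * \<delta>\<^sup>2)"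
      by (simp add: power2_eq_square algebra_simps)
    also have "\<dots> \<le> 1" using \<delta>0 by simp
    finally have "1 - 4 * \<delta> \<le> 1 / ((1 + \<delta>)\<^sup>2 + \<delta>\<^sup>2)"
      using \<delta>0 by (simp add: le_divide_eq add_pos_nonneg)
    also have "\<dots> = 2 / (2 * ((1 + \<delta>)\<^sup>2 + \<delta>\<^sup>2))" by (metis mult.right_neutral mult_divide_mult_cancel_left zero_neq_numeral)
    finally show ?thesis using 1 by linarith
  qed
  have "2 - 2 * u / r - q\<^sup>2 = (2 / (r * (r + u)) - 1) * q\<^sup>2"
    unfolding eq by (simp only: left_diff_distrib) simp
  then have "\<bar>2 - 2 * u / r - q\<^sup>2\<bar> = \<bar>2 / (r * (r + u)) - 1\<bar> * q\<^sup>2" by (simp add: abs_mult)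
  also have "\<dots> \<le> (4 * \<delta>) * q\<^sup>2" using up low by (intro mult_right_mono) auto
  finally show ?thesis by (simp add: u_def r_def)
qed

text \<open>In coordinates whitened by the prediction the error \<open>y\<close> of the ridge
  estimator solves \<open>(I + E) y = s\<close>, where \<open>s\<close> is the whitened noise minus
  bias and \<open>E\<close> has norm at most \<kappa>. So \<open>y\<close> is close to
  \<open>s\<close>, and \<open>normalisation_error\<close> passes from the part across \<theta> to
  the projected estimator. The error terms are \<open>4 \<delta> (5 K)^2\<close> and a bound for
  \<open>(5 K \<kappa>) (6 K)\<close>.\<close>

lemma projected_error_approx:
  fixes a :: "nat \<Rightarrow> real^'n" and \<theta> :: "real^'n"
  assumes \<theta>: "norm \<theta> = 1" and \<beta>: "\<beta> > 0" and a: "\<And>s. s \<in> {1..t} \<Longrightarrow> norm (a s) = 1"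
    and r: "\<And>s. s \<in> {1..t} \<Longrightarrow> r s = a s \<bullet> \<theta> + e s"
    and proj: "ridge a r t \<noteq> 0 \<Longrightarrow> \<theta>' = ridge a r t /\<^sub>R norm (ridge a r t)"
    and lyap: "lyap \<theta> \<beta> a t \<le> \<psi>" and \<psi>: "\<psi> \<le> 1" "3 * sqrt \<psi> \<le> \<kappa>" "\<kappa> \<le> 1/4"
  defines "h \<equiv> real (Suc t)" and "S \<equiv> noise_sum a e t"
  defines "l \<equiv> rate TYPE('n) \<beta> h"
  defines "N \<equiv> sqrt ((S \<bullet> S - (\<theta> \<bullet> S)\<^sup>2) / l)"
  assumes K: "K \<ge> 1" "N \<le> K" "\<bar>\<theta> \<bullet> S\<bar> \<le> K * sqrt h"
    and \<delta>: "\<delta> \<le> 1/4" "5 * K \<le> \<delta> * sqrt h" "5 * K \<le> \<delta> * sqrt l"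
  shows "\<bar>l * (norm (\<theta>' - \<theta>))\<^sup>2 - N\<^sup>2\<bar> \<le> 100 * K\<^sup>2 * \<delta> + 36 * K\<^sup>2 * \<kappa>"
proof -
  have h: "h \<ge> 1" by (simp add: h_def)
  have l: "l > 0" unfolding l_def using h by (intro rate_pos \<beta>) simp
  have th: "\<theta> \<bullet> \<theta> = 1" using \<theta> by (simp add: norm_eq_1)
  define \<eta> where "\<eta> = ridge a r t"
  define G where "G = gram a t"
  define R Q where "R = stretch \<theta> (sqrt h) (sqrt l)" and "Q = stretch \<theta> (1 / sqrt h) (1 / sqrt l)"
  have QR: "Q ** R = mat 1"
    unfolding R_def Q_def stretch_mult[OF \<theta>] using h l by (simp add: stretch_def)
  have RQ: "R ** Q = mat 1"
    unfolding R_def Q_def stretch_mult[OF \<theta>] using h l by (simp add: stretch_def)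
  have tQ: "transpose Q = Q" by (simp add: Q_def transpose_stretch)
  define E where "E = transpose Q ** G ** Q - mat 1"
  have E: "norm (E *v x) \<le> \<kappa> * norm x" for x
  proof (rule symmetric_operator_bound)
    show "transpose E = E"
      by (simp add: E_def transpose_diff matrix_transpose_mul matrix_mul_assoc tQ G_def
          posdef_transpose[OF posdef_gram] transpose_mat)
    fix x
    have "wnorm2 \<theta> h l (Q *v x) = (R *v (Q *v x)) \<bullet> (R *v (Q *v x))"
      using h l by (simp add: R_def norm_stretch[OF \<theta>])
    then have w: "wnorm2 \<theta> h l (Q *v x) = x \<bullet> x" by (simp add: matrix_vector_mul_assoc RQ)
    have "x \<bullet> (E *v x) = (Q *v x) \<bullet> (G *v (Q *v x)) - x \<bullet> x"
      by (simp add: E_def matrix_vector_mult_diff_rdistrib inner_diff_right inner_sandwich)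
    then have "\<bar>x \<bullet> (E *v x)\<bar> \<le> 3 * sqrt \<psi> * (x \<bullet> x)"
      using gram_form_bounds(1)[OF \<theta> \<beta> a lyap \<psi>(1), of "Q *v x"] w
      by (simp add: G_def h_def l_def)
    also have "\<dots> \<le> \<kappa> * (x \<bullet> x)" using \<psi> by (intro mult_right_mono) auto
    finally show "\<bar>x \<bullet> (E *v x)\<bar> \<le> \<kappa> * (x \<bullet> x)" .
  qed
  define z where "z = \<eta> - \<theta>"
  have Gz: "G *v z = S - \<theta>"
  proof -
    have "z = matrix_inv G *v (S - \<theta>)"
      unfolding z_def \<eta>_def G_def S_def by (rule ridge_error) (use r in auto)
    then show ?thesis by (simp add: G_def posdef_inv_right[OF posdef_gram])
  qed
  define y where "y = R *v z"
  define s where "s = Q *v (S - \<theta>)"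
  have "(transpose Q ** G ** Q) *v y = Q *v (G *v ((Q ** R) *v z))"
    by (simp add: y_def matrix_vector_mul_assoc matrix_mul_assoc tQ)
  then have "E *v y = s - y"
    by (simp add: E_def matrix_vector_mult_diff_rdistrib QR Gz s_def)
  then have sy: "norm (s - y) \<le> \<kappa> * norm y" using E[of y] by simp
  define perp where "perp = (\<lambda>x :: real^'n. x - (\<theta> \<bullet> x) *\<^sub>R \<theta>)"
  have perp_norm: "(norm (perp x))\<^sup>2 = x \<bullet> x - (\<theta> \<bullet> x)\<^sup>2" for x
    unfolding power2_norm_eq_inner perp_def
    by (simp add: inner_diff_left inner_diff_right th inner_commute[of x \<theta>] power2_eq_square)
  have perp_le: "norm (perp x) \<le> norm x" for x
  proof -
    have "(norm (perp x))\<^sup>2 \<le> (norm x)\<^sup>2" unfolding perp_norm by (simp add: power2_norm_eq_inner)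
    then show ?thesis by (rule power2_le_imp_le) simp
  qed
  have perp_diff: "perp x - perp x' = perp (x - x')" for x x'
    by (simp add: perp_def inner_diff_right algebra_simps)
  have Npos: "0 \<le> S \<bullet> S - (\<theta> \<bullet> S)\<^sup>2" unfolding perp_norm[symmetric] by simp
  have N0: "N \<ge> 0" using Npos l by (simp add: N_def)
  \<comment> \<open>The bias \<theta> has no part across \<theta>, so the noise alone gives exactly
    \<open>N\<close>.\<close>
  have perp_s: "norm (perp s) = N"
  proof -
    have "perp s = (1 / sqrt l) *\<^sub>R perp S"
      by (simp add: perp_def s_def Q_def stretch_vec inner_diff_right inner_add_right th algebra_simps)
    then have "norm (perp s) = norm (perp S) / sqrt l" using l by simp
    also have "\<dots> = N"
      unfolding N_def real_sqrt_divide perp_norm[symmetric] by simp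
    finally show ?thesis .
  qed
  have sth: "\<bar>\<theta> \<bullet> s\<bar> \<le> K + 1"
  proof -
    have "\<theta> \<bullet> s = (\<theta> \<bullet> S - 1) / sqrt h"
      by (simp add: s_def Q_def stretch_vec inner_diff_right inner_add_right th algebra_simps diff_divide_distrib)
    moreover have "\<bar>\<theta> \<bullet> S - 1\<bar> \<le> (K + 1) * sqrt h"
    proof -
      have "1 \<le> sqrt h" using h by simp
      then show ?thesis using K(3) abs_triangle_ineq4[of "\<theta> \<bullet> S" 1] by (simp only: distrib_right)
    qed
    ultimately show ?thesis using h by (simp add: divide_le_eq)
  qed
  have ns: "norm s \<le> 3 * K"
  proof -
    have "s = perp s + (\<theta> \<bullet> s) *\<^sub>R \<theta>" by (simp add: perp_def)
    then have "norm s \<le> norm (perp s) + norm ((\<theta> \<bullet> s) *\<^sub>R \<theta>)" by (metis norm_triangle_ineq)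
    then show ?thesis using sth K perp_s \<theta> by simp
  qed
  have ny: "norm y \<le> 5 * K"
  proof -
    have "norm y \<le> norm s + norm (s - y)" using norm_triangle_sub[of y s] by (simp add: norm_minus_commute)
    also have "\<dots> \<le> 3 * K + \<kappa> * norm y" using ns sy by simp
    also have "\<dots> \<le> 3 * K + (1/4) * norm y" using \<psi> by (intro add_left_mono mult_right_mono) auto
    finally show ?thesis using K by simp
  qed
  have k0: "\<kappa> \<ge> 0"
  proof -
    have "0 \<le> lyap \<theta> \<beta> a t" by (rule lyap_nonneg[OF \<theta> \<beta>]) (use a in auto)
    then have "0 \<le> 3 * sqrt \<psi>" using lyap by simp
    then show ?thesis using \<psi>(2) by linarith
  qed
  have sy': "norm (s - y) \<le> 5 * K * \<kappa>" using sy mult_left_mono[OF ny k0] by (simp add: mult_ac)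
  have py: "\<bar>norm (perp y) - N\<bar> \<le> 5 * K * \<kappa>"
  proof -
    have "\<bar>norm (perp s) - norm (perp y)\<bar> \<le> norm (perp (s - y))"
      unfolding perp_diff[symmetric] by (rule norm_triangle_ineq3)
    then show ?thesis using perp_le[of "s - y"] sy' perp_s by linarith
  qed
  have py5: "norm (perp y) \<le> 5 * K" using perp_le[of y] ny by linarith
  define p q where "p = \<theta> \<bullet> z" and "q = norm (perp z)"
  have yp: "\<theta> \<bullet> y = sqrt h * p" and yq: "norm (perp y) = sqrt l * q"
  proof -
    show "\<theta> \<bullet> y = sqrt h * p"
      by (simp add: y_def R_def stretch_vec inner_add_right th p_def algebra_simps)
    have "perp y = sqrt l *\<^sub>R perp z"
      by (simp add: y_def R_def stretch_vec inner_add_right th perp_def algebra_simps)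
    then show "norm (perp y) = sqrt l * q" using l by (simp add: q_def)
  qed
  have p: "\<bar>p\<bar> \<le> \<delta>"
  proof -
    have "sqrt h * \<bar>p\<bar> \<le> norm y"
      using Cauchy_Schwarz_ineq2[of \<theta> y] \<theta> h unfolding yp by (simp add: abs_mult)
    then have "sqrt h * \<bar>p\<bar> \<le> sqrt h * \<delta>" using ny \<delta>(2) by (simp add: mult.commute)
    then show ?thesis using h by simp
  qed
  have q: "0 \<le> q" "q \<le> \<delta>"
  proof -
    show "0 \<le> q" by (simp add: q_def)
    have "sqrt l * q \<le> sqrt l * \<delta>" using py5 \<delta>(3) unfolding yq by (simp add: mult.commute)
    then show "q \<le> \<delta>" using l by simp
  qed
  have u0: "1 + p > 0" using p \<delta>(1) by linarith
  have thn: "\<theta> \<bullet> \<eta> = 1 + p" by (simp add: p_def z_def inner_diff_right th)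
  then have \<eta>0: "\<eta> \<noteq> 0" using u0 by auto
  have "perp z = perp \<eta>" by (simp add: z_def perp_def inner_diff_right th algebra_simps)
  then have q2: "q\<^sup>2 = \<eta> \<bullet> \<eta> - (1 + p)\<^sup>2" by (simp add: q_def perp_norm thn)
  have n\<eta>: "norm \<eta> = sqrt ((1 + p)\<^sup>2 + q\<^sup>2)" by (simp add: q2 norm_eq_sqrt_inner)
  have th': "\<theta>' = \<eta> /\<^sub>R norm \<eta>" using proj \<eta>0 by (simp add: \<eta>_def)
  have "(norm (\<theta>' - \<theta>))\<^sup>2 = 2 - 2 * (\<theta> \<bullet> \<theta>')"
  proof -
    have "norm \<theta>' = 1" using \<eta>0 by (simp add: th')
    then have "\<theta>' \<bullet> \<theta>' = 1" by (simp add: norm_eq_1)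
    then show ?thesis
      unfolding power2_norm_eq_inner by (simp add: inner_diff_left inner_diff_right th inner_commute)
  qed
  also have "\<dots> = 2 - 2 * (1 + p) / sqrt ((1 + p)\<^sup>2 + q\<^sup>2)"
    by (simp add: th' thn n\<eta>[symmetric] divide_inverse mult_ac)
  finally have "\<bar>(norm (\<theta>' - \<theta>))\<^sup>2 - q\<^sup>2\<bar> \<le> 4 * \<delta> * q\<^sup>2"
    using normalisation_error[OF u0 p q \<delta>(1)] by simp
  then have "l * \<bar>(norm (\<theta>' - \<theta>))\<^sup>2 - q\<^sup>2\<bar> \<le> l * (4 * \<delta> * q\<^sup>2)" using l by (intro mult_left_mono) auto
  moreover have "l * \<bar>(norm (\<theta>' - \<theta>))\<^sup>2 - q\<^sup>2\<bar> = \<bar>l * (norm (\<theta>' - \<theta>))\<^sup>2 - l * q\<^sup>2\<bar>"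
    using l by (simp add: abs_mult flip: right_diff_distrib)
  moreover have lq: "l * q\<^sup>2 = (norm (perp y))\<^sup>2" using l by (simp add: yq power_mult_distrib)
  moreover have "l * (4 * \<delta> * q\<^sup>2) = 4 * \<delta> * (norm (perp y))\<^sup>2" by (simp add: lq[symmetric])
  ultimately have "\<bar>l * (norm (\<theta>' - \<theta>))\<^sup>2 - (norm (perp y))\<^sup>2\<bar> \<le> 4 * \<delta> * (norm (perp y))\<^sup>2"
    by simp
  also have "\<dots> \<le> 4 * \<delta> * (5 * K)\<^sup>2"
    using py5 p by (intro mult_left_mono power_mono) auto
  finally have 1: "\<bar>l * (norm (\<theta>' - \<theta>))\<^sup>2 - (norm (perp y))\<^sup>2\<bar> \<le> 100 * K\<^sup>2 * \<delta>"
    by (simp add: power_mult_distrib mult_ac)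
  have "\<bar>(norm (perp y))\<^sup>2 - N\<^sup>2\<bar> = \<bar>norm (perp y) - N\<bar> * (norm (perp y) + N)"
  proof -
    have "(norm (perp y))\<^sup>2 - N\<^sup>2 = (norm (perp y) - N) * (norm (perp y) + N)"
      by (simp add: power2_eq_square algebra_simps)
    then show ?thesis using N0 by (simp add: abs_mult)
  qed
  also have "\<dots> \<le> (5 * K * \<kappa>) * (6 * K)"
    using py py5 K N0 by (intro mult_mono) auto
  also have "\<dots> \<le> 36 * K\<^sup>2 * \<kappa>" using k0 K(1) by (simp add: power2_eq_square)
  finally show ?thesis using 1 by linarith
qed

section \<open>Noise adapted to the choice of the actions\<close>

lemma subalgebra_vimage_algebra:
  assumes "f \<in> measurable M N"
  shows "subalgebra M (vimage_algebra (space M) f N)"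
  unfolding subalgebra_def using sets_image_in_sets[OF refl assms] by simp

text \<open>The noise conditions in integrated form, tested against functions measurable for
  \<open>F t\<close>, so that the later arguments use plain integrals. \<open>F t\<close> is the
  information just before the noise of round \<open>t\<close> is drawn: actions up to
  \<open>t\<close>, noise before \<open>t\<close>.\<close>

locale adapted_noise = prob_space M for M :: "'w measure" +
  fixes F :: "nat \<Rightarrow> 'w measure" and \<sigma> :: real and T :: nat
    and a :: "nat \<Rightarrow> 'w \<Rightarrow> real^'n" and e :: "nat \<Rightarrow> 'w \<Rightarrow> real"
  assumes subalg: "\<And>t. t \<in> {1..T} \<Longrightarrow> subalgebra M (F t)"
    and action_F: "\<And>s t. 1 \<le> s \<Longrightarrow> s \<le> t \<Longrightarrow> t \<le> T \<Longrightarrow> a s \<in> borel_measurable (F t)"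
    and noise_F: "\<And>s t. 1 \<le> s \<Longrightarrow> s < t \<Longrightarrow> t \<le> T \<Longrightarrow> e s \<in> borel_measurable (F t)"
    and noise_M: "\<And>t. t \<in> {1..T} \<Longrightarrow> e t \<in> borel_measurable M"
    and noise_integrable: "\<And>t. t \<in> {1..T} \<Longrightarrow> integrable M (e t)"
      "\<And>t. t \<in> {1..T} \<Longrightarrow> integrable M (\<lambda>\<omega>. (e t \<omega>)\<^sup>2)"
      "\<And>t. t \<in> {1..T} \<Longrightarrow> integrable M (\<lambda>\<omega>. \<bar>e t \<omega>\<bar> ^ 3)"
    and action_norm: "\<And>t \<omega>. t \<in> {1..T} \<Longrightarrow> \<omega> \<in> space M \<Longrightarrow> norm (a t \<omega>) = 1"
    and mgf_const: "\<And>t c Y. t \<in> {1..T} \<Longrightarrow> Y \<in> borel_measurable (F t) \<Longrightarrow>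
      (\<integral>\<^sup>+\<omega>. Y \<omega> * ennreal (exp (c * e t \<omega>)) \<partial>M) \<le> ennreal (exp (\<sigma>\<^sup>2 * c\<^sup>2 / 2)) * (\<integral>\<^sup>+\<omega>. Y \<omega> \<partial>M)"
    and mean_zero: "\<And>t Y B. t \<in> {1..T} \<Longrightarrow> Y \<in> borel_measurable (F t) \<Longrightarrow>
      (\<And>\<omega>. \<omega> \<in> space M \<Longrightarrow> \<bar>Y \<omega>\<bar> \<le> B) \<Longrightarrow> (\<integral>\<omega>. Y \<omega> * e t \<omega> \<partial>M) = 0"
    and variance: "\<And>t Y B. t \<in> {1..T} \<Longrightarrow> Y \<in> borel_measurable (F t) \<Longrightarrow>
      (\<And>\<omega>. \<omega> \<in> space M \<Longrightarrow> \<bar>Y \<omega>\<bar> \<le> B) \<Longrightarrow> (\<integral>\<omega>. Y \<omega> * (e t \<omega>)\<^sup>2 \<partial>M) = \<sigma>\<^sup>2 * (\<integral>\<omega>. Y \<omega> \<partial>M)"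

text \<open>Joins \<open>nonanticipating\<close>, which speaks of \<open>real_cond_exp\<close>, to
  the exponential moment bound, which speaks of \<open>nn_cond_exp\<close>: both satisfy the same
  integral identities over the events of \<open>F\<close>.\<close>

lemma (in prob_space) nn_cond_exp_eq_real:
  assumes sub: "subalgebra M F" and f: "integrable M f" "\<And>x. f x \<ge> 0"
  shows "AE x in M. ennreal (real_cond_exp M F f x) = nn_cond_exp M F (\<lambda>x. ennreal (f x)) x"
proof -
  interpret S: finite_measure_subalgebra M F
    by unfold_locales (rule sub)
  have pos: "AE x in M. 0 \<le> real_cond_exp M F f x"
    using f by (intro S.real_cond_exp_pos) auto
  show ?thesis
  proof (rule S.nn_cond_exp_charact)
    fix A assume A: "A \<in> sets F"
    then have AM: "A \<in> sets M" using sub by (auto simp: subalgebra_def)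
    have i: "integrable M (\<lambda>x. indicator A x * f x)" "integrable M (\<lambda>x. indicator A x * real_cond_exp M F f x)"
      using integrable_mult_indicator[OF AM f(1)] integrable_mult_indicator[OF AM S.real_cond_exp_int(1)[OF f(1)]]
      by auto
    have "(\<integral>\<^sup>+x\<in>A. ennreal (f x) \<partial>M) = (\<integral>\<^sup>+x. ennreal (indicator A x * f x) \<partial>M)"
      by (intro nn_integral_cong) (auto split: split_indicator)
    also have "\<dots> = ennreal (\<integral>x. indicator A x * f x \<partial>M)"
      using i f by (intro nn_integral_eq_integral) auto
    also have "(\<integral>x. indicator A x * f x \<partial>M) = (\<integral>x. indicator A x * real_cond_exp M F f x \<partial>M)"
      using S.real_cond_exp_intA[OF f(1) A] by (simp add: set_lebesgue_integral_def)
    also have "ennreal \<dots> = (\<integral>\<^sup>+x. ennreal (indicator A x * real_cond_exp M F f x) \<partial>M)"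
      using i pos by (intro nn_integral_eq_integral[symmetric]) auto
    also have "\<dots> = (\<integral>\<^sup>+x\<in>A. ennreal (real_cond_exp M F f x) \<partial>M)"
      by (intro nn_integral_cong) (auto split: split_indicator)
    finally show "(\<integral>\<^sup>+x\<in>A. ennreal (f x) \<partial>M) = (\<integral>\<^sup>+x\<in>A. ennreal (real_cond_exp M F f x) \<partial>M)" .
  qed (use f in auto)
qed

lemma cube_le_exp: "\<bar>x\<bar> ^ 3 \<le> 27 * (exp x + exp (- x :: real))"
proof -
  have "\<bar>x\<bar> / 3 \<le> exp (\<bar>x\<bar> / 3)" using exp_ge_add_one_self[of "\<bar>x\<bar> / 3"] by linarith
  then have "(\<bar>x\<bar> / 3) ^ 3 \<le> exp (\<bar>x\<bar> / 3) ^ 3" by (intro power_mono) auto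
  also have "\<dots> = exp \<bar>x\<bar>" by (simp flip: exp_of_nat_mult)
  also have "\<dots> \<le> exp x + exp (- x)" by (auto simp: abs_if)
  finally show ?thesis by (simp add: power_divide)
qed

lemma square_le_exp: "x\<^sup>2 \<le> 2 * (exp x + exp (- x :: real))"
proof -
  have "1 + \<bar>x\<bar> + \<bar>x\<bar>\<^sup>2 / 2 \<le> exp \<bar>x\<bar>" by (rule exp_lower_Taylor_quadratic) simp
  moreover have "exp \<bar>x\<bar> \<le> exp x + exp (- x)" by (auto simp: abs_if)
  ultimately show ?thesis by simp
qed

lemma abs_le_exp: "\<bar>x\<bar> \<le> exp x + exp (- x :: real)"
proof -
  have "1 + \<bar>x\<bar> \<le> exp \<bar>x\<bar>" by (rule exp_ge_add_one_self)
  moreover have "exp \<bar>x\<bar> \<le> exp x + exp (- x)" by (auto simp: abs_if)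
  ultimately show ?thesis by linarith
qed

section \<open>The noise conditions relative to the past together with the current action\<close>

context linucb
begin

lemma measurable_reward: "t \<in> {1..T} \<Longrightarrow> r t \<in> borel_measurable M"
  using measurable_action[of t] measurable_noise[of t]
  by (subst measurable_cong[OF reward]) auto

lemma measurable_past:
  assumes "k \<le> T"
  shows "(\<lambda>\<omega>. \<lambda>s\<in>{1..k}. (a s \<omega>, r s \<omega>)) \<in> measurable M (\<Pi>\<^sub>M s\<in>{1..k}. borel \<Otimes>\<^sub>M borel)"
  using assms by (intro measurable_restrict measurable_Pair measurable_action measurable_reward) auto

lemma measurable_past_action:
  assumes "t \<in> {1..T}"
  shows "(\<lambda>\<omega>. (\<lambda>s\<in>{1..t-1}. (a s \<omega>, r s \<omega>), a t \<omega>))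
    \<in> measurable M ((\<Pi>\<^sub>M s\<in>{1..t-1}. borel \<Otimes>\<^sub>M borel) \<Otimes>\<^sub>M borel)"
  using assms by (intro measurable_Pair measurable_past measurable_action) auto

lemma subalgebra_history: "k \<le> T \<Longrightarrow> subalgebra M (history M a r k)"
  unfolding history_def by (intro subalgebra_vimage_algebra measurable_past)

lemma subalgebra_history_action: "t \<in> {1..T} \<Longrightarrow> subalgebra M (history_action M a r t)"
  unfolding history_action_def by (intro subalgebra_vimage_algebra measurable_past_action)

lemma measurable_history_action:
  assumes t: "t \<in> {1..T}"
  shows "(\<lambda>\<omega>. (\<lambda>s\<in>{1..t-1}. (a s \<omega>, r s \<omega>), a t \<omega>))
    \<in> measurable (history_action M a r t) ((\<Pi>\<^sub>M s\<in>{1..t-1}. borel \<Otimes>\<^sub>M borel) \<Otimes>\<^sub>M borel)"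
  unfolding history_action_def
  by (intro measurable_vimage_algebra1 measurable_space[OF measurable_past_action[OF t]] Pi_I)

lemma action_measurable_history:
  assumes "1 \<le> s" "s \<le> t" "t \<le> T"
  shows "a s \<in> borel_measurable (history_action M a r t)"
proof (cases "s = t")
  case True
  then show ?thesis
    using measurable_compose[OF measurable_history_action[of t] measurable_snd] assms by simp
next
  case False
  then have s: "s \<in> {1..t-1}" using assms by auto
  have "(\<lambda>p. fst (fst p s)) \<in> measurable ((\<Pi>\<^sub>M s\<in>{1..t-1}. borel \<Otimes>\<^sub>M borel) \<Otimes>\<^sub>M borel) borel"
    by (rule measurable_compose[OF measurable_compose[OF measurable_fst measurable_component_singleton[OF s]] measurable_fst])
  from measurable_compose[OF measurable_history_action[of t] this] s assms show ?thesis by simp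
qed

lemma noise_measurable_history:
  assumes "1 \<le> s" "s < t" "t \<le> T"
  shows "\<epsilon> s \<in> borel_measurable (history_action M a r t)"
proof -
  have s: "s \<in> {1..t-1}" using assms by auto
  have "(\<lambda>p. snd (fst p s)) \<in> measurable ((\<Pi>\<^sub>M s\<in>{1..t-1}. borel \<Otimes>\<^sub>M borel) \<Otimes>\<^sub>M borel) borel"
    by (rule measurable_compose[OF measurable_compose[OF measurable_fst measurable_component_singleton[OF s]] measurable_snd])
  from measurable_compose[OF measurable_history_action[of t] this] s assms
  have r: "r s \<in> borel_measurable (history_action M a r t)" by simp
  have a: "a s \<in> borel_measurable (history_action M a r t)"
    using assms by (intro action_measurable_history) auto
  have sp: "space (history_action M a r t) = space M" by (simp add: history_action_def)
  have "(\<lambda>\<omega>. r s \<omega> - a s \<omega> \<bullet> \<theta>) \<in> borel_measurable (history_action M a r t)"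
    using r a by measurable
  then show ?thesis
    by (rule measurable_cong[THEN iffD1, rotated]) (use reward[of s] assms in \<open>auto simp: sp\<close>)
qed

lemma integrable_exp_noise:
  assumes t: "t \<in> {1..T}"
  shows "integrable M (\<lambda>\<omega>. exp (c * \<epsilon> t \<omega>))"
proof -
  interpret S: finite_measure_subalgebra M "history M a r (t - 1)"
    by unfold_locales (use t in \<open>intro subalgebra_history; auto\<close>)
  note [measurable] = measurable_noise[OF t]
  have "(\<integral>\<^sup>+\<omega>. ennreal (exp (c * \<epsilon> t \<omega>)) \<partial>M)
      = (\<integral>\<^sup>+\<omega>. 1 * nn_cond_exp M (history M a r (t - 1)) (\<lambda>\<omega>. ennreal (exp (c * \<epsilon> t \<omega>))) \<omega> \<partial>M)"
    by (subst S.nn_cond_exp_intg) auto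
  also have "\<dots> \<le> (\<integral>\<^sup>+\<omega>. ennreal (exp (\<sigma>\<^sup>2 * c\<^sup>2 / 2)) \<partial>M)"
    using noise_subgaussian[OF t, of c] by (intro nn_integral_mono_AE) auto
  also have "\<dots> < \<infinity>" by (simp add: emeasure_space_1)
  finally show ?thesis by (intro integrableI_bounded) auto
qed

lemma integrable_noise:
  assumes t: "t \<in> {1..T}"
  shows "integrable M (\<epsilon> t)" "integrable M (\<lambda>\<omega>. (\<epsilon> t \<omega>)\<^sup>2)" "integrable M (\<lambda>\<omega>. \<bar>\<epsilon> t \<omega>\<bar> ^ 3)"
proof -
  note [measurable] = measurable_noise[OF t]
  have i: "integrable M (\<lambda>\<omega>. c * (exp (\<epsilon> t \<omega>) + exp (- \<epsilon> t \<omega>)))" for c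
    using integrable_exp_noise[OF t, of 1] integrable_exp_noise[OF t, of "-1"] by simp
  have b1: "norm x \<le> norm (1 * (exp x + exp (- x)))" and b2: "norm (x\<^sup>2) \<le> norm (2 * (exp x + exp (- x)))"
    and b3: "norm (\<bar>x\<bar> ^ 3) \<le> norm (27 * (exp x + exp (- x)))" for x :: real
    using abs_le_exp[of x] square_le_exp[of x] cube_le_exp[of x] by simp_all
  show "integrable M (\<epsilon> t)"
    by (rule Bochner_Integration.integrable_bound[OF i[of 1] _ AE_I2[OF b1]]) measurable
  show "integrable M (\<lambda>\<omega>. (\<epsilon> t \<omega>)\<^sup>2)"
    by (rule Bochner_Integration.integrable_bound[OF i[of 2] _ AE_I2[OF b2]]) measurable
  show "integrable M (\<lambda>\<omega>. \<bar>\<epsilon> t \<omega>\<bar> ^ 3)"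
    by (rule Bochner_Integration.integrable_bound[OF i[of 27] _ AE_I2[OF b3]]) measurable
qed

context
  fixes t assumes t: "t \<in> {1..T}"
begin

text \<open>\<open>nonanticipating\<close> carries the conditional bound from the past to the past
  enlarged by the action of round \<open>t\<close>; there \<open>Y\<close> is measurable and may be
  moved into the conditional expectation.\<close>

lemma noise_mgf:
  assumes [measurable]: "Y \<in> borel_measurable (history_action M a r t)"
  shows "(\<integral>\<^sup>+\<omega>. Y \<omega> * ennreal (exp (c * \<epsilon> t \<omega>)) \<partial>M)
    \<le> ennreal (exp (\<sigma>\<^sup>2 * c\<^sup>2 / 2)) * (\<integral>\<^sup>+\<omega>. Y \<omega> \<partial>M)"
proof -
  let ?F = "history_action M a r t"
  note sub = subalgebra_history_action[OF t]
  interpret S: finite_measure_subalgebra M ?F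
    by unfold_locales (rule sub)
  interpret H: finite_measure_subalgebra M "history M a r (t - 1)"
    by unfold_locales (use t in \<open>intro subalgebra_history; auto\<close>)
  note [measurable] = measurable_noise[OF t]
  have mgf: "AE \<omega> in M. nn_cond_exp M ?F (\<lambda>\<omega>. ennreal (exp (c * \<epsilon> t \<omega>))) \<omega> \<le> ennreal (exp (\<sigma>\<^sup>2 * c\<^sup>2 / 2))" for c
  proof -
    have i: "integrable M (\<lambda>\<omega>. exp (c * \<epsilon> t \<omega>))" by (rule integrable_exp_noise[OF t])
    have "AE \<omega> in M. real_cond_exp M ?F (\<lambda>\<omega>. exp (c * \<epsilon> t \<omega>)) \<omega> = real_cond_exp M (history M a r (t - 1)) (\<lambda>\<omega>. exp (c * \<epsilon> t \<omega>)) \<omega>"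
      using nonanticipating[OF t, of "\<lambda>x. exp (c * x)"] i by auto
    moreover have "AE \<omega> in M. ennreal (real_cond_exp M ?F (\<lambda>\<omega>. exp (c * \<epsilon> t \<omega>)) \<omega>) = nn_cond_exp M ?F (\<lambda>\<omega>. ennreal (exp (c * \<epsilon> t \<omega>))) \<omega>"
      by (rule nn_cond_exp_eq_real[OF sub i]) simp
    moreover have "AE \<omega> in M. ennreal (real_cond_exp M (history M a r (t - 1)) (\<lambda>\<omega>. exp (c * \<epsilon> t \<omega>)) \<omega>) = nn_cond_exp M (history M a r (t - 1)) (\<lambda>\<omega>. ennreal (exp (c * \<epsilon> t \<omega>))) \<omega>"
      by (rule nn_cond_exp_eq_real[OF _ i]) (use t in \<open>auto intro: subalgebra_history\<close>)
    ultimately show ?thesis using noise_subgaussian[OF t, of c] by eventually_elim simp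
  qed
  have [measurable]: "Y \<in> borel_measurable M" by (rule measurable_from_subalg[OF sub]) measurable
  have "(\<integral>\<^sup>+\<omega>. Y \<omega> * ennreal (exp (c * \<epsilon> t \<omega>)) \<partial>M)
      = (\<integral>\<^sup>+\<omega>. Y \<omega> * nn_cond_exp M ?F (\<lambda>\<omega>. ennreal (exp (c * \<epsilon> t \<omega>))) \<omega> \<partial>M)"
    by (subst S.nn_cond_exp_intg) auto
  also have "\<dots> \<le> (\<integral>\<^sup>+\<omega>. Y \<omega> * ennreal (exp (\<sigma>\<^sup>2 * c\<^sup>2 / 2)) \<partial>M)"
    by (intro nn_integral_mono_AE, use mgf[of c] in eventually_elim) (auto intro: mult_left_mono)
  also have "\<dots> = ennreal (exp (\<sigma>\<^sup>2 * c\<^sup>2 / 2)) * (\<integral>\<^sup>+\<omega>. Y \<omega> \<partial>M)"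
    by (subst nn_integral_cmult[symmetric]) (auto simp: mult.commute)
  finally show ?thesis .
qed

context
  fixes Y :: "'w \<Rightarrow> real" and B :: real
  assumes Y [measurable]: "Y \<in> borel_measurable (history_action M a r t)"
    and B: "\<And>\<omega>. \<omega> \<in> space M \<Longrightarrow> \<bar>Y \<omega>\<bar> \<le> B"
begin

lemma integrable_bounded_mult:
  assumes "integrable M g" shows "integrable M (\<lambda>\<omega>. Y \<omega> * (g \<omega> :: real))"
proof (rule Bochner_Integration.integrable_bound)
  have [measurable]: "Y \<in> borel_measurable M"
    by (rule measurable_from_subalg[OF subalgebra_history_action[OF t]]) measurable
  show "integrable M (\<lambda>\<omega>. B * g \<omega>)" using assms by simp
  show "AE \<omega> in M. norm (Y \<omega> * g \<omega>) \<le> norm (B * g \<omega>)"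
    using B by (intro AE_I2) (auto simp: abs_mult intro!: mult_right_mono order_trans[OF B])
  show "(\<lambda>\<omega>. Y \<omega> * g \<omega>) \<in> borel_measurable M" using assms by measurable
qed

lemma noise_mean_zero: "(\<integral>\<omega>. Y \<omega> * \<epsilon> t \<omega> \<partial>M) = 0"
proof -
  let ?F = "history_action M a r t"
  note sub = subalgebra_history_action[OF t]
  interpret S: finite_measure_subalgebra M ?F
    by unfold_locales (rule sub)
  interpret H: finite_measure_subalgebra M "history M a r (t - 1)"
    by unfold_locales (use t in \<open>intro subalgebra_history; auto\<close>)
  note [measurable] = measurable_noise[OF t]
  have mean: "AE \<omega> in M. real_cond_exp M ?F (\<epsilon> t) \<omega> = 0"
    using nonanticipating[OF t, of "\<lambda>x. x"] integrable_noise(1)[OF t] noise_mean[OF t] by auto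
  have "(\<integral>\<omega>. Y \<omega> * \<epsilon> t \<omega> \<partial>M) = (\<integral>\<omega>. Y \<omega> * real_cond_exp M ?F (\<epsilon> t) \<omega> \<partial>M)"
    by (rule S.real_cond_exp_intg(2)[symmetric, OF integrable_bounded_mult[OF integrable_noise(1)[OF t]]]) auto
  also have "\<dots> = (\<integral>\<omega>. 0 \<partial>M)"
    using mean measurable_from_subalg[OF sub Y] by (intro integral_cong_AE) auto
  finally show ?thesis by simp
qed

lemma noise_second_moment: "(\<integral>\<omega>. Y \<omega> * (\<epsilon> t \<omega>)\<^sup>2 \<partial>M) = \<sigma>\<^sup>2 * (\<integral>\<omega>. Y \<omega> \<partial>M)"
proof -
  let ?F = "history_action M a r t"
  note sub = subalgebra_history_action[OF t]
  interpret S: finite_measure_subalgebra M ?F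
    by unfold_locales (rule sub)
  interpret H: finite_measure_subalgebra M "history M a r (t - 1)"
    by unfold_locales (use t in \<open>intro subalgebra_history; auto\<close>)
  note [measurable] = measurable_noise[OF t]
  have var: "AE \<omega> in M. real_cond_exp M ?F (\<lambda>\<omega>. (\<epsilon> t \<omega>)\<^sup>2) \<omega> = \<sigma>\<^sup>2"
  proof -
    have "AE \<omega> in M. cond_variance M (history M a r (t - 1)) (\<epsilon> t) \<omega>
      = real_cond_exp M (history M a r (t - 1)) (\<lambda>\<omega>. (\<epsilon> t \<omega>)\<^sup>2) \<omega>"
      unfolding cond_variance_def
      using noise_mean[OF t] by (intro H.real_cond_exp_cong) auto
    then show ?thesis
      using nonanticipating[OF t, of "\<lambda>x. x\<^sup>2"] integrable_noise(2)[OF t] noise_variance[OF t] by auto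
  qed
  have "(\<integral>\<omega>. Y \<omega> * (\<epsilon> t \<omega>)\<^sup>2 \<partial>M) = (\<integral>\<omega>. Y \<omega> * real_cond_exp M ?F (\<lambda>\<omega>. (\<epsilon> t \<omega>)\<^sup>2) \<omega> \<partial>M)"
    by (rule S.real_cond_exp_intg(2)[symmetric, OF integrable_bounded_mult[OF integrable_noise(2)[OF t]]]) auto
  also have "\<dots> = (\<integral>\<omega>. \<sigma>\<^sup>2 * Y \<omega> \<partial>M)"
    using var measurable_from_subalg[OF sub Y] by (intro integral_cong_AE) auto
  finally show ?thesis by simp
qed

end

end

lemma unit_action:
  assumes "\<beta> > 0" and t: "t \<in> {1..T}" and "\<omega> \<in> space M"
  shows "norm (a t \<omega>) = 1"
  using t assms by (intro ucb_maximiser(1)[OF posdef_gram _ estimator_unit action_arg_max]) auto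

lemma adapted_noise:
  assumes "\<beta> > 0"
  shows "adapted_noise M (history_action M a r) \<sigma> T a \<epsilon>"
  by unfold_locales
    (fact subalgebra_history_action action_measurable_history noise_measurable_history measurable_noise
      integrable_noise unit_action[OF assms] noise_mgf noise_mean_zero noise_second_moment)+

end

section \<open>Maximal inequalities\<close>

lemma exp_dyadic_tendsto:
  "(\<lambda>k. real_of_int \<lfloor>2 ^ k * x\<rfloor> / 2 ^ k) \<longlonglongrightarrow> x"
proof (rule tendsto_sandwich)
  show "\<forall>\<^sub>F k in sequentially. x - (1/2) ^ k \<le> real_of_int \<lfloor>2 ^ k * x\<rfloor> / 2 ^ k"
  proof (intro always_eventually allI)
    fix k :: nat
    have "x - (1/2) ^ k = (2 ^ k * x - 1) / 2 ^ k" by (simp add: field_simps)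
    also have "\<dots> \<le> real_of_int \<lfloor>2 ^ k * x\<rfloor> / 2 ^ k" by (intro divide_right_mono) (linarith, simp)
    finally show "x - (1/2) ^ k \<le> real_of_int \<lfloor>2 ^ k * x\<rfloor> / 2 ^ k" .
  qed
  show "\<forall>\<^sub>F k in sequentially. real_of_int \<lfloor>2 ^ k * x\<rfloor> / 2 ^ k \<le> x"
  proof (intro always_eventually allI)
    fix k :: nat
    have "real_of_int \<lfloor>2 ^ k * x\<rfloor> \<le> 2 ^ k * x" by linarith
    then show "real_of_int \<lfloor>2 ^ k * x\<rfloor> / 2 ^ k \<le> x" by (simp add: pos_divide_le_eq mult.commute)
  qed
  show "(\<lambda>k. x - (1/2) ^ k) \<longlonglongrightarrow> x"
    using tendsto_diff[OF tendsto_const LIMSEQ_realpow_zero[of "1/2 :: real"], of x] by simp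
qed simp

context adapted_noise
begin

lemma space_F: "t \<in> {1..T} \<Longrightarrow> space (F t) = space M"
  using subalg by (auto simp: subalgebra_def)

lemma F_M: "t \<in> {1..T} \<Longrightarrow> X \<in> measurable (F t) N \<Longrightarrow> X \<in> measurable M N"
  by (rule measurable_from_subalg[OF subalg])

text \<open>From deterministic to predictable exponents, by dyadic approximation and Fatou's lemma.\<close>

lemma mgf_predictable:
  assumes t: "t \<in> {1..T}" and Y [measurable]: "Y \<in> borel_measurable (F t)"
    and C [measurable]: "C \<in> borel_measurable (F t)"
    and b: "\<And>\<omega>. \<omega> \<in> space M \<Longrightarrow> \<bar>C \<omega>\<bar> \<le> b"
  shows "(\<integral>\<^sup>+\<omega>. Y \<omega> * ennreal (exp (C \<omega> * e t \<omega> - \<sigma>\<^sup>2 * (C \<omega>)\<^sup>2 / 2)) \<partial>M) \<le> (\<integral>\<^sup>+\<omega>. Y \<omega> \<partial>M)"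
proof -
  note [measurable] = noise_M[OF t] F_M[OF t C] F_M[OF t Y]
  define D where "D = (\<lambda>k \<omega>. real_of_int \<lfloor>2 ^ k * C \<omega>\<rfloor> / 2 ^ k)"
  define g where "g = (\<lambda>c \<omega>. ennreal (exp (c * e t \<omega> - \<sigma>\<^sup>2 * c\<^sup>2 / 2)))"
  have [measurable]: "D k \<in> borel_measurable (F t)" for k unfolding D_def by measurable
  have [measurable]: "D k \<in> borel_measurable M" for k unfolding D_def by measurable
  have [measurable]: "g c \<in> borel_measurable M" for c unfolding g_def by measurable
  have const: "(\<integral>\<^sup>+\<omega>. X \<omega> * g c \<omega> \<partial>M) \<le> (\<integral>\<^sup>+\<omega>. X \<omega> \<partial>M)"
    if [measurable]: "X \<in> borel_measurable (F t)" for X c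
  proof -
    note [measurable] = F_M[OF t that]
    have "(\<integral>\<^sup>+\<omega>. X \<omega> * g c \<omega> \<partial>M) = (\<integral>\<^sup>+\<omega>. ennreal (exp (- (\<sigma>\<^sup>2 * c\<^sup>2 / 2))) * (X \<omega> * ennreal (exp (c * e t \<omega>))) \<partial>M)"
    proof (intro nn_integral_cong)
      fix \<omega>
      have "exp (c * e t \<omega> - \<sigma>\<^sup>2 * c\<^sup>2 / 2) = exp (- (\<sigma>\<^sup>2 * c\<^sup>2 / 2)) * exp (c * e t \<omega>)"
        by (simp add: exp_add[symmetric])
      then show "X \<omega> * g c \<omega> = ennreal (exp (- (\<sigma>\<^sup>2 * c\<^sup>2 / 2))) * (X \<omega> * ennreal (exp (c * e t \<omega>)))"
        by (simp add: g_def ennreal_mult mult.left_commute)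
    qed
    also have "\<dots> = ennreal (exp (- (\<sigma>\<^sup>2 * c\<^sup>2 / 2))) * (\<integral>\<^sup>+\<omega>. X \<omega> * ennreal (exp (c * e t \<omega>)) \<partial>M)"
      by (intro nn_integral_cmult) measurable
    also have "\<dots> \<le> ennreal (exp (- (\<sigma>\<^sup>2 * c\<^sup>2 / 2))) * (ennreal (exp (\<sigma>\<^sup>2 * c\<^sup>2 / 2)) * (\<integral>\<^sup>+\<omega>. X \<omega> \<partial>M))"
      by (intro mult_left_mono mgf_const[OF t]) auto
    also have "\<dots> = (\<integral>\<^sup>+\<omega>. X \<omega> \<partial>M)"
      by (simp add: mult.assoc[symmetric] flip: ennreal_mult exp_add)
    finally show ?thesis .
  qed
  have dyadic: "(\<integral>\<^sup>+\<omega>. Y \<omega> * g (D k \<omega>) \<omega> \<partial>M) \<le> (\<integral>\<^sup>+\<omega>. Y \<omega> \<partial>M)" for k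
  proof -
    \<comment> \<open>The values of \<open>D k\<close> on the space, finitely many because
      \<open>C\<close> is bounded. On each level set the exponent is constant, and the indicator of
      the level set is absorbed into \<open>Y\<close>.\<close>
    define I where "I = (\<lambda>j :: int. real_of_int j / 2 ^ k) ` {\<lfloor>- (2 ^ k * b)\<rfloor> .. \<lfloor>2 ^ k * b\<rfloor>}"
    have fin: "finite I" by (simp add: I_def)
    have DI: "D k \<omega> \<in> I" if "\<omega> \<in> space M" for \<omega>
    proof -
      have "\<bar>2 ^ k * C \<omega>\<bar> \<le> 2 ^ k * b" using b[OF that] by (simp add: abs_mult)
      then have "- (2 ^ k * b) \<le> 2 ^ k * C \<omega>" "2 ^ k * C \<omega> \<le> 2 ^ k * b" by linarith+
      then show ?thesis unfolding I_def D_def by (auto intro!: imageI floor_mono)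
    qed
    have one: "(\<Sum>c\<in>I. indicator {\<omega>. D k \<omega> = c} \<omega>) = (1 :: ennreal)" if "\<omega> \<in> space M" for \<omega>
      using fin DI[OF that] by (simp add: indicator_def if_distrib cong: if_cong)
    have "(\<integral>\<^sup>+\<omega>. Y \<omega> * g (D k \<omega>) \<omega> \<partial>M) = (\<integral>\<^sup>+\<omega>. (\<Sum>c\<in>I. (Y \<omega> * indicator {\<omega>. D k \<omega> = c} \<omega>) * g c \<omega>) \<partial>M)"
    proof (intro nn_integral_cong)
      fix \<omega> assume w: "\<omega> \<in> space M"
      have "(\<Sum>c\<in>I. (Y \<omega> * indicator {\<omega>. D k \<omega> = c} \<omega>) * g c \<omega>)
          = (\<Sum>c\<in>I. (Y \<omega> * g (D k \<omega>) \<omega>) * indicator {\<omega>. D k \<omega> = c} \<omega>)"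
        by (intro sum.cong) (auto split: split_indicator simp: mult_ac)
      then show "Y \<omega> * g (D k \<omega>) \<omega> = (\<Sum>c\<in>I. (Y \<omega> * indicator {\<omega>. D k \<omega> = c} \<omega>) * g c \<omega>)"
        by (simp add: sum_distrib_left[symmetric] one[OF w])
    qed
    also have "\<dots> = (\<Sum>c\<in>I. \<integral>\<^sup>+\<omega>. (Y \<omega> * indicator {\<omega>. D k \<omega> = c} \<omega>) * g c \<omega> \<partial>M)"
      by (intro nn_integral_sum) measurable
    also have "\<dots> \<le> (\<Sum>c\<in>I. \<integral>\<^sup>+\<omega>. Y \<omega> * indicator {\<omega>. D k \<omega> = c} \<omega> \<partial>M)"
      by (intro sum_mono const) measurable
    also have "\<dots> = (\<integral>\<^sup>+\<omega>. (\<Sum>c\<in>I. Y \<omega> * indicator {\<omega>. D k \<omega> = c} \<omega>) \<partial>M)"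
      by (intro nn_integral_sum[symmetric]) measurable
    also have "\<dots> = (\<integral>\<^sup>+\<omega>. Y \<omega> \<partial>M)"
      by (intro nn_integral_cong) (simp add: sum_distrib_left[symmetric] one)
    finally show ?thesis .
  qed
  have lim: "(\<lambda>k. Y \<omega> * g (D k \<omega>) \<omega>) \<longlonglongrightarrow> Y \<omega> * g (C \<omega>) \<omega>" for \<omega>
  proof -
    have "(\<lambda>k. exp (D k \<omega> * e t \<omega> - \<sigma>\<^sup>2 * (D k \<omega>)\<^sup>2 / 2)) \<longlonglongrightarrow> exp (C \<omega> * e t \<omega> - \<sigma>\<^sup>2 * (C \<omega>)\<^sup>2 / 2)"
      unfolding D_def by (intro tendsto_intros exp_dyadic_tendsto) auto
    then show ?thesis unfolding g_def
      by (intro tendsto_mult_ennreal tendsto_ennrealI tendsto_const) auto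
  qed
  have "(\<integral>\<^sup>+\<omega>. Y \<omega> * g (C \<omega>) \<omega> \<partial>M) = (\<integral>\<^sup>+\<omega>. liminf (\<lambda>k. Y \<omega> * g (D k \<omega>) \<omega>) \<partial>M)"
    by (intro nn_integral_cong sym[OF lim_imp_Liminf[OF sequentially_bot lim]])
  also have "\<dots> \<le> liminf (\<lambda>k. \<integral>\<^sup>+\<omega>. Y \<omega> * g (D k \<omega>) \<omega> \<partial>M)"
    unfolding g_def by (intro nn_integral_liminf) measurable
  also have "\<dots> \<le> (\<integral>\<^sup>+\<omega>. Y \<omega> \<partial>M)"
    by (rule Liminf_le) (auto intro!: always_eventually dyadic)
  finally show ?thesis by (simp add: g_def)
qed

text \<open>With \<open>D = 0\<close> this is Ville's inequality for nonnegative supermartingales.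
  The step condition is only asked on events where \<open>Z k\<close> is still below
  \<open>y\<close>: the process is followed up to its first crossing, and being bounded there makes
  the cross term of the self-normalised process integrable.\<close>

lemma maximal_inequality:
  fixes Z D :: "nat \<Rightarrow> 'w \<Rightarrow> ennreal" and y :: ennreal
  assumes Z: "\<And>j k. j < k \<Longrightarrow> k \<le> T \<Longrightarrow> Z j \<in> borel_measurable (F k)"
    and ZM [measurable]: "\<And>k. k \<le> T \<Longrightarrow> Z k \<in> borel_measurable M"
    and DM [measurable]: "\<And>k. D k \<in> borel_measurable M"
    and step: "\<And>k A. k < T \<Longrightarrow> A \<in> sets (F (Suc k)) \<Longrightarrow> (\<And>\<omega>. \<omega> \<in> A \<Longrightarrow> Z k \<omega> < y) \<Longrightarrow>
      (\<integral>\<^sup>+\<omega>. Z (Suc k) \<omega> * indicator A \<omega> \<partial>M) \<le> (\<integral>\<^sup>+\<omega>. Z k \<omega> * indicator A \<omega> \<partial>M) + (\<integral>\<^sup>+\<omega>. D (Suc k) \<omega> \<partial>M)"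
    and n: "n \<le> T"
  shows "y * emeasure M {\<omega> \<in> space M. \<exists>k\<le>n. y \<le> Z k \<omega>}
    \<le> (\<integral>\<^sup>+\<omega>. Z 0 \<omega> \<partial>M) + (\<Sum>k=1..n. \<integral>\<^sup>+\<omega>. D k \<omega> \<partial>M)"
proof -
  define A where "A = (\<lambda>k. {\<omega> \<in> space M. \<forall>j\<le>k. Z j \<omega> < y})"
  define B where "B = (\<lambda>k. {\<omega> \<in> space M. \<exists>j\<le>k. y \<le> Z j \<omega>})"
  have A_M: "A k \<in> sets M" if "k \<le> T" for k
  proof -
    have "A k = (\<Inter>j\<in>{..k}. {\<omega> \<in> space M. Z j \<omega> < y})" by (auto simp: A_def)
    then show ?thesis using that by (auto intro!: sets.finite_INT)
  qed
  have A_F: "A k \<in> sets (F (Suc k))" if "k < T" for k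
  proof -
    have sp: "space (F (Suc k)) = space M" using that by (intro space_F) auto
    have [measurable]: "Z j \<in> borel_measurable (F (Suc k))" if "j \<le> k" for j
      using Z[of j "Suc k"] that \<open>k < T\<close> by simp
    have "A k = (\<Inter>j\<in>{..k}. {\<omega> \<in> space (F (Suc k)). Z j \<omega> < y})" by (auto simp: A_def sp)
    then show ?thesis by (auto intro!: sets.finite_INT)
  qed
  have B_M: "B k \<in> sets M" if "k \<le> T" for k
  proof -
    have "B k = space M - A k" by (auto simp: A_def B_def not_less)
    then show ?thesis using A_M[OF that] by auto
  qed
  \<comment> \<open>The invariant: the price \<open>y\<close> for every path that has crossed, plus
    the mass of \<open>Z\<close> still carried by the paths that have not.\<close>
  have "y * emeasure M (B n) + (\<integral>\<^sup>+\<omega>. Z n \<omega> * indicator (A n) \<omega> \<partial>M)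
      \<le> (\<integral>\<^sup>+\<omega>. Z 0 \<omega> \<partial>M) + (\<Sum>k=1..n. \<integral>\<^sup>+\<omega>. D k \<omega> \<partial>M)"
    using n
  proof (induction n)
    case 0
    have "y * emeasure M (B 0) + (\<integral>\<^sup>+\<omega>. Z 0 \<omega> * indicator (A 0) \<omega> \<partial>M)
      = (\<integral>\<^sup>+\<omega>. y * indicator (B 0) \<omega> + Z 0 \<omega> * indicator (A 0) \<omega> \<partial>M)"
      using B_M[of 0] A_M[of 0] by (subst nn_integral_add) (auto simp: nn_integral_cmult)
    also have "\<dots> \<le> (\<integral>\<^sup>+\<omega>. Z 0 \<omega> \<partial>M)"
      by (intro nn_integral_mono) (auto simp: A_def B_def split: split_indicator)
    finally show ?case by simp
  next
    case (Suc n)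
    let ?H = "A n - A (Suc n)"
    have n: "n < T" "Suc n \<le> T" "n \<le> T" using Suc by auto
    have H: "?H \<in> sets M" using A_M n by auto
    have "B (Suc n) = B n \<union> ?H" "B n \<inter> ?H = {}"
      by (auto simp: A_def B_def not_less le_Suc_eq)
    then have "emeasure M (B (Suc n)) = emeasure M (B n) + emeasure M ?H"
      using H B_M[OF n(3)] by (simp add: plus_emeasure)
    then have "y * emeasure M (B (Suc n)) + (\<integral>\<^sup>+\<omega>. Z (Suc n) \<omega> * indicator (A (Suc n)) \<omega> \<partial>M)
      = y * emeasure M (B n) + (y * emeasure M ?H + (\<integral>\<^sup>+\<omega>. Z (Suc n) \<omega> * indicator (A (Suc n)) \<omega> \<partial>M))"
      by (simp add: distrib_left add.assoc)
    also have "y * emeasure M ?H + (\<integral>\<^sup>+\<omega>. Z (Suc n) \<omega> * indicator (A (Suc n)) \<omega> \<partial>M)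
      = (\<integral>\<^sup>+\<omega>. y * indicator ?H \<omega> + Z (Suc n) \<omega> * indicator (A (Suc n)) \<omega> \<partial>M)"
      using H A_M[OF n(2)] ZM[OF n(2)] by (subst nn_integral_add) (auto simp: nn_integral_cmult)
    also have "\<dots> \<le> (\<integral>\<^sup>+\<omega>. Z (Suc n) \<omega> * indicator (A n) \<omega> \<partial>M)"
      by (intro nn_integral_mono) (auto simp: A_def le_Suc_eq not_less split: split_indicator)
    also have "\<dots> \<le> (\<integral>\<^sup>+\<omega>. Z n \<omega> * indicator (A n) \<omega> \<partial>M) + (\<integral>\<^sup>+\<omega>. D (Suc n) \<omega> \<partial>M)"
      by (rule step[OF n(1) A_F[OF n(1)]]) (auto simp: A_def)
    also have "y * emeasure M (B n) + \<dots> \<le> (\<integral>\<^sup>+\<omega>. Z 0 \<omega> \<partial>M) + (\<Sum>k=1..Suc n. \<integral>\<^sup>+\<omega>. D k \<omega> \<partial>M)"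
      using add_right_mono[OF Suc.IH[OF n(3)], of "\<integral>\<^sup>+\<omega>. D (Suc n) \<omega> \<partial>M"]
      by (simp add: add.assoc)
    finally show ?case by (simp add: add_left_mono)
  qed
  then show ?thesis unfolding B_def by (rule order_trans[rotated]) simp
qed

section \<open>Tails of the noise in fixed directions and in the self-normalised norm\<close>

definition S :: "nat \<Rightarrow> 'w \<Rightarrow> real^'n" where
  "S k \<omega> = noise_sum (\<lambda>s. a s \<omega>) (\<lambda>s. e s \<omega>) k"

lemma S_Suc: "S (Suc k) \<omega> = S k \<omega> + e (Suc k) \<omega> *\<^sub>R a (Suc k) \<omega>"
  by (simp add: S_def noise_sum_def)

lemma S_0: "S 0 \<omega> = 0"
  by (simp add: S_def noise_sum_def)

lemma measurable_S: "j < k \<Longrightarrow> k \<le> T \<Longrightarrow> S j \<in> borel_measurable (F k)"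
  unfolding S_def noise_sum_def
  by (intro borel_measurable_sum borel_measurable_scaleR action_F noise_F) auto

lemma action_M: "1 \<le> t \<Longrightarrow> t \<le> T \<Longrightarrow> a t \<in> borel_measurable M"
  using F_M[OF _ action_F[of t t]] by auto

lemma measurable_S_M: "k \<le> T \<Longrightarrow> S k \<in> borel_measurable M"
  unfolding S_def noise_sum_def
  by (intro borel_measurable_sum borel_measurable_scaleR action_M noise_M) auto

text \<open>The exponential of \<open>c (x . S)\<close> minus half of \<open>\<sigma>^2 c^2\<close>
  times the sum of the \<open>(x . a)^2\<close> is a supermartingale with mean 1 at the start; the
  maximal inequality makes the bound hold for all rounds at once.\<close>

lemma directional_tail:
  fixes x :: "real^'n" and c L :: real
  assumes c: "c > 0"
  shows "measure M {\<omega> \<in> space M. \<exists>k\<le>T. L / c + c * \<sigma>\<^sup>2 * (\<Sum>s=1..k. (x \<bullet> a s \<omega>)\<^sup>2) / 2 \<le> x \<bullet> S k \<omega>} \<le> exp (- L)"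
proof -
  define X where "X = (\<lambda>k \<omega>. c * (x \<bullet> S k \<omega>) - \<sigma>\<^sup>2 * c\<^sup>2 * (\<Sum>s=1..k. (x \<bullet> a s \<omega>)\<^sup>2) / 2)"
  define Z where "Z = (\<lambda>k \<omega>. ennreal (exp (X k \<omega>)))"
  have XF: "X j \<in> borel_measurable (F k)" if "j < k" "k \<le> T" for j k
  proof -
    note [measurable] = measurable_S[OF that]
    have [measurable]: "(\<lambda>\<omega>. \<Sum>s=1..j. (x \<bullet> a s \<omega>)\<^sup>2) \<in> borel_measurable (F k)"
      using that action_F[of _ k] by (intro borel_measurable_sum borel_measurable_power borel_measurable_inner) auto
    show ?thesis unfolding X_def by measurable
  qed
  have XM: "X k \<in> borel_measurable M" if "k \<le> T" for k
  proof -
    note [measurable] = measurable_S_M[OF that]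
    have [measurable]: "(\<lambda>\<omega>. \<Sum>s=1..k. (x \<bullet> a s \<omega>)\<^sup>2) \<in> borel_measurable M"
      using that action_M by (intro borel_measurable_sum borel_measurable_power borel_measurable_inner) auto
    show ?thesis unfolding X_def by measurable
  qed
  have "ennreal (exp L) * emeasure M {\<omega> \<in> space M. \<exists>k\<le>T. ennreal (exp L) \<le> Z k \<omega>}
      \<le> (\<integral>\<^sup>+\<omega>. Z 0 \<omega> \<partial>M) + (\<Sum>k=1..T. \<integral>\<^sup>+\<omega>. 0 \<partial>M)"
  proof (rule maximal_inequality)
    show "Z j \<in> borel_measurable (F k)" if "j < k" "k \<le> T" for j k
      using XF[OF that] unfolding Z_def by measurable
    show "Z k \<in> borel_measurable M" if "k \<le> T" for k
      using XM[OF that] unfolding Z_def by measurable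
    fix k A assume k: "k < T" and A: "A \<in> sets (F (Suc k))"
    let ?C = "\<lambda>\<omega>. c * (x \<bullet> a (Suc k) \<omega>)"
    have t: "Suc k \<in> {1..T}" using k by auto
    have aF [measurable]: "a (Suc k) \<in> borel_measurable (F (Suc k))" using k by (intro action_F) auto
    have [measurable]: "Z k \<in> borel_measurable (F (Suc k))"
    proof -
      have [measurable]: "X k \<in> borel_measurable (F (Suc k))" using k by (intro XF) auto
      show ?thesis unfolding Z_def by measurable
    qed
    note [measurable] = A
    have eq: "Z (Suc k) \<omega> = Z k \<omega> * ennreal (exp (?C \<omega> * e (Suc k) \<omega> - \<sigma>\<^sup>2 * (?C \<omega>)\<^sup>2 / 2))" for \<omega>
    proof -
      have "X (Suc k) \<omega> = X k \<omega> + (?C \<omega> * e (Suc k) \<omega> - \<sigma>\<^sup>2 * (?C \<omega>)\<^sup>2 / 2)"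
        by (simp add: X_def S_Suc inner_add_right power_mult_distrib algebra_simps add_divide_distrib)
      then show ?thesis by (simp add: Z_def exp_add ennreal_mult)
    qed
    have "(\<integral>\<^sup>+\<omega>. Z (Suc k) \<omega> * indicator A \<omega> \<partial>M)
        = (\<integral>\<^sup>+\<omega>. (Z k \<omega> * indicator A \<omega>) * ennreal (exp (?C \<omega> * e (Suc k) \<omega> - \<sigma>\<^sup>2 * (?C \<omega>)\<^sup>2 / 2)) \<partial>M)"
      by (intro nn_integral_cong) (simp add: eq mult_ac)
    also have "\<dots> \<le> (\<integral>\<^sup>+\<omega>. Z k \<omega> * indicator A \<omega> \<partial>M)"
    proof (rule mgf_predictable[OF t])
      fix \<omega> assume "\<omega> \<in> space M"
      then have "\<bar>x \<bullet> a (Suc k) \<omega>\<bar> \<le> norm x"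
        using Cauchy_Schwarz_ineq2[of x "a (Suc k) \<omega>"] action_norm[OF t] by simp
      then show "\<bar>c * (x \<bullet> a (Suc k) \<omega>)\<bar> \<le> c * norm x" using c by (simp add: abs_mult)
    qed measurable
    finally show "(\<integral>\<^sup>+\<omega>. Z (Suc k) \<omega> * indicator A \<omega> \<partial>M) \<le> (\<integral>\<^sup>+\<omega>. Z k \<omega> * indicator A \<omega> \<partial>M) + (\<integral>\<^sup>+\<omega>. 0 \<partial>M)"
      by simp
  qed auto
  also have "\<dots> = 1" by (simp add: Z_def X_def S_0 emeasure_space_1)
  finally have "ennreal (exp L) * emeasure M {\<omega> \<in> space M. \<exists>k\<le>T. ennreal (exp L) \<le> Z k \<omega>} \<le> 1" .
  moreover have "{\<omega> \<in> space M. \<exists>k\<le>T. ennreal (exp L) \<le> Z k \<omega>}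
    = {\<omega> \<in> space M. \<exists>k\<le>T. L / c + c * \<sigma>\<^sup>2 * (\<Sum>s=1..k. (x \<bullet> a s \<omega>)\<^sup>2) / 2 \<le> x \<bullet> S k \<omega>}"
  proof -
    have "L \<le> X k \<omega> \<longleftrightarrow> L / c + c * \<sigma>\<^sup>2 * (\<Sum>s=1..k. (x \<bullet> a s \<omega>)\<^sup>2) / 2 \<le> x \<bullet> S k \<omega>" for k \<omega>
      using c by (simp add: X_def field_simps power2_eq_square)
    then show ?thesis by (simp add: Z_def)
  qed
  ultimately have "ennreal (exp L) * ennreal (measure M {\<omega> \<in> space M. \<exists>k\<le>T. L / c + c * \<sigma>\<^sup>2 * (\<Sum>s=1..k. (x \<bullet> a s \<omega>)\<^sup>2) / 2 \<le> x \<bullet> S k \<omega>}) \<le> 1"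
    by (simp add: emeasure_eq_measure)
  then have "exp L * measure M {\<omega> \<in> space M. \<exists>k\<le>T. L / c + c * \<sigma>\<^sup>2 * (\<Sum>s=1..k. (x \<bullet> a s \<omega>)\<^sup>2) / 2 \<le> x \<bullet> S k \<omega>} \<le> 1"
    by (simp flip: ennreal_mult ennreal_1)
  then show ?thesis by (simp add: exp_minus field_simps)
qed

text \<open>\<open>matrix_inv\<close> is defined by choice. The rank-one update expresses the next
  inverse by arithmetic operations in the previous one, so measurability follows by induction from
  the identity.\<close>

lemma measurable_inverse_gram:
  fixes N :: "'w measure"
  assumes "\<And>s. s \<in> {1..k} \<Longrightarrow> a s \<in> borel_measurable N" and "x \<in> borel_measurable N"
  shows "(\<lambda>\<omega>. matrix_inv (gram (\<lambda>s. a s \<omega>) k) *v x \<omega>) \<in> borel_measurable N"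
  using assms
proof (induction k arbitrary: x)
  case 0
  have "matrix_inv (mat 1 :: real^'n^'n) *v y = y" for y
    using posdef_inv_left[OF posdef_gram[of _ 0], of "\<lambda>_. 0" y] by simp
  then show ?case using 0 by simp
next
  case (Suc k)
  have a: "a (Suc k) \<in> borel_measurable N" using Suc by auto
  have V: "(\<lambda>\<omega>. matrix_inv (gram (\<lambda>s. a s \<omega>) k) *v y \<omega>) \<in> borel_measurable N"
    if "y \<in> borel_measurable N" for y
    using Suc that by (intro Suc.IH) auto
  have pd: "posdef (gram b k + tensor (b (Suc k)) (b (Suc k)))" for b :: "nat \<Rightarrow> real^'n"
    using posdef_gram[of b "Suc k"] by (simp add: gram_Suc)
  have eq: "matrix_inv (gram (\<lambda>s. a s \<omega>) (Suc k)) *v x \<omega> = matrix_inv (gram (\<lambda>s. a s \<omega>) k) *v x \<omega>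
    - ((a (Suc k) \<omega> \<bullet> (matrix_inv (gram (\<lambda>s. a s \<omega>) k) *v x \<omega>))
        / (1 + a (Suc k) \<omega> \<bullet> (matrix_inv (gram (\<lambda>s. a s \<omega>) k) *v a (Suc k) \<omega>)))
      *\<^sub>R (matrix_inv (gram (\<lambda>s. a s \<omega>) k) *v a (Suc k) \<omega>)" for \<omega>
    unfolding gram_Suc by (rule sherman_morrison_vec[OF posdef_gram pd[of "\<lambda>s. a s \<omega>"]])
  show ?case
    unfolding eq using V[OF a] V[OF Suc.prems(2)] a by measurable
qed

text \<open>A bound of Markov type from second moments, for the whole ellipsoid at once. The mean
  increments are at most \<open>\<sigma>^2 w2 / (1 + w2) \<le> \<sigma>^2 ln (1 + w2)\<close>, and
  these sum to the log-determinant.\<close>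

lemma selfnorm_tail:
  assumes n: "n \<le> T" and y: "y > 0"
  shows "y * measure M {\<omega> \<in> space M. \<exists>k\<le>n. y \<le> S k \<omega> \<bullet> (matrix_inv (gram (\<lambda>s. a s \<omega>) k) *v S k \<omega>)}
    \<le> \<sigma>\<^sup>2 * (real CARD('n) * ln (1 + real n))"
proof -
  define V where "V = (\<lambda>k \<omega> x. matrix_inv (gram (\<lambda>s. a s \<omega>) k) *v x)"
  define Q where "Q = (\<lambda>k \<omega>. S k \<omega> \<bullet> V k \<omega> (S k \<omega>))"
  define w2 where "w2 = (\<lambda>k \<omega>. a (Suc k) \<omega> \<bullet> V k \<omega> (a (Suc k) \<omega>))"
  define b where "b = (\<lambda>k \<omega>. a (Suc k) \<omega> \<bullet> V k \<omega> (S k \<omega>))"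
  \<comment> \<open>Shifted by one because \<open>w2 k\<close> belongs to the action of round
    \<open>Suc k\<close>; zero outside the run, since the maximal inequality asks for measurability
    at every index.\<close>
  define d where "d = (\<lambda>k \<omega>. if 1 \<le> k \<and> k \<le> T then \<sigma>\<^sup>2 * (w2 (k - 1) \<omega> / (1 + w2 (k - 1) \<omega>)) else 0)"
  have Q0: "0 \<le> Q k \<omega>" and w0: "0 \<le> w2 k \<omega>" for k \<omega>
    unfolding Q_def w2_def V_def by (intro posdef_nonneg posdef_inverse posdef_gram)+
  have VF: "(\<lambda>\<omega>. V j \<omega> (x \<omega>)) \<in> borel_measurable (F k)" if "j < k" "k \<le> T" "x \<in> borel_measurable (F k)" for j k x
    unfolding V_def using that by (intro measurable_inverse_gram action_F) auto
  have VM: "(\<lambda>\<omega>. V k \<omega> (x \<omega>)) \<in> borel_measurable M" if "k \<le> T" "x \<in> borel_measurable M" for k x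
    unfolding V_def using that by (intro measurable_inverse_gram action_M) auto
  have QF: "Q j \<in> borel_measurable (F k)" if "j < k" "k \<le> T" for j k
    unfolding Q_def using that by (intro borel_measurable_inner VF measurable_S) auto
  have QM: "Q k \<in> borel_measurable M" if "k \<le> T" for k
    unfolding Q_def using that by (intro borel_measurable_inner VM measurable_S_M) auto
  have wF: "w2 k \<in> borel_measurable (F (Suc k))" "b k \<in> borel_measurable (F (Suc k))" if "k < T" for k
    unfolding w2_def b_def using that by (intro borel_measurable_inner VF measurable_S action_F; simp)+
  have dM: "d k \<in> borel_measurable M" for k
  proof (cases "1 \<le> k \<and> k \<le> T")
    case True
    then obtain j where j: "k = Suc j" "j < T" by (cases k) auto
    have [measurable]: "w2 j \<in> borel_measurable M" using j by (intro F_M[OF _ wF(1)]) auto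
    show ?thesis using True unfolding d_def j(1) by simp
  next
    case False
    then have "d k = (\<lambda>\<omega>. 0)" by (auto simp: d_def)
    then show ?thesis by simp
  qed
  have "ennreal y * emeasure M {\<omega> \<in> space M. \<exists>k\<le>n. ennreal y \<le> ennreal (Q k \<omega>)}
      \<le> (\<integral>\<^sup>+\<omega>. ennreal (Q 0 \<omega>) \<partial>M) + (\<Sum>k=1..n. \<integral>\<^sup>+\<omega>. ennreal (d k \<omega>) \<partial>M)"
  proof (rule maximal_inequality[OF _ _ _ _ n])
    show "(\<lambda>\<omega>. ennreal (Q j \<omega>)) \<in> borel_measurable (F k)" if "j < k" "k \<le> T" for j k
      using QF[OF that] by measurable
    show "(\<lambda>\<omega>. ennreal (Q k \<omega>)) \<in> borel_measurable M" if "k \<le> T" for k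
      using QM[OF that] by measurable
    show "(\<lambda>\<omega>. ennreal (d k \<omega>)) \<in> borel_measurable M" for k
      using dM[of k] by measurable
    fix k A assume k: "k < T" and A: "A \<in> sets (F (Suc k))"
      and small: "\<And>\<omega>. \<omega> \<in> A \<Longrightarrow> ennreal (Q k \<omega>) < ennreal y"
    have t: "Suc k \<in> {1..T}" using k by auto
    have small': "Q k \<omega> < y" if "\<omega> \<in> A" for \<omega>
      using small[OF that] y Q0[of k \<omega>] by (simp add: ennreal_less_iff)
    have AM [measurable]: "A \<in> sets M" using A subalg[OF t] by (auto simp: subalgebra_def)
    \<comment> \<open>The coefficients of the noise and of its square in the increment. On
      \<open>A\<close> the form is below \<open>y\<close>, so by Cauchy-Schwarz \<open>b\<close> is
      bounded; this makes \<open>Y1\<close> admissible in \<open>mean_zero\<close>.\<close>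
    define Y1 where "Y1 = (\<lambda>\<omega>. indicat_real A \<omega> * (2 * b k \<omega> / (1 + w2 k \<omega>)))"
    define Y2 where "Y2 = (\<lambda>\<omega>. indicat_real A \<omega> * (w2 k \<omega> / (1 + w2 k \<omega>)))"
    have Y1F: "Y1 \<in> borel_measurable (F (Suc k))" and Y2F: "Y2 \<in> borel_measurable (F (Suc k))"
      using wF[OF k] A unfolding Y1_def Y2_def by measurable
    note [measurable] = F_M[OF t Y1F] F_M[OF t Y2F] noise_M[OF t] QM[of k] QM[of "Suc k"] F_M[OF t wF(1)[OF k]]
    have [measurable]: "Q k \<in> borel_measurable M" "Q (Suc k) \<in> borel_measurable M"
      using QM k by auto
    have w1: "w2 k \<omega> \<le> 1" if "\<omega> \<in> space M" for \<omega>
      using inverse_gram_form_le[of "a (Suc k) \<omega>" "\<lambda>s. a s \<omega>" k] action_norm[OF t that]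
      by (simp add: w2_def V_def norm_eq_1)
    have Y1b: "\<bar>Y1 \<omega>\<bar> \<le> 2 * (1 + y)" if "\<omega> \<in> space M" for \<omega>
    proof (cases "\<omega> \<in> A")
      case True
      have "(b k \<omega>)\<^sup>2 \<le> w2 k \<omega> * Q k \<omega>"
        unfolding b_def w2_def Q_def V_def by (intro posdef_cauchy posdef_inverse posdef_gram)
      also have "\<dots> \<le> 1 * y" using w1[OF that] small'[OF True] w0 Q0 y by (intro mult_mono) auto
      also have "\<dots> \<le> (1 + y)\<^sup>2" using y by (simp add: power2_eq_square algebra_simps)
      finally have "\<bar>b k \<omega>\<bar> \<le> 1 + y" using y by (simp add: power2_le_iff_abs_le)
      moreover have "\<bar>2 * b k \<omega> / (1 + w2 k \<omega>)\<bar> \<le> \<bar>2 * b k \<omega>\<bar>"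
        using w0[of k \<omega>] mult_left_mono[of 1 "1 + w2 k \<omega>" "\<bar>2 * b k \<omega>\<bar>"]
        by (simp add: abs_divide pos_divide_le_eq)
      ultimately show ?thesis by (simp add: Y1_def True)
    qed (use y in \<open>simp add: Y1_def\<close>)
    have Y2b: "\<bar>Y2 \<omega>\<bar> \<le> 1" for \<omega>
      using w0[of k \<omega>] by (auto simp: Y2_def indicator_def abs_le_iff divide_le_eq)
    have step: "Q (Suc k) \<omega> \<le> Q k \<omega> + e (Suc k) \<omega> * (2 * b k \<omega> / (1 + w2 k \<omega>)) + (w2 k \<omega> / (1 + w2 k \<omega>)) * (e (Suc k) \<omega>)\<^sup>2" for \<omega>
    proof -
      have pd: "posdef (gram (\<lambda>s. a s \<omega>) k + tensor (a (Suc k) \<omega>) (a (Suc k) \<omega>))"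
        using posdef_gram[of "\<lambda>s. a s \<omega>" "Suc k"] by (simp add: gram_Suc)
      have "Q (Suc k) \<omega> = Q k \<omega> - (b k \<omega>)\<^sup>2 / (1 + w2 k \<omega>) + 2 * e (Suc k) \<omega> * b k \<omega> / (1 + w2 k \<omega>)
          + (e (Suc k) \<omega>)\<^sup>2 * w2 k \<omega> / (1 + w2 k \<omega>)"
        unfolding Q_def S_Suc V_def gram_Suc selfnorm_step[OF posdef_gram pd] w2_def b_def ..
      moreover have "0 \<le> (b k \<omega>)\<^sup>2 / (1 + w2 k \<omega>)" using w0[of k \<omega>] by simp
      ultimately show ?thesis by (simp add: mult_ac)
    qed
    have bd: "integrable M (\<lambda>\<omega>. Y \<omega> * g \<omega>)"
      if "integrable M g" "Y \<in> borel_measurable M" "\<And>\<omega>. \<omega> \<in> space M \<Longrightarrow> \<bar>Y \<omega>\<bar> \<le> B" for g Y :: "'w \<Rightarrow> real" and B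
    proof (rule Bochner_Integration.integrable_bound)
      show "integrable M (\<lambda>\<omega>. B * g \<omega>)" using that by simp
      show "AE \<omega> in M. norm (Y \<omega> * g \<omega>) \<le> norm (B * g \<omega>)"
        using that(3) by (intro AE_I2) (auto simp: abs_mult intro!: mult_right_mono order_trans[OF that(3)])
      show "(\<lambda>\<omega>. Y \<omega> * g \<omega>) \<in> borel_measurable M" using that by measurable
    qed
    have ei: "integrable M (e (Suc k))" "integrable M (\<lambda>\<omega>. (e (Suc k) \<omega>)\<^sup>2)"
      using noise_integrable[OF t] by auto
    have i1: "integrable M (\<lambda>\<omega>. Y1 \<omega> * e (Suc k) \<omega>)" by (rule bd[OF ei(1) _ Y1b]) measurable
    have i2: "integrable M (\<lambda>\<omega>. Y2 \<omega> * (e (Suc k) \<omega>)\<^sup>2)" by (rule bd[OF ei(2) _ Y2b]) measurable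
    have iQ: "integrable M (\<lambda>\<omega>. indicat_real A \<omega> * Q k \<omega>)"
      by (rule integrable_const_bound[of _ y]) (use small' Q0 y in \<open>auto simp: indicator_def less_imp_le\<close>)
    have iY2: "integrable M Y2"
      by (rule integrable_const_bound[of _ 1]) (use Y2b in auto)
    have le: "ennreal (Q (Suc k) \<omega>) * indicator A \<omega>
      \<le> ennreal (indicat_real A \<omega> * Q k \<omega> + Y1 \<omega> * e (Suc k) \<omega> + Y2 \<omega> * (e (Suc k) \<omega>)\<^sup>2)" for \<omega>
      using step[of \<omega>] by (auto simp: Y1_def Y2_def indicator_def mult_ac intro!: ennreal_leI)
    have "(\<integral>\<^sup>+\<omega>. ennreal (Q (Suc k) \<omega>) * indicator A \<omega> \<partial>M)
        \<le> (\<integral>\<^sup>+\<omega>. ennreal (indicat_real A \<omega> * Q k \<omega> + Y1 \<omega> * e (Suc k) \<omega> + Y2 \<omega> * (e (Suc k) \<omega>)\<^sup>2) \<partial>M)"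
      by (intro nn_integral_mono le)
    also have "\<dots> = ennreal (\<integral>\<omega>. indicat_real A \<omega> * Q k \<omega> + Y1 \<omega> * e (Suc k) \<omega> + Y2 \<omega> * (e (Suc k) \<omega>)\<^sup>2 \<partial>M)"
    proof (rule nn_integral_eq_integral)
      have "0 \<le> indicat_real A \<omega> * Q k \<omega> + Y1 \<omega> * e (Suc k) \<omega> + Y2 \<omega> * (e (Suc k) \<omega>)\<^sup>2" for \<omega>
        using step[of \<omega>] Q0[of "Suc k" \<omega>] by (auto simp: Y1_def Y2_def indicator_def mult_ac)
      then show "AE \<omega> in M. 0 \<le> indicat_real A \<omega> * Q k \<omega> + Y1 \<omega> * e (Suc k) \<omega> + Y2 \<omega> * (e (Suc k) \<omega>)\<^sup>2" by simp
    qed (intro Bochner_Integration.integrable_add iQ i1 i2)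
    also have "(\<integral>\<omega>. indicat_real A \<omega> * Q k \<omega> + Y1 \<omega> * e (Suc k) \<omega> + Y2 \<omega> * (e (Suc k) \<omega>)\<^sup>2 \<partial>M)
       = (\<integral>\<omega>. indicat_real A \<omega> * Q k \<omega> \<partial>M) + \<sigma>\<^sup>2 * (\<integral>\<omega>. Y2 \<omega> \<partial>M)"
      using iQ i1 i2 mean_zero[OF t Y1F Y1b] variance[OF t Y2F Y2b]
      by (simp add: Bochner_Integration.integral_add Bochner_Integration.integrable_add)
    also have "ennreal \<dots> = ennreal (\<integral>\<omega>. indicat_real A \<omega> * Q k \<omega> \<partial>M) + ennreal (\<integral>\<omega>. \<sigma>\<^sup>2 * Y2 \<omega> \<partial>M)"
      using Q0 w0 unfolding integral_mult_right_zero[symmetric]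
      by (subst ennreal_plus[symmetric]) (auto intro!: Bochner_Integration.integral_nonneg simp: Y2_def)
    also have "ennreal (\<integral>\<omega>. indicat_real A \<omega> * Q k \<omega> \<partial>M) = (\<integral>\<^sup>+\<omega>. ennreal (indicat_real A \<omega> * Q k \<omega>) \<partial>M)"
      using iQ Q0 by (intro nn_integral_eq_integral[symmetric]) auto
    also have "\<dots> = (\<integral>\<^sup>+\<omega>. ennreal (Q k \<omega>) * indicator A \<omega> \<partial>M)"
      by (intro nn_integral_cong) (auto simp: indicator_def)
    also have "ennreal (\<integral>\<omega>. \<sigma>\<^sup>2 * Y2 \<omega> \<partial>M) = (\<integral>\<^sup>+\<omega>. ennreal (\<sigma>\<^sup>2 * Y2 \<omega>) \<partial>M)"
    proof (rule nn_integral_eq_integral[symmetric])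
      show "integrable M (\<lambda>\<omega>. \<sigma>\<^sup>2 * Y2 \<omega>)" using iY2 by simp
      show "AE \<omega> in M. 0 \<le> \<sigma>\<^sup>2 * Y2 \<omega>" using w0 by (auto simp: Y2_def)
    qed
    also have "\<dots> \<le> (\<integral>\<^sup>+\<omega>. ennreal (d (Suc k) \<omega>) \<partial>M)"
      using k w0 by (intro nn_integral_mono ennreal_leI) (auto simp: d_def Y2_def indicator_def)
    finally show "(\<integral>\<^sup>+\<omega>. ennreal (Q (Suc k) \<omega>) * indicator A \<omega> \<partial>M)
      \<le> (\<integral>\<^sup>+\<omega>. ennreal (Q k \<omega>) * indicator A \<omega> \<partial>M) + (\<integral>\<^sup>+\<omega>. ennreal (d (Suc k) \<omega>) \<partial>M)"
      by (simp add: add_left_mono)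
  qed
  also have "(\<integral>\<^sup>+\<omega>. ennreal (Q 0 \<omega>) \<partial>M) = 0" by (simp add: Q_def S_0)
  also have "(\<Sum>k=1..n. \<integral>\<^sup>+\<omega>. ennreal (d k \<omega>) \<partial>M) = (\<integral>\<^sup>+\<omega>. (\<Sum>k=1..n. ennreal (d k \<omega>)) \<partial>M)"
    using dM by (intro nn_integral_sum[symmetric]) auto
  also have "\<dots> \<le> (\<integral>\<^sup>+\<omega>. ennreal (\<sigma>\<^sup>2 * (real CARD('n) * ln (1 + real n))) \<partial>M)"
  proof (intro nn_integral_mono)
    fix \<omega> assume w: "\<omega> \<in> space M"
    have d0: "0 \<le> d k \<omega>" for k using w0 by (simp add: d_def)
    have "(\<Sum>k=1..n. d k \<omega>) = (\<Sum>k<n. d (Suc k) \<omega>)"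
      by (simp add: sum.atLeast1_atMost_eq)
    also have "\<dots> \<le> (\<Sum>k<n. \<sigma>\<^sup>2 * ln (1 + w2 k \<omega>))"
    proof (intro sum_mono)
      fix k assume "k \<in> {..<n}"
      then have k: "k < T" using n by auto
      have "- ln (1 + w2 k \<omega>) = ln (1 / (1 + w2 k \<omega>))" using w0[of k \<omega>] by (simp add: ln_div)
      also have "\<dots> \<le> 1 / (1 + w2 k \<omega>) - 1" using w0[of k \<omega>] by (intro ln_le_minus_one) auto
      also have "\<dots> = - (w2 k \<omega> / (1 + w2 k \<omega>))" using w0[of k \<omega>] by (simp add: field_simps)
      finally have "w2 k \<omega> / (1 + w2 k \<omega>) \<le> ln (1 + w2 k \<omega>)" by simp
      then have "\<sigma>\<^sup>2 * (w2 k \<omega> / (1 + w2 k \<omega>)) \<le> \<sigma>\<^sup>2 * ln (1 + w2 k \<omega>)"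
        by (intro mult_left_mono) auto
      then show "d (Suc k) \<omega> \<le> \<sigma>\<^sup>2 * ln (1 + w2 k \<omega>)" using k by (simp add: d_def)
    qed
    also have "\<dots> = \<sigma>\<^sup>2 * ln (det (gram (\<lambda>s. a s \<omega>) n))"
      by (simp add: ln_det_gram w2_def V_def sum_distrib_left)
    also have "\<dots> \<le> \<sigma>\<^sup>2 * (real CARD('n) * ln (1 + real n))"
      using n w by (intro mult_left_mono sum_ln_le action_norm) auto
    finally show "(\<Sum>k=1..n. ennreal (d k \<omega>)) \<le> ennreal (\<sigma>\<^sup>2 * (real CARD('n) * ln (1 + real n)))"
      using d0 by (subst sum_ennreal) (auto intro: ennreal_leI)
  qed
  also have "\<dots> = ennreal (\<sigma>\<^sup>2 * (real CARD('n) * ln (1 + real n)))" by (simp add: emeasure_space_1)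
  finally have "ennreal y * emeasure M {\<omega> \<in> space M. \<exists>k\<le>n. y \<le> Q k \<omega>} \<le> ennreal (\<sigma>\<^sup>2 * (real CARD('n) * ln (1 + real n)))"
    using Q0 y by simp
  then have "ennreal (y * measure M {\<omega> \<in> space M. \<exists>k\<le>n. y \<le> Q k \<omega>}) \<le> ennreal (\<sigma>\<^sup>2 * (real CARD('n) * ln (1 + real n)))"
    using y by (simp add: emeasure_eq_measure ennreal_mult)
  then show ?thesis by (simp add: Q_def V_def ennreal_le_iff)
qed

end

section \<open>A martingale central limit theorem\<close>

lemma cos_sin_taylor:
  fixes x :: real
  shows "\<bar>cos x - (1 - x\<^sup>2 / 2)\<bar> \<le> \<bar>x\<bar> ^ 3 / 6" "\<bar>sin x - x\<bar> \<le> \<bar>x\<bar> ^ 3 / 6"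
proof -
  let ?z = "iexp x - (\<Sum>k\<le>2. (\<i> * x) ^ k / fact k)"
  have z: "cmod ?z \<le> \<bar>x\<bar> ^ 3 / 6"
    using iexp_approx1[of x 2] by (simp add: fact_numeral eval_nat_numeral)
  have "(\<Sum>k\<le>2. (\<i> * x) ^ k / fact k) = Complex (1 - x\<^sup>2 / 2) x"
    by (simp add: eval_nat_numeral complex_eq_iff)
  then have "Re ?z = cos x - (1 - x\<^sup>2 / 2)" "Im ?z = sin x - x" by (simp_all add: Re_exp Im_exp)
  then show "\<bar>cos x - (1 - x\<^sup>2 / 2)\<bar> \<le> \<bar>x\<bar> ^ 3 / 6" "\<bar>sin x - x\<bar> \<le> \<bar>x\<bar> ^ 3 / 6"
    using z abs_Re_le_cmod[of ?z] abs_Im_le_cmod[of ?z] by linarith+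
qed

lemma abs_integral_diff_le:
  fixes f g h :: "'a \<Rightarrow> real"
  assumes "integrable M f" "integrable M g" "integrable M h"
    and "\<And>x. x \<in> space M \<Longrightarrow> \<bar>f x - g x\<bar> \<le> h x"
  shows "\<bar>(\<integral>x. f x \<partial>M) - (\<integral>x. g x \<partial>M)\<bar> \<le> (\<integral>x. h x \<partial>M)"
proof -
  have "\<bar>(\<integral>x. f x \<partial>M) - (\<integral>x. g x \<partial>M)\<bar> = \<bar>\<integral>x. f x - g x \<partial>M\<bar>"
    using assms by simp
  also have "\<dots> \<le> (\<integral>x. \<bar>f x - g x\<bar> \<partial>M)"
    by (rule integral_abs_bound)
  also have "\<dots> \<le> (\<integral>x. h x \<partial>M)"
    using assms by (intro integral_mono) auto
  finally show ?thesis .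
qed

text \<open>\<open>1 - v\<close> is the second-order approximation of the mean cosine of one
  increment and \<open>exp v\<close> its compensator; their product misses 1 only by a term
  quadratic in \<open>v\<close>.\<close>

lemma exp_times_one_minus:
  fixes v :: real
  assumes "v \<ge> 0"
  shows "\<bar>exp v * (1 - v) - 1\<bar> \<le> exp v * v\<^sup>2"
proof -
  have "1 - v \<le> exp (- v)" using exp_ge_add_one_self[of "- v"] by simp
  then have "exp v * (1 - v) \<le> exp v * exp (- v)" by (intro mult_left_mono) auto
  then have 1: "exp v * (1 - v) \<le> 1" by (simp flip: exp_add)
  have "exp (- v) \<le> 1 - v + v\<^sup>2"
  proof -
    have "1 \<le> (1 - v + v\<^sup>2) * (1 + v)"
    proof -
      have "(1 - v + v\<^sup>2) * (1 + v) = 1 + v ^ 3" by (simp add: power2_eq_square power3_eq_cube algebra_simps)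
      then show ?thesis using assms by simp
    qed
    also have "\<dots> \<le> (1 - v + v\<^sup>2) * exp v"
    proof (intro mult_left_mono exp_ge_add_one_self)
      have "0 \<le> (v - 1/2)\<^sup>2" by simp
      then show "0 \<le> 1 - v + v\<^sup>2" by (simp add: power2_eq_square algebra_simps)
    qed
    finally show ?thesis by (simp add: exp_minus divide_simps mult.commute)
  qed
  then have "exp v * exp (- v) \<le> exp v * (1 - v + v\<^sup>2)" by (intro mult_left_mono) auto
  then have "1 \<le> exp v * (1 - v) + exp v * v\<^sup>2" by (simp add: algebra_simps flip: exp_add)
  then show ?thesis using 1 by simp
qed

context adapted_noise
begin

text \<open>The exponential moments at 1 and -1 dominate the cube, with \<open>54 = 2 * 27\<close>
  from \<open>cube_le_exp\<close>. The bound is linear in the integral of \<open>Y\<close>, so that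
  remainders can be summed over the rounds.\<close>

lemma third_moment:
  assumes t: "t \<in> {1..T}" and Y: "Y \<in> borel_measurable (F t)"
    and B: "\<And>\<omega>. \<omega> \<in> space M \<Longrightarrow> 0 \<le> Y \<omega> \<and> Y \<omega> \<le> B"
  shows "(\<integral>\<omega>. Y \<omega> * \<bar>e t \<omega>\<bar> ^ 3 \<partial>M) \<le> 54 * exp (\<sigma>\<^sup>2 / 2) * (\<integral>\<omega>. Y \<omega> \<partial>M)"
proof -
  note [measurable] = Y F_M[OF t Y] noise_M[OF t]
  have YF: "(\<lambda>\<omega>. ennreal (Y \<omega>)) \<in> borel_measurable (F t)" by measurable
  have iY: "integrable M Y"
    by (rule integrable_const_bound[of _ B]) (use B in auto)
  have iYe: "integrable M (\<lambda>\<omega>. Y \<omega> * \<bar>e t \<omega>\<bar> ^ 3)"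
  proof (rule Bochner_Integration.integrable_bound)
    show "integrable M (\<lambda>\<omega>. B * \<bar>e t \<omega>\<bar> ^ 3)" using noise_integrable(3)[OF t] by simp
    show "AE \<omega> in M. norm (Y \<omega> * \<bar>e t \<omega>\<bar> ^ 3) \<le> norm (B * \<bar>e t \<omega>\<bar> ^ 3)"
      using B by (intro AE_I2) (force simp: abs_mult intro!: mult_right_mono)
  qed measurable
  have "ennreal (\<integral>\<omega>. Y \<omega> * \<bar>e t \<omega>\<bar> ^ 3 \<partial>M) = (\<integral>\<^sup>+\<omega>. ennreal (Y \<omega> * \<bar>e t \<omega>\<bar> ^ 3) \<partial>M)"
    using iYe B by (intro nn_integral_eq_integral[symmetric] AE_I2) auto
  also have "\<dots> \<le> (\<integral>\<^sup>+\<omega>. 27 * (ennreal (Y \<omega>) * ennreal (exp (1 * e t \<omega>)) + ennreal (Y \<omega>) * ennreal (exp ((-1) * e t \<omega>))) \<partial>M)"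
  proof (intro nn_integral_mono)
    fix \<omega> assume w: "\<omega> \<in> space M"
    have "Y \<omega> * \<bar>e t \<omega>\<bar> ^ 3 \<le> Y \<omega> * (27 * (exp (e t \<omega>) + exp (- e t \<omega>)))"
      using B[OF w] cube_le_exp[of "e t \<omega>"] by (intro mult_left_mono) auto
    then have "ennreal (Y \<omega> * \<bar>e t \<omega>\<bar> ^ 3) \<le> ennreal (27 * (Y \<omega> * exp (1 * e t \<omega>) + Y \<omega> * exp ((-1) * e t \<omega>)))"
      by (intro ennreal_leI) (simp add: algebra_simps)
    also have "\<dots> = 27 * (ennreal (Y \<omega>) * ennreal (exp (1 * e t \<omega>)) + ennreal (Y \<omega>) * ennreal (exp ((-1) * e t \<omega>)))"
      using B[OF w] by (simp add: ennreal_mult ennreal_plus)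
    finally show "ennreal (Y \<omega> * \<bar>e t \<omega>\<bar> ^ 3) \<le> 27 * (ennreal (Y \<omega>) * ennreal (exp (1 * e t \<omega>)) + ennreal (Y \<omega>) * ennreal (exp ((-1) * e t \<omega>)))" .
  qed
  also have "\<dots> = 27 * ((\<integral>\<^sup>+\<omega>. ennreal (Y \<omega>) * ennreal (exp (1 * e t \<omega>)) \<partial>M) + (\<integral>\<^sup>+\<omega>. ennreal (Y \<omega>) * ennreal (exp ((-1) * e t \<omega>)) \<partial>M))"
    by (simp add: nn_integral_cmult nn_integral_add)
  also have "\<dots> \<le> 27 * (ennreal (exp (\<sigma>\<^sup>2 * 1\<^sup>2 / 2)) * (\<integral>\<^sup>+\<omega>. ennreal (Y \<omega>) \<partial>M) + ennreal (exp (\<sigma>\<^sup>2 * (-1)\<^sup>2 / 2)) * (\<integral>\<^sup>+\<omega>. ennreal (Y \<omega>) \<partial>M))"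
    by (intro mult_left_mono add_mono mgf_const[OF t] YF) auto
  also have "(\<integral>\<^sup>+\<omega>. ennreal (Y \<omega>) \<partial>M) = ennreal (\<integral>\<omega>. Y \<omega> \<partial>M)"
    using iY B by (intro nn_integral_eq_integral AE_I2) auto
  also have "27 * (ennreal (exp (\<sigma>\<^sup>2 * 1\<^sup>2 / 2)) * ennreal (\<integral>\<omega>. Y \<omega> \<partial>M) + ennreal (exp (\<sigma>\<^sup>2 * (-1)\<^sup>2 / 2)) * ennreal (\<integral>\<omega>. Y \<omega> \<partial>M))
     = ennreal (54 * exp (\<sigma>\<^sup>2 / 2) * (\<integral>\<omega>. Y \<omega> \<partial>M))"
  proof -
    have n: "0 \<le> (\<integral>\<omega>. Y \<omega> \<partial>M)" using B by (intro Bochner_Integration.integral_nonneg) auto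
    define c where "c = exp (\<sigma>\<^sup>2 / 2) * (\<integral>\<omega>. Y \<omega> \<partial>M)"
    have c: "0 \<le> c" using n by (simp add: c_def)
    have "27 * (ennreal (exp (\<sigma>\<^sup>2 * 1\<^sup>2 / 2)) * ennreal (\<integral>\<omega>. Y \<omega> \<partial>M) + ennreal (exp (\<sigma>\<^sup>2 * (-1)\<^sup>2 / 2)) * ennreal (\<integral>\<omega>. Y \<omega> \<partial>M))
      = ennreal 27 * (ennreal c + ennreal c)"
      using n by (simp add: ennreal_mult c_def)
    also have "ennreal c + ennreal c = ennreal (c + c)" using c c by (rule ennreal_plus[symmetric])
    also have "ennreal 27 * ennreal (c + c) = ennreal (27 * (c + c))" using c by (intro ennreal_mult[symmetric]) auto
    also have "27 * (c + c) = 54 * exp (\<sigma>\<^sup>2 / 2) * (\<integral>\<omega>. Y \<omega> \<partial>M)" by (simp add: c_def)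
    finally show ?thesis .
  qed
  finally show ?thesis
    using B by (subst (asm) ennreal_le_iff) (auto intro!: mult_nonneg_nonneg Bochner_Integration.integral_nonneg)
qed

text \<open>The cosine of the sum, compensated by \<open>W\<close>, is nearly a martingale starting
  at 1. The error of a round is proportional to the mean of the squared coefficient, and these means
  sum to at most \<open>B\<close>; the pointwise bound on the bracket also keeps \<open>W\<close>
  bounded.\<close>

lemma cos_martingale:
  assumes C: "\<And>s t. 1 \<le> s \<Longrightarrow> s \<le> t \<Longrightarrow> t \<le> T \<Longrightarrow> C s \<in> borel_measurable (F t)"
    and b: "\<And>t \<omega>. t \<in> {1..T} \<Longrightarrow> \<omega> \<in> space M \<Longrightarrow> \<bar>C t \<omega>\<bar> \<le> b" "b \<ge> 0"
    and B: "\<And>\<omega>. \<omega> \<in> space M \<Longrightarrow> (\<Sum>s=1..T. (C s \<omega>)\<^sup>2) \<le> B"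
  defines "X \<equiv> \<lambda>k \<omega>. \<Sum>s=1..k. C s \<omega> * e s \<omega>"
    and "W \<equiv> \<lambda>k \<omega>. exp (\<sigma>\<^sup>2 / 2 * (\<Sum>s=1..k. (C s \<omega>)\<^sup>2))"
  shows "\<bar>(\<integral>\<omega>. cos (X T \<omega>) * W T \<omega> \<partial>M) - 1\<bar>
    \<le> exp (\<sigma>\<^sup>2 / 2 * B) * (54 * exp (\<sigma>\<^sup>2 / 2) * b + \<sigma> ^ 4 * b\<^sup>2 / 4) * B"
proof -
  define E0 where "E0 = exp (\<sigma>\<^sup>2 / 2 * B)"
  define \<kappa> where "\<kappa> = 54 * exp (\<sigma>\<^sup>2 / 2)"
  have sumB: "(\<Sum>s=1..k. (C s \<omega>)\<^sup>2) \<le> B" if "\<omega> \<in> space M" "k \<le> T" for k \<omega>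
    using that by (intro order_trans[OF sum_mono2 B[OF that(1)]]) auto
  have W: "0 < W k \<omega>" "\<omega> \<in> space M \<Longrightarrow> k \<le> T \<Longrightarrow> W k \<omega> \<le> E0" for k \<omega>
    using sumB[of \<omega> k] by (auto simp: W_def E0_def intro!: mult_left_mono)
  have CM [measurable]: "C s \<in> borel_measurable M" if "s \<in> {1..T}" for s
    using that C[of s s] by (intro F_M[OF that]) auto
  have WF: "W j \<in> borel_measurable (F k)" if "j \<le> k" "k \<le> T" for j k
  proof -
    have [measurable]: "(\<lambda>\<omega>. \<Sum>s=1..j. (C s \<omega>)\<^sup>2) \<in> borel_measurable (F k)"
      using that by (intro borel_measurable_sum borel_measurable_power C) auto
    show ?thesis unfolding W_def by measurable
  qed
  have XF: "X j \<in> borel_measurable (F k)" if "j < k" "k \<le> T" for j k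
    unfolding X_def using that by (intro borel_measurable_sum borel_measurable_times C noise_F) auto
  have XM [measurable]: "X k \<in> borel_measurable M" if "k \<le> T" for k
    unfolding X_def using that by (intro borel_measurable_sum borel_measurable_times CM noise_M) auto
  have WM [measurable]: "W k \<in> borel_measurable M" if "k \<le> T" for k
  proof -
    have [measurable]: "(\<lambda>\<omega>. \<Sum>s=1..k. (C s \<omega>)\<^sup>2) \<in> borel_measurable M"
      using that by (intro borel_measurable_sum borel_measurable_power CM) auto
    show ?thesis unfolding W_def by measurable
  qed
  have iC2: "integrable M (\<lambda>\<omega>. (C t \<omega>)\<^sup>2)" if "t \<in> {1..T}" for t
    using that b(1)[OF that] b(2) CM[OF that]
    by (intro integrable_const_bound[of _ "b\<^sup>2"] AE_I2) (auto simp: abs_le_square_iff[symmetric] power2_le_iff_abs_le)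
  have step: "\<bar>(\<integral>\<omega>. cos (X (Suc k) \<omega>) * W (Suc k) \<omega> \<partial>M) - (\<integral>\<omega>. cos (X k \<omega>) * W k \<omega> \<partial>M)\<bar>
      \<le> E0 * (\<kappa> * b + \<sigma> ^ 4 * b\<^sup>2 / 4) * (\<integral>\<omega>. (C (Suc k) \<omega>)\<^sup>2 \<partial>M)" if k: "k < T" for k
  proof -
    define t where "t = Suc k"
    have t: "t \<in> {1..T}" "t \<le> T" using k by (auto simp: t_def)
    \<comment> \<open>The weight is \<open>W t\<close>, not \<open>W k\<close>: it contains the
      coefficient of round \<open>t\<close> but no noise, so both functions are measurable for
      \<open>F t\<close>.\<close>
    define Y1 Y2 where "Y1 = (\<lambda>\<omega>. cos (X k \<omega>) * W t \<omega>)" and "Y2 = (\<lambda>\<omega>. sin (X k \<omega>) * W t \<omega>)"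
    note [measurable] = C[of t t] XF[of k t] WF[of t t] noise_M[OF t(1)]
    have CF [measurable]: "C t \<in> borel_measurable (F t)" using t by (intro C) auto
    have Xkt [measurable]: "X k \<in> borel_measurable (F t)" using t by (intro XF) (auto simp: t_def)
    have WFt [measurable]: "W t \<in> borel_measurable (F t)" using t by (intro WF) auto
    have Y1F [measurable]: "Y1 \<in> borel_measurable (F t)" unfolding Y1_def by measurable
    have Y2F [measurable]: "Y2 \<in> borel_measurable (F t)" unfolding Y2_def by measurable
    note mM [measurable] = F_M[OF t(1) Y1F] F_M[OF t(1) Y2F] F_M[OF t(1) CF]
    have Y: "\<bar>Y1 \<omega>\<bar> \<le> E0" "\<bar>Y2 \<omega>\<bar> \<le> E0" if "\<omega> \<in> space M" for \<omega>
    proof -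
      have "\<bar>Y1 \<omega>\<bar> = \<bar>cos (X k \<omega>)\<bar> * W t \<omega>" "\<bar>Y2 \<omega>\<bar> = \<bar>sin (X k \<omega>)\<bar> * W t \<omega>"
        using W(1)[of t \<omega>] by (simp_all add: Y1_def Y2_def abs_mult)
      moreover have "\<bar>cos (X k \<omega>)\<bar> * W t \<omega> \<le> 1 * W t \<omega>" "\<bar>sin (X k \<omega>)\<bar> * W t \<omega> \<le> 1 * W t \<omega>"
        using W(1)[of t \<omega>] by (intro mult_right_mono; simp)+
      ultimately show "\<bar>Y1 \<omega>\<bar> \<le> E0" "\<bar>Y2 \<omega>\<bar> \<le> E0"
        using W(2)[OF that t(2)] by linarith+
    qed
    have cb: "\<bar>C t \<omega>\<bar> \<le> b" if "\<omega> \<in> space M" for \<omega> using b(1)[OF t(1) that] .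
    have c2b: "(C t \<omega>)\<^sup>2 \<le> b\<^sup>2" if "\<omega> \<in> space M" for \<omega>
      using cb[OF that] by (simp add: abs_le_square_iff[symmetric] b(2))
    have E0: "E0 > 0" by (simp add: E0_def)
    have bdd: "integrable M g" if "g \<in> borel_measurable M" "\<And>\<omega>. \<omega> \<in> space M \<Longrightarrow> \<bar>g \<omega>\<bar> \<le> K" for g :: "'w \<Rightarrow> real" and K
      using that by (intro integrable_const_bound[of _ K] AE_I2) auto
    have bmul: "integrable M (\<lambda>\<omega>. Y \<omega> * g \<omega>)"
      if "integrable M g" "Y \<in> borel_measurable M" "\<And>\<omega>. \<omega> \<in> space M \<Longrightarrow> \<bar>Y \<omega>\<bar> \<le> K" for g Y :: "'w \<Rightarrow> real" and K
    proof (rule Bochner_Integration.integrable_bound)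
      show "integrable M (\<lambda>\<omega>. K * g \<omega>)" using that by simp
      show "AE \<omega> in M. norm (Y \<omega> * g \<omega>) \<le> norm (K * g \<omega>)"
        using that(3) by (intro AE_I2) (auto simp: abs_mult intro!: mult_right_mono order_trans[OF that(3)])
      show "(\<lambda>\<omega>. Y \<omega> * g \<omega>) \<in> borel_measurable M" using that by measurable
    qed
    have y1c: "\<bar>Y1 \<omega> * (C t \<omega>)\<^sup>2 / 2\<bar> \<le> E0 * b\<^sup>2" and y2c: "\<bar>Y2 \<omega> * C t \<omega>\<bar> \<le> E0 * b" if w: "\<omega> \<in> space M" for \<omega>
    proof -
      have "\<bar>Y1 \<omega>\<bar> * (C t \<omega>)\<^sup>2 \<le> E0 * b\<^sup>2" using Y(1)[OF w] c2b[OF w] E0 by (intro mult_mono) auto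
      moreover have "0 \<le> E0 * b\<^sup>2" using E0 by simp
      ultimately show "\<bar>Y1 \<omega> * (C t \<omega>)\<^sup>2 / 2\<bar> \<le> E0 * b\<^sup>2" by (simp add: abs_mult)
      show "\<bar>Y2 \<omega> * C t \<omega>\<bar> \<le> E0 * b"
        unfolding abs_mult using Y(2)[OF w] cb[OF w] E0 by (intro mult_mono) auto
    qed
    define f where "f = (\<lambda>\<omega>. cos (X t \<omega>) * W t \<omega>)"
    \<comment> \<open>The second-order Taylor expansion of \<open>f\<close> in the noise of round
      \<open>t\<close>, whose terms \<open>mean_zero\<close> and \<open>variance\<close> evaluate;
      \<open>h\<close> dominates the remainder.\<close>
    define g where "g = (\<lambda>\<omega>. Y1 \<omega> - Y1 \<omega> * (C t \<omega>)\<^sup>2 / 2 * (e t \<omega>)\<^sup>2 - Y2 \<omega> * C t \<omega> * e t \<omega>)"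
    define h where "h = (\<lambda>\<omega>. E0 * b * ((C t \<omega>)\<^sup>2 * \<bar>e t \<omega>\<bar> ^ 3))"
    have fi: "integrable M f" unfolding f_def
    proof (rule bdd)
      show "(\<lambda>\<omega>. cos (X t \<omega>) * W t \<omega>) \<in> borel_measurable M" using XM[OF t(2)] WM[OF t(2)] by measurable
      fix \<omega> assume w: "\<omega> \<in> space M"
      have "\<bar>cos (X t \<omega>)\<bar> * W t \<omega> \<le> 1 * W t \<omega>" using W(1)[of t \<omega>] by (intro mult_right_mono) auto
      then have "\<bar>cos (X t \<omega>)\<bar> * W t \<omega> \<le> E0" using W(2)[OF w t(2)] by linarith
      then show "\<bar>cos (X t \<omega>) * W t \<omega>\<bar> \<le> E0" using W(1)[of t \<omega>] by (simp add: abs_mult)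
    qed
    have i1: "integrable M Y1" by (rule bdd[OF _ Y(1)]) measurable
    have i2: "integrable M (\<lambda>\<omega>. Y1 \<omega> * (C t \<omega>)\<^sup>2 / 2 * (e t \<omega>)\<^sup>2)"
      by (rule bmul[OF noise_integrable(2)[OF t(1)] _ y1c]) measurable
    have i3: "integrable M (\<lambda>\<omega>. Y2 \<omega> * C t \<omega> * e t \<omega>)"
      by (rule bmul[OF noise_integrable(1)[OF t(1)] _ y2c]) measurable
    have gi: "integrable M g" unfolding g_def by (intro Bochner_Integration.integrable_diff i1 i2 i3)
    have i4: "integrable M (\<lambda>\<omega>. (C t \<omega>)\<^sup>2 * \<bar>e t \<omega>\<bar> ^ 3)"
    proof (rule bmul[OF noise_integrable(3)[OF t(1)]])
      show "\<bar>(C t \<omega>)\<^sup>2\<bar> \<le> b\<^sup>2" if "\<omega> \<in> space M" for \<omega> using c2b[OF that] by simp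
    qed measurable
    have hi: "integrable M h" unfolding h_def using i4 by simp
    have "\<bar>(\<integral>\<omega>. f \<omega> \<partial>M) - (\<integral>\<omega>. g \<omega> \<partial>M)\<bar> \<le> (\<integral>\<omega>. h \<omega> \<partial>M)"
    proof (rule abs_integral_diff_le[OF fi gi hi])
      fix \<omega> assume w: "\<omega> \<in> space M"
      define u where "u = C t \<omega> * e t \<omega>"
      have "X t \<omega> = X k \<omega> + u" by (simp add: X_def t_def u_def)
      then have "f \<omega> = Y1 \<omega> * cos u - Y2 \<omega> * sin u"
        by (simp add: f_def Y1_def Y2_def cos_add algebra_simps)
      then have "f \<omega> - g \<omega> = Y1 \<omega> * (cos u - (1 - u\<^sup>2 / 2)) - Y2 \<omega> * (sin u - u)"
        by (simp add: g_def u_def power_mult_distrib algebra_simps)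
      then have "\<bar>f \<omega> - g \<omega>\<bar> \<le> \<bar>Y1 \<omega>\<bar> * \<bar>cos u - (1 - u\<^sup>2 / 2)\<bar> + \<bar>Y2 \<omega>\<bar> * \<bar>sin u - u\<bar>"
        by (simp add: abs_mult[symmetric])
      also have "\<dots> \<le> E0 * (\<bar>u\<bar> ^ 3 / 6) + E0 * (\<bar>u\<bar> ^ 3 / 6)"
        using Y[OF w] cos_sin_taylor[of u] E0 by (intro add_mono mult_mono) auto
      also have "\<dots> \<le> E0 * \<bar>u\<bar> ^ 3" using E0 by (simp add: mult_left_mono)
      also have "\<bar>u\<bar> ^ 3 = \<bar>C t \<omega>\<bar> * ((C t \<omega>)\<^sup>2 * \<bar>e t \<omega>\<bar> ^ 3)"
      proof -
        have "\<bar>C t \<omega>\<bar> ^ 3 = \<bar>C t \<omega>\<bar> * (C t \<omega>)\<^sup>2" by (simp add: power3_eq_cube power2_eq_square)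
        then show ?thesis by (simp add: u_def abs_mult power_mult_distrib mult.assoc)
      qed
      also have "E0 * \<dots> \<le> E0 * (b * ((C t \<omega>)\<^sup>2 * \<bar>e t \<omega>\<bar> ^ 3))"
        using cb[OF w] E0 by (intro mult_left_mono mult_right_mono) auto
      finally show "\<bar>f \<omega> - g \<omega>\<bar> \<le> h \<omega>" by (simp add: h_def mult_ac)
    qed
    also have "(\<integral>\<omega>. h \<omega> \<partial>M) \<le> E0 * b * (\<kappa> * (\<integral>\<omega>. (C t \<omega>)\<^sup>2 \<partial>M))"
    proof -
      have "(\<integral>\<omega>. (C t \<omega>)\<^sup>2 * \<bar>e t \<omega>\<bar> ^ 3 \<partial>M) \<le> \<kappa> * (\<integral>\<omega>. (C t \<omega>)\<^sup>2 \<partial>M)"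
      proof -
        have C2F: "(\<lambda>\<omega>. (C t \<omega>)\<^sup>2) \<in> borel_measurable (F t)" by measurable
        show ?thesis unfolding \<kappa>_def using c2b by (intro third_moment[OF t(1) C2F, of "b\<^sup>2"]) auto
      qed
      then show ?thesis unfolding h_def using E0 b(2) by (simp add: mult_left_mono)
    qed
    finally have fg: "\<bar>(\<integral>\<omega>. f \<omega> \<partial>M) - (\<integral>\<omega>. g \<omega> \<partial>M)\<bar> \<le> E0 * b * (\<kappa> * (\<integral>\<omega>. (C t \<omega>)\<^sup>2 \<partial>M))" .
    have "(\<integral>\<omega>. g \<omega> \<partial>M) = (\<integral>\<omega>. Y1 \<omega> \<partial>M) - (\<integral>\<omega>. Y1 \<omega> * (C t \<omega>)\<^sup>2 / 2 * (e t \<omega>)\<^sup>2 \<partial>M) - (\<integral>\<omega>. Y2 \<omega> * C t \<omega> * e t \<omega> \<partial>M)"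
      unfolding g_def using i1 i2 i3 by simp
    also have "(\<integral>\<omega>. Y2 \<omega> * C t \<omega> * e t \<omega> \<partial>M) = 0"
      by (rule mean_zero[OF t(1) _ y2c]) measurable
    also have "(\<integral>\<omega>. Y1 \<omega> * (C t \<omega>)\<^sup>2 / 2 * (e t \<omega>)\<^sup>2 \<partial>M) = \<sigma>\<^sup>2 * (\<integral>\<omega>. Y1 \<omega> * (C t \<omega>)\<^sup>2 / 2 \<partial>M)"
      by (rule variance[OF t(1) _ y1c]) measurable
    also have "(\<integral>\<omega>. Y1 \<omega> \<partial>M) - \<sigma>\<^sup>2 * (\<integral>\<omega>. Y1 \<omega> * (C t \<omega>)\<^sup>2 / 2 \<partial>M) - 0
        = (\<integral>\<omega>. Y1 \<omega> - \<sigma>\<^sup>2 * (Y1 \<omega> * (C t \<omega>)\<^sup>2 / 2) \<partial>M)"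
    proof -
      have "integrable M (\<lambda>\<omega>. Y1 \<omega> * (C t \<omega>)\<^sup>2 / 2)" by (rule bdd[OF _ y1c]) measurable
      then have "integrable M (\<lambda>\<omega>. \<sigma>\<^sup>2 * (Y1 \<omega> * (C t \<omega>)\<^sup>2 / 2))" by (rule integrable_mult_right)
      then show ?thesis
        using i1 by (subst Bochner_Integration.integral_diff) (simp_all only: integral_mult_right_zero diff_zero)
    qed
    finally have gint: "(\<integral>\<omega>. g \<omega> \<partial>M) = (\<integral>\<omega>. Y1 \<omega> - \<sigma>\<^sup>2 * (Y1 \<omega> * (C t \<omega>)\<^sup>2 / 2) \<partial>M)" .
    have "\<bar>(\<integral>\<omega>. Y1 \<omega> - \<sigma>\<^sup>2 * (Y1 \<omega> * (C t \<omega>)\<^sup>2 / 2) \<partial>M) - (\<integral>\<omega>. cos (X k \<omega>) * W k \<omega> \<partial>M)\<bar>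
      \<le> (\<integral>\<omega>. E0 * (\<sigma> ^ 4 * b\<^sup>2 / 4) * (C t \<omega>)\<^sup>2 \<partial>M)"
    proof (rule abs_integral_diff_le)
      show "integrable M (\<lambda>\<omega>. Y1 \<omega> - \<sigma>\<^sup>2 * (Y1 \<omega> * (C t \<omega>)\<^sup>2 / 2))"
        by (intro Bochner_Integration.integrable_diff integrable_mult_right i1 bdd[OF _ y1c]) measurable
      show "integrable M (\<lambda>\<omega>. cos (X k \<omega>) * W k \<omega>)"
      proof (rule bdd)
        show "(\<lambda>\<omega>. cos (X k \<omega>) * W k \<omega>) \<in> borel_measurable M"
        proof -
          have [measurable]: "X k \<in> borel_measurable M" "W k \<in> borel_measurable M" using k XM WM by auto
          show ?thesis by measurable
        qed
        fix \<omega> assume w: "\<omega> \<in> space M"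
        have "\<bar>cos (X k \<omega>)\<bar> * W k \<omega> \<le> 1 * W k \<omega>" using W(1)[of k \<omega>] by (intro mult_right_mono) auto
        then have "\<bar>cos (X k \<omega>)\<bar> * W k \<omega> \<le> E0" using W(2)[OF w, of k] k by linarith
        then show "\<bar>cos (X k \<omega>) * W k \<omega>\<bar> \<le> E0" using W(1)[of k \<omega>] by (simp add: abs_mult)
      qed
      show "integrable M (\<lambda>\<omega>. E0 * (\<sigma> ^ 4 * b\<^sup>2 / 4) * (C t \<omega>)\<^sup>2)" using iC2[OF t(1)] by simp
      fix \<omega> assume w: "\<omega> \<in> space M"
      define v where "v = \<sigma>\<^sup>2 * (C t \<omega>)\<^sup>2 / 2"
      have v: "v \<ge> 0" by (simp add: v_def)
      have Wt: "W t \<omega> = W k \<omega> * exp v"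
        by (simp add: W_def t_def v_def exp_add[symmetric] algebra_simps)
      have "Y1 \<omega> - \<sigma>\<^sup>2 * (Y1 \<omega> * (C t \<omega>)\<^sup>2 / 2) - cos (X k \<omega>) * W k \<omega> = cos (X k \<omega>) * W k \<omega> * (exp v * (1 - v) - 1)"
        by (simp add: Y1_def Wt v_def algebra_simps)
      then have "\<bar>Y1 \<omega> - \<sigma>\<^sup>2 * (Y1 \<omega> * (C t \<omega>)\<^sup>2 / 2) - cos (X k \<omega>) * W k \<omega>\<bar> = \<bar>cos (X k \<omega>)\<bar> * (W k \<omega> * \<bar>exp v * (1 - v) - 1\<bar>)"
        using W(1)[of k \<omega>] by (simp add: abs_mult)
      also have "\<dots> \<le> 1 * (W k \<omega> * (exp v * v\<^sup>2))"
        using W(1)[of k \<omega>] exp_times_one_minus[OF v] by (intro mult_mono) auto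
      also have "\<dots> = W t \<omega> * v\<^sup>2" by (simp add: Wt)
      also have "\<dots> \<le> E0 * v\<^sup>2" using W(2)[OF w t(2)] by (intro mult_right_mono) auto
      also have "v\<^sup>2 = (\<sigma> ^ 4 / 4) * ((C t \<omega>)\<^sup>2 * (C t \<omega>)\<^sup>2)" by (simp add: v_def power2_eq_square eval_nat_numeral)
      also have "E0 * \<dots> \<le> E0 * ((\<sigma> ^ 4 / 4) * (b\<^sup>2 * (C t \<omega>)\<^sup>2))"
        using c2b[OF w] E0 by (intro mult_left_mono mult_right_mono) auto
      finally show "\<bar>Y1 \<omega> - \<sigma>\<^sup>2 * (Y1 \<omega> * (C t \<omega>)\<^sup>2 / 2) - cos (X k \<omega>) * W k \<omega>\<bar> \<le> E0 * (\<sigma> ^ 4 * b\<^sup>2 / 4) * (C t \<omega>)\<^sup>2"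
        by (simp add: mult_ac)
    qed
    then have "\<bar>(\<integral>\<omega>. g \<omega> \<partial>M) - (\<integral>\<omega>. cos (X k \<omega>) * W k \<omega> \<partial>M)\<bar> \<le> E0 * (\<sigma> ^ 4 * b\<^sup>2 / 4) * (\<integral>\<omega>. (C t \<omega>)\<^sup>2 \<partial>M)"
      unfolding gint by simp
    then have "\<bar>(\<integral>\<omega>. f \<omega> \<partial>M) - (\<integral>\<omega>. cos (X k \<omega>) * W k \<omega> \<partial>M)\<bar>
      \<le> E0 * b * (\<kappa> * (\<integral>\<omega>. (C t \<omega>)\<^sup>2 \<partial>M)) + E0 * (\<sigma> ^ 4 * b\<^sup>2 / 4) * (\<integral>\<omega>. (C t \<omega>)\<^sup>2 \<partial>M)"
      using fg by linarith
    then show ?thesis by (simp add: f_def t_def algebra_simps)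
  qed
  have "\<bar>(\<integral>\<omega>. cos (X k \<omega>) * W k \<omega> \<partial>M) - 1\<bar> \<le> E0 * (\<kappa> * b + \<sigma> ^ 4 * b\<^sup>2 / 4) * (\<Sum>s=1..k. \<integral>\<omega>. (C s \<omega>)\<^sup>2 \<partial>M)"
    if "k \<le> T" for k
    using that
  proof (induction k)
    case 0
    then show ?case by (simp add: X_def W_def prob_space)
  next
    case (Suc k)
    then show ?case using step[of k] by (simp add: distrib_left)
  qed
  from this[OF order_refl]
  have "\<bar>(\<integral>\<omega>. cos (X T \<omega>) * W T \<omega> \<partial>M) - 1\<bar> \<le> E0 * (\<kappa> * b + \<sigma> ^ 4 * b\<^sup>2 / 4) * (\<Sum>s=1..T. \<integral>\<omega>. (C s \<omega>)\<^sup>2 \<partial>M)" .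
  also have "(\<Sum>s=1..T. \<integral>\<omega>. (C s \<omega>)\<^sup>2 \<partial>M) = (\<integral>\<omega>. (\<Sum>s=1..T. (C s \<omega>)\<^sup>2) \<partial>M)"
    using iC2 by (intro Bochner_Integration.integral_sum[symmetric]) auto
  also have "\<dots> \<le> (\<integral>\<omega>. B \<partial>M)"
    using iC2 B by (intro integral_mono Bochner_Integration.integrable_sum) auto
  also have "\<dots> = B" by (simp add: prob_space)
  finally show ?thesis using b(2) by (simp add: E0_def \<kappa>_def mult_left_mono)
qed

text \<open>The bracket is near \<open>v\<close> only with high probability, while
  \<open>cos_martingale\<close> wants a pointwise bound. So the coefficients are cut off; outside
  the exceptional event \<open>H\<close> nothing is cut, and the compensator is within \<eta> of its
  limit in the exponent.\<close>

lemma directional_clt_bound: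
  fixes x :: "real^'n" and l v \<eta> :: real
  assumes l: "l > 0" and v: "v \<ge> 0" and \<eta>: "0 < \<eta>" "\<eta> \<le> 1"
  defines "G \<equiv> \<lambda>\<omega>. (\<Sum>s=1..T. (x \<bullet> a s \<omega>)\<^sup>2) / l" and "b \<equiv> norm x / sqrt l"
  shows "\<bar>(\<integral>\<omega>. cos ((x \<bullet> S T \<omega>) / sqrt l) \<partial>M) - exp (- (\<sigma>\<^sup>2 / 2 * v))\<bar>
    \<le> exp (\<sigma>\<^sup>2 / 2 * (v + 1)) * (54 * exp (\<sigma>\<^sup>2 / 2) * b + \<sigma> ^ 4 * b\<^sup>2 / 4) * (v + 1)
      + (exp (\<sigma>\<^sup>2 / 2 * \<eta>) - 1) + (3 + exp (\<sigma>\<^sup>2 / 2)) * measure M {\<omega> \<in> space M. \<bar>G \<omega> - v\<bar> > \<eta>}"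
proof -
  define g where "g = (\<lambda>t \<omega>. (\<Sum>s=1..t. (x \<bullet> a s \<omega>)\<^sup>2) / l)"
  \<comment> \<open>The partial bracket \<open>g t\<close> is increasing in \<open>t\<close> and
    involves actions up to round \<open>t\<close> only: the cut-off is predictable, permanent, and
    keeps the bracket below \<open>v + 1\<close> on every path.\<close>
  define C where "C = (\<lambda>t \<omega>. if g t \<omega> \<le> v + 1 then (x \<bullet> a t \<omega>) / sqrt l else 0)"
  define X where "X = (\<lambda>\<omega>. \<Sum>s=1..T. C s \<omega> * e s \<omega>)"
  define U where "U = (\<lambda>\<omega>. \<Sum>s=1..T. (C s \<omega>)\<^sup>2)"
  define W where "W = (\<lambda>\<omega>. exp (\<sigma>\<^sup>2 / 2 * U \<omega>))"
  define H where "H = {\<omega> \<in> space M. \<bar>G \<omega> - v\<bar> > \<eta>}"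
  have gF: "g s \<in> borel_measurable (F t)" if "s \<le> t" "t \<le> T" for s t
    unfolding g_def using that
    by (intro borel_measurable_divide borel_measurable_const borel_measurable_sum borel_measurable_power borel_measurable_inner action_F) auto
  have CF: "C s \<in> borel_measurable (F t)" if "1 \<le> s" "s \<le> t" "t \<le> T" for s t
  proof -
    note [measurable] = gF[of s t, OF that(2,3)] action_F[OF that]
    show ?thesis unfolding C_def by measurable
  qed
  have CM: "C s \<in> borel_measurable M" if "s \<in> {1..T}" for s
    using that CF[of s s] by (intro F_M[OF that]) auto
  have GM [measurable]: "G \<in> borel_measurable M"
    unfolding G_def by (intro borel_measurable_divide borel_measurable_const borel_measurable_sum
        borel_measurable_power borel_measurable_inner action_M) auto
  have XM [measurable]: "X \<in> borel_measurable M"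
    unfolding X_def by (intro borel_measurable_sum borel_measurable_times CM noise_M) auto
  have UM [measurable]: "U \<in> borel_measurable M"
    unfolding U_def by (intro borel_measurable_sum borel_measurable_power CM) auto
  have WM [measurable]: "W \<in> borel_measurable M" unfolding W_def by measurable
  have SM [measurable]: "S T \<in> borel_measurable M" by (rule measurable_S_M) simp
  have HM [measurable]: "H \<in> sets M" unfolding H_def by measurable
  have Csq: "(C t \<omega>)\<^sup>2 \<le> (x \<bullet> a t \<omega>)\<^sup>2 / l" for t \<omega>
    using l by (simp add: C_def power_divide)
  have Ub: "(\<Sum>s=1..k. (C s \<omega>)\<^sup>2) \<le> v + 1" for k \<omega>
  proof (induction k)
    case (Suc k)
    show ?case
    proof (cases "g (Suc k) \<omega> \<le> v + 1")
      case True
      have "(\<Sum>s=1..Suc k. (C s \<omega>)\<^sup>2) \<le> (\<Sum>s=1..Suc k. (x \<bullet> a s \<omega>)\<^sup>2 / l)" by (intro sum_mono Csq)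
      also have "\<dots> = g (Suc k) \<omega>" by (simp add: g_def sum_divide_distrib)
      finally show ?thesis using True by linarith
    next
      case False
      then show ?thesis using Suc by (simp add: C_def)
    qed
  qed (use v in simp)
  have U: "0 \<le> U \<omega>" "U \<omega> \<le> v + 1" for \<omega> using Ub[of \<omega> T] by (auto simp: U_def sum_nonneg)
  have good: "X \<omega> = (x \<bullet> S T \<omega>) / sqrt l \<and> U \<omega> = G \<omega>" if w: "\<omega> \<in> space M" "\<omega> \<notin> H" for \<omega>
  proof -
    have "G \<omega> \<le> v + 1" using w \<eta> by (auto simp: H_def)
    then have "g s \<omega> \<le> v + 1" if "s \<le> T" for s
    proof -
      have "g s \<omega> \<le> G \<omega>"
        unfolding g_def G_def using that l by (intro divide_right_mono sum_mono2) auto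
      then show ?thesis using \<open>G \<omega> \<le> v + 1\<close> by linarith
    qed
    then have C: "C s \<omega> = (x \<bullet> a s \<omega>) / sqrt l" if "s \<in> {1..T}" for s
      using that by (simp add: C_def)
    have "X \<omega> = (\<Sum>s=1..T. (x \<bullet> a s \<omega>) / sqrt l * e s \<omega>)" unfolding X_def by (intro sum.cong) (auto simp: C)
    also have "\<dots> = (x \<bullet> S T \<omega>) / sqrt l"
      by (simp add: S_def noise_sum_def inner_sum_right sum_divide_distrib mult.commute)
    finally have 1: "X \<omega> = (x \<bullet> S T \<omega>) / sqrt l" .
    have "U \<omega> = (\<Sum>s=1..T. (x \<bullet> a s \<omega>)\<^sup>2 / l)" unfolding U_def using l by (intro sum.cong) (auto simp: C power_divide)
    also have "\<dots> = G \<omega>" by (simp add: G_def sum_divide_distrib)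
    finally show ?thesis using 1 by simp
  qed
  have bdd: "integrable M f" if "f \<in> borel_measurable M" "\<And>\<omega>. \<bar>f \<omega>\<bar> \<le> K" for f :: "'w \<Rightarrow> real" and K
    using that by (intro integrable_const_bound[of _ K] AE_I2) auto
  define A B where "A = (\<integral>\<omega>. cos ((x \<bullet> S T \<omega>) / sqrt l) \<partial>M)" and "B = (\<integral>\<omega>. cos (X \<omega>) \<partial>M)"
  define D where "D = (\<integral>\<omega>. cos (X \<omega>) * W \<omega> \<partial>M)"
  define q where "q = exp (- (\<sigma>\<^sup>2 / 2 * v))"
  have q: "0 < q" "q \<le> 1" using v by (auto simp: q_def)
  have cos_i: "integrable M (\<lambda>\<omega>. cos (X \<omega>))" by (rule bdd[of _ 1]) auto
  have Wle: "W \<omega> \<le> exp (\<sigma>\<^sup>2 / 2 * (v + 1))" "0 < W \<omega>" for \<omega>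
    using U[of \<omega>] by (auto simp: W_def intro!: mult_left_mono)
  have D_i: "integrable M (\<lambda>\<omega>. cos (X \<omega>) * W \<omega>)"
  proof (rule bdd)
    fix \<omega>
    have "\<bar>cos (X \<omega>)\<bar> * W \<omega> \<le> 1 * W \<omega>" using Wle(2)[of \<omega>] by (intro mult_right_mono) auto
    then have "\<bar>cos (X \<omega>)\<bar> * W \<omega> \<le> exp (\<sigma>\<^sup>2 / 2 * (v + 1))" using Wle[of \<omega>] by linarith
    then show "\<bar>cos (X \<omega>) * W \<omega>\<bar> \<le> exp (\<sigma>\<^sup>2 / 2 * (v + 1))" using Wle[of \<omega>] by (simp add: abs_mult)
  qed measurable
  have intH: "(\<integral>\<omega>. c * indicat_real H \<omega> \<partial>M) = c * measure M H" for c by simp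
  have iH: "integrable M (\<lambda>\<omega>. c * indicat_real H \<omega>)" for c
    by (rule bdd[of _ "\<bar>c\<bar>"]) (auto simp: indicator_def)
  have AB: "\<bar>A - B\<bar> \<le> 2 * measure M H"
    unfolding A_def B_def intH[symmetric]
  proof (rule abs_integral_diff_le[OF _ cos_i iH])
    show "integrable M (\<lambda>\<omega>. cos ((x \<bullet> S T \<omega>) / sqrt l))" by (rule bdd[of _ 1]) auto
    fix \<omega> assume w: "\<omega> \<in> space M"
    have "\<bar>cos ((x \<bullet> S T \<omega>) / sqrt l) - cos (X \<omega>)\<bar> \<le> 2"
      using abs_triangle_ineq4[of "cos ((x \<bullet> S T \<omega>) / sqrt l)" "cos (X \<omega>)"]
        abs_cos_le_one[of "(x \<bullet> S T \<omega>) / sqrt l"] abs_cos_le_one[of "X \<omega>"] by linarith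
    then show "\<bar>cos ((x \<bullet> S T \<omega>) / sqrt l) - cos (X \<omega>)\<bar> \<le> 2 * indicat_real H \<omega>"
      using good[of \<omega>] w by (cases "\<omega> \<in> H") auto
  qed
  \<comment> \<open>\<open>q W\<close> is \<open>exp z\<close> with \<open>z\<close> half of
    \<sigma>^2 times the deviation of the truncated bracket from \<open>v\<close>. Off
    \<open>H\<close> it is small; on \<open>H\<close> the truncation still gives
    \<open>z \<le> \<sigma>^2 / 2\<close>.\<close>
  have BD: "\<bar>B - q * D\<bar> \<le> (exp (\<sigma>\<^sup>2 / 2 * \<eta>) - 1) + (1 + exp (\<sigma>\<^sup>2 / 2)) * measure M H"
  proof -
    have "\<bar>B - (\<integral>\<omega>. q * (cos (X \<omega>) * W \<omega>) \<partial>M)\<bar> \<le> (\<integral>\<omega>. (exp (\<sigma>\<^sup>2 / 2 * \<eta>) - 1) + (1 + exp (\<sigma>\<^sup>2 / 2)) * indicat_real H \<omega> \<partial>M)"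
      unfolding B_def
    proof (rule abs_integral_diff_le[OF cos_i])
      show "integrable M (\<lambda>\<omega>. q * (cos (X \<omega>) * W \<omega>))" using D_i by simp
      show "integrable M (\<lambda>\<omega>. (exp (\<sigma>\<^sup>2 / 2 * \<eta>) - 1) + (1 + exp (\<sigma>\<^sup>2 / 2)) * indicat_real H \<omega>)"
        using iH by simp
      fix \<omega> assume w: "\<omega> \<in> space M"
      define z where "z = \<sigma>\<^sup>2 / 2 * (U \<omega> - v)"
      have "q * W \<omega> = exp z" by (simp add: q_def W_def z_def exp_add[symmetric] algebra_simps)
      then have "cos (X \<omega>) - q * (cos (X \<omega>) * W \<omega>) = cos (X \<omega>) * (1 - exp z)" by (simp add: algebra_simps)
      then have "\<bar>cos (X \<omega>) - q * (cos (X \<omega>) * W \<omega>)\<bar> = \<bar>cos (X \<omega>)\<bar> * \<bar>1 - exp z\<bar>" by (simp add: abs_mult)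
      also have "\<dots> \<le> 1 * \<bar>1 - exp z\<bar>" by (intro mult_right_mono) auto
      also have "1 * \<bar>1 - exp z\<bar> \<le> (exp (\<sigma>\<^sup>2 / 2 * \<eta>) - 1) + (1 + exp (\<sigma>\<^sup>2 / 2)) * indicat_real H \<omega>"
      proof (cases "\<omega> \<in> H")
        case True
        have "z \<le> \<sigma>\<^sup>2 / 2 * 1" unfolding z_def using U[of \<omega>] by (intro mult_left_mono) auto
        then have "exp z \<le> exp (\<sigma>\<^sup>2 / 2)" by simp
        then have "\<bar>1 - exp z\<bar> \<le> 1 + exp (\<sigma>\<^sup>2 / 2)" using exp_gt_zero[of z] by linarith
        moreover have "1 \<le> exp (\<sigma>\<^sup>2 / 2 * \<eta>)" using \<eta> by simp
        moreover have "indicat_real H \<omega> = 1" using True by simp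
        moreover have "\<lbrakk>p \<le> 1 + q; 1 \<le> r; i = 1\<rbrakk> \<Longrightarrow> 1 * p \<le> (r - 1) + (1 + q) * i" for p q r i :: real by simp
        ultimately show ?thesis by blast
      next
        case False
        then have "\<bar>U \<omega> - v\<bar> \<le> \<eta>" using good[OF w False] w by (auto simp: H_def)
        then have "\<bar>z\<bar> \<le> \<sigma>\<^sup>2 / 2 * \<eta>" unfolding z_def abs_mult by (intro mult_mono) auto
        then have 1: "exp z \<le> exp (\<sigma>\<^sup>2 / 2 * \<eta>)" "exp (- (\<sigma>\<^sup>2 / 2 * \<eta>)) \<le> exp z" by auto
        have "2 \<le> exp (\<sigma>\<^sup>2 / 2 * \<eta>) + exp (- (\<sigma>\<^sup>2 / 2 * \<eta>))"
          using exp_ge_add_one_self[of "\<sigma>\<^sup>2 / 2 * \<eta>"] exp_ge_add_one_self[of "- (\<sigma>\<^sup>2 / 2 * \<eta>)"] by linarith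
        then have "\<bar>1 - exp z\<bar> \<le> exp (\<sigma>\<^sup>2 / 2 * \<eta>) - 1" using 1 by linarith
        then show ?thesis using False by simp
      qed
      finally show "\<bar>cos (X \<omega>) - q * (cos (X \<omega>) * W \<omega>)\<bar> \<le> (exp (\<sigma>\<^sup>2 / 2 * \<eta>) - 1) + (1 + exp (\<sigma>\<^sup>2 / 2)) * indicat_real H \<omega>" .
    qed
    moreover have "(\<integral>\<omega>. (exp (\<sigma>\<^sup>2 / 2 * \<eta>) - 1) + (1 + exp (\<sigma>\<^sup>2 / 2)) * indicat_real H \<omega> \<partial>M)
        = (exp (\<sigma>\<^sup>2 / 2 * \<eta>) - 1) + (1 + exp (\<sigma>\<^sup>2 / 2)) * measure M H"
      using iH by (subst Bochner_Integration.integral_add) (auto simp: prob_space)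
    ultimately show ?thesis by (simp add: D_def)
  qed
  have D1: "\<bar>D - 1\<bar> \<le> exp (\<sigma>\<^sup>2 / 2 * (v + 1)) * (54 * exp (\<sigma>\<^sup>2 / 2) * b + \<sigma> ^ 4 * b\<^sup>2 / 4) * (v + 1)"
    unfolding D_def X_def W_def U_def
  proof (rule cos_martingale[OF CF])
    fix t \<omega> assume t: "t \<in> {1..T}" and w: "\<omega> \<in> space M"
    have "\<bar>x \<bullet> a t \<omega>\<bar> \<le> norm x" using Cauchy_Schwarz_ineq2[of x "a t \<omega>"] action_norm[OF t w] by simp
    then show "\<bar>C t \<omega>\<bar> \<le> b" using l by (simp add: C_def b_def abs_divide divide_right_mono)
  qed (use Ub l in \<open>auto simp: b_def\<close>)
  have "\<bar>q * D - q\<bar> \<le> 1 * \<bar>D - 1\<bar>"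
  proof -
    have "q * D - q = q * (D - 1)" by (simp add: algebra_simps)
    then have "\<bar>q * D - q\<bar> = q * \<bar>D - 1\<bar>" using q by (simp add: abs_mult)
    then show ?thesis using q by (simp add: mult_left_le_one_le)
  qed
  then have "\<bar>A - q\<bar> \<le> exp (\<sigma>\<^sup>2 / 2 * (v + 1)) * (54 * exp (\<sigma>\<^sup>2 / 2) * b + \<sigma> ^ 4 * b\<^sup>2 / 4) * (v + 1)
    + ((exp (\<sigma>\<^sup>2 / 2 * \<eta>) - 1) + (1 + exp (\<sigma>\<^sup>2 / 2)) * measure M H) + 2 * measure M H"
  proof -
    have "\<lbrakk>\<bar>q * D - q\<bar> \<le> 1 * d; \<bar>A - B\<bar> \<le> z; \<bar>B - q * D\<bar> \<le> y; d \<le> x\<rbrakk> \<Longrightarrow> \<bar>A - q\<bar> \<le> x + y + z"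
      for d x y z :: real by linarith
    then show ?thesis using \<open>\<bar>q * D - q\<bar> \<le> 1 * \<bar>D - 1\<bar>\<close> AB BD D1 by blast
  qed
  then show ?thesis by (simp add: A_def q_def H_def algebra_simps)
qed

end

section \<open>Convergence to the chi-square law\<close>

definition gauss :: "nat \<Rightarrow> (nat \<Rightarrow> real) measure" where
  "gauss k = (\<Pi>\<^sub>M i\<in>{..<k}. std_normal_distribution)"

lemma prob_space_gauss: "prob_space (gauss k)"
  unfolding gauss_def by (intro prob_space_PiM prob_space_normal_density) simp

lemma measurable_gauss_component [measurable]:
  "i \<in> {..<k} \<Longrightarrow> (\<lambda>z. z i) \<in> borel_measurable (gauss k)"
  unfolding gauss_def by measurable

lemma chi_square_eq: "chi_square k = distr (gauss k) borel (\<lambda>z. \<Sum>i<k. (z i)\<^sup>2)"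
  by (simp add: chi_square_def gauss_def)

text \<open>The real part of a product of one-dimensional characteristic functions.\<close>

lemma gauss_cos_integral:
  "(\<integral>z. cos (\<Sum>i<k. z i * c i) \<partial>gauss k) = exp (- (\<Sum>i<k. (c i)\<^sup>2) / 2)"
proof -
  interpret N: prob_space std_normal_distribution by (rule prob_space_normal_density) simp
  interpret P: product_sigma_finite "\<lambda>_ :: nat. std_normal_distribution" by unfold_locales
  interpret G: prob_space "gauss k" by (rule prob_space_gauss)
  have int: "integrable std_normal_distribution (\<lambda>x. iexp (c i * x))" for i
    by (rule N.integrable_const_bound[of _ 1]) (auto simp: norm_exp_i_times)
  have "(\<integral>z. (\<Prod>i<k. iexp (c i * z i)) \<partial>gauss k) = (\<Prod>i<k. char std_normal_distribution (c i))"
    unfolding gauss_def char_def by (rule P.product_integral_prod[OF finite_lessThan int])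
  also have "\<dots> = (\<Prod>i<k. complex_of_real (exp (- ((c i)\<^sup>2) / 2)))"
    by (simp add: char_std_normal_distribution)
  also have "\<dots> = complex_of_real (exp (- (\<Sum>i<k. (c i)\<^sup>2) / 2))"
    by (simp add: exp_sum[symmetric] sum_negf sum_divide_distrib flip: of_real_prod)
  finally have eq: "(\<integral>z. iexp (\<Sum>i<k. z i * c i) \<partial>gauss k) = complex_of_real (exp (- (\<Sum>i<k. (c i)\<^sup>2) / 2))"
    by (simp add: exp_sum[symmetric] sum_distrib_left mult_ac)
  have "integrable (gauss k) (\<lambda>z. iexp (\<Sum>i<k. z i * c i))"
    by (rule G.integrable_const_bound[of _ 1]) (auto simp: norm_exp_i_times)
  from integral_Re[OF this] show ?thesis unfolding eq by (simp add: Re_exp)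
qed

text \<open>The Gaussian density is its own characteristic function up to scaling:
  \<open>exp (- |y|^2 / 2)\<close> is the mean of \<open>cos (z . y)\<close> over a standard normal
  \<open>z\<close>. Fubini exchanges the two means.\<close>

lemma laplace_eq_gauss_cos:
  fixes y :: "nat \<Rightarrow> 'a \<Rightarrow> real"
  assumes "prob_space M" and [measurable]: "\<And>i. i < k \<Longrightarrow> y i \<in> borel_measurable M"
  shows "(\<integral>\<omega>. exp (- (\<Sum>i<k. (y i \<omega>)\<^sup>2) / 2) \<partial>M) = (\<integral>z. (\<integral>\<omega>. cos (\<Sum>i<k. z i * y i \<omega>) \<partial>M) \<partial>gauss k)"
proof -
  interpret M: prob_space M by fact
  interpret G: prob_space "gauss k" by (rule prob_space_gauss)
  interpret MG: pair_prob_space M "gauss k" ..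
  have [measurable]: "(\<lambda>p. \<Sum>i<k. snd p i * y i (fst p)) \<in> borel_measurable (M \<Otimes>\<^sub>M gauss k)"
    by (intro borel_measurable_sum borel_measurable_times measurable_compose[OF measurable_snd measurable_gauss_component]
        measurable_compose[OF measurable_fst assms(2)]) auto
  have i: "integrable (M \<Otimes>\<^sub>M gauss k) (\<lambda>p. cos (\<Sum>i<k. snd p i * y i (fst p)))"
    by (rule MG.integrable_const_bound[of _ 1]) auto
  have "(\<integral>\<omega>. exp (- (\<Sum>i<k. (y i \<omega>)\<^sup>2) / 2) \<partial>M) = (\<integral>\<omega>. (\<integral>z. cos (\<Sum>i<k. z i * y i \<omega>) \<partial>gauss k) \<partial>M)"
    by (simp add: gauss_cos_integral)
  also have "\<dots> = (\<integral>z. (\<integral>\<omega>. cos (\<Sum>i<k. z i * y i \<omega>) \<partial>M) \<partial>gauss k)"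
    by (rule MG.Fubini_integral[symmetric]) (use i in \<open>simp add: case_prod_unfold\<close>)
  finally show ?thesis .
qed

text \<open>One coordinate is integrated first: given the others, at most two of its values lie on
  the sphere. This yields the continuity of the chi-square distribution function.\<close>

lemma gauss_sphere_null:
  assumes "k \<ge> 1"
  shows "emeasure (gauss k) {z \<in> space (gauss k). (\<Sum>i<k. (z i)\<^sup>2) = c} = 0"
proof -
  interpret N: prob_space std_normal_distribution by (rule prob_space_normal_density) simp
  interpret P: product_sigma_finite "\<lambda>_ :: nat. std_normal_distribution" by unfold_locales
  obtain m where k: "k = Suc m" using assms by (cases k) auto
  let ?A = "{z \<in> space (gauss k). (\<Sum>i<k. (z i)\<^sup>2) = c}"
  have ins: "{..<k} = insert m {..<m}" by (auto simp: k)
  have A [measurable]: "?A \<in> sets (gauss k)" by measurable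
  have "emeasure (gauss k) ?A = (\<integral>\<^sup>+z. indicator ?A z \<partial>gauss k)" by simp
  also have "\<dots> = (\<integral>\<^sup>+z. (\<integral>\<^sup>+x. indicator ?A (z(m := x)) \<partial>std_normal_distribution) \<partial>gauss m)"
    unfolding gauss_def ins
    by (rule P.product_nn_integral_insert) (use A in \<open>auto simp: gauss_def ins\<close>)
  also have "\<dots> = (\<integral>\<^sup>+z. 0 \<partial>gauss m)"
  proof (intro nn_integral_cong)
    fix z assume "z \<in> space (gauss m)"
    define B where "B = {x :: real. x\<^sup>2 = c - (\<Sum>i<m. (z i)\<^sup>2)}"
    have "B \<subseteq> {sqrt (c - (\<Sum>i<m. (z i)\<^sup>2)), - sqrt (c - (\<Sum>i<m. (z i)\<^sup>2))}"
    proof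
      fix x assume "x \<in> B"
      then have "sqrt (c - (\<Sum>i<m. (z i)\<^sup>2)) = \<bar>x\<bar>" by (simp add: B_def flip: real_sqrt_abs)
      then show "x \<in> {sqrt (c - (\<Sum>i<m. (z i)\<^sup>2)), - sqrt (c - (\<Sum>i<m. (z i)\<^sup>2))}" by auto
    qed
    then have "finite B" by (rule finite_subset) simp
    then have B: "B \<in> null_sets lborel" by (rule finite_imp_null_set_lborel)
    then have [measurable]: "B \<in> sets borel" by auto
    have "(\<integral>\<^sup>+x. indicator ?A (z(m := x)) \<partial>std_normal_distribution) \<le> (\<integral>\<^sup>+x. indicator B x \<partial>std_normal_distribution)"
      by (intro nn_integral_mono) (auto simp: indicator_def B_def k)
    also have "\<dots> = emeasure std_normal_distribution B" by simp
    also have "\<dots> = (\<integral>\<^sup>+x\<in>B. ennreal (std_normal_density x) \<partial>lborel)"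
      by (subst emeasure_density) auto
    also have "\<dots> = 0" using B by (intro nn_integral_null_set)
    finally show "(\<integral>\<^sup>+x. indicator ?A (z(m := x)) \<partial>std_normal_distribution) = 0" by simp
  qed
  finally show ?thesis by simp
qed

section \<open>The chi-square distribution function and its quantiles\<close>

lemma real_distribution_chi_square: "real_distribution (chi_square k)"
proof -
  interpret G: prob_space "gauss k" by (rule prob_space_gauss)
  show ?thesis unfolding chi_square_eq by (intro G.real_distribution_distr) measurable
qed

lemma cdf_chi_square:
  "cdf (chi_square k) x = measure (gauss k) {z \<in> space (gauss k). (\<Sum>i<k. (z i)\<^sup>2) \<le> x}"
  unfolding cdf_def chi_square_eq
  by (subst measure_distr) (auto intro!: arg_cong[where f = "measure (gauss k)"])

lemma isCont_cdf_chi_square: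
  assumes "k \<ge> 1" shows "isCont (cdf (chi_square k)) x"
proof -
  interpret R: real_distribution "chi_square k" by (rule real_distribution_chi_square)
  have "measure (chi_square k) {x} = measure (gauss k) {z \<in> space (gauss k). (\<Sum>i<k. (z i)\<^sup>2) = x}"
    unfolding chi_square_eq by (subst measure_distr) (auto intro!: arg_cong[where f = "measure (gauss k)"])
  then show ?thesis using gauss_sphere_null[OF assms, of x] by (simp add: R.isCont_cdf measure_def)
qed

text \<open>By continuity the infimum hits the level exactly: closedness of the set gives one
  inequality, left continuity the other. Nonnegativity holds because there is no mass below
  0.\<close>

lemma cdf_quantile_chi_square:
  assumes k: "k \<ge> 1" and p: "0 < p" "p < 1"
  shows "cdf (chi_square k) (quantile (chi_square k) p) = p" "quantile (chi_square k) p \<ge> 0"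
proof -
  interpret R: real_distribution "chi_square k" by (rule real_distribution_chi_square)
  define S where "S = {x. p \<le> cdf (chi_square k) x}"
  define q where "q = quantile (chi_square k) p"
  have q: "q = Inf S" by (simp add: q_def S_def quantile_def)
  have neg: "cdf (chi_square k) x = 0" if "x < 0" for x
  proof -
    have "x < (\<Sum>i<k. (z i)\<^sup>2)" for z using that by (rule order_less_le_trans) (simp add: sum_nonneg)
    then have "{z \<in> space (gauss k). (\<Sum>i<k. (z i)\<^sup>2) \<le> x} = {}" by (simp add: not_le)
    then show ?thesis by (simp only: cdf_chi_square measure_empty)
  qed
  have lb: "x \<ge> 0" if "x \<in> S" for x
    using that neg[of x] p by (force simp: S_def)
  have "eventually (\<lambda>x. p < cdf (chi_square k) x) at_top"
    using R.cdf_lim_at_top_prob p(2) by (rule order_tendstoD)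
  then obtain x0 where "p < cdf (chi_square k) x0"
    using eventually_happens[of _ "at_top :: real filter"] by auto
  then have ne: "S \<noteq> {}" by (auto simp: S_def intro: less_imp_le)
  have bb: "bdd_below S" by (rule bdd_belowI[of _ 0]) (rule lb)
  have q0: "q \<ge> 0" unfolding q using ne lb by (intro cInf_greatest)
  have cl: "closed S"
  proof -
    have "continuous_on UNIV (cdf (chi_square k))"
      using isCont_cdf_chi_square[OF k] by (simp add: continuous_on_eq_continuous_at)
    then show ?thesis unfolding S_def by (intro closed_Collect_le continuous_on_const)
  qed
  have "q \<in> S" unfolding q using ne bb cl by (rule closed_contains_Inf)
  then have ge: "p \<le> cdf (chi_square k) q" by (simp add: S_def)
  have le: "cdf (chi_square k) q \<le> p"
  proof (rule tendsto_upperbound)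
    show "(cdf (chi_square k) \<longlongrightarrow> cdf (chi_square k) q) (at_left q)"
      using isCont_cdf_chi_square[OF k, of q] by (simp add: isCont_def filterlim_at_split)
    have "cdf (chi_square k) x \<le> p" if "x < q" for x
      using that cInf_lower[OF _ bb, of x] unfolding q by (force simp: S_def)
    then show "\<forall>\<^sub>F x in at_left q. cdf (chi_square k) x \<le> p"
      by (auto intro!: eventually_at_leftI[of "q - 1"])
  qed simp
  show "cdf (chi_square k) (quantile (chi_square k) p) = p" "quantile (chi_square k) p \<ge> 0"
    using ge le q0 by (simp_all add: q_def)
qed

section \<open>Weak convergence from Laplace transforms\<close>

lemma (in prob_space) polynomial_approx_integral:
  fixes Z :: "'a \<Rightarrow> real"
  assumes [measurable]: "Z \<in> borel_measurable M" and Z: "\<And>\<omega>. Z \<omega> \<in> {0..1}"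
    and h: "continuous_on UNIV h" and close: "\<And>x. x \<in> {0..1} \<Longrightarrow> \<bar>h x - (\<Sum>i\<le>d. c i * x ^ i)\<bar> < (r :: real)"
  shows "\<bar>(\<integral>\<omega>. h (Z \<omega>) \<partial>M) - (\<Sum>i\<le>d. c i * (\<integral>\<omega>. Z \<omega> ^ i \<partial>M))\<bar> \<le> r"
proof -
  define g where "g = (\<lambda>x. \<Sum>i\<le>d. c i * x ^ i)"
  have gc: "continuous_on UNIV g" unfolding g_def by (intro continuous_intros)
  have int: "integrable M (\<lambda>\<omega>. f (Z \<omega>))" if f: "continuous_on UNIV f" for f :: "real \<Rightarrow> real"
  proof -
    have [measurable]: "f \<in> borel_measurable borel" by (rule borel_measurable_continuous_onI[OF f])
    obtain K where "\<forall>x\<in>{0..1}. \<bar>f x\<bar> \<le> K"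
      using compact_imp_bounded[OF compact_continuous_image[OF continuous_on_subset[OF f], of "{0..1}"]]
      by (auto simp: bounded_iff)
    then show ?thesis using Z by (intro integrable_const_bound[of _ K]) auto
  qed
  have "(\<Sum>i\<le>d. c i * (\<integral>\<omega>. Z \<omega> ^ i \<partial>M)) = (\<integral>\<omega>. g (Z \<omega>) \<partial>M)"
  proof -
    have "integrable M (\<lambda>\<omega>. Z \<omega> ^ i)" for i by (intro int[of "\<lambda>x. x ^ i"] continuous_intros)
    then show ?thesis unfolding g_def by (subst Bochner_Integration.integral_sum) auto
  qed
  then have "\<bar>(\<integral>\<omega>. h (Z \<omega>) \<partial>M) - (\<Sum>i\<le>d. c i * (\<integral>\<omega>. Z \<omega> ^ i \<partial>M))\<bar> = \<bar>\<integral>\<omega>. h (Z \<omega>) - g (Z \<omega>) \<partial>M\<bar>"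
    using int[OF h] int[OF gc] by simp
  also have "\<dots> \<le> (\<integral>\<omega>. \<bar>h (Z \<omega>) - g (Z \<omega>)\<bar> \<partial>M)" by (rule integral_abs_bound)
  also have "\<dots> \<le> (\<integral>\<omega>. r \<partial>M)"
    using int[OF h] int[OF gc] close[OF Z] unfolding g_def by (intro integral_mono) (auto intro: less_imp_le)
  finally show ?thesis by (simp add: prob_space)
qed

text \<open>Convergence of the moments of \<open>exp (- X / 2)\<close> gives weak convergence, by Weierstrass
  approximation on the unit interval.\<close>

lemma laplace_imp_weak:
  fixes X :: "nat \<Rightarrow> 'a \<Rightarrow> real" and Y :: "'b \<Rightarrow> real"
  assumes M: "\<And>T. prob_space (M T)" and N: "prob_space N"
    and X [measurable]: "\<And>T. X T \<in> borel_measurable (M T)" and Y [measurable]: "Y \<in> borel_measurable N"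
    and X0: "\<And>T \<omega>. X T \<omega> \<ge> 0" and Y0: "\<And>\<omega>. Y \<omega> \<ge> 0"
    and conv: "\<And>k :: nat. (\<lambda>T. \<integral>\<omega>. exp (- (X T \<omega>) / 2) ^ k \<partial>M T) \<longlonglongrightarrow> (\<integral>\<omega>. exp (- (Y \<omega>) / 2) ^ k \<partial>N)"
    and cont: "isCont (cdf (distr N borel Y)) c"
  shows "(\<lambda>T. measure (M T) {\<omega> \<in> space (M T). X T \<omega> \<le> c}) \<longlonglongrightarrow> measure N {\<omega> \<in> space N. Y \<omega> \<le> c}"
proof -
  interpret N: prob_space N by fact
  have RX: "real_distribution (distr (M T) borel (X T))" for T
    using M by (intro prob_space.real_distribution_distr) auto
  have RY: "real_distribution (distr N borel Y)" by (intro N.real_distribution_distr) auto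
  define U W where "U = (\<lambda>T \<omega>. exp (- (X T \<omega>) / 2))" and "W = (\<lambda>\<omega>. exp (- (Y \<omega>) / 2))"
  have UM: "U T \<in> borel_measurable (M T)" and WM: "W \<in> borel_measurable N" for T
    unfolding U_def W_def by measurable
  have U01: "U T \<omega> \<in> {0..1}" for T \<omega> using X0[of T \<omega>] by (simp add: U_def)
  have W01: "W \<omega> \<in> {0..1}" for \<omega> using Y0[of \<omega>] by (simp add: W_def)
  have main: "(\<lambda>T. \<integral>\<omega>. h (U T \<omega>) \<partial>M T) \<longlonglongrightarrow> (\<integral>\<omega>. h (W \<omega>) \<partial>N)"
    if h: "continuous_on UNIV h" for h :: "real \<Rightarrow> real"
  proof (rule LIMSEQ_I)
    fix r :: real assume r: "r > 0"
    obtain g where g: "real_polynomial_function g" "\<And>x. x \<in> {0..1} \<Longrightarrow> \<bar>h x - g x\<bar> < r / 4"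
    proof (rule Stone_Weierstrass_real_polynomial_function[of "{0..1::real}" h "r / 4"])
      show "continuous_on {0..1} h" using h by (rule continuous_on_subset) simp
    qed (use r in auto)
    obtain cf d where gd: "g = (\<lambda>x. \<Sum>i\<le>d. cf i * x ^ i)"
      using g(1) real_polynomial_function_iff_sum by blast
    define p where "p = (\<lambda>T. \<Sum>i\<le>d. cf i * (\<integral>\<omega>. U T \<omega> ^ i \<partial>M T))"
    define p' where "p' = (\<Sum>i\<le>d. cf i * (\<integral>\<omega>. W \<omega> ^ i \<partial>N))"
    have "p \<longlonglongrightarrow> p'" unfolding p_def p'_def U_def W_def by (intro tendsto_intros conv)
    then obtain n0 where n0: "\<bar>p T - p'\<bar> < r / 4" if "T \<ge> n0" for T
      using LIMSEQ_D[of p p' "r / 4"] r by auto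
    have 1: "\<bar>(\<integral>\<omega>. h (U T \<omega>) \<partial>M T) - p T\<bar> \<le> r / 4" for T
      unfolding p_def by (rule prob_space.polynomial_approx_integral[OF M UM U01 h]) (use g(2) in \<open>simp add: gd\<close>)
    have 2: "\<bar>(\<integral>\<omega>. h (W \<omega>) \<partial>N) - p'\<bar> \<le> r / 4"
      unfolding p'_def by (rule prob_space.polynomial_approx_integral[OF N WM W01 h]) (use g(2) in \<open>simp add: gd\<close>)
    have "norm ((\<integral>\<omega>. h (U T \<omega>) \<partial>M T) - (\<integral>\<omega>. h (W \<omega>) \<partial>N)) < r" if "T \<ge> n0" for T
      unfolding real_norm_def using 1[of T] 2 n0[OF that] r by linarith
    then show "\<exists>n0. \<forall>T\<ge>n0. norm ((\<integral>\<omega>. h (U T \<omega>) \<partial>M T) - (\<integral>\<omega>. h (W \<omega>) \<partial>N)) < r" by blast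
  qed
  have "weak_conv_m (\<lambda>T. distr (M T) borel (X T)) (distr N borel Y)"
  proof (rule integral_cts_step_conv_imp_weak_conv[OF RX RY])
    fix x y :: real assume xy: "x < y"
    \<comment> \<open>The step function read through \<open>u = exp (- x / 2)\<close>. The clipping
      at \<open>exp (- y / 2)\<close> removes the singularity of the logarithm at 0 and changes
      nothing, since the step function vanishes from \<open>y\<close> on.\<close>
    define h where "h = (\<lambda>z. cts_step x y (- 2 * ln (max z (exp (- y / 2)))))"
    have cs: "continuous_on UNIV (cts_step x y)"
      using cts_step_uniformly_continuous[OF xy] by (rule uniformly_continuous_imp_continuous)
    have hc: "continuous_on UNIV h"
      unfolding h_def
    proof (rule continuous_on_compose2[OF cs])
      have "max z (exp (- y / 2)) \<noteq> 0" for z :: real using less_le_trans[OF exp_gt_zero[of "- y / 2"] max.cobounded2[of _ z]] by simp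
      then show "continuous_on UNIV (\<lambda>z :: real. - 2 * ln (max z (exp (- y / 2))))"
        by (intro continuous_intros) auto
    qed simp
    have hv: "h (exp (- u / 2)) = cts_step x y u" for u
    proof (cases "u \<le> y")
      case True
      then have "max (exp (- u / 2)) (exp (- y / 2)) = exp (- u / 2)" by simp
      then show ?thesis by (simp add: h_def)
    next
      case False
      then have "max (exp (- u / 2)) (exp (- y / 2)) = exp (- y / 2)" by simp
      then show ?thesis using False xy by (simp add: h_def cts_step_def)
    qed
    have csm: "cts_step x y \<in> borel_measurable borel" by (rule borel_measurable_continuous_onI[OF cs])
    show "(\<lambda>n. integral\<^sup>L (distr (M n) borel (X n)) (cts_step x y)) \<longlonglongrightarrow> integral\<^sup>L (distr N borel Y) (cts_step x y)"
      using main[OF hc] unfolding U_def W_def hv integral_distr[OF X csm] integral_distr[OF Y csm] .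
  qed
  then have "(\<lambda>T. cdf (distr (M T) borel (X T)) c) \<longlonglongrightarrow> cdf (distr N borel Y) c"
    using cont by (simp add: weak_conv_m_def weak_conv_def)
  moreover have "cdf (distr (M T) borel (X T)) c = measure (M T) {\<omega> \<in> space (M T). X T \<omega> \<le> c}" for T
    unfolding cdf_def by (subst measure_distr) (auto intro!: arg_cong[where f = "measure (M T)"])
  moreover have "cdf (distr N borel Y) c = measure N {\<omega> \<in> space N. Y \<omega> \<le> c}"
    unfolding cdf_def by (subst measure_distr) (auto intro!: arg_cong[where f = "measure N"])
  ultimately show ?thesis by simp
qed

text \<open>A multivariate central limit theorem for the squared norm: the characteristic function of
  the vector determines the Laplace transform of its squared norm by Gaussian averaging.\<close>

lemma chi_square_limit:
  fixes y :: "nat \<Rightarrow> nat \<Rightarrow> 'a \<Rightarrow> real"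
  assumes M: "\<And>T. prob_space (M T)" and y: "\<And>T i. i < k \<Longrightarrow> y T i \<in> borel_measurable (M T)"
    and k: "k \<ge> 1" and \<sigma>: "\<sigma> > 0"
    and cf: "\<And>c :: nat \<Rightarrow> real. (\<lambda>T. \<integral>\<omega>. cos (\<Sum>i<k. c i * y T i \<omega>) \<partial>M T) \<longlonglongrightarrow> exp (- (\<sigma>\<^sup>2 / 2 * (\<Sum>i<k. (c i)\<^sup>2)))"
  shows "(\<lambda>T. measure (M T) {\<omega> \<in> space (M T). (\<Sum>i<k. (y T i \<omega>)\<^sup>2) \<le> c}) \<longlonglongrightarrow> cdf (chi_square k) (c / \<sigma>\<^sup>2)"
proof -
  interpret G: prob_space "gauss k" by (rule prob_space_gauss)
  define Q where "Q = (\<lambda>z :: nat \<Rightarrow> real. \<sigma>\<^sup>2 * (\<Sum>i<k. (z i)\<^sup>2))"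
  have Qm [measurable]: "Q \<in> borel_measurable (gauss k)" unfolding Q_def by measurable
  have eq: "{z \<in> space (gauss k). Q z \<le> c} = {z \<in> space (gauss k). (\<Sum>i<k. (z i)\<^sup>2) \<le> c / \<sigma>\<^sup>2}" for c
    using \<sigma> by (auto simp: Q_def field_simps)
  have "(\<lambda>T. measure (M T) {\<omega> \<in> space (M T). (\<Sum>i<k. (y T i \<omega>)\<^sup>2) \<le> c}) \<longlonglongrightarrow> measure (gauss k) {z \<in> space (gauss k). Q z \<le> c}"
  proof (rule laplace_imp_weak[OF M prob_space_gauss _ Qm])
    show "(\<lambda>\<omega>. \<Sum>i<k. (y T i \<omega>)\<^sup>2) \<in> borel_measurable (M T)" for T
      using y by (intro borel_measurable_sum borel_measurable_power) auto
    show "0 \<le> Q z" for z by (simp add: Q_def sum_nonneg)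
    show "0 \<le> (\<Sum>i<k. (y T i \<omega>)\<^sup>2)" for T \<omega> by (simp add: sum_nonneg)
    have "cdf (distr (gauss k) borel Q) x = cdf (chi_square k) (x / \<sigma>\<^sup>2)" for x
    proof -
      have "cdf (distr (gauss k) borel Q) x = measure (gauss k) {z \<in> space (gauss k). Q z \<le> x}"
        unfolding cdf_def by (subst measure_distr) (auto intro!: arg_cong[where f = "measure (gauss k)"])
      then show ?thesis by (simp only: eq cdf_chi_square)
    qed
    then have "cdf (distr (gauss k) borel Q) = (\<lambda>x. cdf (chi_square k) (x / \<sigma>\<^sup>2))" by auto
    moreover have "isCont (\<lambda>x. cdf (chi_square k) (x / \<sigma>\<^sup>2)) c"
      by (rule isCont_o2[OF _ isCont_cdf_chi_square[OF k]]) (use \<sigma> in \<open>simp\<close>)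
    ultimately show "isCont (cdf (distr (gauss k) borel Q)) c" by simp
    fix m :: nat
    \<comment> \<open>The power \<open>m\<close> scales the vector by \<open>sqrt m\<close>, so
      every moment is again a Laplace transform, hence a Gaussian mean of characteristic functions;
      dominated convergence then applies.\<close>
    have L: "(\<integral>\<omega>. exp (- (\<Sum>i<k. (y T i \<omega>)\<^sup>2) / 2) ^ m \<partial>M T)
        = (\<integral>z. (\<integral>\<omega>. cos (\<Sum>i<k. z i * (sqrt m * y T i \<omega>)) \<partial>M T) \<partial>gauss k)" for T
    proof -
      have "(\<lambda>\<omega>. exp (- (\<Sum>i<k. (y T i \<omega>)\<^sup>2) / 2) ^ m) = (\<lambda>\<omega>. exp (- (\<Sum>i<k. (sqrt m * y T i \<omega>)\<^sup>2) / 2))"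
        by (simp add: power_mult_distrib sum_distrib_left[symmetric] flip: exp_of_nat_mult)
      then have "(\<integral>\<omega>. exp (- (\<Sum>i<k. (y T i \<omega>)\<^sup>2) / 2) ^ m \<partial>M T) = (\<integral>\<omega>. exp (- (\<Sum>i<k. (sqrt m * y T i \<omega>)\<^sup>2) / 2) \<partial>M T)"
        by (rule arg_cong)
      also have "\<dots> = (\<integral>z. (\<integral>\<omega>. cos (\<Sum>i<k. z i * (sqrt m * y T i \<omega>)) \<partial>M T) \<partial>gauss k)"
        by (rule laplace_eq_gauss_cos[OF M]) (use y in auto)
      finally show ?thesis .
    qed
    have R: "(\<integral>z. exp (- Q z / 2) ^ m \<partial>gauss k) = (\<integral>z. exp (- (\<sigma>\<^sup>2 / 2 * (\<Sum>i<k. (sqrt m * z i)\<^sup>2))) \<partial>gauss k)"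
      by (intro Bochner_Integration.integral_cong)
        (simp_all add: Q_def power_mult_distrib sum_distrib_left[symmetric] mult_ac flip: exp_of_nat_mult)
    show "(\<lambda>T. \<integral>\<omega>. exp (- (\<Sum>i<k. (y T i \<omega>)\<^sup>2) / 2) ^ m \<partial>M T) \<longlonglongrightarrow> (\<integral>z. exp (- Q z / 2) ^ m \<partial>gauss k)"
      unfolding L R
    proof (rule integral_dominated_convergence[where w = "\<lambda>_. 1"])
      show "(\<lambda>z. exp (- (\<sigma>\<^sup>2 / 2 * (\<Sum>i<k. (sqrt m * z i)\<^sup>2)))) \<in> borel_measurable (gauss k)"
        unfolding power_mult_distrib sum_distrib_left[symmetric] by measurable
      fix T
      interpret MT: prob_space "M T" by (rule M)
      have [measurable]: "(\<lambda>p. \<Sum>i<k. fst p i * (sqrt m * y T i (snd p))) \<in> borel_measurable (gauss k \<Otimes>\<^sub>M M T)"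
        by (intro borel_measurable_sum borel_measurable_times borel_measurable_const
            measurable_compose[OF measurable_fst measurable_gauss_component] measurable_compose[OF measurable_snd y]) auto
      have "(\<lambda>z. \<integral>\<omega>. cos (\<Sum>i<k. z i * (sqrt m * y T i \<omega>)) \<partial>M T) \<in> borel_measurable (gauss k)"
        by (rule MT.borel_measurable_lebesgue_integral) (simp add: case_prod_beta)
      then show "(\<lambda>z. \<integral>\<omega>. cos (\<Sum>i<k. z i * (sqrt m * y T i \<omega>)) \<partial>M T) \<in> borel_measurable (gauss k)" .
      show "AE z in gauss k. norm (\<integral>\<omega>. cos (\<Sum>i<k. z i * (sqrt m * y T i \<omega>)) \<partial>M T) \<le> 1"
      proof (rule AE_I2)
        fix z
        have [measurable]: "(\<lambda>\<omega>. \<Sum>i<k. z i * (sqrt m * y T i \<omega>)) \<in> borel_measurable (M T)"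
          using y by (intro borel_measurable_sum borel_measurable_times borel_measurable_const) auto
        have i: "integrable (M T) (\<lambda>\<omega>. \<bar>cos (\<Sum>i<k. z i * (sqrt m * y T i \<omega>))\<bar>)"
          by (rule MT.integrable_const_bound[of _ 1]) auto
        have "norm (\<integral>\<omega>. cos (\<Sum>i<k. z i * (sqrt m * y T i \<omega>)) \<partial>M T) \<le> (\<integral>\<omega>. \<bar>cos (\<Sum>i<k. z i * (sqrt m * y T i \<omega>))\<bar> \<partial>M T)"
          unfolding real_norm_def by (rule integral_abs_bound)
        also have "\<dots> \<le> (\<integral>\<omega>. 1 \<partial>M T)" using i by (intro integral_mono) auto
        finally show "norm (\<integral>\<omega>. cos (\<Sum>i<k. z i * (sqrt m * y T i \<omega>)) \<partial>M T) \<le> 1" by (simp add: MT.prob_space)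
      qed
    next
      show "AE z in gauss k. (\<lambda>T. \<integral>\<omega>. cos (\<Sum>i<k. z i * (sqrt m * y T i \<omega>)) \<partial>M T) \<longlonglongrightarrow> exp (- (\<sigma>\<^sup>2 / 2 * (\<Sum>i<k. (sqrt m * z i)\<^sup>2)))"
        using cf[of "\<lambda>i. sqrt m * z i" for z] by (intro AE_I2) (simp add: mult_ac)
    qed simp
  qed
  then show ?thesis by (simp add: eq cdf_chi_square)
qed

lemma slutsky:
  fixes X Y :: "nat \<Rightarrow> 'a \<Rightarrow> real"
  assumes M: "\<And>T. prob_space (M T)"
    and X [measurable]: "\<And>T. X T \<in> borel_measurable (M T)" and Y [measurable]: "\<And>T. Y T \<in> borel_measurable (M T)"
    and lim: "\<And>c. (\<lambda>T. measure (M T) {\<omega> \<in> space (M T). X T \<omega> \<le> c}) \<longlonglongrightarrow> G c" and G: "isCont G c"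
    and close: "\<And>\<eta>. \<eta> > 0 \<Longrightarrow> (\<lambda>T. measure (M T) {\<omega> \<in> space (M T). \<bar>Y T \<omega> - X T \<omega>\<bar> > \<eta>}) \<longlonglongrightarrow> 0"
  shows "(\<lambda>T. measure (M T) {\<omega> \<in> space (M T). Y T \<omega> \<le> c}) \<longlonglongrightarrow> G c"
proof (rule LIMSEQ_I)
  fix r :: real assume r: "r > 0"
  obtain d where d: "d > 0" "\<And>x. \<bar>x - c\<bar> < d \<Longrightarrow> \<bar>G x - G c\<bar> < r / 3"
    using G[unfolded continuous_at_eps_delta, rule_format, of "r / 3"] r by (auto simp: dist_real_def)
  define \<eta> where "\<eta> = d / 2"
  have \<eta>: "\<eta> > 0" using d by (simp add: \<eta>_def)
  have G1: "\<bar>G (c + \<eta>) - G c\<bar> < r / 3" "\<bar>G (c - \<eta>) - G c\<bar> < r / 3"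
    using d by (auto simp: \<eta>_def)
  define P where "P = (\<lambda>T c. measure (M T) {\<omega> \<in> space (M T). X T \<omega> \<le> c})"
  define E where "E = (\<lambda>T. measure (M T) {\<omega> \<in> space (M T). \<bar>Y T \<omega> - X T \<omega>\<bar> > \<eta>})"
  have "\<forall>\<^sub>F T in sequentially. \<bar>P T (c + \<eta>) - G (c + \<eta>)\<bar> < r / 3"
    using tendstoD[OF lim, of "r / 3"] r by (simp add: dist_real_def P_def)
  moreover have "\<forall>\<^sub>F T in sequentially. \<bar>P T (c - \<eta>) - G (c - \<eta>)\<bar> < r / 3"
    using tendstoD[OF lim, of "r / 3"] r by (simp add: dist_real_def P_def)
  moreover have "\<forall>\<^sub>F T in sequentially. \<bar>E T\<bar> < r / 3"
    using tendstoD[OF close[OF \<eta>], of "r / 3"] r by (simp add: dist_real_def E_def)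
  ultimately have "\<forall>\<^sub>F T in sequentially. norm (measure (M T) {\<omega> \<in> space (M T). Y T \<omega> \<le> c} - G c) < r"
  proof eventually_elim
    case (elim T)
    interpret prob_space "M T" by (rule M)
    have "prob {\<omega> \<in> space (M T). Y T \<omega> \<le> c} \<le> prob ({\<omega> \<in> space (M T). X T \<omega> \<le> c + \<eta>} \<union> {\<omega> \<in> space (M T). \<bar>Y T \<omega> - X T \<omega>\<bar> > \<eta>})"
      by (intro finite_measure_mono) auto
    also have "\<dots> \<le> P T (c + \<eta>) + E T"
      unfolding P_def E_def by (intro measure_Un_le) auto
    finally have 1: "prob {\<omega> \<in> space (M T). Y T \<omega> \<le> c} \<le> P T (c + \<eta>) + E T" .
    have "P T (c - \<eta>) \<le> prob ({\<omega> \<in> space (M T). Y T \<omega> \<le> c} \<union> {\<omega> \<in> space (M T). \<bar>Y T \<omega> - X T \<omega>\<bar> > \<eta>})"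
      unfolding P_def by (intro finite_measure_mono) auto
    also have "\<dots> \<le> prob {\<omega> \<in> space (M T). Y T \<omega> \<le> c} + E T"
      unfolding E_def by (intro measure_Un_le) auto
    finally show ?case using 1 elim G1 unfolding real_norm_def by linarith
  qed
  then show "\<exists>n0. \<forall>T\<ge>n0. norm (measure (M T) {\<omega> \<in> space (M T). Y T \<omega> \<le> c} - G c) < r"
    by (simp add: eventually_sequentially)
qed

section \<open>Concentration of the Gram matrix\<close>

context adapted_noise begin

lemma directional_tail_two_sided:
  fixes x :: "real^'n" and g L :: real
  assumes \<sigma>: "\<sigma> > 0" and g: "g > 0" and L: "L > 0"
  defines "A \<equiv> {\<omega> \<in> space M. \<exists>k\<le>T. (\<Sum>s=1..k. (x \<bullet> a s \<omega>)\<^sup>2) \<le> g \<and> 2 * L * \<sigma>\<^sup>2 * g \<le> (x \<bullet> S k \<omega>)\<^sup>2}"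
  shows "A \<in> sets M" "measure M A \<le> 2 * exp (- L)"
proof -
  have Sm [measurable]: "(\<lambda>\<omega>. x \<bullet> S k \<omega>) \<in> borel_measurable M" if "k \<le> T" for k
    using measurable_S_M[OF that] by (intro borel_measurable_inner) auto
  have Qm [measurable]: "(\<lambda>\<omega>. \<Sum>s=1..k. (x \<bullet> a s \<omega>)\<^sup>2) \<in> borel_measurable M" if "k \<le> T" for k
    using that by (intro borel_measurable_sum borel_measurable_power borel_measurable_inner action_M) auto
  have "A = (\<Union>k\<in>{..T}. {\<omega> \<in> space M. (\<Sum>s=1..k. (x \<bullet> a s \<omega>)\<^sup>2) \<le> g \<and> 2 * L * \<sigma>\<^sup>2 * g \<le> (x \<bullet> S k \<omega>)\<^sup>2})"
    by (auto simp: A_def)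
  also have "\<dots> \<in> sets M"
  proof (intro sets.finite_UN)
    fix k assume "k \<in> {..T}"
    then have [measurable]: "(\<lambda>\<omega>. x \<bullet> S k \<omega>) \<in> borel_measurable M"
      "(\<lambda>\<omega>. \<Sum>s=1..k. (x \<bullet> a s \<omega>)\<^sup>2) \<in> borel_measurable M" using Sm Qm by auto
    show "{\<omega> \<in> space M. (\<Sum>s=1..k. (x \<bullet> a s \<omega>)\<^sup>2) \<le> g \<and> 2 * L * \<sigma>\<^sup>2 * g \<le> (x \<bullet> S k \<omega>)\<^sup>2} \<in> sets M"
      by measurable
  qed simp
  finally show "A \<in> sets M" .
  \<comment> \<open>The minimiser of \<open>L / c + c \<sigma>^2 g / 2\<close>: both terms become
    equal and their sum is \<open>2 L / c\<close>.\<close>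
  define c where "c = sqrt (2 * L / (\<sigma>\<^sup>2 * g))"
  have c: "c > 0" using assms by (simp add: c_def)
  have c2: "c\<^sup>2 * (\<sigma>\<^sup>2 * g) = 2 * L" using assms by (simp add: c_def)
  have sq: "(2 * L / c)\<^sup>2 = 2 * L * \<sigma>\<^sup>2 * g"
  proof -
    have "(2 * L / c)\<^sup>2 = 2 * L * (c\<^sup>2 * (\<sigma>\<^sup>2 * g)) / c\<^sup>2" unfolding c2 by (simp add: power_divide power2_eq_square)
    then show ?thesis using c by simp
  qed
  define H where "H = (\<lambda>y :: real^'n. {\<omega> \<in> space M. \<exists>k\<le>T. L / c + c * \<sigma>\<^sup>2 * (\<Sum>s=1..k. (y \<bullet> a s \<omega>)\<^sup>2) / 2 \<le> y \<bullet> S k \<omega>})"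
  have HM: "H y \<in> sets M" for y
  proof -
    have "H y = (\<Union>k\<in>{..T}. {\<omega> \<in> space M. L / c + c * \<sigma>\<^sup>2 * (\<Sum>s=1..k. (y \<bullet> a s \<omega>)\<^sup>2) / 2 \<le> y \<bullet> S k \<omega>})"
      by (auto simp: H_def)
    also have "\<dots> \<in> sets M"
    proof (intro sets.finite_UN)
      fix k assume k: "k \<in> {..T}"
      have [measurable]: "(\<lambda>\<omega>. y \<bullet> S k \<omega>) \<in> borel_measurable M"
        using k measurable_S_M by (intro borel_measurable_inner) auto
      have [measurable]: "(\<lambda>\<omega>. \<Sum>s=1..k. (y \<bullet> a s \<omega>)\<^sup>2) \<in> borel_measurable M"
        using k by (intro borel_measurable_sum borel_measurable_power borel_measurable_inner action_M) auto
      show "{\<omega> \<in> space M. L / c + c * \<sigma>\<^sup>2 * (\<Sum>s=1..k. (y \<bullet> a s \<omega>)\<^sup>2) / 2 \<le> y \<bullet> S k \<omega>} \<in> sets M"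
        by measurable
    qed simp
    finally show ?thesis .
  qed
  have "A \<subseteq> H x \<union> H (- x)"
  proof
    fix \<omega> assume "\<omega> \<in> A"
    then obtain k where k: "\<omega> \<in> space M" "k \<le> T" "(\<Sum>s=1..k. (x \<bullet> a s \<omega>)\<^sup>2) \<le> g" "2 * L * \<sigma>\<^sup>2 * g \<le> (x \<bullet> S k \<omega>)\<^sup>2"
      by (auto simp: A_def)
    have "(2 * L / c)\<^sup>2 \<le> (x \<bullet> S k \<omega>)\<^sup>2" using k(4) sq by simp
    then have "2 * L / c \<le> \<bar>x \<bullet> S k \<omega>\<bar>" using c L by (simp add: abs_le_square_iff[symmetric])
    moreover have "L / c + c * \<sigma>\<^sup>2 * (\<Sum>s=1..k. (x \<bullet> a s \<omega>)\<^sup>2) / 2 \<le> 2 * L / c"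
    proof -
      have "c * \<sigma>\<^sup>2 * (\<Sum>s=1..k. (x \<bullet> a s \<omega>)\<^sup>2) \<le> c * \<sigma>\<^sup>2 * g"
        using k(3) c by (intro mult_left_mono) auto
      also have "\<dots> = 2 * L / c" using c2 c by (simp add: field_simps power2_eq_square)
      finally show ?thesis by simp
    qed
    ultimately have "L / c + c * \<sigma>\<^sup>2 * (\<Sum>s=1..k. (x \<bullet> a s \<omega>)\<^sup>2) / 2 \<le> \<bar>x \<bullet> S k \<omega>\<bar>" by linarith
    then show "\<omega> \<in> H x \<union> H (- x)"
      using k(1,2) by (cases "0 \<le> x \<bullet> S k \<omega>") (auto simp: H_def)
  qed
  then have "measure M A \<le> measure M (H x \<union> H (- x))" by (intro finite_measure_mono) (use HM in auto)
  also have "\<dots> \<le> measure M (H x) + measure M (H (- x))" using HM by (intro measure_Un_le)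
  also have "\<dots> \<le> 2 * exp (- L)"
    using directional_tail[OF c, of L x] directional_tail[OF c, of L "- x"] unfolding H_def by linarith
  finally show "measure M A \<le> 2 * exp (- L)" .
qed

text \<open>Peeling over the dyadic blocks of rounds replaces the fixed level \<open>g\<close> by a growing one.\<close>

lemma dyadic_tail:
  fixes x :: "real^'n" and g :: "real \<Rightarrow> real" and L :: real
  assumes \<sigma>: "\<sigma> > 0" and L: "L > 0" and J: "T + 1 < 2 ^ Suc J"
    and g: "\<And>h. h > 0 \<Longrightarrow> g h > 0" "\<And>h h'. 0 < h \<Longrightarrow> h \<le> h' \<Longrightarrow> g h \<le> g h'" "\<And>h. h > 0 \<Longrightarrow> g (2 * h) \<le> 2 * g h"
  obtains B where "B \<in> sets M" "measure M B \<le> 2 * (real J + 1) * exp (- L)"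
    "\<And>\<omega> k. \<omega> \<in> space M - B \<Longrightarrow> k \<le> T \<Longrightarrow> (\<Sum>s=1..k. (x \<bullet> a s \<omega>)\<^sup>2) \<le> g (real (Suc k)) \<Longrightarrow>
      (x \<bullet> S k \<omega>)\<^sup>2 \<le> 4 * L * \<sigma>\<^sup>2 * g (real (Suc k))"
proof -
  define A where "A = (\<lambda>j. {\<omega> \<in> space M. \<exists>k\<le>T. (\<Sum>s=1..k. (x \<bullet> a s \<omega>)\<^sup>2) \<le> g (2 ^ Suc j) \<and>
    2 * L * \<sigma>\<^sup>2 * g (2 ^ Suc j) \<le> (x \<bullet> S k \<omega>)\<^sup>2})"
  have A: "A j \<in> sets M" "measure M (A j) \<le> 2 * exp (- L)" for j
    unfolding A_def by (rule directional_tail_two_sided[OF \<sigma> g(1) L]; simp)+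
  have "measure M (\<Union>j\<le>J. A j) \<le> (\<Sum>j\<le>J. measure M (A j))"
    using A by (intro finite_measure_subadditive_finite) auto
  also have "\<dots> \<le> (\<Sum>j\<le>J. 2 * exp (- L))" by (intro sum_mono A)
  finally have 1: "measure M (\<Union>j\<le>J. A j) \<le> 2 * (real J + 1) * exp (- L)" by (simp add: algebra_simps)
  have 2: "(x \<bullet> S k \<omega>)\<^sup>2 \<le> 4 * L * \<sigma>\<^sup>2 * g (real (Suc k))"
    if \<omega>: "\<omega> \<in> space M - (\<Union>j\<le>J. A j)" and k: "k \<le> T" "(\<Sum>s=1..k. (x \<bullet> a s \<omega>)\<^sup>2) \<le> g (real (Suc k))" for \<omega> k
  proof -
    \<comment> \<open>The block of round \<open>k\<close>. Using the level at its right end instead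
      of \<open>g (Suc k)\<close> costs at most the factor 2 of the doubling condition.\<close>
    obtain j where j: "2 ^ j \<le> Suc k" "Suc k < 2 ^ Suc j"
      using ex_power_ivl1[of 2 "Suc k"] by auto
    have "(2::nat) ^ j < 2 ^ Suc J" using j(1) k(1) J by linarith
    then have "j \<le> J" using power_less_imp_less_exp[of "2::nat" j "Suc J"] by simp
    then have n: "\<omega> \<notin> A j" using \<omega> by auto
    have j': "2 ^ j \<le> real (Suc k)" "real (Suc k) < 2 ^ Suc j"
    proof -
      have "real (2 ^ j) \<le> real (Suc k)" "real (Suc k) < real (2 ^ Suc j)"
        using j by (simp_all only: of_nat_le_iff of_nat_less_iff)
      then show "2 ^ j \<le> real (Suc k)" "real (Suc k) < 2 ^ Suc j"
        by (simp_all only: of_nat_power of_nat_numeral)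
    qed
    have "(\<Sum>s=1..k. (x \<bullet> a s \<omega>)\<^sup>2) \<le> g (2 ^ Suc j)"
      using k(2) g(2)[of "real (Suc k)" "2 ^ Suc j"] j'(2) by simp
    then have "(x \<bullet> S k \<omega>)\<^sup>2 \<le> 2 * L * \<sigma>\<^sup>2 * g (2 ^ Suc j)"
      using n \<omega> k(1) unfolding A_def by (blast intro: less_imp_le leI)
    also have "\<dots> \<le> 2 * L * \<sigma>\<^sup>2 * (2 * g (real (Suc k)))"
    proof -
      have "g (2 ^ Suc j) \<le> g (2 * real (Suc k))" using j'(1) by (intro g(2)) auto
      also have "\<dots> \<le> 2 * g (real (Suc k))" by (intro g(3)) simp
      finally show ?thesis using L by (intro mult_left_mono) auto
    qed
    finally show ?thesis by simp
  qed
  show thesis using that[of "\<Union>j\<le>J. A j"] A 1 2 by blast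
qed

text \<open>As long as the function is at most 1, the self-normalised norm is at most 10 times a
  deterministic one, which is computed from the directions \<theta> and \<open>f j\<close>. These
  are \<open>d + 1\<close> fixed directions, each with a peeled tail over \<open>J + 1\<close>
  blocks. The constant comes from \<open>10 (4 + 16 d) \<le> 200 d\<close>.\<close>

lemma selfnorm_uniform:
  fixes \<theta> :: "real^'n" and L \<beta> :: real
  assumes \<sigma>: "\<sigma> > 0" and L: "L > 0" and J: "T + 1 < 2 ^ Suc J" and \<theta>: "norm \<theta> = 1" and \<beta>: "\<beta> > 0"
  obtains B where "B \<in> sets M" "measure M B \<le> 2 * (real CARD('n) + 1) * (real J + 1) * exp (- L)"
    "\<And>\<omega> k. \<omega> \<in> space M - B \<Longrightarrow> k \<le> T \<Longrightarrow> lyap \<theta> \<beta> (\<lambda>s. a s \<omega>) k \<le> 1 \<Longrightarrow>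
      S k \<omega> \<bullet> (matrix_inv (gram (\<lambda>s. a s \<omega>) k) *v S k \<omega>) \<le> 200 * real CARD('n) * L * \<sigma>\<^sup>2"
proof -
  have card: "real CARD('n) \<ge> 1" by (simp add: Suc_leI)
  define f where "f = (\<lambda>j. axis j 1 - (\<theta> $ j) *\<^sub>R \<theta> :: real^'n)"
  have tt: "\<theta> \<bullet> \<theta> = 1" using \<theta> by (simp add: norm_eq_1)
  have f\<theta>: "\<theta> \<bullet> f j = 0" for j
    by (simp add: f_def inner_diff_right tt inner_axis)
  have ff: "f j \<bullet> f j \<le> 1" for j
  proof -
    have "f j \<bullet> f j = axis j 1 \<bullet> f j - \<theta> $ j * (\<theta> \<bullet> f j)"
      unfolding f_def inner_diff_left inner_scaleR_left ..
    also have "\<dots> = f j $ j" unfolding f\<theta> by (simp add: inner_axis')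
    also have "\<dots> = 1 - \<theta> $ j * \<theta> $ j" by (simp add: f_def)
    finally show ?thesis by simp
  qed
  have fx: "(\<Sum>j\<in>UNIV. (f j \<bullet> x)\<^sup>2) = x \<bullet> x - (\<theta> \<bullet> x)\<^sup>2" for x
  proof -
    have "(\<Sum>j\<in>UNIV. (f j \<bullet> x)\<^sup>2) = (\<Sum>j\<in>UNIV. x $ j * x $ j - 2 * (\<theta> \<bullet> x) * (\<theta> $ j * x $ j) + (\<theta> \<bullet> x)\<^sup>2 * (\<theta> $ j * \<theta> $ j))"
      by (intro sum.cong) (simp_all add: f_def inner_diff_left inner_axis' power2_eq_square algebra_simps)
    also have "\<dots> = x \<bullet> x - 2 * (\<theta> \<bullet> x) * (\<theta> \<bullet> x) + (\<theta> \<bullet> x)\<^sup>2 * (\<theta> \<bullet> \<theta>)"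
      by (simp add: sum.distrib sum_subtractf sum_distrib_left[symmetric] inner_vec_def)
    finally show ?thesis by (simp add: tt power2_eq_square)
  qed
  \<comment> \<open>The factor 4 is the one by which \<open>gram_form_bounds\<close> lets the Gram
    form exceed its prediction; growth like \<open>sqrt h\<close> satisfies the doubling
    condition.\<close>
  define g where "g = (\<lambda>h. 4 * rate TYPE('n) \<beta> h)"
  have g: "h > 0 \<Longrightarrow> g h > 0" "0 < h \<Longrightarrow> h \<le> h' \<Longrightarrow> g h \<le> g h'" "h > 0 \<Longrightarrow> g (2 * h) \<le> 2 * g h" for h h'
  proof -
    show "g (2 * h) \<le> 2 * g h" if "h > 0"
    proof -
      have "2 * (2 * h) / (real CARD('n) + 1) \<le> 2\<^sup>2 * (2 * h / (real CARD('n) + 1))" using that by (simp add: field_simps)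
      then have "sqrt (2 * (2 * h) / (real CARD('n) + 1)) \<le> sqrt (2\<^sup>2 * (2 * h / (real CARD('n) + 1)))" by (rule real_sqrt_le_mono)
      also have "\<dots> = 2 * sqrt (2 * h / (real CARD('n) + 1))" by (simp only: real_sqrt_mult real_sqrt_abs)
      finally show ?thesis using \<beta> by (simp add: g_def rate_def)
    qed
  qed (use \<beta> in \<open>auto simp: g_def rate_def intro!: divide_pos_pos divide_right_mono\<close>)
  obtain B0 where B0: "B0 \<in> sets M" "measure M B0 \<le> 2 * (real J + 1) * exp (- L)"
    "\<And>\<omega> k. \<omega> \<in> space M - B0 \<Longrightarrow> k \<le> T \<Longrightarrow> (\<Sum>s=1..k. (\<theta> \<bullet> a s \<omega>)\<^sup>2) \<le> real (Suc k) \<Longrightarrow>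
      (\<theta> \<bullet> S k \<omega>)\<^sup>2 \<le> 4 * L * \<sigma>\<^sup>2 * real (Suc k)"
    using dyadic_tail[OF \<sigma> L J, of "\<lambda>h. h" \<theta>] by auto
  have "\<exists>B. B \<in> sets M \<and> measure M B \<le> 2 * (real J + 1) * exp (- L) \<and>
    (\<forall>\<omega> k. \<omega> \<in> space M - B \<longrightarrow> k \<le> T \<longrightarrow> (\<Sum>s=1..k. (f j \<bullet> a s \<omega>)\<^sup>2) \<le> g (real (Suc k)) \<longrightarrow>
      (f j \<bullet> S k \<omega>)\<^sup>2 \<le> 4 * L * \<sigma>\<^sup>2 * g (real (Suc k)))" for j
    by (rule dyadic_tail[OF \<sigma> L J, where g = g and x = "f j"]) (use g in blast)+
  then have "\<exists>B. \<forall>j. B j \<in> sets M \<and> measure M (B j) \<le> 2 * (real J + 1) * exp (- L) \<and>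
    (\<forall>\<omega> k. \<omega> \<in> space M - B j \<longrightarrow> k \<le> T \<longrightarrow> (\<Sum>s=1..k. (f j \<bullet> a s \<omega>)\<^sup>2) \<le> g (real (Suc k)) \<longrightarrow>
      (f j \<bullet> S k \<omega>)\<^sup>2 \<le> 4 * L * \<sigma>\<^sup>2 * g (real (Suc k)))"
    by (intro choice allI)
  then obtain B where B: "\<And>j. B j \<in> sets M" "\<And>j. measure M (B j) \<le> 2 * (real J + 1) * exp (- L)"
    "\<And>j \<omega> k. \<omega> \<in> space M - B j \<Longrightarrow> k \<le> T \<Longrightarrow> (\<Sum>s=1..k. (f j \<bullet> a s \<omega>)\<^sup>2) \<le> g (real (Suc k)) \<Longrightarrow>
      (f j \<bullet> S k \<omega>)\<^sup>2 \<le> 4 * L * \<sigma>\<^sup>2 * g (real (Suc k))"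
    by blast
  define C where "C = B0 \<union> (\<Union>j\<in>UNIV. B j)"
  have CM: "C \<in> sets M" unfolding C_def using B0(1) B(1) by (intro sets.Un sets.finite_UN) auto
  have "measure M C \<le> measure M B0 + measure M (\<Union>j\<in>UNIV. B j)"
    unfolding C_def using B0(1) B(1) by (intro measure_Un_le sets.finite_UN) auto
  also have "measure M (\<Union>j\<in>UNIV. B j) \<le> (\<Sum>j\<in>UNIV. measure M (B j))"
    using B(1) by (intro finite_measure_subadditive_finite) auto
  also have "\<dots> \<le> (\<Sum>j::'n\<in>UNIV. 2 * (real J + 1) * exp (- L))" by (intro sum_mono B)
  finally have 1: "measure M C \<le> 2 * (real CARD('n) + 1) * (real J + 1) * exp (- L)"
    using B0(2) by (simp add: algebra_simps)
  have 2: "S k \<omega> \<bullet> (matrix_inv (gram (\<lambda>s. a s \<omega>) k) *v S k \<omega>) \<le> 200 * real CARD('n) * L * \<sigma>\<^sup>2"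
    if \<omega>: "\<omega> \<in> space M - C" and k: "k \<le> T" and ly: "lyap \<theta> \<beta> (\<lambda>s. a s \<omega>) k \<le> 1" for \<omega> k
  proof -
    define h l where "h = real (Suc k)" and "l = rate TYPE('n) \<beta> h"
    have h: "h > 0" "l > 0" using rate_pos[OF \<beta>, of h, where 'n = 'n] by (simp_all add: h_def l_def)
    have na: "norm (a s \<omega>) = 1" if "s \<in> {1..k}" for s using that k \<omega> by (intro action_norm) auto
    have "(\<Sum>s=1..k. (\<theta> \<bullet> a s \<omega>)\<^sup>2) \<le> (\<Sum>s=1..k. 1)"
    proof (intro sum_mono)
      fix s assume "s \<in> {1..k}"
      then have "\<bar>\<theta> \<bullet> a s \<omega>\<bar> \<le> 1" using Cauchy_Schwarz_ineq2[of \<theta> "a s \<omega>"] na \<theta> by simp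
      then show "(\<theta> \<bullet> a s \<omega>)\<^sup>2 \<le> 1" by (simp add: abs_square_le_1)
    qed
    then have par: "(\<theta> \<bullet> S k \<omega>)\<^sup>2 \<le> 4 * L * \<sigma>\<^sup>2 * h"
      unfolding h_def using \<omega> k by (intro B0(3)) (auto simp: C_def)
    have "(f j \<bullet> S k \<omega>)\<^sup>2 \<le> 4 * L * \<sigma>\<^sup>2 * (4 * l)" for j
    proof -
      have "(\<Sum>s=1..k. (f j \<bullet> a s \<omega>)\<^sup>2) \<le> f j \<bullet> (gram (\<lambda>s. a s \<omega>) k *v f j)"
        by (simp add: gram_form inner_commute)
      also have "\<dots> \<le> 4 * wnorm2 \<theta> (real (Suc k)) (rate TYPE('n) \<beta> (real (Suc k))) (f j)"
        by (rule gram_form_bounds(2)[OF \<theta> \<beta> _ ly]) (use na in auto)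
      also have "\<dots> = 4 * l * (f j \<bullet> f j)" by (simp add: wnorm2_def f\<theta> l_def h_def)
      also have "\<dots> \<le> 4 * l * 1" using ff h by (intro mult_left_mono) auto
      finally have "(\<Sum>s=1..k. (f j \<bullet> a s \<omega>)\<^sup>2) \<le> g (real (Suc k))" by (simp add: g_def l_def h_def)
      then have "(f j \<bullet> S k \<omega>)\<^sup>2 \<le> 4 * L * \<sigma>\<^sup>2 * g (real (Suc k))"
        using \<omega> k by (intro B(3)) (auto simp: C_def)
      then show ?thesis by (simp add: g_def l_def h_def)
    qed
    then have "(\<Sum>j\<in>UNIV. (f j \<bullet> S k \<omega>)\<^sup>2) \<le> (\<Sum>j::'n\<in>UNIV. 4 * L * \<sigma>\<^sup>2 * (4 * l))" by (intro sum_mono)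
    then have perp: "S k \<omega> \<bullet> S k \<omega> - (\<theta> \<bullet> S k \<omega>)\<^sup>2 \<le> real CARD('n) * (4 * L * \<sigma>\<^sup>2 * (4 * l))"
      by (simp add: fx)
    have "S k \<omega> \<bullet> (matrix_inv (gram (\<lambda>s. a s \<omega>) k) *v S k \<omega>) \<le> 10 * wnorm2 \<theta> (1 / h) (1 / l) (S k \<omega>)"
      unfolding h_def l_def by (rule selfnorm_le_wnorm2[OF \<theta> \<beta> _ ly]) (use na in auto)
    also have "wnorm2 \<theta> (1 / h) (1 / l) (S k \<omega>) = (\<theta> \<bullet> S k \<omega>)\<^sup>2 / h + (S k \<omega> \<bullet> S k \<omega> - (\<theta> \<bullet> S k \<omega>)\<^sup>2) / l"
      by (simp add: wnorm2_def)
    also have "(\<theta> \<bullet> S k \<omega>)\<^sup>2 / h \<le> 4 * L * \<sigma>\<^sup>2" using par h by (simp add: pos_divide_le_eq)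
    also have "(S k \<omega> \<bullet> S k \<omega> - (\<theta> \<bullet> S k \<omega>)\<^sup>2) / l \<le> real CARD('n) * (4 * L * \<sigma>\<^sup>2 * 4)"
      using perp h by (simp add: pos_divide_le_eq mult_ac)
    also have "10 * (4 * L * \<sigma>\<^sup>2 + real CARD('n) * (4 * L * \<sigma>\<^sup>2 * 4)) \<le> 200 * real CARD('n) * L * \<sigma>\<^sup>2"
    proof -
      have "1 * (L * \<sigma>\<^sup>2) \<le> real CARD('n) * (L * \<sigma>\<^sup>2)" using card L by (intro mult_right_mono) auto
      then show ?thesis by (simp add: algebra_simps)
    qed
    finally show ?thesis by simp
  qed
  show thesis using that[OF CM 1 2] by blast
qed

end

context linucb begin

text \<open>The exceptional set is a union: \<open>B\<close> from the tail bound that is valid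
  whenever the function is at most 1, \<open>A\<close> from the general maximal inequality over the
  initial phase. Outside both, the noise condition of \<open>lyap_trajectory\<close> holds in every
  round; the level \<open>e \<beta> - 1\<close> leaves room for the bias 1.\<close>

lemma lyap_small_whp:
  fixes e L :: real and K J :: nat
  assumes \<sigma>: "\<sigma> > 0" and \<theta>: "norm \<theta> = 1" and \<beta>: "\<beta> \<ge> 1"
    and e: "0 < e" "e \<le> 1/4" "84 * (real CARD('n) + 1) * e \<le> 1"
    and K: "K \<ge> 1" and KT: "K \<le> T"
    and late1: "8 * real CARD('n) * ln (1 + real K) * (\<beta>\<^sup>2 + 1 / e)\<^sup>2 \<le> real K"
    and late2: "\<beta>\<^sup>2 \<le> e * rate TYPE('n) \<beta> (real (Suc K))" and late3: "1 \<le> e * real (Suc K)"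
    and L: "L > 0" and J: "T + 1 < 2 ^ Suc J"
    and e\<beta>: "e * \<beta> > 1" and Lb: "200 * real CARD('n) * L * \<sigma>\<^sup>2 \<le> (e * \<beta> - 1)\<^sup>2"
  obtains B where "B \<in> sets M"
    "measure M B \<le> 2 * (real CARD('n) + 1) * (real J + 1) * exp (- L)
      + \<sigma>\<^sup>2 * (real CARD('n) * ln (1 + 256 * real CARD('n) ^ 4 * real (Suc K) ^ 9)) / (e * \<beta> - 1)\<^sup>2"
    "\<And>\<omega>. \<omega> \<in> space M - B \<Longrightarrow> lyap \<theta> \<beta> (\<lambda>s. a s \<omega>) T \<le> 42 * (real CARD('n) + 1) * e
      + 2 * real CARD('n) * (real (Suc K))\<^sup>2 * (real (Suc K) / real (Suc T)) powr (1/4)"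
proof -
  have b0: "\<beta> > 0" using \<beta> by simp
  interpret N: adapted_noise M "history_action M a r" \<sigma> T a \<epsilon> by (rule adapted_noise[OF b0])
  define K1 where "K1 = 256 * CARD('n) ^ 4 * (Suc K) ^ 9"
  define n where "n = min T K1"
  define y where "y = (e * \<beta> - 1)\<^sup>2"
  have y: "y > 0" using e\<beta> by (simp add: y_def)
  define Q where "Q = (\<lambda>k \<omega>. N.S k \<omega> \<bullet> (matrix_inv (gram (\<lambda>s. a s \<omega>) k) *v N.S k \<omega>))"
  obtain B where B: "B \<in> sets M" "measure M B \<le> 2 * (real CARD('n) + 1) * (real J + 1) * exp (- L)"
    "\<And>\<omega> k. \<omega> \<in> space M - B \<Longrightarrow> k \<le> T \<Longrightarrow> lyap \<theta> \<beta> (\<lambda>s. a s \<omega>) k \<le> 1 \<Longrightarrow>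
      Q k \<omega> \<le> 200 * real CARD('n) * L * \<sigma>\<^sup>2"
    using N.selfnorm_uniform[OF \<sigma> L J \<theta> b0] unfolding Q_def by blast
  define A where "A = {\<omega> \<in> space M. \<exists>k\<le>n. y \<le> Q k \<omega>}"
  have AM: "A \<in> sets M"
  proof -
    have "A = (\<Union>k\<in>{..n}. {\<omega> \<in> space M. y \<le> Q k \<omega>})" by (auto simp: A_def)
    also have "\<dots> \<in> sets M"
    proof (intro sets.finite_UN)
      fix k assume "k \<in> {..n}"
      then have k: "k \<le> T" by (simp add: n_def)
      have [measurable]: "Q k \<in> borel_measurable M"
        unfolding Q_def using k
        by (intro borel_measurable_inner N.measurable_S_M N.measurable_inverse_gram N.action_M) auto
      show "{\<omega> \<in> space M. y \<le> Q k \<omega>} \<in> sets M" by measurable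
    qed simp
    finally show ?thesis .
  qed
  have nT: "n \<le> T" by (simp add: n_def)
  have "y * measure M A \<le> \<sigma>\<^sup>2 * (real CARD('n) * ln (1 + real n))"
    unfolding A_def Q_def by (rule N.selfnorm_tail[OF nT y])
  also have "\<dots> \<le> \<sigma>\<^sup>2 * (real CARD('n) * ln (1 + real K1))"
    by (intro mult_left_mono) (auto simp: n_def)
  finally have "measure M A \<le> \<sigma>\<^sup>2 * (real CARD('n) * ln (1 + real K1)) / y"
    using y by (simp add: pos_le_divide_eq mult.commute)
  moreover have "real K1 = 256 * real CARD('n) ^ 4 * real (Suc K) ^ 9" by (simp only: K1_def of_nat_mult of_nat_power of_nat_numeral)
  ultimately have mA: "measure M A \<le> \<sigma>\<^sup>2 * (real CARD('n) * ln (1 + 256 * real CARD('n) ^ 4 * real (Suc K) ^ 9)) / (e * \<beta> - 1)\<^sup>2"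
    by (simp only: y_def)
  have "measure M (B \<union> A) \<le> measure M B + measure M A" using B AM by (intro measure_Un_le)
  then have 1: "measure M (B \<union> A) \<le> 2 * (real CARD('n) + 1) * (real J + 1) * exp (- L)
      + \<sigma>\<^sup>2 * (real CARD('n) * ln (1 + 256 * real CARD('n) ^ 4 * real (Suc K) ^ 9)) / (e * \<beta> - 1)\<^sup>2"
    using B(2) mA by linarith
  have 2: "lyap \<theta> \<beta> (\<lambda>s. a s \<omega>) T \<le> 42 * (real CARD('n) + 1) * e
      + 2 * real CARD('n) * (real (Suc K))\<^sup>2 * (real (Suc K) / real (Suc T)) powr (1/4)"
    if \<omega>: "\<omega> \<in> space M - (B \<union> A)" for \<omega>
  proof (rule lyap_trajectory[OF \<theta> \<beta> _ _ _ e K KT _ late1 late2 late3,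
      where \<theta>' = "\<lambda>k. \<theta>hat k \<omega>" and \<eta> = "\<lambda>k. ridge (\<lambda>s. a s \<omega>) (\<lambda>s. r s \<omega>) k"])
    fix k assume k: "k < T"
    show "is_arg_max (ucb \<beta> (\<theta>hat k \<omega>) (gram (\<lambda>s. a s \<omega>) k)) (\<lambda>x. x \<in> cball 0 1) (a (Suc k) \<omega>)"
      using action_arg_max[of "Suc k" \<omega>] k \<omega> by simp
    show "norm (\<theta>hat k \<omega>) = 1" using k \<omega> by (intro estimator_unit) auto
    show "ridge (\<lambda>s. a s \<omega>) (\<lambda>s. r s \<omega>) k = norm (ridge (\<lambda>s. a s \<omega>) (\<lambda>s. r s \<omega>) k) *\<^sub>R \<theta>hat k \<omega>"
      using estimator_projected[of k \<omega>] k \<omega> by (cases "ridge (\<lambda>s. a s \<omega>) (\<lambda>s. r s \<omega>) k = 0") auto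
    assume "K \<le> k" and c: "k \<le> 256 * CARD('n) ^ 4 * Suc K ^ 9 \<or> lyap \<theta> \<beta> (\<lambda>s. a s \<omega>) k \<le> 1"
    have "Q k \<omega> \<le> y"
      using c
    proof
      assume "k \<le> 256 * CARD('n) ^ 4 * Suc K ^ 9"
      then have "k \<le> n" using k by (simp add: n_def K1_def)
      then have "\<not> y \<le> Q k \<omega>" using \<omega> by (auto simp: A_def)
      then show ?thesis by simp
    next
      assume "lyap \<theta> \<beta> (\<lambda>s. a s \<omega>) k \<le> 1"
      then show ?thesis using B(3)[of \<omega> k] \<omega> k Lb by (simp add: y_def)
    qed
    then have "(ridge (\<lambda>s. a s \<omega>) (\<lambda>s. r s \<omega>) k - \<theta>) \<bullet> (gram (\<lambda>s. a s \<omega>) k *v (ridge (\<lambda>s. a s \<omega>) (\<lambda>s. r s \<omega>) k - \<theta>))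
      \<le> ((e * \<beta> - 1) + 1)\<^sup>2"
      using k \<omega> e\<beta> unfolding Q_def y_def N.S_def
      by (intro ridge_error_norm[where e = "\<lambda>s. \<epsilon> s \<omega>"] reward \<theta>) auto
    then show "(ridge (\<lambda>s. a s \<omega>) (\<lambda>s. r s \<omega>) k - \<theta>) \<bullet> (gram (\<lambda>s. a s \<omega>) k *v (ridge (\<lambda>s. a s \<omega>) (\<lambda>s. r s \<omega>) k - \<theta>))
      \<le> (e * \<beta>)\<^sup>2" by simp
  qed
  show thesis using that[OF _ 1 2] B AM by blast
qed

end

section \<open>The sequence of runs and the choice of the parameters\<close>

locale linucb_sequence =
  fixes M :: "nat \<Rightarrow> 'w measure"
    and \<theta> :: "real^'n"
    and \<sigma> :: real
    and \<beta> :: "nat \<Rightarrow> real"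
    and a \<theta>hat :: "nat \<Rightarrow> nat \<Rightarrow> 'w \<Rightarrow> real^'n"
    and r \<epsilon> :: "nat \<Rightarrow> nat \<Rightarrow> 'w \<Rightarrow> real"
  assumes \<theta>: "norm \<theta> = 1"
    and \<sigma>: "\<sigma> > 0"
    and \<beta>: "\<And>T. \<beta> T > 0"
    and run: "\<And>T. linucb (M T) \<theta> \<sigma> (\<beta> T) T (a T) (r T) (\<epsilon> T) (\<theta>hat T)"
    and growth: "filterlim (\<lambda>T. \<beta> T / (real CARD('n) ^ 2 *
           (\<sigma> * sqrt (real CARD('n) + ln (ln (real T))) + 1))) at_top sequentially"
    and polylog: "\<exists>C. \<exists>k::nat. \<forall>\<^sub>F T in sequentially. \<beta> T \<le> C * ln (real T) ^ k"
begin

lemma beta_ge: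
  assumes "q > 0"
  shows "\<forall>\<^sub>F T in sequentially. q * (\<sigma> * sqrt (ln (ln (real T))) + 1) \<le> \<beta> T"
proof -
  have "\<forall>\<^sub>F T in sequentially. ln (ln (real T)) \<ge> 0" by real_asymp
  moreover have "\<forall>\<^sub>F T in sequentially. q \<le> \<beta> T / (real CARD('n) ^ 2 *
      (\<sigma> * sqrt (real CARD('n) + ln (ln (real T))) + 1))"
    using growth by (simp add: filterlim_at_top)
  ultimately show ?thesis
  proof eventually_elim
    case (elim T)
    define D where "D = \<sigma> * sqrt (real CARD('n) + ln (ln (real T))) + 1"
    have D: "D > 0" unfolding D_def using \<sigma> elim by (intro add_nonneg_pos mult_nonneg_nonneg) auto
    have c: "(1::real) \<le> real CARD('n) ^ 2" by (simp add: Suc_leI)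
    have "\<sigma> * sqrt (ln (ln (real T))) + 1 \<le> 1 * D" unfolding D_def using \<sigma> by simp
    also have "\<dots> \<le> real CARD('n) ^ 2 * D" using c D by (intro mult_right_mono) auto
    finally have "q * (\<sigma> * sqrt (ln (ln (real T))) + 1) \<le> q * (real CARD('n) ^ 2 * D)"
      using assms by (intro mult_left_mono) auto
    also have "\<dots> \<le> \<beta> T" using elim(2) D c by (simp add: D_def[symmetric] pos_le_divide_eq)
    finally show ?case .
  qed
qed

lemma beta_ge_const:
  assumes "q > 0" shows "\<forall>\<^sub>F T in sequentially. q \<le> \<beta> T"
proof -
  have "\<forall>\<^sub>F T in sequentially. ln (ln (real T)) \<ge> 0" by real_asymp
  with beta_ge[OF assms] show ?thesis
  proof eventually_elim
    case (elim T)
    have "q * 1 \<le> q * (\<sigma> * sqrt (ln (ln (real T))) + 1)"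
      using assms \<sigma> elim(2) by (intro mult_left_mono) auto
    then show ?case using elim(1) by linarith
  qed
qed

text \<open>One more factor \<open>ln T\<close> absorbs the constant.\<close>

lemma beta_le_ln_power:
  obtains q where "q \<ge> 1" "\<forall>\<^sub>F T in sequentially. \<beta> T \<le> ln (real T) ^ q"
proof -
  obtain C k where Ck: "\<forall>\<^sub>F T in sequentially. \<beta> T \<le> C * ln (real T) ^ k" using polylog by blast
  have "\<forall>\<^sub>F T in sequentially. \<bar>C\<bar> + 1 \<le> ln (real T)" by real_asymp
  with Ck have "\<forall>\<^sub>F T in sequentially. \<beta> T \<le> ln (real T) ^ Suc k"
  proof eventually_elim
    case (elim T)
    then have "C * ln (real T) ^ k \<le> ln (real T) * ln (real T) ^ k" by (intro mult_right_mono) auto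
    with elim(1) show ?case unfolding power_Suc by (rule order_trans)
  qed
  then show thesis using that[of "Suc k"] by simp
qed

text \<open>Convergence to 0 in probability, stated with an explicit exceptional event so that
  measurability of the divergence need not be discussed.\<close>

lemma lyap_vanishes:
  assumes \<psi>: "\<psi> > 0" and \<rho>: "\<rho> > 0"
  shows "\<forall>\<^sub>F T in sequentially. \<exists>B\<in>sets (M T). measure (M T) B \<le> \<rho> \<and>
    (\<forall>\<omega>\<in>space (M T) - B. lyap \<theta> (\<beta> T) (\<lambda>s. a T s \<omega>) T \<le> \<psi>)"
proof -
  define d where "d = real CARD('n)"
  have d: "d \<ge> 1" by (simp add: d_def Suc_leI)
  \<comment> \<open>The trajectory bound is \<open>42 (d + 1) e\<close> plus a vanishing term,
    eventually no larger; together at most \<psi>. The minimum with 1 gives the smallness condition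
    of \<open>lyap_trajectory\<close>.\<close>
  define e where "e = min 1 \<psi> / (84 * (d + 1))"
  have e: "0 < e" "e \<le> 1/4" "84 * (d + 1) * e \<le> 1" "84 * (d + 1) * e \<le> \<psi>"
  proof -
    have eq: "84 * (d + 1) * e = min 1 \<psi>" using d by (simp add: e_def)
    then show "84 * (d + 1) * e \<le> 1" "84 * (d + 1) * e \<le> \<psi>" by auto
    show "0 < e" using \<psi> d by (simp add: e_def)
    then have "4 * e \<le> 84 * (d + 1) * e" using d by (intro mult_right_mono) auto
    then show "e \<le> 1/4" using eq by simp
  qed
  obtain q where q: "q \<ge> 1" "\<forall>\<^sub>F T in sequentially. \<beta> T \<le> ln (real T) ^ q" by (rule beta_le_ln_power)
  \<comment> \<open>With \<open>x = ln T\<close>, the square of \<open>\<beta>^2 + 1 / e\<close> is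
    at most \<open>4 x^(4 q)\<close>, \<open>ln (1 + K)\<close> costs one factor \<open>x\<close>,
    and the last factor \<open>x\<close> absorbs \<open>32 d\<close>.\<close>
  define p where "p = 4 * q + 2"
  define K where "K = (\<lambda>T. nat \<lceil>ln (real T) ^ p\<rceil>)"
  \<comment> \<open>Enough blocks to cover all rounds, because
    \<open>T + 1 < T^2 \<le> 2 powr (3 ln T)\<close> by \<open>ln 2 \<ge> 2/3\<close>.\<close>
  define J where "J = (\<lambda>T. nat \<lfloor>3 * ln (real T)\<rfloor>)"
  \<comment> \<open>\<open>exp (- L)\<close> is \<open>(ln T)^-2\<close>, which beats the number of
    blocks, of order \<open>ln T\<close>.\<close>
  define L where "L = (\<lambda>T. 2 * ln (ln (real T)))"
  \<comment> \<open>One summand per requirement: \<open>e \<beta> \<ge> 2\<close>, so that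
    \<open>e \<beta> - 1\<close> is at least \<open>e \<beta> / 2\<close>; the tail level
    \<open>Lb\<close>; and a failure probability of at most \<open>\<rho> / 2\<close> for the
    initial phase.\<close>
  define Q where "Q = 2 / e + 40 * sqrt d / e + sqrt (8 * d * real (9 * p + 1) / (e\<^sup>2 * \<rho>))"
  have Q: "Q > 0" using e d \<rho> by (auto simp: Q_def intro!: add_pos_nonneg)
  \<comment> \<open>The exponent 1/18 leaves room in the remaining start term:
    \<open>T^(1/9)\<close> times the fourth root of \<open>T^(-17/18)\<close> is
    \<open>T^(-1/8)\<close>.\<close>
  have power: "\<forall>\<^sub>F T in sequentially. ln (real T) ^ p + 2 \<le> real T powr (1/18)"
  proof -
    have "(\<lambda>T. ln (real T) ^ p / real T powr (1/18)) \<longlonglongrightarrow> 0" by real_asymp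
    then have "\<forall>\<^sub>F T in sequentially. ln (real T) ^ p / real T powr (1/18) < 1/2" by (rule order_tendstoD) simp
    moreover have "\<forall>\<^sub>F T in sequentially. 4 \<le> real T powr (1/18)" by real_asymp
    ultimately show ?thesis
    proof eventually_elim
      case (elim T)
      then have "real T powr (1/18) > 0" by linarith
      with elim show ?case by (simp add: pos_divide_less_eq)
    qed
  qed
  have fail: "\<forall>\<^sub>F T in sequentially. 2 * (d + 1) * (3 * ln (real T) + 1) * exp (- L T) \<le> \<rho> / 2"
  proof -
    have "(\<lambda>T. 2 * (d + 1) * (3 * ln (real T) + 1) * exp (- L T)) \<longlonglongrightarrow> 0"
      unfolding L_def by real_asymp
    then have "\<forall>\<^sub>F T in sequentially. 2 * (d + 1) * (3 * ln (real T) + 1) * exp (- L T) < \<rho> / 2"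
      by (rule order_tendstoD) (use \<rho> in simp)
    then show ?thesis by eventually_elim simp
  qed
  have rest: "\<forall>\<^sub>F T in sequentially. 2 * d * real T powr (- (1/8)) \<le> 42 * (d + 1) * e"
  proof -
    have "(\<lambda>T. 2 * d * real T powr (- (1/8))) \<longlonglongrightarrow> 0" by real_asymp
    then have "\<forall>\<^sub>F T in sequentially. 2 * d * real T powr (- (1/8)) < 42 * (d + 1) * e"
      by (rule order_tendstoD) (use e d in simp)
    then show ?thesis by eventually_elim simp
  qed
  have big: "\<forall>\<^sub>F T in sequentially. c \<le> ln (real T)" for c by real_asymp
  have lnln: "\<forall>\<^sub>F T in sequentially. 1 \<le> ln (ln (real T))" by real_asymp
  define c0 where "c0 = 1 + 32 * d + (d + 1) / (2 * e\<^sup>2) + 1 / e + (1 + 256 * d ^ 4 * 4 ^ 9)"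
  have T2: "\<forall>\<^sub>F T in sequentially. (2::nat) \<le> T" by (rule eventually_ge_at_top)
  show ?thesis
    using q(2) beta_ge[OF Q] power fail rest big[of c0] lnln T2
  proof eventually_elim
    case (elim T)
    interpret linucb "M T" \<theta> \<sigma> "\<beta> T" T "a T" "r T" "\<epsilon> T" "\<theta>hat T" by (rule run)
    define x where "x = ln (real T)"
    have c0: "1 + 32 * d \<le> c0" "1 + (d + 1) / (2 * e\<^sup>2) \<le> c0" "1 + 1 / e \<le> c0" "1 + 256 * d ^ 4 * 4 ^ 9 \<le> c0" "1 \<le> c0"
      using e d by (auto simp: c0_def intro!: add_nonneg_nonneg)
    then have x: "x \<ge> 1 + 32 * d" "x \<ge> 1 + (d + 1) / (2 * e\<^sup>2)" "x \<ge> 1 + 1 / e" "x \<ge> 1 + 256 * d ^ 4 * 4 ^ 9" "x \<ge> 1"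
      using elim by (auto simp: x_def)
    have T: "real T \<ge> 2" using elim by simp
    have lx: "ln x \<ge> 1" using elim by (simp add: x_def)
    have xp: "x ^ i \<le> x ^ j" if "i \<le> j" for i j using x that by (intro power_increasing) auto
    have x1: "1 \<le> x ^ i" for i using x by (intro one_le_power) auto
    have K: "x ^ p \<le> real (K T)" "real (K T) < x ^ p + 1"
      using x1[of p] by (auto simp: K_def x_def) linarith+
    have K1: "K T \<ge> 1" using K(1) x1[of p] by (metis le_trans of_nat_1 of_nat_le_iff order_trans)
    have KT1: "1 + real (K T) \<le> real T powr (1/18)" using K elim by (simp add: x_def)
    also have "\<dots> \<le> real T powr 1" using T by (intro powr_mono) auto
    finally have KT: "1 + real (K T) \<le> real T" using T by simp
    have s: "0 \<le> \<sigma> * sqrt (ln x)" using \<sigma> lx by simp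
    have bQ: "Q * (\<sigma> * sqrt (ln x) + 1) \<le> \<beta> T" using elim by (simp add: x_def)
    have b2: "2 / e \<le> \<beta> T"
    proof -
      have "2 / e * 1 \<le> Q * (\<sigma> * sqrt (ln x) + 1)"
        using e d \<rho> s by (intro mult_mono) (auto simp: Q_def intro!: add_nonneg_nonneg)
      then show ?thesis using bQ by simp
    qed
    have b1: "\<beta> T \<ge> 1"
    proof -
      have "1 \<le> 2 / e" using e by (simp add: pos_le_divide_eq)
      then show ?thesis using b2 by linarith
    qed
    have eb: "e * \<beta> T \<ge> 2" using b2 e by (simp add: pos_divide_le_eq mult.commute)
    have bq: "\<beta> T \<le> x ^ q" using elim by (simp add: x_def)
    then have bq2: "(\<beta> T)\<^sup>2 \<le> x ^ (2 * q)"
      using power_mono[OF bq, of 2] b1 by (simp add: power_mult[symmetric] mult.commute)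
    have late1: "8 * real CARD('n) * ln (1 + real (K T)) * ((\<beta> T)\<^sup>2 + 1 / e)\<^sup>2 \<le> real (K T)"
    proof -
      have "1 / e \<le> x ^ 1" using x by simp
      also have "\<dots> \<le> x ^ (2 * q)" using q(1) by (intro xp) simp
      finally have "(\<beta> T)\<^sup>2 + 1 / e \<le> 2 * x ^ (2 * q)" using bq2 by simp
      then have "((\<beta> T)\<^sup>2 + 1 / e)\<^sup>2 \<le> (2 * x ^ (2 * q))\<^sup>2" using e by (intro power_mono) auto
      also have "\<dots> = 4 * x ^ (4 * q)" by (simp add: power_mult_distrib power_mult[symmetric] mult.commute)
      finally have "8 * d * ln (1 + real (K T)) * ((\<beta> T)\<^sup>2 + 1 / e)\<^sup>2 \<le> 8 * d * x * (4 * x ^ (4 * q))"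
        using d KT T x by (intro mult_mono mult_left_mono) (auto simp: x_def)
      also have "\<dots> = 32 * d * x ^ (4 * q + 1)" by simp
      also have "\<dots> \<le> x * x ^ (4 * q + 1)" using x by (intro mult_right_mono) auto
      also have "\<dots> = x ^ p" by (simp add: p_def)
      finally show ?thesis using K(1) by (simp add: d_def)
    qed
    have late2: "(\<beta> T)\<^sup>2 \<le> e * rate TYPE('n) (\<beta> T) (real (Suc (K T)))"
    proof -
      have "(\<beta> T)\<^sup>2 * ((d + 1) / (2 * e\<^sup>2)) \<le> x ^ (2 * q) * x" using bq2 x d e by (intro mult_mono) auto
      also have "\<dots> \<le> x ^ p" using xp[of "2 * q + 1" p] by (simp add: p_def mult.commute)
      also have "\<dots> \<le> real (Suc (K T))" using K by simp
      finally have "(\<beta> T)\<^sup>2 \<le> e\<^sup>2 * (2 * real (Suc (K T)) / (d + 1))"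
        using e d by (simp add: field_simps)
      then have "sqrt ((\<beta> T)\<^sup>2) \<le> sqrt (e\<^sup>2 * (2 * real (Suc (K T)) / (d + 1)))" by (rule real_sqrt_le_mono)
      then have "\<beta> T \<le> e * sqrt (2 * real (Suc (K T)) / (d + 1))"
        using b1 e unfolding real_sqrt_mult[of "e\<^sup>2"] real_sqrt_abs by simp
      then have "\<beta> T * \<beta> T \<le> \<beta> T * (e * sqrt (2 * real (Suc (K T)) / (d + 1)))"
        using b1 by (intro mult_left_mono) auto
      then show ?thesis by (simp add: rate_def d_def power2_eq_square mult_ac)
    qed
    have late3: "1 \<le> e * real (Suc (K T))"
    proof -
      have "1 / e \<le> x ^ 1" using x by simp
      also have "\<dots> \<le> x ^ p" by (intro xp) (simp add: p_def)
      finally have "1 / e \<le> real (Suc (K T))" using K by simp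
      then show ?thesis using e by (simp add: pos_divide_le_eq mult.commute)
    qed
    have J: "T + 1 < 2 ^ Suc (J T)"
    proof -
      have J1: "3 * x < real (J T) + 1" using x by (simp add: J_def x_def)
      have "real T * 2 \<le> real T * real T" using T by (intro mult_left_mono) auto
      then have "real T + 1 < real T ^ 2" using T unfolding power2_eq_square by linarith
      also have "\<dots> = exp (2 * x)" using T exp_double[of x] by (simp add: x_def)
      also have "\<dots> \<le> exp (ln 2 * (3 * x))" using mult_right_mono[of 2 "ln 2 * 3" x] ln2_ge_two_thirds x by (simp add: mult.assoc)
      also have "\<dots> \<le> exp (ln 2 * (real (J T) + 1))" using J1 by simp
      also have "\<dots> = 2 powr (real (Suc (J T)))" by (simp add: powr_def mult.commute)
      also have "\<dots> = 2 ^ Suc (J T)" by (simp only: powr_realpow zero_less_numeral)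
      finally have "real (T + 1) < real (2 ^ Suc (J T))" by simp
      then show ?thesis by (simp only: of_nat_less_iff)
    qed
    have J2: "real (J T) + 1 \<le> 3 * x + 1" using x by (simp add: J_def x_def)
    have half: "e * \<beta> T / 2 \<le> e * \<beta> T - 1" using eb by simp
    have Lb: "200 * real CARD('n) * L T * \<sigma>\<^sup>2 \<le> (e * \<beta> T - 1)\<^sup>2"
    proof -
      have "40 * sqrt d / e * (\<sigma> * sqrt (ln x)) \<le> Q * (\<sigma> * sqrt (ln x) + 1)"
        using e d \<rho> s by (intro mult_mono) (auto simp: Q_def)
      then have "40 * sqrt d * (\<sigma> * sqrt (ln x)) / e \<le> \<beta> T" using bQ by simp
      then have "40 * sqrt d * (\<sigma> * sqrt (ln x)) \<le> e * \<beta> T"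
        using e by (simp only: pos_divide_le_eq mult.commute)
      then have "20 * sqrt d * (\<sigma> * sqrt (ln x)) \<le> e * \<beta> T - 1" using half by simp
      then have "(20 * sqrt d * (\<sigma> * sqrt (ln x)))\<^sup>2 \<le> (e * \<beta> T - 1)\<^sup>2"
        using d s by (intro power_mono) auto
      then show ?thesis using d lx by (simp add: power_mult_distrib L_def x_def d_def mult_ac)
    qed
    obtain B where B: "B \<in> sets (M T)"
      "prob B \<le> 2 * (real CARD('n) + 1) * (real (J T) + 1) * exp (- L T)
        + \<sigma>\<^sup>2 * (real CARD('n) * ln (1 + 256 * real CARD('n) ^ 4 * real (Suc (K T)) ^ 9)) / (e * \<beta> T - 1)\<^sup>2"
      "\<And>\<omega>. \<omega> \<in> space (M T) - B \<Longrightarrow> lyap \<theta> (\<beta> T) (\<lambda>s. a T s \<omega>) T \<le> 42 * (real CARD('n) + 1) * e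
        + 2 * real CARD('n) * (real (Suc (K T)))\<^sup>2 * (real (Suc (K T)) / real (Suc T)) powr (1/4)"
    proof (rule lyap_small_whp[OF \<sigma> \<theta> b1 e(1,2) e(3)[unfolded d_def] K1 _ late1 late2 late3 _ J _ Lb])
      show "K T \<le> T" using KT by simp
      show "0 < L T" using lx by (simp add: L_def x_def)
      show "1 < e * \<beta> T" using eb by simp
    qed blast
    have 1: "2 * (d + 1) * (real (J T) + 1) * exp (- L T) \<le> \<rho> / 2"
    proof -
      have "2 * (d + 1) * (real (J T) + 1) * exp (- L T) \<le> 2 * (d + 1) * (3 * x + 1) * exp (- L T)"
        using J2 d by (intro mult_right_mono mult_left_mono) auto
      then show ?thesis using elim by (simp add: x_def)
    qed
    have 2: "\<sigma>\<^sup>2 * (d * ln (1 + 256 * d ^ 4 * real (Suc (K T)) ^ 9)) / (e * \<beta> T - 1)\<^sup>2 \<le> \<rho> / 2"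
    proof -
      have "real (Suc (K T)) \<le> 4 * x ^ p" using K x1[of p] by simp
      then have "real (Suc (K T)) ^ 9 \<le> (4 * x ^ p) ^ 9" by (intro power_mono) auto
      then have "1 + 256 * d ^ 4 * real (Suc (K T)) ^ 9 \<le> 1 * x ^ (9 * p) + 256 * d ^ 4 * (4 ^ 9 * x ^ (9 * p))"
        using d x1[of "9 * p"] by (intro add_mono mult_left_mono) (auto simp: power_mult_distrib power_mult[symmetric] mult.commute)
      also have "\<dots> = (1 + 256 * d ^ 4 * 4 ^ 9) * x ^ (9 * p)" by (simp add: algebra_simps)
      also have "\<dots> \<le> x * x ^ (9 * p)" using x by (intro mult_right_mono) auto
      also have "\<dots> = x ^ (9 * p + 1)" by simp
      finally have "ln (1 + 256 * d ^ 4 * real (Suc (K T)) ^ 9) \<le> ln (x ^ (9 * p + 1))"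
        using d x by (subst ln_le_cancel_iff) (auto intro!: add_pos_nonneg)
      also have "\<dots> = real (9 * p + 1) * ln x" using x by (intro ln_realpow)
      finally have ln: "ln (1 + 256 * d ^ 4 * real (Suc (K T)) ^ 9) \<le> real (9 * p + 1) * ln x" .
      have "sqrt (8 * d * real (9 * p + 1) / (e\<^sup>2 * \<rho>)) * (\<sigma> * sqrt (ln x)) \<le> Q * (\<sigma> * sqrt (ln x) + 1)"
        using e d \<rho> s by (intro mult_mono) (auto simp: Q_def)
      also note bQ
      finally have "(sqrt (8 * d * real (9 * p + 1) / (e\<^sup>2 * \<rho>)) * (\<sigma> * sqrt (ln x)))\<^sup>2 \<le> (\<beta> T)\<^sup>2"
        using d \<rho> by (intro power_mono mult_nonneg_nonneg[OF _ s]) auto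
      also have "(sqrt (8 * d * real (9 * p + 1) / (e\<^sup>2 * \<rho>)) * (\<sigma> * sqrt (ln x)))\<^sup>2
        = 8 * d * real (9 * p + 1) / (e\<^sup>2 * \<rho>) * (\<sigma>\<^sup>2 * ln x)"
        unfolding power_mult_distrib using d \<rho> lx by (subst (1 2) real_sqrt_pow2) auto
      finally have "8 * (\<sigma>\<^sup>2 * (d * (real (9 * p + 1) * ln x))) \<le> (\<beta> T)\<^sup>2 * (e\<^sup>2 * \<rho>)"
        using e \<rho> by (simp add: pos_divide_le_eq mult_ac del: of_nat_add of_nat_Suc of_nat_mult)
      also have "\<dots> = 4 * \<rho> * (e * \<beta> T / 2)\<^sup>2" by (simp add: power2_eq_square)
      also have "\<dots> \<le> 4 * \<rho> * (e * \<beta> T - 1)\<^sup>2"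
        using half eb \<rho> by (intro mult_left_mono power_mono) auto
      finally have "\<sigma>\<^sup>2 * (d * (real (9 * p + 1) * ln x)) \<le> \<rho> / 2 * (e * \<beta> T - 1)\<^sup>2" by linarith
      moreover have "\<sigma>\<^sup>2 * (d * ln (1 + 256 * d ^ 4 * real (Suc (K T)) ^ 9)) \<le> \<sigma>\<^sup>2 * (d * (real (9 * p + 1) * ln x))"
        using ln d by (intro mult_left_mono) auto
      ultimately have "\<sigma>\<^sup>2 * (d * ln (1 + 256 * d ^ 4 * real (Suc (K T)) ^ 9)) \<le> \<rho> / 2 * (e * \<beta> T - 1)\<^sup>2"
        by (rule order_trans[rotated])
      then show ?thesis using eb by (simp add: pos_divide_le_eq)
    qed
    have 3: "2 * d * (real (Suc (K T)))\<^sup>2 * (real (Suc (K T)) / real (Suc T)) powr (1/4) \<le> 42 * (d + 1) * e"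
    proof -
      have u: "real (Suc (K T)) \<le> real T powr (1/18)" using KT1 by simp
      have "(real (Suc (K T)))\<^sup>2 \<le> (real T powr (1/18))\<^sup>2" using u by (intro power_mono) auto
      also have "\<dots> = real T powr (1/9)" using T by (simp add: powr_realpow[symmetric] powr_powr)
      finally have A: "(real (Suc (K T)))\<^sup>2 \<le> real T powr (1/9)" .
      have "real (Suc (K T)) / real (Suc T) \<le> real T powr (1/18) / real T"
        using u T by (intro frac_le) auto
      also have "\<dots> = real T powr (- (17/18))" using powr_diff[of "real T" "1/18" 1] T by simp
      finally have "(real (Suc (K T)) / real (Suc T)) powr (1/4) \<le> (real T powr (- (17/18))) powr (1/4)"
        by (intro powr_mono2) auto
      also have "\<dots> = real T powr (- (17/72))" by (simp add: powr_powr)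
      finally have "(real (Suc (K T)))\<^sup>2 * (real (Suc (K T)) / real (Suc T)) powr (1/4) \<le> real T powr (1/9) * real T powr (- (17/72))"
        using A by (intro mult_mono) auto
      also have "\<dots> = real T powr (- (1/8))" by (simp flip: powr_add)
      finally have "2 * d * ((real (Suc (K T)))\<^sup>2 * (real (Suc (K T)) / real (Suc T)) powr (1/4)) \<le> 2 * d * real T powr (- (1/8))"
        using d by (intro mult_left_mono) auto
      then show ?thesis using elim by (simp add: mult_ac)
    qed
    show ?case
    proof (intro bexI[OF _ B(1)] conjI ballI)
      show "prob B \<le> \<rho>" using B(2) 1 2 unfolding d_def by linarith
      fix \<omega> assume "\<omega> \<in> space (M T) - B"
      from B(3)[OF this] 3 have "lyap \<theta> (\<beta> T) (\<lambda>s. a T s \<omega>) T \<le> 42 * (d + 1) * e + 42 * (d + 1) * e"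
        unfolding d_def by linarith
      then show "lyap \<theta> (\<beta> T) (\<lambda>s. a T s \<omega>) T \<le> \<psi>" using e(4) by linarith
    qed
  qed
qed

end

section \<open>Asymptotic coverage\<close>

text \<open>An orthonormal basis of the hyperplane across \<theta> with Parseval's identity. In
  contrast to the \<open>d\<close> projected axes it has exactly \<open>d - 1\<close> members, the
  degrees of freedom of the limit.\<close>

lemma hyperplane_coordinates:
  fixes \<theta> :: "real^'n"
  assumes \<theta>: "norm \<theta> = 1"
  obtains b :: "nat \<Rightarrow> real^'n" where "\<And>i. i < CARD('n) - 1 \<Longrightarrow> \<theta> \<bullet> b i = 0"
    "\<And>i j. i < CARD('n) - 1 \<Longrightarrow> j < CARD('n) - 1 \<Longrightarrow> b i \<bullet> b j = (if i = j then 1 else 0)"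
    "\<And>x. (\<Sum>i<CARD('n) - 1. (b i \<bullet> x)\<^sup>2) = x \<bullet> x - (\<theta> \<bullet> x)\<^sup>2"
proof -
  define V where "V = {x. \<theta> \<bullet> x = 0}"
  have tt: "\<theta> \<bullet> \<theta> = 1" using \<theta> by (simp add: norm_eq_1)
  then have "\<theta> \<noteq> 0" by auto
  then have dim: "dim V = CARD('n) - 1" unfolding V_def by (simp add: dim_hyperplane)
  have "subspace V" unfolding V_def by (rule subspace_hyperplane)
  then obtain B where B: "B \<subseteq> V" "pairwise orthogonal B" "\<And>x. x \<in> B \<Longrightarrow> norm x = 1"
    "independent B" "card B = dim V" "span B = V"
    by (rule orthonormal_basis_subspace) blast
  have fin: "finite B" using B(4) by (rule independent_imp_finite)
  obtain b where b: "bij_betw b {..<CARD('n) - 1} B"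
    using ex_bij_betw_nat_finite[OF fin] B(5) dim by (auto simp: lessThan_atLeast0)
  have bB: "b i \<in> B" if "i < CARD('n) - 1" for i using b that by (auto simp: bij_betw_def)
  show thesis
  proof (rule that)
    show "\<theta> \<bullet> b i = 0" if "i < CARD('n) - 1" for i using bB[OF that] B(1) by (auto simp: V_def)
    show "b i \<bullet> b j = (if i = j then 1 else 0)" if ij: "i < CARD('n) - 1" "j < CARD('n) - 1" for i j
    proof (cases "i = j")
      case True
      then show ?thesis using B(3)[OF bB[OF ij(1)]] by (simp add: norm_eq_1)
    next
      case False
      then have "b i \<noteq> b j" using b ij by (auto simp: bij_betw_def inj_on_def)
      then show ?thesis using B(2) bB ij False by (auto simp: pairwise_def orthogonal_def)
    qed
    show "(\<Sum>i<CARD('n) - 1. (b i \<bullet> x)\<^sup>2) = x \<bullet> x - (\<theta> \<bullet> x)\<^sup>2" for x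
    proof -
      define z where "z = x - (\<theta> \<bullet> x) *\<^sub>R \<theta>"
      have zV: "z \<in> V" by (simp add: z_def V_def inner_diff_right tt)
      have "(\<Sum>i<CARD('n) - 1. (b i \<bullet> x)\<^sup>2) = (\<Sum>u\<in>B. (u \<bullet> x)\<^sup>2)"
        by (rule sum.reindex_bij_betw[OF b])
      also have "\<dots> = (\<Sum>u\<in>B. (z \<bullet> u) * (u \<bullet> z))"
        using B(1) by (intro sum.cong) (auto simp: z_def V_def inner_diff_left inner_diff_right inner_commute power2_eq_square)
      also have "\<dots> = (\<Sum>u\<in>B. (z \<bullet> u) *\<^sub>R u) \<bullet> z" by (simp add: inner_sum_left)
      also have "(\<Sum>u\<in>B. (z \<bullet> u) *\<^sub>R u) = z"
        using B fin zV by (intro orthonormal_basis_expand) auto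
      also have "z \<bullet> z = x \<bullet> x - (\<theta> \<bullet> x)\<^sup>2"
        by (simp add: z_def inner_diff_left inner_diff_right tt inner_commute power2_eq_square)
      finally show ?thesis .
    qed
  qed
qed

context linucb_sequence begin

definition l :: "nat \<Rightarrow> real" where
  "l T = rate TYPE('n) (\<beta> T) (real (Suc T))"

definition S :: "nat \<Rightarrow> 'w \<Rightarrow> real^'n" where
  "S T \<omega> = noise_sum (\<lambda>s. a T s \<omega>) (\<lambda>s. \<epsilon> T s \<omega>) T"

lemma prob_space_M: "prob_space (M T)"
  using run[of T] by (simp add: linucb_def)

lemma adapted_noise_run:
  "adapted_noise (M T) (history_action (M T) (a T) (r T)) \<sigma> T (a T) (\<epsilon> T)"
  using \<beta> by (rule linucb.adapted_noise[OF run])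

lemma unit_run: "s \<in> {1..T} \<Longrightarrow> \<omega> \<in> space (M T) \<Longrightarrow> norm (a T s \<omega>) = 1"
  using \<beta> by (intro linucb.unit_action[OF run])

lemma S_eq: "S T = adapted_noise.S (a T) (\<epsilon> T) T"
  by (rule ext) (simp add: S_def adapted_noise.S_def[OF adapted_noise_run])

lemma measurable_S: "S T \<in> borel_measurable (M T)"
  unfolding S_eq by (rule adapted_noise.measurable_S_M[OF adapted_noise_run order_refl])

lemma l_pos: "l T > 0"
  unfolding l_def by (rule rate_pos[OF \<beta>]) simp

lemma l_at_top: "filterlim l at_top sequentially"
proof (rule filterlim_at_top_mono)
  define D where "D = real CARD('n) + 1"
  have "D > 0" by (simp add: D_def add_nonneg_pos)
  then show "filterlim (\<lambda>T. sqrt (2 * real (Suc T) / D)) at_top sequentially"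
    by real_asymp
  have "\<forall>\<^sub>F T in sequentially. 1 \<le> \<beta> T" by (rule beta_ge_const) simp
  then show "\<forall>\<^sub>F T in sequentially. sqrt (2 * real (Suc T) / D) \<le> l T"
  proof eventually_elim
    case (elim T)
    have "1 * sqrt (2 * real (Suc T) / D) \<le> \<beta> T * sqrt (2 * real (Suc T) / D)"
      using elim \<open>D > 0\<close> by (intro mult_right_mono) auto
    then show ?case by (simp add: l_def rate_def D_def)
  qed
qed

text \<open>Across \<theta> the predicted Gram form is \<open>l T\<close> times
  \<open>x . x\<close>. The Gram form exceeds the bracket by the share \<open>x . x\<close> of the
  identity matrix, which disappears after division by \<open>l T\<close>.\<close>

lemma bracket_limit:
  assumes x: "\<theta> \<bullet> x = 0" and \<eta>: "\<eta> > 0"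
  shows "(\<lambda>T. measure (M T) {\<omega> \<in> space (M T). \<bar>(\<Sum>s=1..T. (x \<bullet> a T s \<omega>)\<^sup>2) / l T - x \<bullet> x\<bar> > \<eta>}) \<longlonglongrightarrow> 0"
proof (rule LIMSEQ_I)
  fix \<rho> :: real assume \<rho>: "\<rho> > 0"
  \<comment> \<open>Makes the relative error \<open>3 sqrt \<psi>\<close> cost at most
    \<open>\<eta> / 2\<close>; the summand 1 covers \<open>x = 0\<close>.\<close>
  define \<psi> where "\<psi> = (min 1 (\<eta> / (6 * (x \<bullet> x + 1))))\<^sup>2"
  have m: "0 < min 1 (\<eta> / (6 * (x \<bullet> x + 1)))" using \<eta> by (simp add: add_nonneg_pos)
  have \<psi>: "0 < \<psi>" "\<psi> \<le> 1" using m by (auto simp: \<psi>_def power_le_one)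
  have s\<psi>: "sqrt \<psi> \<le> \<eta> / (6 * (x \<bullet> x + 1))" using m by (simp add: \<psi>_def)
  have sx: "3 * sqrt \<psi> * (x \<bullet> x) \<le> \<eta> / 2"
  proof -
    have "3 * sqrt \<psi> * (x \<bullet> x) \<le> 3 * (\<eta> / (6 * (x \<bullet> x + 1))) * (x \<bullet> x + 1)"
      using s\<psi> \<eta> \<psi> by (intro mult_mono) auto
    also have "\<dots> = \<eta> / 2"
    proof -
      have "3 * (\<eta> / (6 * w)) * w = \<eta> / 2" if "w > 0" for w using that by simp
      then show ?thesis by (meson add_nonneg_pos inner_ge_zero zero_less_one)
    qed
    finally show ?thesis .
  qed
  have "\<forall>\<^sub>F T in sequentially. 2 * (x \<bullet> x) / \<eta> \<le> l T" using l_at_top by (simp add: filterlim_at_top)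
  moreover have "\<forall>\<^sub>F T in sequentially. \<exists>B\<in>sets (M T). measure (M T) B \<le> \<rho> / 2 \<and>
    (\<forall>\<omega>\<in>space (M T) - B. lyap \<theta> (\<beta> T) (\<lambda>s. a T s \<omega>) T \<le> \<psi>)"
    using \<psi> \<rho> by (intro lyap_vanishes) auto
  ultimately have "\<forall>\<^sub>F T in sequentially. norm (measure (M T) {\<omega> \<in> space (M T). \<bar>(\<Sum>s=1..T. (x \<bullet> a T s \<omega>)\<^sup>2) / l T - x \<bullet> x\<bar> > \<eta>} - 0) < \<rho>"
  proof eventually_elim
    case (elim T)
    interpret prob_space "M T" by (rule prob_space_M)
    obtain B where B: "B \<in> sets (M T)" "prob B \<le> \<rho> / 2"
      "\<And>\<omega>. \<omega> \<in> space (M T) - B \<Longrightarrow> lyap \<theta> (\<beta> T) (\<lambda>s. a T s \<omega>) T \<le> \<psi>" using elim(2) by blast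
    have lp: "l T > 0" by (rule l_pos)
    have xl: "(x \<bullet> x) / l T \<le> \<eta> / 2" using elim(1) lp \<eta> by (simp add: field_simps)
    have "{\<omega> \<in> space (M T). \<bar>(\<Sum>s=1..T. (x \<bullet> a T s \<omega>)\<^sup>2) / l T - x \<bullet> x\<bar> > \<eta>} \<subseteq> B"
    proof
      fix \<omega> assume \<omega>: "\<omega> \<in> {\<omega> \<in> space (M T). \<bar>(\<Sum>s=1..T. (x \<bullet> a T s \<omega>)\<^sup>2) / l T - x \<bullet> x\<bar> > \<eta>}"
      show "\<omega> \<in> B"
      proof (rule ccontr)
        assume "\<omega> \<notin> B"
        then have ly: "lyap \<theta> (\<beta> T) (\<lambda>s. a T s \<omega>) T \<le> \<psi>" using B(3) \<omega> by auto
        define q where "q = (\<Sum>s=1..T. (x \<bullet> a T s \<omega>)\<^sup>2)"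
        have "wnorm2 \<theta> (real (Suc T)) (rate TYPE('n) (\<beta> T) (real (Suc T))) x = l T * (x \<bullet> x)"
          by (simp add: wnorm2_def x l_def)
        moreover have "x \<bullet> (gram (\<lambda>s. a T s \<omega>) T *v x) = x \<bullet> x + q"
          by (simp add: gram_form q_def inner_commute)
        ultimately have "\<bar>x \<bullet> x + q - l T * (x \<bullet> x)\<bar> \<le> 3 * sqrt \<psi> * (l T * (x \<bullet> x))"
          using gram_form_bounds(1)[OF \<theta> \<beta> _ ly \<psi>(2), of x] unit_run[of _ T \<omega>] \<omega> by auto
        then have "\<bar>x \<bullet> x + q - l T * (x \<bullet> x)\<bar> / l T \<le> 3 * sqrt \<psi> * (l T * (x \<bullet> x)) / l T"
          using lp by (intro divide_right_mono) auto
        also have "\<dots> = 3 * sqrt \<psi> * (x \<bullet> x)" using lp by simp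
        also have "\<bar>x \<bullet> x + q - l T * (x \<bullet> x)\<bar> / l T = \<bar>(x \<bullet> x) / l T + (q / l T - x \<bullet> x)\<bar>"
        proof -
          have "(x \<bullet> x) / l T + (q / l T - x \<bullet> x) = (x \<bullet> x + q - l T * (x \<bullet> x)) / l T"
            using lp by (simp add: field_simps)
          then show ?thesis using lp by (simp add: abs_divide)
        qed
        finally have "\<bar>(x \<bullet> x) / l T + (q / l T - x \<bullet> x)\<bar> \<le> \<eta> / 2" using sx by linarith
        moreover have "0 \<le> (x \<bullet> x) / l T" using lp by simp
        ultimately have "\<bar>q / l T - x \<bullet> x\<bar> \<le> \<eta>" using xl by linarith
        then show False using \<omega> by (simp add: q_def)
      qed
    qed
    then have "prob {\<omega> \<in> space (M T). \<bar>(\<Sum>s=1..T. (x \<bullet> a T s \<omega>)\<^sup>2) / l T - x \<bullet> x\<bar> > \<eta>} \<le> prob B"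
      using B(1) by (rule finite_measure_mono)
    then show ?case using B(2) \<rho> by simp
  qed
  then show "\<exists>n0. \<forall>T\<ge>n0. norm (measure (M T) {\<omega> \<in> space (M T). \<bar>(\<Sum>s=1..T. (x \<bullet> a T s \<omega>)\<^sup>2) / l T - x \<bullet> x\<bar> > \<eta>} - 0) < \<rho>"
    by (simp add: eventually_sequentially)
qed

lemma characteristic_limit:
  assumes x: "\<theta> \<bullet> x = 0"
  shows "(\<lambda>T. \<integral>\<omega>. cos ((x \<bullet> S T \<omega>) / sqrt (l T)) \<partial>M T) \<longlonglongrightarrow> exp (- (\<sigma>\<^sup>2 / 2 * (x \<bullet> x)))"
proof (rule LIMSEQ_I)
  fix \<rho> :: real assume \<rho>: "\<rho> > 0"
  define v where "v = x \<bullet> x"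
  have v: "v \<ge> 0" by (simp add: v_def)
  \<comment> \<open>\<eta> is fixed first, so that its own contribution is below \<rho>; all other
    terms of the bound vanish as \<open>T\<close> grows.\<close>
  have "((\<lambda>\<eta>. exp (\<sigma>\<^sup>2 / 2 * \<eta>) - 1) \<longlongrightarrow> exp (\<sigma>\<^sup>2 / 2 * 0) - 1) (at_right 0)"
    by (intro tendsto_intros)
  then have "\<forall>\<^sub>F \<eta> in at_right 0. exp (\<sigma>\<^sup>2 / 2 * \<eta>) - 1 < \<rho>" by (rule order_tendstoD) (use \<rho> in simp)
  moreover have "\<forall>\<^sub>F \<eta> in at_right (0::real). \<eta> \<in> {0<..<1}" by (rule eventually_at_right_real) simp
  ultimately have "\<forall>\<^sub>F \<eta> in at_right 0. exp (\<sigma>\<^sup>2 / 2 * \<eta>) - 1 < \<rho> \<and> \<eta> \<in> {0<..<1}" by (rule eventually_conj)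
  then obtain \<eta> where \<eta>: "exp (\<sigma>\<^sup>2 / 2 * \<eta>) - 1 < \<rho>" "0 < \<eta>" "\<eta> < 1"
    using eventually_happens[of _ "at_right (0::real)"] by auto
  define P where "P = (\<lambda>T. measure (M T) {\<omega> \<in> space (M T). \<bar>(\<Sum>s=1..T. (x \<bullet> a T s \<omega>)\<^sup>2) / l T - v\<bar> > \<eta>})"
  define b where "b = (\<lambda>T. norm x / sqrt (l T))"
  define R where "R = (\<lambda>T. exp (\<sigma>\<^sup>2 / 2 * (v + 1)) * (54 * exp (\<sigma>\<^sup>2 / 2) * b T + \<sigma> ^ 4 * (b T)\<^sup>2 / 4) * (v + 1)
      + (exp (\<sigma>\<^sup>2 / 2 * \<eta>) - 1) + (3 + exp (\<sigma>\<^sup>2 / 2)) * P T)"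
  have Pl: "P \<longlonglongrightarrow> 0" unfolding P_def v_def by (rule bracket_limit[OF x \<eta>(2)])
  have bl: "b \<longlonglongrightarrow> 0" unfolding b_def
    by (rule real_tendsto_divide_at_top[OF tendsto_const filterlim_compose[OF sqrt_at_top l_at_top]])
  have "R \<longlonglongrightarrow> exp (\<sigma>\<^sup>2 / 2 * (v + 1)) * (54 * exp (\<sigma>\<^sup>2 / 2) * 0 + \<sigma> ^ 4 * 0\<^sup>2 / 4) * (v + 1)
      + (exp (\<sigma>\<^sup>2 / 2 * \<eta>) - 1) + (3 + exp (\<sigma>\<^sup>2 / 2)) * 0"
    unfolding R_def by (intro tendsto_intros Pl bl) auto
  then have "\<forall>\<^sub>F T in sequentially. R T < \<rho>" by (rule order_tendstoD) (use \<eta> in simp)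
  then have "\<forall>\<^sub>F T in sequentially. norm ((\<integral>\<omega>. cos ((x \<bullet> S T \<omega>) / sqrt (l T)) \<partial>M T) - exp (- (\<sigma>\<^sup>2 / 2 * v))) < \<rho>"
  proof eventually_elim
    case (elim T)
    have "\<bar>(\<integral>\<omega>. cos ((x \<bullet> S T \<omega>) / sqrt (l T)) \<partial>M T) - exp (- (\<sigma>\<^sup>2 / 2 * v))\<bar> \<le> R T"
      unfolding R_def P_def b_def S_eq
      by (rule adapted_noise.directional_clt_bound[OF adapted_noise_run]) (use l_pos v \<eta> in auto)
    then show ?case using elim by simp
  qed
  then show "\<exists>n0. \<forall>T\<ge>n0. norm ((\<integral>\<omega>. cos ((x \<bullet> S T \<omega>) / sqrt (l T)) \<partial>M T) - exp (- (\<sigma>\<^sup>2 / 2 * (x \<bullet> x)))) < \<rho>"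
    by (simp add: eventually_sequentially v_def)
qed

definition N2 :: "nat \<Rightarrow> 'w \<Rightarrow> real" where
  "N2 T \<omega> = (S T \<omega> \<bullet> S T \<omega> - (\<theta> \<bullet> S T \<omega>)\<^sup>2) / l T"

lemma measurable_N2 [measurable]: "N2 T \<in> borel_measurable (M T)"
  unfolding N2_def using measurable_S[of T] by measurable

text \<open>Coefficients \<open>c\<close> on an orthonormal basis correspond to the direction
  \<open>x\<close> with \<open>x . x\<close> equal to the sum of the squares of \<open>c\<close>, so
  the limit in single directions is all that \<open>chi_square_limit\<close> asks for.\<close>

lemma N2_limit:
  assumes "CARD('n) \<ge> 2"
  shows "(\<lambda>T. measure (M T) {\<omega> \<in> space (M T). N2 T \<omega> \<le> c}) \<longlonglongrightarrow> cdf (chi_square (CARD('n) - 1)) (c / \<sigma>\<^sup>2)"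
proof -
  obtain b :: "nat \<Rightarrow> real^'n" where b: "\<And>i. i < CARD('n) - 1 \<Longrightarrow> \<theta> \<bullet> b i = 0"
    "\<And>i j. i < CARD('n) - 1 \<Longrightarrow> j < CARD('n) - 1 \<Longrightarrow> b i \<bullet> b j = (if i = j then 1 else 0)"
    "\<And>x. (\<Sum>i<CARD('n) - 1. (b i \<bullet> x)\<^sup>2) = x \<bullet> x - (\<theta> \<bullet> x)\<^sup>2"
    using hyperplane_coordinates[OF \<theta>] by blast
  define y where "y = (\<lambda>T i \<omega>. (b i \<bullet> S T \<omega>) / sqrt (l T))"
  have "(\<Sum>i<CARD('n) - 1. (y T i \<omega>)\<^sup>2) = N2 T \<omega>" for T \<omega>
    using l_pos[of T] by (simp add: y_def N2_def power_divide b(3)[simplified] flip: sum_divide_distrib)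
  moreover have "(\<lambda>T. measure (M T) {\<omega> \<in> space (M T). (\<Sum>i<CARD('n) - 1. (y T i \<omega>)\<^sup>2) \<le> c})
      \<longlonglongrightarrow> cdf (chi_square (CARD('n) - 1)) (c / \<sigma>\<^sup>2)"
  proof (rule chi_square_limit[OF prob_space_M _ _ \<sigma>])
    show "y T i \<in> borel_measurable (M T)" for T i
      unfolding y_def using measurable_S[of T] by measurable
    show "1 \<le> CARD('n) - 1" using assms by simp
    fix c :: "nat \<Rightarrow> real"
    define x where "x = (\<Sum>i<CARD('n) - 1. c i *\<^sub>R b i)"
    have "\<theta> \<bullet> x = 0" by (simp add: x_def inner_sum_right b(1))
    moreover have "x \<bullet> x = (\<Sum>i<CARD('n) - 1. (c i)\<^sup>2)"
      by (simp add: x_def inner_sum_right inner_sum_left b(2) if_distrib[of "\<lambda>z. _ * z"] sum.delta power2_eq_square cong: if_cong)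
    moreover have "(\<Sum>i<CARD('n) - 1. c i * y T i \<omega>) = (x \<bullet> S T \<omega>) / sqrt (l T)" for T \<omega>
      by (simp add: x_def y_def inner_sum_left sum_divide_distrib)
    ultimately show "(\<lambda>T. \<integral>\<omega>. cos (\<Sum>i<CARD('n) - 1. c i * y T i \<omega>) \<partial>M T)
        \<longlonglongrightarrow> exp (- (\<sigma>\<^sup>2 / 2 * (\<Sum>i<CARD('n) - 1. (c i)\<^sup>2)))"
      using characteristic_limit[of x] by simp
  qed
  ultimately show ?thesis by simp
qed

text \<open>The tail with fixed level \<open>Suc T\<close>, which unit actions never exceed, and
  \<open>L = K^2 / (2 \<sigma>^2)\<close>. Along \<theta>, boundedness in probability at scale
  \<open>sqrt T\<close> suffices, because this part affects the squared error only through the small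
  quantities \<delta> and \<kappa>.\<close>

lemma parallel_tail:
  assumes "K > 0"
  obtains B where "B \<in> sets (M T)" "measure (M T) B \<le> 2 * exp (- (K\<^sup>2 / (2 * \<sigma>\<^sup>2)))"
    "\<And>\<omega>. \<omega> \<in> space (M T) - B \<Longrightarrow> \<bar>\<theta> \<bullet> S T \<omega>\<bar> \<le> K * sqrt (real (Suc T))"
proof -
  interpret N: adapted_noise "M T" "history_action (M T) (a T) (r T)" \<sigma> T "a T" "\<epsilon> T" by (rule adapted_noise_run)
  define L where "L = K\<^sup>2 / (2 * \<sigma>\<^sup>2)"
  have L: "L > 0" "2 * L * \<sigma>\<^sup>2 = K\<^sup>2" using assms \<sigma> by (auto simp: L_def)
  define B where "B = {\<omega> \<in> space (M T). \<exists>k\<le>T. (\<Sum>s=1..k. (\<theta> \<bullet> a T s \<omega>)\<^sup>2) \<le> real (Suc T) \<and>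
    2 * L * \<sigma>\<^sup>2 * real (Suc T) \<le> (\<theta> \<bullet> N.S k \<omega>)\<^sup>2}"
  have B: "B \<in> sets (M T)" "measure (M T) B \<le> 2 * exp (- L)"
    unfolding B_def by (rule N.directional_tail_two_sided[OF \<sigma> _ L(1)]; simp)+
  have "\<bar>\<theta> \<bullet> S T \<omega>\<bar> \<le> K * sqrt (real (Suc T))" if \<omega>: "\<omega> \<in> space (M T) - B" for \<omega>
  proof (rule ccontr)
    assume n: "\<not> \<bar>\<theta> \<bullet> S T \<omega>\<bar> \<le> K * sqrt (real (Suc T))"
    have "(\<Sum>s=1..T. (\<theta> \<bullet> a T s \<omega>)\<^sup>2) \<le> (\<Sum>s=1..T. 1)"
    proof (intro sum_mono)
      fix s assume "s \<in> {1..T}"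
      then have "\<bar>\<theta> \<bullet> a T s \<omega>\<bar> \<le> 1" using Cauchy_Schwarz_ineq2[of \<theta> "a T s \<omega>"] unit_run \<omega> \<theta> by simp
      then show "(\<theta> \<bullet> a T s \<omega>)\<^sup>2 \<le> 1" by (simp add: abs_square_le_1)
    qed
    then have "(\<Sum>s=1..T. (\<theta> \<bullet> a T s \<omega>)\<^sup>2) \<le> real (Suc T)" by simp
    moreover have "(K * sqrt (real (Suc T)))\<^sup>2 \<le> \<bar>\<theta> \<bullet> S T \<omega>\<bar>\<^sup>2" using n assms by (intro power_mono) auto
    then have "2 * L * \<sigma>\<^sup>2 * real (Suc T) \<le> (\<theta> \<bullet> N.S T \<omega>)\<^sup>2"
      unfolding L(2) S_eq by (simp add: power_mult_distrib)
    ultimately have "\<omega> \<in> B" using \<omega> unfolding B_def by blast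
    then show False using \<omega> by simp
  qed
  then show thesis using that B unfolding L_def by blast
qed

definition E :: "nat \<Rightarrow> 'w \<Rightarrow> real" where
  "E T \<omega> = l T * (norm (\<theta>hat T T \<omega> - \<theta>))\<^sup>2"

lemma measurable_E [measurable]: "E T \<in> borel_measurable (M T)"
  unfolding E_def using linucb.measurable_estimator[OF run, of T T] by measurable

text \<open>Order of choices: \<open>K\<close> first, so that the noise along and across \<theta>
  rarely exceeds it; then \<delta>, \<kappa> and \<psi> from \<eta> and \<open>K\<close>;
  \<open>T\<close> last. The failure probabilities \<open>\<rho> / 4\<close>,
  \<open>\<rho> / 4\<close> and \<open>\<rho> / 8\<close> add up to less than \<rho>.\<close>

lemma E_close_N2:
  assumes d: "CARD('n) \<ge> 2" and \<eta>: "\<eta> > 0"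
  shows "(\<lambda>T. measure (M T) {\<omega> \<in> space (M T). \<bar>E T \<omega> - N2 T \<omega>\<bar> > \<eta>}) \<longlonglongrightarrow> 0"
proof (rule LIMSEQ_I)
  fix \<rho> :: real assume \<rho>: "\<rho> > 0"
  interpret R: real_distribution "chi_square (CARD('n) - 1)" by (rule real_distribution_chi_square)
  have "((\<lambda>K. 2 * exp (- (K\<^sup>2 / (2 * \<sigma>\<^sup>2)))) \<longlongrightarrow> 0) at_top" using \<sigma> by real_asymp
  then have "\<forall>\<^sub>F K in at_top. 2 * exp (- (K\<^sup>2 / (2 * \<sigma>\<^sup>2))) < \<rho> / 4" by (rule order_tendstoD) (use \<rho> in simp)
  moreover have "filterlim (\<lambda>K. K\<^sup>2 / \<sigma>\<^sup>2) at_top at_top" using \<sigma> by real_asymp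
  then have "\<forall>\<^sub>F K in at_top. 1 - \<rho> / 8 < cdf (chi_square (CARD('n) - 1)) (K\<^sup>2 / \<sigma>\<^sup>2)"
    using filterlim_compose[OF R.cdf_lim_at_top_prob] \<rho> by (intro order_tendstoD(1)[where y = 1]) auto
  moreover have "\<forall>\<^sub>F K in at_top. (1::real) \<le> K" by (rule eventually_ge_at_top)
  ultimately have "\<forall>\<^sub>F K in at_top. 2 * exp (- (K\<^sup>2 / (2 * \<sigma>\<^sup>2))) < \<rho> / 4 \<and>
    1 - \<rho> / 8 < cdf (chi_square (CARD('n) - 1)) (K\<^sup>2 / \<sigma>\<^sup>2) \<and> 1 \<le> K"
    by eventually_elim blast
  then obtain K :: real where K: "2 * exp (- (K\<^sup>2 / (2 * \<sigma>\<^sup>2))) < \<rho> / 4"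
    "1 - \<rho> / 8 < cdf (chi_square (CARD('n) - 1)) (K\<^sup>2 / \<sigma>\<^sup>2)" "1 \<le> K"
    using eventually_happens[of _ "at_top :: real filter"] by auto
  define \<delta> where "\<delta> = min (1/4) (\<eta> / (200 * K\<^sup>2))"
  define \<kappa> where "\<kappa> = min (1/4) (\<eta> / (72 * K\<^sup>2))"
  define \<psi> where "\<psi> = (\<kappa> / 3)\<^sup>2"
  have \<delta>: "0 < \<delta>" "\<delta> \<le> 1/4" "100 * K\<^sup>2 * \<delta> \<le> \<eta> / 2"
  proof -
    show "0 < \<delta>" "\<delta> \<le> 1/4" using \<eta> K by (auto simp: \<delta>_def)
    have "100 * K\<^sup>2 * \<delta> \<le> 100 * K\<^sup>2 * (\<eta> / (200 * K\<^sup>2))" by (intro mult_left_mono) (auto simp: \<delta>_def)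
    then show "100 * K\<^sup>2 * \<delta> \<le> \<eta> / 2" using K by simp
  qed
  have \<kappa>: "0 < \<kappa>" "\<kappa> \<le> 1/4" "36 * K\<^sup>2 * \<kappa> \<le> \<eta> / 2"
  proof -
    show "0 < \<kappa>" "\<kappa> \<le> 1/4" using \<eta> K by (auto simp: \<kappa>_def)
    have "36 * K\<^sup>2 * \<kappa> \<le> 36 * K\<^sup>2 * (\<eta> / (72 * K\<^sup>2))" by (intro mult_left_mono) (auto simp: \<kappa>_def)
    then show "36 * K\<^sup>2 * \<kappa> \<le> \<eta> / 2" using K by simp
  qed
  have \<psi>: "0 < \<psi>" "\<psi> \<le> 1" "3 * sqrt \<psi> \<le> \<kappa>"
    using \<kappa> by (auto simp: \<psi>_def intro: power_le_one)
  have "\<forall>\<^sub>F T in sequentially. 1 - \<rho> / 8 < measure (M T) {\<omega> \<in> space (M T). N2 T \<omega> \<le> K\<^sup>2}"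
    by (rule order_tendstoD(1)[OF N2_limit[OF d] K(2)])
  moreover have "\<forall>\<^sub>F T in sequentially. 5 * K / \<delta> \<le> sqrt (l T)"
    using filterlim_compose[OF sqrt_at_top l_at_top] by (simp add: filterlim_at_top)
  moreover have "\<forall>\<^sub>F T in sequentially. 5 * K / \<delta> \<le> sqrt (real (Suc T))" by real_asymp
  moreover have "\<forall>\<^sub>F T in sequentially. \<exists>B\<in>sets (M T). measure (M T) B \<le> \<rho> / 4 \<and>
    (\<forall>\<omega>\<in>space (M T) - B. lyap \<theta> (\<beta> T) (\<lambda>s. a T s \<omega>) T \<le> \<psi>)"
    using \<psi> \<rho> by (intro lyap_vanishes) auto
  ultimately have "\<forall>\<^sub>F T in sequentially. norm (measure (M T) {\<omega> \<in> space (M T). \<bar>E T \<omega> - N2 T \<omega>\<bar> > \<eta>} - 0) < \<rho>"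
  proof eventually_elim
    case (elim T)
    interpret linucb "M T" \<theta> \<sigma> "\<beta> T" T "a T" "r T" "\<epsilon> T" "\<theta>hat T" by (rule run)
    obtain B where B: "B \<in> sets (M T)" "prob B \<le> \<rho> / 4"
      "\<And>\<omega>. \<omega> \<in> space (M T) - B \<Longrightarrow> lyap \<theta> (\<beta> T) (\<lambda>s. a T s \<omega>) T \<le> \<psi>" using elim(4) by blast
    obtain C where C: "C \<in> sets (M T)" "prob C \<le> 2 * exp (- (K\<^sup>2 / (2 * \<sigma>\<^sup>2)))"
      "\<And>\<omega>. \<omega> \<in> space (M T) - C \<Longrightarrow> \<bar>\<theta> \<bullet> S T \<omega>\<bar> \<le> K * sqrt (real (Suc T))"
      using parallel_tail[of K T] K(3) by auto
    define D where "D = space (M T) - {\<omega> \<in> space (M T). N2 T \<omega> \<le> K\<^sup>2}"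
    have D: "D \<in> sets (M T)" unfolding D_def by measurable
    have "prob D = 1 - prob {\<omega> \<in> space (M T). N2 T \<omega> \<le> K\<^sup>2}" unfolding D_def by (rule prob_compl) measurable
    then have PD: "prob D \<le> \<rho> / 8" using elim(1) by simp
    have "{\<omega> \<in> space (M T). \<bar>E T \<omega> - N2 T \<omega>\<bar> > \<eta>} \<subseteq> (B \<union> C) \<union> D"
    proof
      fix \<omega> assume \<omega>: "\<omega> \<in> {\<omega> \<in> space (M T). \<bar>E T \<omega> - N2 T \<omega>\<bar> > \<eta>}"
      show "\<omega> \<in> (B \<union> C) \<union> D"
      proof (rule ccontr)
        assume n: "\<omega> \<notin> (B \<union> C) \<union> D"
        have nK: "N2 T \<omega> \<le> K\<^sup>2" using n \<omega> by (auto simp: D_def)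
        have N0: "N2 T \<omega> \<ge> 0"
        proof -
          have "\<bar>\<theta> \<bullet> S T \<omega>\<bar> \<le> norm (S T \<omega>)" using Cauchy_Schwarz_ineq2[of \<theta> "S T \<omega>"] \<theta> by simp
          then have "\<bar>\<theta> \<bullet> S T \<omega>\<bar>\<^sup>2 \<le> (norm (S T \<omega>))\<^sup>2" by (intro power_mono) auto
          then show ?thesis using l_pos[of T] by (simp add: N2_def power2_norm_eq_inner)
        qed
        have "\<bar>l T * (norm (\<theta>hat T T \<omega> - \<theta>))\<^sup>2 - (sqrt (N2 T \<omega>))\<^sup>2\<bar> \<le> 100 * K\<^sup>2 * \<delta> + 36 * K\<^sup>2 * \<kappa>"
          unfolding l_def N2_def S_def
        proof (rule projected_error_approx[OF \<theta> \<beta>, where \<psi> = \<psi> and r = "\<lambda>s. r T s \<omega>"])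
          show "norm (a T s \<omega>) = 1" if "s \<in> {1..T}" for s using that \<omega> by (intro unit_run) auto
          show "r T s \<omega> = a T s \<omega> \<bullet> \<theta> + \<epsilon> T s \<omega>" if "s \<in> {1..T}" for s using that \<omega> by (intro reward) auto
          show "\<theta>hat T T \<omega> = ridge (\<lambda>s. a T s \<omega>) (\<lambda>s. r T s \<omega>) T /\<^sub>R norm (ridge (\<lambda>s. a T s \<omega>) (\<lambda>s. r T s \<omega>) T)"
            if "ridge (\<lambda>s. a T s \<omega>) (\<lambda>s. r T s \<omega>) T \<noteq> 0" using that \<omega> by (intro estimator_projected) auto
          show "lyap \<theta> (\<beta> T) (\<lambda>s. a T s \<omega>) T \<le> \<psi>" using B(3) n \<omega> by auto
          show "\<bar>\<theta> \<bullet> noise_sum (\<lambda>s. a T s \<omega>) (\<lambda>s. \<epsilon> T s \<omega>) T\<bar> \<le> K * sqrt (real (Suc T))"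
            using C(3)[of \<omega>] n \<omega> by (auto simp: S_def)
          show "sqrt ((noise_sum (\<lambda>s. a T s \<omega>) (\<lambda>s. \<epsilon> T s \<omega>) T \<bullet> noise_sum (\<lambda>s. a T s \<omega>) (\<lambda>s. \<epsilon> T s \<omega>) T
              - (\<theta> \<bullet> noise_sum (\<lambda>s. a T s \<omega>) (\<lambda>s. \<epsilon> T s \<omega>) T)\<^sup>2) / rate TYPE('n) (\<beta> T) (real (Suc T))) \<le> K"
            using nK K(3) by (intro real_le_lsqrt) (auto simp: N2_def S_def l_def)
          show "5 * K \<le> \<delta> * sqrt (real (Suc T))" using elim(3) \<delta>(1) by (simp add: pos_divide_le_eq mult.commute)
          show "5 * K \<le> \<delta> * sqrt (rate TYPE('n) (\<beta> T) (real (Suc T)))"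
            using elim(2) \<delta>(1) by (simp add: pos_divide_le_eq mult.commute l_def)
        qed (use \<psi> \<kappa> \<delta> K in auto)
        then have "\<bar>E T \<omega> - N2 T \<omega>\<bar> \<le> \<eta>" using N0 \<delta>(3) \<kappa>(3) by (simp add: E_def)
        then show False using \<omega> by simp
      qed
    qed
    then have "prob {\<omega> \<in> space (M T). \<bar>E T \<omega> - N2 T \<omega>\<bar> > \<eta>} \<le> prob ((B \<union> C) \<union> D)"
      using B C D by (intro finite_measure_mono) auto
    also have "\<dots> \<le> prob (B \<union> C) + prob D" using B C D by (intro measure_Un_le) auto
    also have "prob (B \<union> C) \<le> prob B + prob C" using B C by (intro measure_Un_le) auto
    finally show ?case using B(2) C(2) PD K(1) \<rho> by simp
  qed
  then show "\<exists>n0. \<forall>T\<ge>n0. norm (measure (M T) {\<omega> \<in> space (M T). \<bar>E T \<omega> - N2 T \<omega>\<bar> > \<eta>} - 0) < \<rho>"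
    by (simp add: eventually_sequentially)
qed

lemma coverage_limit:
  assumes d: "CARD('n) \<ge> 2" and v: "tendsto_in_prob M v (\<sigma>\<^sup>2)" and \<delta>: "0 < \<delta>" "\<delta> < 1"
  shows "(\<lambda>T. measure (M T) {\<omega> \<in> space (M T). \<theta> \<in> confidence_set (\<beta> T) T \<delta> (\<theta>hat T T \<omega>) (v T \<omega>)}) \<longlonglongrightarrow> 1 - \<delta>"
proof -
  define n where "n = CARD('n) - 1"
  have n: "n \<ge> 1" using d by (simp add: n_def)
  define q where "q = quantile (chi_square n) (1 - \<delta>)"
  have q: "cdf (chi_square n) q = 1 - \<delta>" "q \<ge> 0"
    using cdf_quantile_chi_square[OF n, of "1 - \<delta>"] \<delta> by (auto simp: q_def)
  \<comment> \<open>The rate is taken at \<open>Suc T\<close> and the width of the confidence set at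
    \<open>T\<close>, so for \<open>T \<ge> 1\<close> this is
    \<open>sqrt ((T + 1) / T)\<close>.\<close>
  define u where "u = (\<lambda>T. l T * sqrt ((real CARD('n) + 1) / (2 * (\<beta> T)\<^sup>2 * real T)))"
  \<comment> \<open>The random part of the radius is moved to the left: coverage becomes the event
    \<open>Y T \<omega> \<le> \<sigma>^2 q\<close> with a fixed threshold, and \<open>Y - N2\<close>
    tends to 0 in probability.\<close>
  define Y where "Y = (\<lambda>T \<omega>. E T \<omega> - (v T \<omega> * u T - \<sigma>\<^sup>2) * q)"
  have vm [measurable]: "v T \<in> borel_measurable (M T)" for T using v by (simp add: tendsto_in_prob_def)
  have u: "u \<longlonglongrightarrow> 1"
  proof (rule Lim_transform_eventually)
    show "(\<lambda>T. sqrt (real (Suc T) / real T)) \<longlonglongrightarrow> 1" by real_asymp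
    have "\<forall>\<^sub>F T in sequentially. (1::nat) \<le> T" by (rule eventually_ge_at_top)
    then show "\<forall>\<^sub>F T in sequentially. sqrt (real (Suc T) / real T) = u T"
    proof eventually_elim
      case (elim T)
      define D where "D = real CARD('n) + 1"
      have D: "D > 0" by (simp add: D_def add_nonneg_pos)
      have "u T = \<beta> T * sqrt (2 * real (Suc T) / D * (D / (2 * (\<beta> T)\<^sup>2 * real T)))"
        unfolding u_def l_def rate_def D_def real_sqrt_mult by simp
      also have "2 * real (Suc T) / D * (D / (2 * (\<beta> T)\<^sup>2 * real T)) = real (Suc T) / real T / (\<beta> T)\<^sup>2"
        using D \<beta>[of T] elim by (simp add: field_simps)
      also have "\<beta> T * sqrt (real (Suc T) / real T / (\<beta> T)\<^sup>2) = sqrt (real (Suc T) / real T)"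
        using \<beta>[of T] unfolding real_sqrt_divide[of _ "(\<beta> T)\<^sup>2"] real_sqrt_abs by simp
      finally show ?case by simp
    qed
  qed
  have "(\<lambda>T. measure (M T) {\<omega> \<in> space (M T). Y T \<omega> \<le> \<sigma>\<^sup>2 * q}) \<longlonglongrightarrow> cdf (chi_square n) (\<sigma>\<^sup>2 * q / \<sigma>\<^sup>2)"
  proof (rule slutsky[OF prob_space_M measurable_N2 _ N2_limit[OF d, folded n_def]])
    show "Y T \<in> borel_measurable (M T)" for T unfolding Y_def by measurable
    show "isCont (\<lambda>c. cdf (chi_square n) (c / \<sigma>\<^sup>2)) (\<sigma>\<^sup>2 * q)"
      by (rule isCont_o2[OF _ isCont_cdf_chi_square[OF n]]) (use \<sigma> in simp)
    fix \<eta> :: real assume \<eta>: "\<eta> > 0"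
    define \<eta>' where "\<eta>' = \<eta> / (8 * (q + 1))"
    have \<eta>': "\<eta>' > 0" "8 * (q * \<eta>') \<le> \<eta>"
    proof -
      show "\<eta>' > 0" using \<eta> q by (simp add: \<eta>'_def)
      then have "8 * (q * \<eta>') \<le> 8 * (q + 1) * \<eta>'" by simp
      also have "\<dots> = \<eta>" using q by (simp add: \<eta>'_def)
      finally show "8 * (q * \<eta>') \<le> \<eta>" .
    qed
    define P where "P = (\<lambda>T. measure (M T) {\<omega> \<in> space (M T). \<bar>E T \<omega> - N2 T \<omega>\<bar> > \<eta> / 2}
      + measure (M T) {\<omega> \<in> space (M T). \<bar>v T \<omega> - \<sigma>\<^sup>2\<bar> > \<eta>'})"
    have "P \<longlonglongrightarrow> 0 + 0" unfolding P_def
    proof (intro tendsto_add E_close_N2[OF d])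
      show "(\<lambda>T. measure (M T) {\<omega> \<in> space (M T). \<bar>v T \<omega> - \<sigma>\<^sup>2\<bar> > \<eta>'}) \<longlonglongrightarrow> 0"
        using v \<eta>' by (simp add: tendsto_in_prob_def)
    qed (use \<eta> in simp)
    then have P: "P \<longlonglongrightarrow> 0" by simp
    have "(\<lambda>T. \<sigma>\<^sup>2 * q * (u T - 1)) \<longlonglongrightarrow> \<sigma>\<^sup>2 * q * (1 - 1)" by (intro tendsto_intros u)
    then have "\<forall>\<^sub>F T in sequentially. \<bar>\<sigma>\<^sup>2 * q * (u T - 1)\<bar> < \<eta> / 4"
      using \<eta> by (auto dest!: tendstoD[where e = "\<eta> / 4"] simp: dist_real_def)
    moreover have "\<forall>\<^sub>F T in sequentially. u T < 2" using u by (rule order_tendstoD) simp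
    ultimately have le: "\<forall>\<^sub>F T in sequentially. measure (M T) {\<omega> \<in> space (M T). \<bar>Y T \<omega> - N2 T \<omega>\<bar> > \<eta>} \<le> P T"
    proof eventually_elim
      case (elim T)
      interpret prob_space "M T" by (rule prob_space_M)
      have u0: "u T \<ge> 0" using l_pos[of T] by (simp add: u_def)
      have "{\<omega> \<in> space (M T). \<bar>Y T \<omega> - N2 T \<omega>\<bar> > \<eta>}
        \<subseteq> {\<omega> \<in> space (M T). \<bar>E T \<omega> - N2 T \<omega>\<bar> > \<eta> / 2} \<union> {\<omega> \<in> space (M T). \<bar>v T \<omega> - \<sigma>\<^sup>2\<bar> > \<eta>'}"
      proof
        fix \<omega> assume \<omega>: "\<omega> \<in> {\<omega> \<in> space (M T). \<bar>Y T \<omega> - N2 T \<omega>\<bar> > \<eta>}"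
        have "\<bar>Y T \<omega> - N2 T \<omega>\<bar> \<le> \<eta>" if "\<bar>E T \<omega> - N2 T \<omega>\<bar> \<le> \<eta> / 2" "\<bar>v T \<omega> - \<sigma>\<^sup>2\<bar> \<le> \<eta>'"
        proof -
          have "Y T \<omega> - N2 T \<omega> = (E T \<omega> - N2 T \<omega>) - (v T \<omega> - \<sigma>\<^sup>2) * (u T * q) - \<sigma>\<^sup>2 * q * (u T - 1)"
            by (simp add: Y_def algebra_simps)
          moreover have "\<bar>(v T \<omega> - \<sigma>\<^sup>2) * (u T * q)\<bar> \<le> \<eta>' * (2 * q)"
            unfolding abs_mult using that(2) u0 q(2) elim(2) by (intro mult_mono) auto
          moreover have "\<eta>' * (2 * q) \<le> \<eta> / 4" using \<eta>'(2) by (simp add: mult.commute)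
          ultimately show ?thesis using that(1) elim(1) by linarith
        qed
        then show "\<omega> \<in> {\<omega> \<in> space (M T). \<bar>E T \<omega> - N2 T \<omega>\<bar> > \<eta> / 2} \<union> {\<omega> \<in> space (M T). \<bar>v T \<omega> - \<sigma>\<^sup>2\<bar> > \<eta>'}"
          using \<omega> by fastforce
      qed
      then have "prob {\<omega> \<in> space (M T). \<bar>Y T \<omega> - N2 T \<omega>\<bar> > \<eta>}
        \<le> prob ({\<omega> \<in> space (M T). \<bar>E T \<omega> - N2 T \<omega>\<bar> > \<eta> / 2} \<union> {\<omega> \<in> space (M T). \<bar>v T \<omega> - \<sigma>\<^sup>2\<bar> > \<eta>'})"
        by (intro finite_measure_mono) auto
      also have "\<dots> \<le> P T" unfolding P_def by (intro measure_Un_le) auto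
      finally show ?case .
    qed
    show "(\<lambda>T. measure (M T) {\<omega> \<in> space (M T). \<bar>Y T \<omega> - N2 T \<omega>\<bar> > \<eta>}) \<longlonglongrightarrow> 0"
      by (rule tendsto_sandwich[OF _ le tendsto_const P]) simp
  qed
  moreover have "{\<omega> \<in> space (M T). Y T \<omega> \<le> \<sigma>\<^sup>2 * q}
      = {\<omega> \<in> space (M T). \<theta> \<in> confidence_set (\<beta> T) T \<delta> (\<theta>hat T T \<omega>) (v T \<omega>)}" for T
  proof -
    define w where "w = sqrt ((real CARD('n) + 1) / (2 * (\<beta> T)\<^sup>2 * real T))"
    have "Y T \<omega> \<le> \<sigma>\<^sup>2 * q \<longleftrightarrow> (norm (\<theta>hat T T \<omega> - \<theta>))\<^sup>2 \<le> v T \<omega> * w * q" for \<omega>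
    proof -
      have "Y T \<omega> \<le> \<sigma>\<^sup>2 * q \<longleftrightarrow> l T * (norm (\<theta>hat T T \<omega> - \<theta>))\<^sup>2 \<le> l T * (v T \<omega> * w * q)"
        by (simp add: Y_def E_def u_def w_def algebra_simps)
      then show ?thesis using l_pos[of T] by (simp add: mult.assoc)
    qed
    then show ?thesis using \<theta> by (simp add: confidence_set_def w_def q_def n_def)
  qed
  ultimately show ?thesis using \<sigma> q(1) by simp
qed

end

theorem corollary1:
  fixes M :: "nat \<Rightarrow> 'w measure"
    and \<theta> :: "real^'n"
    and \<sigma> \<delta> :: real
    and \<beta> :: "nat \<Rightarrow> real"
    and a \<theta>hat :: "nat \<Rightarrow> nat \<Rightarrow> 'w \<Rightarrow> real^'n"
    and r \<epsilon> :: "nat \<Rightarrow> nat \<Rightarrow> 'w \<Rightarrow> real"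
    and v :: "nat \<Rightarrow> 'w \<Rightarrow> real"
  assumes "CARD('n) \<ge> 2"
    and "norm \<theta> = 1"
    and "\<sigma> > 0"
    and "\<And>T. \<beta> T > 0"
    and "\<And>T. linucb (M T) \<theta> \<sigma> (\<beta> T) T (a T) (r T) (\<epsilon> T) (\<theta>hat T)"
    and "filterlim (\<lambda>T. \<beta> T / (real CARD('n) ^ 2 *
           (\<sigma> * sqrt (real CARD('n) + ln (ln (real T))) + 1))) at_top sequentially"
    and "\<exists>C. \<exists>k::nat. \<forall>\<^sub>F T in sequentially. \<beta> T \<le> C * ln (real T) ^ k"
    and "tendsto_in_prob M v (\<sigma>\<^sup>2)"
    and "0 < \<delta>" "\<delta> < 1"
  shows "(\<lambda>T. measure (M T)
           {\<omega> \<in> space (M T). \<theta> \<in> confidence_set (\<beta> T) T \<delta> (\<theta>hat T T \<omega>) (v T \<omega>)})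
         \<longlonglongrightarrow> 1 - \<delta>"
proof -
  interpret linucb_sequence M \<theta> \<sigma> \<beta> a \<theta>hat r \<epsilon>
    by (rule linucb_sequence.intro) (fact assms)+
  show ?thesis by (rule coverage_limit) (fact assms)+
qed

end
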